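(* Let $\mathcal{E}$ be an arbitrary unknown $n$-qubit completely positive trace-preserving (CPTP) map. Let $\epsilon,\epsilon'=\Theta(1)$ (positive constants independent of $n$) and let $S_N(\mathcal{E})$ be a training set (classical shadow of $\mathcal{E}$) of size $N=\mathcal{O}(\log n)$. Then there is a learning algorithm which, with high probability over $S_N(\mathcal{E})$, learns from $S_N(\mathcal{E})$ a function $h(\rho,O)$ such that for every distribution $\mathcal{D}$ over $n$-qubit states that is invariant under single-qubit Clifford gates, and for every bounded-degree observable $O$ with $\|O\|\le 1$, $$\mathbb{E}_{\rho\sim\mathcal{D}}\big|h(\rho,O)-\mathrm{tr}(O\,\mathcal{E}(\rho))\big|^2\le \epsilon+\max\big(\|O'\|^2,1\big)\,\epsilon',$$ where $O'$ is the low-degree truncation, of degree $k=\lceil\log_{1.5}(1/\epsilon)\rceil$, of the Heisenberg-evolved observable $\mathcal{E}^\dagger(O)$. The training time and the prediction time of $h(\rho,O)$ are both polynomial in $n$. Moreover, when $\epsilon$ is small and $\epsilon'=0$ (so that the right-hand side of the error bound is $\epsilon$), the guarantee is achieved with data size $N$ and computational time scaling as $2^{\mathcal{O}(\log(1/\epsilon)\log(n))}$.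
   Context: $\{I,X,Y,Z\}^{\otimes n}$ is the set of $n$-qubit Pauli observables $P=P_1\otimes\cdots\otimes P_n$; $|P|$ is the number of $i$ with $P_i\ne I$. $\|\cdot\|$ is the spectral norm. $\mathcal{E}^\dagger$ is the dual (Heisenberg-picture) map: $\mathrm{tr}(O\,\mathcal{E}(\rho))=\mathrm{tr}(\mathcal{E}^\dagger(O)\rho)$. Training set. Let $\mathrm{stab}_1=\{|0\rangle,|1\rangle,|+\rangle,|-\rangle,|y+\rangle,|y-\rangle\}$ be the six eigenstates of the single-qubit Pauli matrices. $S_N(\mathcal{E})=\{(|\psi^{(\mathrm{in})}_\ell\rangle,|\psi^{(\mathrm{out})}_\ell\rangle)\}_{\ell=1}^N$ comes from $N$ independent experiments: in each, $|\psi^{(\mathrm{in})}_\ell\rangle=\bigotimes_{i=1}^n|s^{(\mathrm{in})}_{\ell,i}\rangle$ with each $|s^{(\mathrm{in})}_{\ell,i}\rangle$ uniform in $\mathrm{stab}_1$, independently; $\mathcal{E}$ is applied to $|\psi^{(\mathrm{in})}_\ell\rangle\langle\psi^{(\mathrm{in})}_\ell|$; and a randomized Pauli measurement is performed on the output, i.e. the POVM $\{3^{-n}\bigotimes_i|s_i\rangle\langle s_i|\}_{s_1,\dots,s_n\in\mathrm{stab}_1}$ (each qubit measured in a uniformly random basis among $X,Y,Z$), with outcome $|\psi^{(\mathrm{out})}_\ell\rangle=\bigotimes_{i=1}^n|s^{(\mathrm{out})}_{\ell,i}\rangle$. A bounded-degree observable is a Hermitian operator that is a sum of few-body observables (each acting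 nontrivially on at most a constant number of qubits) such that each qubit is acted on by at most a constant number of them, the constants being independent of $n$; implied constants may depend on these. A distribution $\mathcal{D}$ over $n$-qubit states is invariant under single-qubit Clifford gates if for every single-qubit Clifford gate $U$ acting on any one qubit, $U\rho U^\dagger$ has the same distribution as $\rho\sim\mathcal{D}$. If $\mathcal{E}^\dagger(O)=\sum_P\alpha_P P$, its low-degree truncation of degree $k$ is $O'=\sum_{P:|P|\le k}\alpha_P P$. Prediction: to evaluate $h(\rho,O)$ the algorithm is given the few-body reduced density matrices of $\rho$ (the values $\mathrm{tr}(P\rho)$ for low-weight $P$) and the Pauli coefficients of $O$. "With high probability" means with probability at least any prescribed constant less than $1$. *)

theory Defs
  imports
    "HOL-Probability.Probability"
    "HOL-Library.Landau_Symbols"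
    "Jordan_Normal_Form.Schur_Decomposition"
begin

section \<open>Operators on \<open>n\<close> qubits\<close>

text \<open>
  Operators on \<open>n\<close> qubits are matrices of dimension \<open>2 ^ n\<close>. In the computational basis vector
  with index \<open>i < 2 ^ n\<close>, qubit \<open>q < n\<close> has the value \<open>bit i q\<close>.
\<close>

abbreviation operators :: "nat \<Rightarrow> complex mat set" where
  "operators n \<equiv> carrier_mat (2 ^ n) (2 ^ n)"

definition mat_trace :: "complex mat \<Rightarrow> complex" where
  "mat_trace A = (\<Sum>i<dim_row A. A $$ (i, i))"

definition hermitian :: "complex mat \<Rightarrow> bool" where
  "hermitian A \<longleftrightarrow> mat_adjoint A = A"

text \<open>
  The order on complex numbers is that of \<open>HOL-Library.Complex_Order\<close>: \<open>0 \<le> z\<close> says that \<open>z\<close> is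
  real and nonnegative.
\<close>

definition psd :: "nat \<Rightarrow> complex mat \<Rightarrow> bool" where
  "psd m A \<longleftrightarrow> A \<in> carrier_mat m m \<and> (\<forall>v \<in> carrier_vec m. 0 \<le> (A *\<^sub>v v) \<bullet>c v)"

definition density :: "nat \<Rightarrow> complex mat set" where
  "density n = {\<rho> \<in> operators n. psd (2 ^ n) \<rho> \<and> mat_trace \<rho> = 1}"

definition euclidean_norm :: "complex vec \<Rightarrow> real" where
  "euclidean_norm v = sqrt (Re (v \<bullet>c v))"

definition spectral_norm :: "complex mat \<Rightarrow> real" where
  "spectral_norm A =
     Sup {euclidean_norm (A *\<^sub>v v) | v. v \<in> carrier_vec (dim_col A) \<and> euclidean_norm v = 1}"

definition tensor :: "complex mat list \<Rightarrow> complex mat" where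
  "tensor As = mat (2 ^ length As) (2 ^ length As)
     (\<lambda>(i, j). \<Prod>q<length As. (As ! q) $$ (of_bool (bit i q), of_bool (bit j q)))"

definition single_qubit_gate :: "nat \<Rightarrow> nat \<Rightarrow> complex mat \<Rightarrow> complex mat" where
  "single_qubit_gate n q U = tensor ((replicate n (1\<^sub>m 2))[q := U])"


section \<open>Pauli observables\<close>

datatype pauli = PI | PX | PY | PZ

fun pauli1 :: "pauli \<Rightarrow> complex mat" where
  "pauli1 PI = mat_of_rows_list 2 [[1, 0], [0, 1]]"
| "pauli1 PX = mat_of_rows_list 2 [[0, 1], [1, 0]]"
| "pauli1 PY = mat_of_rows_list 2 [[0, - \<i>], [\<i>, 0]]"
| "pauli1 PZ = mat_of_rows_list 2 [[1, 0], [0, - 1]]"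

definition paulis :: "nat \<Rightarrow> pauli list list" where
  "paulis n = List.n_lists n [PI, PX, PY, PZ]"

definition pauli_mat :: "pauli list \<Rightarrow> complex mat" where
  "pauli_mat P = tensor (map pauli1 P)"

definition weight :: "pauli list \<Rightarrow> nat" where
  "weight P = length (filter (\<lambda>p. p \<noteq> PI) P)"

definition pauli_sum :: "nat \<Rightarrow> (pauli list \<Rightarrow> complex) \<Rightarrow> complex mat" where
  "pauli_sum n \<alpha> = mat (2 ^ n) (2 ^ n) (\<lambda>ij. \<Sum>P\<in>set (paulis n). \<alpha> P * pauli_mat P $$ ij)"

definition pauli_coeffs :: "nat \<Rightarrow> complex mat \<Rightarrow> pauli list \<Rightarrow> complex" where
  "pauli_coeffs n A =
     (THE \<alpha>. (\<forall>P. P \<notin> set (paulis n) \<longrightarrow> \<alpha> P = 0) \<and> A = pauli_sum n \<alpha>)"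

text \<open>The degree is an integer, so that negative values of \<open>\<lceil>log 1.5 (1 / \<epsilon>)\<rceil>\<close> are covered.\<close>

definition truncation :: "nat \<Rightarrow> int \<Rightarrow> complex mat \<Rightarrow> complex mat" where
  "truncation n k A =
     pauli_sum n (\<lambda>P. if int (weight P) \<le> k then pauli_coeffs n A P else 0)"

definition trunc_degree :: "real \<Rightarrow> int" where
  "trunc_degree \<epsilon> = \<lceil>log 1.5 (1 / \<epsilon>)\<rceil>"


section \<open>Quantum channels\<close>

text \<open>
  An operator on the tensor product of an \<open>m\<close>-dimensional ancilla and \<open>n\<close> qubits is an
  \<open>m \<times> m\<close> block matrix with blocks in \<open>operators n\<close>. The ampliation \<open>id \<otimes> \<E>\<close> applies \<open>\<E>\<close> to every
  block.
\<close>

definition block :: "nat \<Rightarrow> complex mat \<Rightarrow> nat \<Rightarrow> nat \<Rightarrow> complex mat" where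
  "block n A a b = mat (2 ^ n) (2 ^ n) (\<lambda>(i, j). A $$ (a * 2 ^ n + i, b * 2 ^ n + j))"

definition ampliation ::
    "nat \<Rightarrow> nat \<Rightarrow> (complex mat \<Rightarrow> complex mat) \<Rightarrow> complex mat \<Rightarrow> complex mat" where
  "ampliation m n \<E> A = mat (m * 2 ^ n) (m * 2 ^ n)
     (\<lambda>(r, c). \<E> (block n A (r div 2 ^ n) (c div 2 ^ n)) $$ (r mod 2 ^ n, c mod 2 ^ n))"

definition cptp :: "nat \<Rightarrow> (complex mat \<Rightarrow> complex mat) \<Rightarrow> bool" where
  "cptp n \<E> \<longleftrightarrow>
     (\<forall>A \<in> operators n. \<E> A \<in> operators n) \<and>
     (\<forall>A \<in> operators n. \<forall>B \<in> operators n. \<E> (A + B) = \<E> A + \<E> B) \<and>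
     (\<forall>A \<in> operators n. \<forall>c. \<E> (c \<cdot>\<^sub>m A) = c \<cdot>\<^sub>m \<E> A) \<and>
     (\<forall>m A. psd (m * 2 ^ n) A \<longrightarrow> psd (m * 2 ^ n) (ampliation m n \<E> A)) \<and>
     (\<forall>A \<in> operators n. mat_trace (\<E> A) = mat_trace A)"

definition dual_map :: "nat \<Rightarrow> (complex mat \<Rightarrow> complex mat) \<Rightarrow> complex mat \<Rightarrow> complex mat" where
  "dual_map n \<E> Obs = (THE A. A \<in> operators n \<and>
     (\<forall>\<rho> \<in> operators n. mat_trace (Obs * \<E> \<rho>) = mat_trace (A * \<rho>)))"


section \<open>Bounded-degree observables\<close>

text \<open>\<open>A\<close> acts trivially on qubit \<open>q\<close> if it is the identity on \<open>q\<close> tensored with an operator on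
  the other qubits; the latter is read off from the entries whose indices have bit \<open>q\<close> unset.\<close>

definition acts_trivially :: "nat \<Rightarrow> nat \<Rightarrow> complex mat \<Rightarrow> bool" where
  "acts_trivially n q A \<longleftrightarrow> (\<forall>i < 2 ^ n. \<forall>j < 2 ^ n. A $$ (i, j) =
     (if bit i q = bit j q then A $$ (unset_bit q i, unset_bit q j) else 0))"

definition support :: "nat \<Rightarrow> complex mat \<Rightarrow> nat set" where
  "support n A = {q. q < n \<and> \<not> acts_trivially n q A}"

definition bounded_degree :: "nat \<Rightarrow> nat \<Rightarrow> nat \<Rightarrow> complex mat \<Rightarrow> bool" where
  "bounded_degree \<kappa> d n Obs \<longleftrightarrow>
     Obs \<in> operators n \<and> hermitian Obs \<and>
     (\<exists>(m::nat) A.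
        (\<forall>j < m. A j \<in> operators n \<and> hermitian (A j) \<and> card (support n (A j)) \<le> \<kappa>) \<and>
        (\<forall>q < n. card {j. j < m \<and> q \<in> support n (A j)} \<le> d) \<and>
        Obs = mat (2 ^ n) (2 ^ n) (\<lambda>ij. \<Sum>j<m. A j $$ ij))"


section \<open>Distributions over states\<close>

text \<open>The Borel structure on the set of density matrices, generated by the matrix entries.\<close>

definition state_space :: "nat \<Rightarrow> complex mat measure" where
  "state_space n = vimage_algebra (density n)
     (\<lambda>\<rho>. \<lambda>ij \<in> {..<2 ^ n} \<times> {..<2 ^ n}. \<rho> $$ ij)
     (\<Pi>\<^sub>M ij \<in> {..<2 ^ n} \<times> {..<2 ^ n}. borel)"

definition state_distribution :: "nat \<Rightarrow> complex mat measure \<Rightarrow> bool" where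
  "state_distribution n D \<longleftrightarrow> prob_space D \<and> sets D = sets (state_space n)"

definition clifford1 :: "complex mat \<Rightarrow> bool" where
  "clifford1 U \<longleftrightarrow> U \<in> carrier_mat 2 2 \<and> U * mat_adjoint U = 1\<^sub>m 2 \<and>
     (\<forall>P. \<exists>Q. \<exists>s \<in> {1, - 1}. U * pauli1 P * mat_adjoint U = s \<cdot>\<^sub>m pauli1 Q)"

definition clifford_invariant :: "nat \<Rightarrow> complex mat measure \<Rightarrow> bool" where
  "clifford_invariant n D \<longleftrightarrow> (\<forall>q < n. \<forall>U. clifford1 U \<longrightarrow>
     distr D (state_space n)
       (\<lambda>\<rho>. single_qubit_gate n q U * \<rho> * mat_adjoint (single_qubit_gate n q U)) = D)"


section \<open>Training sets\<close>

datatype stab = Z0 | Z1 | XPlus | XMinus | YPlus | YMinus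

fun ket :: "stab \<Rightarrow> complex mat" where
  "ket Z0 = mat_of_rows_list 1 [[1], [0]]"
| "ket Z1 = mat_of_rows_list 1 [[0], [1]]"
| "ket XPlus = complex_of_real (1 / sqrt 2) \<cdot>\<^sub>m mat_of_rows_list 1 [[1], [1]]"
| "ket XMinus = complex_of_real (1 / sqrt 2) \<cdot>\<^sub>m mat_of_rows_list 1 [[1], [- 1]]"
| "ket YPlus = complex_of_real (1 / sqrt 2) \<cdot>\<^sub>m mat_of_rows_list 1 [[1], [\<i>]]"
| "ket YMinus = complex_of_real (1 / sqrt 2) \<cdot>\<^sub>m mat_of_rows_list 1 [[1], [- \<i>]]"

definition stab_state :: "stab list \<Rightarrow> complex mat" where
  "stab_state ss = tensor (map (\<lambda>s. ket s * mat_adjoint (ket s)) ss)"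

text \<open>The POVM with elements \<open>3 ^ (- n) * stab_state ss\<close>, performed on the state \<open>\<sigma>\<close>.\<close>

definition pauli_measurement :: "nat \<Rightarrow> complex mat \<Rightarrow> stab list pmf" where
  "pauli_measurement n \<sigma> = embed_pmf (\<lambda>ss.
     if length ss = n then Re (mat_trace (stab_state ss * \<sigma>)) / 3 ^ n else 0)"

type_synonym sample = "stab list \<times> stab list"

definition experiment_pmf :: "nat \<Rightarrow> (complex mat \<Rightarrow> complex mat) \<Rightarrow> sample pmf" where
  "experiment_pmf n \<E> =
     bind_pmf (replicate_pmf n (pmf_of_set {Z0, Z1, XPlus, XMinus, YPlus, YMinus}))
       (\<lambda>s_in. map_pmf (\<lambda>s_out. (s_in, s_out)) (pauli_measurement n (\<E> (stab_state s_in))))"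

definition training_pmf ::
    "nat \<Rightarrow> nat \<Rightarrow> (complex mat \<Rightarrow> complex mat) \<Rightarrow> sample list pmf" where
  "training_pmf n N \<E> = replicate_pmf N (experiment_pmf n \<E>)"

definition training_sets :: "nat \<Rightarrow> nat \<Rightarrow> sample list set" where
  "training_sets n N =
     {S. length S = N \<and> (\<forall>(s_in, s_out) \<in> set S. length s_in = n \<and> length s_out = n)}"


section \<open>Algorithms and running time\<close>

text \<open>
  Algorithms are programs of a WHILE language over binary trees with real numbers at the leaves:
  a pointer machine with exact real arithmetic (real-RAM/Blum-Shub-Smale style). There is no
  rounding operation, and the constants in programs are rational, so that a program is a finite
  object. Assignments and tests have unit cost. As a program contains only finitely many
  expressions, charging instead for every operation in an expression would change running times by
  at most a factor that depends only on the program. Ill-typed operations have default values.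
\<close>

datatype data = Num real | Null | Node data data

fun num_of :: "data \<Rightarrow> real" where
  "num_of (Num r) = r"
| "num_of _ = 0"

fun left_of :: "data \<Rightarrow> data" where
  "left_of (Node x y) = x"
| "left_of _ = Null"

fun right_of :: "data \<Rightarrow> data" where
  "right_of (Node x y) = y"
| "right_of _ = Null"

datatype expr =
    Var nat | Const rat | Empty | Join expr expr | Left expr | Right expr
  | Add expr expr | Sub expr expr | Mul expr expr | Div expr expr

datatype test = Less expr expr | IsNum expr | IsNode expr | Neg test | Conj test test

datatype com = Skip | Assign nat expr | Seq com com | Cond test com com | While test com

type_synonym store = "nat \<Rightarrow> data"

fun expr_val :: "expr \<Rightarrow> store \<Rightarrow> data" where
  "expr_val (Var x) s = s x"
| "expr_val (Const c) s = Num (of_rat c)"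
| "expr_val Empty s = Null"
| "expr_val (Join a b) s = Node (expr_val a s) (expr_val b s)"
| "expr_val (Left a) s = left_of (expr_val a s)"
| "expr_val (Right a) s = right_of (expr_val a s)"
| "expr_val (Add a b) s = Num (num_of (expr_val a s) + num_of (expr_val b s))"
| "expr_val (Sub a b) s = Num (num_of (expr_val a s) - num_of (expr_val b s))"
| "expr_val (Mul a b) s = Num (num_of (expr_val a s) * num_of (expr_val b s))"
| "expr_val (Div a b) s = Num (num_of (expr_val a s) / num_of (expr_val b s))"

fun test_val :: "test \<Rightarrow> store \<Rightarrow> bool" where
  "test_val (Less a b) s \<longleftrightarrow> num_of (expr_val a s) < num_of (expr_val b s)"
| "test_val (IsNum a) s \<longleftrightarrow> (\<exists>r. expr_val a s = Num r)"
| "test_val (IsNode a) s \<longleftrightarrow> (\<exists>x y. expr_val a s = Node x y)"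
| "test_val (Neg b) s \<longleftrightarrow> \<not> test_val b s"
| "test_val (Conj b c) s \<longleftrightarrow> test_val b s \<and> test_val c s"

inductive exec :: "com \<Rightarrow> store \<Rightarrow> nat \<Rightarrow> store \<Rightarrow> bool" where
  Skip: "exec Skip s 1 s"
| Assign: "exec (Assign x a) s 1 (s(x := expr_val a s))"
| Seq: "exec c1 s t1 s' \<Longrightarrow> exec c2 s' t2 s'' \<Longrightarrow> exec (Seq c1 c2) s (t1 + t2) s''"
| CondTrue: "test_val b s \<Longrightarrow> exec c1 s t s' \<Longrightarrow> exec (Cond b c1 c2) s (t + 1) s'"
| CondFalse: "\<not> test_val b s \<Longrightarrow> exec c2 s t s' \<Longrightarrow> exec (Cond b c1 c2) s (t + 1) s'"
| WhileFalse: "\<not> test_val b s \<Longrightarrow> exec (While b c) s 1 s"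
| WhileTrue: "test_val b s \<Longrightarrow> exec c s t1 s' \<Longrightarrow> exec (While b c) s' t2 s'' \<Longrightarrow>
    exec (While b c) s (t1 + t2 + 1) s''"

text \<open>The input is placed in variable \<open>0\<close>, and the output is read from there.\<close>

definition runs :: "com \<Rightarrow> data \<Rightarrow> nat \<Rightarrow> data \<Rightarrow> bool" where
  "runs c x t y \<longleftrightarrow> (\<exists>s. exec c ((\<lambda>_. Null)(0 := x)) t s \<and> s 0 = y)"

definition halts_within :: "com \<Rightarrow> data \<Rightarrow> nat \<Rightarrow> bool" where
  "halts_within c x T \<longleftrightarrow> (\<exists>t y. runs c x t y \<and> t \<le> T)"

definition result_of :: "com \<Rightarrow> data \<Rightarrow> data" where
  "result_of c x = (THE y. \<exists>t. runs c x t y)"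

inductive_cases SkipE: "exec Skip s t s'"
inductive_cases AssignE: "exec (Assign x a) s t s'"
inductive_cases SeqE: "exec (Seq c1 c2) s t s'"
inductive_cases CondE: "exec (Cond b c1 c2) s t s'"
inductive_cases WhileE: "exec (While b c) s t s'"

lemma exec_deterministic: "exec c s t s1 \<Longrightarrow> exec c s t' s2 \<Longrightarrow> t' = t \<and> s2 = s1"
proof (induction arbitrary: t' s2 rule: exec.induct)
  case (Skip s)
  then show ?case by (rule SkipE) simp
next
  case (Assign x a s)
  then show ?case by (rule AssignE) simp
next
  case (Seq c1 s t1 s' c2 t2 s'')
  from Seq.prems show ?case by (rule SeqE) (metis Seq.IH)
next
  case (CondTrue b s c1 t s' c2)
  from CondTrue.prems show ?case by (rule CondE) (metis CondTrue.hyps(1) CondTrue.IH Suc_eq_plus1)+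
next
  case (CondFalse b s c2 t s' c1)
  from CondFalse.prems show ?case by (rule CondE) (metis CondFalse.hyps(1) CondFalse.IH Suc_eq_plus1)+
next
  case (WhileFalse b s c)
  from WhileFalse.prems show ?case by (rule WhileE) (use WhileFalse.hyps in simp_all)
next
  case (WhileTrue b s c t1 s' t2 s'')
  from WhileTrue.prems show ?case by (rule WhileE) (metis WhileTrue.hyps(1) WhileTrue.IH Suc_eq_plus1)+
qed

lemma result_of_eq: "runs c x t y \<Longrightarrow> result_of c x = y"
  unfolding result_of_def runs_def by (rule the_equality) (auto dest: exec_deterministic)


section \<open>The learning task\<close>

definition encode_list :: "('a \<Rightarrow> data) \<Rightarrow> 'a list \<Rightarrow> data" where
  "encode_list f xs = foldr (\<lambda>x. Node (f x)) xs Null"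

fun encode_pauli :: "pauli \<Rightarrow> data" where
  "encode_pauli PI = Num 0"
| "encode_pauli PX = Num 1"
| "encode_pauli PY = Num 2"
| "encode_pauli PZ = Num 3"

fun encode_stab :: "stab \<Rightarrow> data" where
  "encode_stab Z0 = Num 0"
| "encode_stab Z1 = Num 1"
| "encode_stab XPlus = Num 2"
| "encode_stab XMinus = Num 3"
| "encode_stab YPlus = Num 4"
| "encode_stab YMinus = Num 5"

definition encode_sample :: "sample \<Rightarrow> data" where
  "encode_sample = (\<lambda>(s_in, s_out). Node (encode_list encode_stab s_in) (encode_list encode_stab s_out))"

text \<open>States are presented by the values \<open>tr (P \<rho>)\<close> for Pauli observables of weight at most \<open>k\<close>,
  observables by their nonzero Pauli coefficients. These numbers are real.\<close>

definition encode_state :: "nat \<Rightarrow> int \<Rightarrow> complex mat \<Rightarrow> data" where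
  "encode_state n k \<rho> = encode_list
     (\<lambda>P. Node (encode_list encode_pauli P) (Num (Re (mat_trace (pauli_mat P * \<rho>)))))
     (filter (\<lambda>P. int (weight P) \<le> k) (paulis n))"

definition encode_observable :: "nat \<Rightarrow> complex mat \<Rightarrow> data" where
  "encode_observable n Obs = encode_list
     (\<lambda>P. Node (encode_list encode_pauli P) (Num (Re (pauli_coeffs n Obs P))))
     (filter (\<lambda>P. pauli_coeffs n Obs P \<noteq> 0) (paulis n))"

definition train_input :: "nat \<Rightarrow> real \<Rightarrow> real \<Rightarrow> sample list \<Rightarrow> data" where
  "train_input n \<epsilon> \<epsilon>' S =
     Node (Num (real n)) (Node (Num \<epsilon>) (Node (Num \<epsilon>') (encode_list encode_sample S)))"

text \<open>The prediction program receives the output of the training program, which represents the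
  learned function.\<close>

definition predict_input ::
    "com \<Rightarrow> nat \<Rightarrow> real \<Rightarrow> real \<Rightarrow> sample list \<Rightarrow> complex mat \<Rightarrow> complex mat \<Rightarrow> data" where
  "predict_input train n \<epsilon> \<epsilon>' S \<rho> Obs =
     Node (result_of train (train_input n \<epsilon> \<epsilon>' S))
       (Node (encode_state n (trunc_degree \<epsilon>) \<rho>) (encode_observable n Obs))"

definition learned_function ::
    "com \<Rightarrow> com \<Rightarrow> nat \<Rightarrow> real \<Rightarrow> real \<Rightarrow> sample list \<Rightarrow> complex mat \<Rightarrow> complex mat \<Rightarrow> real" where
  "learned_function train predict n \<epsilon> \<epsilon>' S \<rho> Obs =
     num_of (result_of predict (predict_input train n \<epsilon> \<epsilon>' S \<rho> Obs))"

definition admissible_observable :: "nat \<Rightarrow> nat \<Rightarrow> nat \<Rightarrow> complex mat \<Rightarrow> bool" where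
  "admissible_observable \<kappa> d n Obs \<longleftrightarrow> bounded_degree \<kappa> d n Obs \<and> spectral_norm Obs \<le> 1"

definition time_bounded ::
    "nat \<Rightarrow> nat \<Rightarrow> com \<Rightarrow> com \<Rightarrow> nat \<Rightarrow> real \<Rightarrow> real \<Rightarrow> nat \<Rightarrow> nat \<Rightarrow> bool" where
  "time_bounded \<kappa> d train predict n \<epsilon> \<epsilon>' N T \<longleftrightarrow>
     (\<forall>S \<in> training_sets n N.
        halts_within train (train_input n \<epsilon> \<epsilon>' S) T \<and>
        (\<forall>\<rho> \<in> density n. \<forall>Obs. admissible_observable \<kappa> d n Obs \<longrightarrow>
           halts_within predict (predict_input train n \<epsilon> \<epsilon>' S \<rho> Obs) T))"

text \<open>Integrability is part of the claim, since the integral of a non-integrable function is \<open>0\<close>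
  by convention.\<close>

definition predicts_well ::
    "nat \<Rightarrow> nat \<Rightarrow> nat \<Rightarrow> real \<Rightarrow> real \<Rightarrow> (complex mat \<Rightarrow> complex mat) \<Rightarrow>
     (complex mat \<Rightarrow> complex mat \<Rightarrow> real) \<Rightarrow> bool" where
  "predicts_well \<kappa> d n \<epsilon> \<epsilon>' \<E> h \<longleftrightarrow>
     (\<forall>D Obs. state_distribution n D \<and> clifford_invariant n D \<and> admissible_observable \<kappa> d n Obs \<longrightarrow>
        integrable D (\<lambda>\<rho>. (cmod (complex_of_real (h \<rho> Obs) - mat_trace (Obs * \<E> \<rho>)))\<^sup>2) \<and>
        (\<integral>\<rho>. (cmod (complex_of_real (h \<rho> Obs) - mat_trace (Obs * \<E> \<rho>)))\<^sup>2 \<partial>D)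
          \<le> \<epsilon> + max ((spectral_norm (truncation n (trunc_degree \<epsilon>) (dual_map n \<E> Obs)))\<^sup>2) 1 * \<epsilon>')"

definition learns ::
    "nat \<Rightarrow> nat \<Rightarrow> real \<Rightarrow> com \<Rightarrow> com \<Rightarrow> nat \<Rightarrow> real \<Rightarrow> real \<Rightarrow> nat \<Rightarrow> bool" where
  "learns \<kappa> d p train predict n \<epsilon> \<epsilon>' N \<longleftrightarrow>
     (\<forall>\<E>. cptp n \<E> \<longrightarrow>
        measure_pmf.prob (training_pmf n N \<E>)
          {S. predicts_well \<kappa> d n \<epsilon> \<epsilon>' \<E> (learned_function train predict n \<epsilon> \<epsilon>' S)} \<ge> p)"

end

theory Submission
  imports Defs
begin

text \<open>
  Training does nothing; the predictor evaluates classical-shadow estimates. As a product of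
  rescaled overlaps with the input and output states of a sample has mean \<open>tr (Q \<E>(P)) / 2 ^ n\<close>, the
  coefficients \<open>\<alpha>_P\<close> of \<open>\<E>\<^sup>\<dagger>(O)\<close> with \<open>|P| \<le> k\<close> are estimated by averages over the samples.
  Estimates with \<open>\<alpha>^4 N \<le> \<lceil>log 2 n\<rceil> + 1\<close> are discarded, and the others are paired with the given
  values \<open>tr (P \<rho>)\<close>.

  Clifford invariance makes different Pauli observables uncorrelated, and the purity bound
  \<open>\<Sum> tr (P \<rho>)^2 \<le> 2 ^ |A|\<close>, over the \<open>P\<close> supported in \<open>A\<close>, gives each of them second moment at most
  \<open>(2/3) ^ |P|\<close>. As \<open>\<Sum> \<alpha>_P^2 \<le> 1\<close>, coefficients beyond degree \<open>k\<close> cost at most \<open>2/3 * \<epsilon>\<close>, since for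
  them \<open>|P| \<ge> k + 1\<close>, and it remains to estimate the others in \<open>\<ell>^2\<close>.

  The expectation of an operator in a random product of stabilizer states with prescribed biases
  is a multilinear polynomial on the cube, bounded by the spectral norm, whose coefficients are
  \<open>\<alpha>_P / 3 ^ |P|\<close>. For bounded polynomials of degree \<open>k\<close>, the \<open>\<ell>^1\<close> norm of the \<open>L^2\<close> norms of the
  partial derivatives is bounded independently of the number of variables. This bounds the sum of
  the moduli of the Pauli coefficients of a bounded-degree observable by a constant, so that
  accurate shadow estimates yield accurate \<open>\<alpha>_P\<close>; and it shows that small coefficients of \<open>O'\<close> have
  small total weight, so that discarding them costs at most \<open>max (\<parallel>O'\<parallel>^2) 1 * \<epsilon>'\<close>. The kept estimates
  have small relative error. With a Chernoff bound, \<open>O(log n)\<close> samples suffice. For \<open>\<epsilon>' = 0\<close>, the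
  samples are so many that all of the \<open>n ^ O(k)\<close> coefficients are estimated well.
\<close>


section \<open>Bounded low-degree polynomials on the cube\<close>

text \<open>Why a filter: with \<open>O(log n)\<close> samples each estimate has an error of fixed
  size, and there are about \<open>n ^ k\<close> of them, so their squared errors cannot simply be
  added up. Only coefficients that stand out from the noise are usable, and the loss from dropping
  the others has to be bounded uniformly in \<open>n\<close>.

  Why a fourth power: with \<open>N = m^2 * (log n + 1)\<close> a union bound over polynomially many
  Pauli pairs gives errors of order \<open>sqrt (log n / N)\<close>, about \<open>1 / m\<close>,
  while the cutoff is exactly \<open>1 / sqrt m\<close>. It does not depend on \<open>n\<close> and
  tends to 0 as \<open>m\<close> grows, but exceeds the noise by a factor of order
  \<open>sqrt m\<close>; hence the small relative error of what is kept. The same program thus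
  serves all error parameters, and \<open>m\<close> is a power of \<open>n\<close> when \<epsilon>'
  = 0.

  Why the cube: the polynomial inequalities need commuting variables. With one variable per qubit
  and Pauli axis, distinct Pauli strings become distinct monomials. The price is a factor 1/3 per
  nontrivial site, the chance that a random axis is the right one, which is harmless at bounded
  weight.\<close>

definition multilinear :: "'i set \<Rightarrow> ('i set \<Rightarrow> real) \<Rightarrow> ('i \<Rightarrow> real) \<Rightarrow> real" where
  "multilinear I a x = (\<Sum>S\<in>Pow I. a S * (\<Prod>i\<in>S. x i))"

definition degree_le :: "nat \<Rightarrow> 'i set \<Rightarrow> ('i set \<Rightarrow> real) \<Rightarrow> bool" where
  "degree_le k I a \<longleftrightarrow> (\<forall>S\<subseteq>I. a S \<noteq> 0 \<longrightarrow> card S \<le> k)"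

definition cube_bounded :: "'i set \<Rightarrow> ('i set \<Rightarrow> real) \<Rightarrow> real \<Rightarrow> bool" where
  "cube_bounded I a M \<longleftrightarrow> (\<forall>x. (\<forall>i\<in>I. \<bar>x i\<bar> \<le> 1) \<longrightarrow> \<bar>multilinear I a x\<bar> \<le> M)"

definition cube_avg :: "'i set \<Rightarrow> (('i \<Rightarrow> real) \<Rightarrow> real) \<Rightarrow> real" where
  "cube_avg I f = (\<Sum>T\<in>Pow I. f (\<lambda>i. if i \<in> T then 1 else - 1)) / 2 ^ card I"

section \<open>Multilinear polynomials and averages over the vertices of the cube\<close>

lemma sum_Pow_insert:
  assumes "finite I" "i \<notin> I"
  shows "(\<Sum>T\<in>Pow (insert i I). F T) = (\<Sum>T\<in>Pow I. F T) + (\<Sum>T\<in>Pow I. F (insert i T))"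
proof -
  have inj: "inj_on (insert i) (Pow I)"
    using assms(2) by (intro inj_onI) (metis PowD insert_ident subsetD)
  have disj: "Pow I \<inter> insert i ` Pow I = {}" using assms(2) by auto
  show ?thesis
    unfolding Pow_insert
    by (subst sum.union_disjoint) (use assms disj inj in \<open>auto simp: sum.reindex\<close>)
qed

lemma multilinear_cong:
  "(\<And>i. i \<in> I \<Longrightarrow> x i = y i) \<Longrightarrow> multilinear I a x = multilinear I a y"
  unfolding multilinear_def by (intro sum.cong refl arg_cong2[where f="(*)"] prod.cong) auto

lemma multilinear_insert:
  assumes "finite I" "i \<notin> I"
  shows "multilinear (insert i I) a x = multilinear I a x + x i * multilinear I (\<lambda>S. a (insert i S)) x"
proof -
  have "(\<Prod>j\<in>insert i T. x j) = x i * (\<Prod>j\<in>T. x j)" if "T \<in> Pow I" for T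
    using that assms by (subst prod.insert) (auto intro: finite_subset)
  then have "(\<Sum>T\<in>Pow I. a (insert i T) * (\<Prod>j\<in>insert i T. x j))
      = x i * (\<Sum>T\<in>Pow I. a (insert i T) * (\<Prod>j\<in>T. x j))"
    unfolding sum_distrib_left by (intro sum.cong) (auto simp: algebra_simps)
  then show ?thesis unfolding multilinear_def by (subst sum_Pow_insert) (use assms in auto)
qed

lemma multilinear_upd: "i \<notin> I \<Longrightarrow> multilinear I a (x(i := c)) = multilinear I a x"
  by (rule multilinear_cong) auto

lemma cube_avg_insert:
  assumes "finite I" "i \<notin> I"
  shows "cube_avg (insert i I) f = (cube_avg I (\<lambda>x. f (x(i := - 1))) + cube_avg I (\<lambda>x. f (x(i := 1)))) / 2"
proof -
  have 1: "(\<lambda>j. if j \<in> T then 1 else - 1) = (\<lambda>j. if j \<in> T then 1 else - 1 :: real)(i := - 1)"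
    if "T \<in> Pow I" for T using that assms by (auto simp: fun_eq_iff)
  have 2: "(\<lambda>j. if j \<in> insert i T then 1 else - 1) = (\<lambda>j. if j \<in> T then 1 else - 1 :: real)(i := 1)"
    for T by auto
  have "(\<Sum>T\<in>Pow I. f (\<lambda>j. if j \<in> T then 1 else - 1))
      = (\<Sum>T\<in>Pow I. f ((\<lambda>j. if j \<in> T then 1 else - 1)(i := - 1)))"
    by (intro sum.cong refl arg_cong[where f=f] 1)
  then show ?thesis
    unfolding cube_avg_def sum_Pow_insert[OF assms] 2 using assms by (simp add: field_simps)
qed

lemma cube_avg_add: "cube_avg I (\<lambda>x. f x + g x) = cube_avg I f + cube_avg I g"
  unfolding cube_avg_def by (simp add: sum.distrib add_divide_distrib)

lemma cube_avg_cmult: "cube_avg I (\<lambda>x. c * f x) = c * cube_avg I f"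
  unfolding cube_avg_def by (simp add: sum_distrib_left)

lemma cube_avg_sum: "cube_avg I (\<lambda>x. \<Sum>j\<in>J. f j x) = (\<Sum>j\<in>J. cube_avg I (f j))"
  unfolding cube_avg_def by (subst sum.swap) (simp add: sum_divide_distrib)

lemma cube_avg_mono:
  assumes "\<And>x. (\<forall>i. \<bar>x i\<bar> = 1) \<Longrightarrow> f x \<le> g x"
  shows "cube_avg I f \<le> cube_avg I g"
  unfolding cube_avg_def by (intro divide_right_mono sum_mono assms) auto

lemma cube_avg_const: "finite I \<Longrightarrow> cube_avg I (\<lambda>_. c) = c"
  unfolding cube_avg_def by (simp add: card_Pow)

lemma cube_avg_nonneg: "(\<And>x. 0 \<le> f x) \<Longrightarrow> 0 \<le> cube_avg I f"
  unfolding cube_avg_def by (intro divide_nonneg_nonneg sum_nonneg) auto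

lemma cube_avg_Cauchy_Schwarz:
  "(cube_avg I (\<lambda>x. f x * g x))\<^sup>2 \<le> cube_avg I (\<lambda>x. (f x)\<^sup>2) * cube_avg I (\<lambda>x. (g x)\<^sup>2)"
proof -
  let ?c = "\<lambda>T i. if i \<in> T then 1 else - 1 :: real"
  have "(\<Sum>T\<in>Pow I. f (?c T) * g (?c T))\<^sup>2 / (2 ^ card I)\<^sup>2
      \<le> ((\<Sum>T\<in>Pow I. (f (?c T))\<^sup>2) * (\<Sum>T\<in>Pow I. (g (?c T))\<^sup>2)) / (2 ^ card I)\<^sup>2"
    by (intro divide_right_mono Cauchy_Schwarz_ineq_sum) auto
  then show ?thesis unfolding cube_avg_def by (simp add: power_divide power2_eq_square)
qed

text \<open>The parallelogram law: averaging over the sign of the split-off variable removes the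
  mixed terms.\<close>

lemma cube_avg_sum_diff_squares:
  "(cube_avg I (\<lambda>x. (u x - v x)\<^sup>2) + cube_avg I (\<lambda>x. (u x + v x)\<^sup>2)) / 2
    = cube_avg I (\<lambda>x. (u x)\<^sup>2) + cube_avg I (\<lambda>x. (v x)\<^sup>2)"
proof -
  have "(\<lambda>x. (u x - v x)\<^sup>2 + (u x + v x)\<^sup>2) = (\<lambda>x. 2 * ((u x)\<^sup>2 + (v x)\<^sup>2))"
    by (rule ext) (simp add: power2_sum power2_diff)
  then have "cube_avg I (\<lambda>x. (u x - v x)\<^sup>2 + (u x + v x)\<^sup>2) = 2 * cube_avg I (\<lambda>x. (u x)\<^sup>2 + (v x)\<^sup>2)"
    by (simp only: cube_avg_cmult)
  then show ?thesis by (simp add: cube_avg_add)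
qed

lemma fourth_power_sum: "(p - q) ^ 4 + (p + q) ^ 4 = 2 * (p ^ 4 + 6 * (p\<^sup>2 * q\<^sup>2) + q ^ 4)"
  for p q :: real
proof -
  have "r ^ 4 = (r\<^sup>2)\<^sup>2" for r :: real by simp
  then show ?thesis unfolding power2_sum power2_diff by (simp only:) (simp add: power2_eq_square algebra_simps)
qed

section \<open>Parseval's identity and hypercontractivity\<close>

lemma Parseval:
  assumes "finite I"
  shows "cube_avg I (\<lambda>x. (multilinear I a x)\<^sup>2) = (\<Sum>S\<in>Pow I. (a S)\<^sup>2)"
  using assms
proof (induction I arbitrary: a)
  case empty
  then show ?case by (simp add: cube_avg_def multilinear_def)
next
  case (insert i I)
  let ?u = "multilinear I a" and ?v = "multilinear I (\<lambda>S. a (insert i S))"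
  have "cube_avg (insert i I) (\<lambda>x. (multilinear (insert i I) a x)\<^sup>2)
      = (cube_avg I (\<lambda>x. (?u x - ?v x)\<^sup>2) + cube_avg I (\<lambda>x. (?u x + ?v x)\<^sup>2)) / 2"
    using insert by (simp add: cube_avg_insert multilinear_insert multilinear_upd)
  also have "\<dots> = cube_avg I (\<lambda>x. (?u x)\<^sup>2) + cube_avg I (\<lambda>x. (?v x)\<^sup>2)" by (rule cube_avg_sum_diff_squares)
  finally show ?case using insert by (simp add: sum_Pow_insert)
qed

text \<open>Bonami's lemma, by induction on the variables. In \<open>f = u + x i * v\<close> odd
  powers of \<open>x i\<close> average out, and the mixed term is controlled by Cauchy-Schwarz. As
  \<open>v\<close> has degree one less, its fourth moment is smaller by a factor 9, which pays for
  the binomial coefficient 6.\<close>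

lemma Bonami:
  assumes "finite I" "degree_le k I a"
  shows "cube_avg I (\<lambda>x. (multilinear I a x) ^ 4) \<le> 9 ^ k * (cube_avg I (\<lambda>x. (multilinear I a x)\<^sup>2))\<^sup>2"
  using assms
proof (induction I arbitrary: a k)
  case empty
  have "(a {}) ^ 4 \<le> 9 ^ k * (a {}) ^ 4"
    using mult_right_mono[of 1 "9 ^ k" "a {} ^ 4"] by simp
  then show ?case by (simp add: cube_avg_def multilinear_def)
next
  case (insert i I)
  define u where "u = multilinear I a"
  define v where "v = multilinear I (\<lambda>S. a (insert i S))"
  define U where "U = cube_avg I (\<lambda>x. (u x)\<^sup>2)"
  define V where "V = cube_avg I (\<lambda>x. (v x)\<^sup>2)"
  have UV: "0 \<le> U" "0 \<le> V" unfolding U_def V_def by (auto intro: cube_avg_nonneg)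
  have f: "multilinear (insert i I) a x = u x + x i * v x" for x
    using insert.hyps by (simp add: multilinear_insert u_def v_def)
  have upd: "u (x(i := c)) = u x" "v (x(i := c)) = v x" for x c
    using insert.hyps by (simp_all add: u_def v_def multilinear_upd)
  have sq: "cube_avg (insert i I) (\<lambda>x. (multilinear (insert i I) a x)\<^sup>2) = U + V"
  proof -
    have "cube_avg (insert i I) (\<lambda>x. (multilinear (insert i I) a x)\<^sup>2)
      = (cube_avg I (\<lambda>x. (u x - v x)\<^sup>2) + cube_avg I (\<lambda>x. (u x + v x)\<^sup>2)) / 2"
      using insert.hyps by (simp add: cube_avg_insert f upd)
    also have "\<dots> = U + V" unfolding U_def V_def by (rule cube_avg_sum_diff_squares)
    finally show ?thesis .
  qed
  have fourth: "cube_avg (insert i I) (\<lambda>x. (multilinear (insert i I) a x) ^ 4)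
      = cube_avg I (\<lambda>x. (u x) ^ 4) + 6 * cube_avg I (\<lambda>x. (u x)\<^sup>2 * (v x)\<^sup>2) + cube_avg I (\<lambda>x. (v x) ^ 4)"
  proof -
    have "cube_avg (insert i I) (\<lambda>x. (multilinear (insert i I) a x) ^ 4)
      = (cube_avg I (\<lambda>x. (u x - v x) ^ 4) + cube_avg I (\<lambda>x. (u x + v x) ^ 4)) / 2"
      using insert.hyps by (simp add: cube_avg_insert f upd)
    also have "\<dots> = (1/2) * cube_avg I (\<lambda>x. (u x - v x) ^ 4 + (u x + v x) ^ 4)"
      by (simp add: cube_avg_add)
    also have "(\<lambda>x. (u x - v x) ^ 4 + (u x + v x) ^ 4)
        = (\<lambda>x. 2 * ((u x) ^ 4 + 6 * ((u x)\<^sup>2 * (v x)\<^sup>2) + (v x) ^ 4))"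
      by (rule ext) (rule fourth_power_sum)
    finally show ?thesis by (simp add: cube_avg_add cube_avg_cmult)
  qed
  have du: "degree_le k I a" using insert.prems unfolding degree_le_def by blast
  have u4: "cube_avg I (\<lambda>x. (u x) ^ 4) \<le> 9 ^ k * U\<^sup>2"
    unfolding U_def u_def by (rule insert.IH[OF du])
  show ?case
  proof (cases k)
    case 0
    have "a (insert i S) = 0" if "S \<in> Pow I" for S
    proof (rule ccontr)
      assume "a (insert i S) \<noteq> 0"
      then have "card (insert i S) \<le> 0"
        using insert.prems that 0 unfolding degree_le_def by blast
      moreover have "finite (insert i S)" using that insert.hyps finite_subset by auto
      ultimately show False by simp
    qed
    then have "v = (\<lambda>x. 0)" unfolding v_def multilinear_def by auto
    then have "V = 0" "cube_avg I (\<lambda>x. (v x) ^ 4) = 0" "cube_avg I (\<lambda>x. (u x)\<^sup>2 * (v x)\<^sup>2) = 0"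
      unfolding V_def by (simp_all add: cube_avg_def)
    then show ?thesis unfolding fourth sq using u4 by simp
  next
    case (Suc l)
    have dv: "degree_le l I (\<lambda>S. a (insert i S))"
      unfolding degree_le_def
    proof (intro allI impI)
      fix S assume S: "S \<subseteq> I" "a (insert i S) \<noteq> 0"
      then have "card (insert i S) \<le> k" using insert.prems unfolding degree_le_def by blast
      moreover have "card (insert i S) = Suc (card S)"
        using S insert.hyps finite_subset[of S I] by (intro card_insert_disjoint) auto
      ultimately show "card S \<le> l" using Suc by simp
    qed
    have v4: "cube_avg I (\<lambda>x. (v x) ^ 4) \<le> 9 ^ l * V\<^sup>2"
      unfolding V_def v_def by (rule insert.IH[OF dv])
    have "(cube_avg I (\<lambda>x. (u x)\<^sup>2 * (v x)\<^sup>2))\<^sup>2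
        \<le> cube_avg I (\<lambda>x. (u x) ^ 4) * cube_avg I (\<lambda>x. (v x) ^ 4)"
      using cube_avg_Cauchy_Schwarz[of I "\<lambda>x. (u x)\<^sup>2" "\<lambda>x. (v x)\<^sup>2"] by simp
    also have "\<dots> \<le> (9 ^ k * U\<^sup>2) * (9 ^ l * V\<^sup>2)"
      by (intro mult_mono u4 v4 cube_avg_nonneg) auto
    also have "\<dots> = (9 * (9 ^ l * 9 ^ l)) * (U * V)\<^sup>2" by (simp add: Suc power_mult_distrib)
    also have "9 * (9 ^ l * 9 ^ l) = (3 * 9 ^ l :: real)\<^sup>2" by (simp add: power2_eq_square)
    also have "(3 * 9 ^ l)\<^sup>2 * (U * V)\<^sup>2 = (3 * 9 ^ l * (U * V))\<^sup>2" by (rule power_mult_distrib[symmetric])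
    finally have "cube_avg I (\<lambda>x. (u x)\<^sup>2 * (v x)\<^sup>2) \<le> 3 * 9 ^ l * (U * V)"
      by (rule power2_le_imp_le) (use UV in auto)
    then have "cube_avg I (\<lambda>x. (u x) ^ 4) + 6 * cube_avg I (\<lambda>x. (u x)\<^sup>2 * (v x)\<^sup>2) + cube_avg I (\<lambda>x. (v x) ^ 4)
        \<le> 9 ^ k * U\<^sup>2 + 6 * (3 * 9 ^ l * (U * V)) + 9 ^ l * V\<^sup>2"
      using u4 v4 by linarith
    \<comment> \<open>With \<open>k = Suc l\<close> the mixed term is
      \<open>6 * 3 * 9 ^ l * (U * V) = 2 * 9 ^ k * (U * V)\<close>, exactly the cross term of the
      square.\<close>
    also have "\<dots> \<le> 9 ^ k * (U + V)\<^sup>2"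
    proof -
      have "9 ^ l * V\<^sup>2 \<le> 9 ^ k * V\<^sup>2" unfolding Suc by (intro mult_right_mono power_increasing) auto
      moreover have "9 ^ k * (U + V)\<^sup>2 = 9 ^ k * U\<^sup>2 + 6 * (3 * 9 ^ l * (U * V)) + 9 ^ k * V\<^sup>2"
        by (simp add: Suc power2_sum distrib_left)
      ultimately show ?thesis by linarith
    qed
    finally show ?thesis unfolding fourth sq .
  qed
qed

text \<open>By Bonami's lemma the second moment cannot come from rare large values: where
  \<open>\<bar>g\<bar>\<close> exceeds a level \<open>l\<close>, \<open>g^2\<close> is at most
  \<open>g^4 / l^2\<close>, and elsewhere it is at most \<open>l * \<bar>g\<bar>\<close>.\<close>

lemma L2_le_L1:
  assumes "finite I" "degree_le k I a"
  shows "sqrt (\<Sum>S\<in>Pow I. (a S)\<^sup>2) \<le> 3 * 3 ^ k * cube_avg I (\<lambda>x. \<bar>multilinear I a x\<bar>)"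
proof -
  define g where "g = multilinear I a"
  define s where "s = sqrt (\<Sum>S\<in>Pow I. (a S)\<^sup>2)"
  have s2: "cube_avg I (\<lambda>x. (g x)\<^sup>2) = s\<^sup>2"
    unfolding s_def g_def by (simp add: Parseval[OF assms(1)] sum_nonneg)
  have s0: "0 \<le> s" unfolding s_def by (simp add: sum_nonneg)
  have E0: "0 \<le> cube_avg I (\<lambda>x. \<bar>g x\<bar>)" by (rule cube_avg_nonneg) simp
  show ?thesis
  proof (cases "s = 0")
    case True
    then show ?thesis unfolding s_def[symmetric] g_def[symmetric] using E0 by simp
  next
    case False
    then have sp: "0 < s" using s0 by simp
    \<comment> \<open>This level makes the fourth-moment term \<open>4/9 * s^2\<close>, so that
      \<open>5/9 * s^2\<close> is left for the first moment. The resulting constant 27/10 is rounded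
      up to 3.\<close>
    define l where "l = 3 / 2 * 3 ^ k * s"
    have lp: "0 < l" unfolding l_def using sp by simp
    have pt: "(g x)\<^sup>2 \<le> l * \<bar>g x\<bar> + (1 / l\<^sup>2) * (g x) ^ 4" for x
    proof (cases "\<bar>g x\<bar> \<le> l")
      case True
      then have "\<bar>g x\<bar> * \<bar>g x\<bar> \<le> l * \<bar>g x\<bar>" by (intro mult_right_mono) auto
      then show ?thesis by (simp add: power2_eq_square add_increasing2)
    next
      case False
      then have "l\<^sup>2 \<le> (g x)\<^sup>2" using lp by (intro abs_le_square_iff[THEN iffD1]) auto
      then have "(g x)\<^sup>2 * l\<^sup>2 \<le> (g x)\<^sup>2 * (g x)\<^sup>2" by (intro mult_left_mono) auto
      then have "(g x)\<^sup>2 \<le> (1 / l\<^sup>2) * (g x) ^ 4"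
        using lp by (simp add: field_simps power2_eq_square power4_eq_xxxx)
      then show ?thesis using lp by (simp add: add_increasing)
    qed
    have "s\<^sup>2 \<le> l * cube_avg I (\<lambda>x. \<bar>g x\<bar>) + (1 / l\<^sup>2) * cube_avg I (\<lambda>x. (g x) ^ 4)"
      unfolding s2[symmetric] cube_avg_cmult[symmetric] cube_avg_add[symmetric]
      by (rule cube_avg_mono) (rule pt)
    also have "\<dots> \<le> l * cube_avg I (\<lambda>x. \<bar>g x\<bar>) + (1 / l\<^sup>2) * (9 ^ k * (s\<^sup>2)\<^sup>2)"
      using Bonami[OF assms] unfolding g_def[symmetric] s2
      by (intro add_left_mono mult_left_mono) auto
    also have "(1 / l\<^sup>2) * (9 ^ k * (s\<^sup>2)\<^sup>2) = 4 / 9 * s\<^sup>2"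
    proof -
      have "l\<^sup>2 = 9 / 4 * 9 ^ k * s\<^sup>2"
        unfolding l_def by (simp add: power_mult_distrib power_even_eq[symmetric] power_mult[symmetric] power2_eq_square)
          (simp add: power_mult_distrib[symmetric])
      then have "9 ^ k * (s\<^sup>2)\<^sup>2 = 4 / 9 * s\<^sup>2 * l\<^sup>2" by (simp add: power2_eq_square)
      then show ?thesis using lp by simp
    qed
    finally have "s * (5 / 9 * s) \<le> s * (3 / 2 * 3 ^ k * cube_avg I (\<lambda>x. \<bar>g x\<bar>))"
      unfolding l_def by (simp add: power2_eq_square algebra_simps)
    then have "5 / 9 * s \<le> 3 / 2 * 3 ^ k * cube_avg I (\<lambda>x. \<bar>g x\<bar>)" using sp by simp
    then have "s \<le> 27 / 10 * (3 ^ k * cube_avg I (\<lambda>x. \<bar>g x\<bar>))" by simp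
    also have "\<dots> \<le> 3 * (3 ^ k * cube_avg I (\<lambda>x. \<bar>g x\<bar>))"
      using E0 by (intro mult_right_mono) auto
    finally show ?thesis unfolding s_def g_def by (simp add: mult.assoc)
  qed
qed

text \<open>The leading coefficient is eliminated by passing from \<open>p(t)\<close> to \<open>p(t) - 2 ^ k p(t/2)\<close>.\<close>

lemma linear_coeff_bound:
  "\<exists>C>0. \<forall>p M. degree p \<le> k \<longrightarrow> (\<forall>t::real. \<bar>t\<bar> \<le> 1/2 \<longrightarrow> \<bar>poly p t\<bar> \<le> M) \<longrightarrow> \<bar>coeff p 1\<bar> \<le> C * M"
proof (induction k)
  case 0
  have "\<bar>coeff p 1\<bar> \<le> 1 * M" if "degree p \<le> 0" "\<forall>t::real. \<bar>t\<bar> \<le> 1/2 \<longrightarrow> \<bar>poly p t\<bar> \<le> M" for p M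
  proof -
    have "coeff p 1 = 0" using that by (simp add: coeff_eq_0)
    moreover have "0 \<le> M" using that(2)[rule_format, of 0] by linarith
    ultimately show ?thesis by simp
  qed
  then show ?case by (intro exI[of _ 1]) auto
next
  case (Suc k)
  then obtain C where C: "C > 0"
    "\<And>p M. degree p \<le> k \<Longrightarrow> (\<forall>t::real. \<bar>t\<bar> \<le> 1/2 \<longrightarrow> \<bar>poly p t\<bar> \<le> M) \<Longrightarrow> \<bar>coeff p 1\<bar> \<le> C * M"
    by blast
  show ?case
  \<comment> \<open>The elimination multiplies the linear coefficient by \<open>1 - 2 ^ k\<close>.
    For \<open>k = 0\<close> it would destroy that coefficient, so linear polynomials are treated by
    the difference of two values.\<close>
  proof (cases "k = 0")
    case True
    have "\<bar>coeff p 1\<bar> \<le> 2 * M" if "degree p \<le> Suc k" "\<forall>t::real. \<bar>t\<bar> \<le> 1/2 \<longrightarrow> \<bar>poly p t\<bar> \<le> M" for p M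
    proof -
      have "degree p \<le> 1" using that True by simp
      then have "poly p t = coeff p 0 + coeff p 1 * t" for t
        unfolding poly_altdef by (cases "degree p = 0") (auto simp: coeff_eq_0 le_Suc_eq)
      then have "coeff p 1 = poly p (1/2) - poly p (- 1/2)" by simp
      then show ?thesis using that(2)[rule_format, of "1/2"] that(2)[rule_format, of "- 1/2"] by simp
    qed
    then show ?thesis by (intro exI[of _ 2]) auto
  next
    case False
    have "\<bar>coeff p 1\<bar> \<le> (C * (1 + 2 ^ Suc k)) * M"
      if d: "degree p \<le> Suc k" and b: "\<forall>t::real. \<bar>t\<bar> \<le> 1/2 \<longrightarrow> \<bar>poly p t\<bar> \<le> M" for p M
    proof -
      define q where "q = p - Polynomial.smult (2 ^ Suc k) (pcompose p [:0, 1/2:])"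
      have cq: "coeff q j = coeff p j * (1 - 2 ^ Suc k * (1/2) ^ j)" for j
        unfolding q_def by (simp add: coeff_pcompose_linear algebra_simps)
      have "degree q \<le> k"
      proof (rule degree_le, intro allI impI)
        fix j assume "k < j"
        show "coeff q j = 0"
        proof (cases "j = Suc k")
          case True
          then show ?thesis unfolding cq by (simp add: power_one_over)
        next
          case False
          then show ?thesis unfolding cq using \<open>k < j\<close> d by (simp add: coeff_eq_0)
        qed
      qed
      moreover have "\<forall>t::real. \<bar>t\<bar> \<le> 1/2 \<longrightarrow> \<bar>poly q t\<bar> \<le> (1 + 2 ^ Suc k) * M"
      proof (intro allI impI)
        fix t :: real assume t: "\<bar>t\<bar> \<le> 1/2"
        have "poly q t = poly p t - 2 ^ Suc k * poly p (t / 2)"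
          unfolding q_def by (simp add: poly_pcompose mult.commute)
        also have "\<bar>\<dots>\<bar> \<le> \<bar>poly p t\<bar> + 2 ^ Suc k * \<bar>poly p (t / 2)\<bar>"
          by (rule order_trans[OF abs_triangle_ineq4]) (simp add: abs_mult)
        also have "\<dots> \<le> M + 2 ^ Suc k * M"
          using b[rule_format, of t] b[rule_format, of "t/2"] t by (intro add_mono mult_left_mono) auto
        finally show "\<bar>poly q t\<bar> \<le> (1 + 2 ^ Suc k) * M" by (simp add: algebra_simps)
      qed
      ultimately have "\<bar>coeff q 1\<bar> \<le> C * ((1 + 2 ^ Suc k) * M)" by (rule C(2))
      moreover have "\<bar>coeff p 1\<bar> \<le> \<bar>coeff q 1\<bar>"
      proof -
        have "(2::real) ^ 1 \<le> 2 ^ k" using False by (intro power_increasing) auto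
        then have "1 \<le> \<bar>1 - 2 ^ Suc k * (1/2) ^ 1 :: real\<bar>" by simp
        then show ?thesis unfolding cq abs_mult
          using mult_left_mono[of 1 "\<bar>1 - 2 ^ Suc k * (1/2) ^ 1 :: real\<bar>" "\<bar>coeff p 1\<bar>"] by simp
      qed
      ultimately show ?thesis by (simp add: mult.assoc)
    qed
    moreover have "C * (1 + 2 ^ Suc k) > 0" using C(1) by (intro mult_pos_pos) (auto intro: add_pos_pos)
    ultimately show ?thesis by blast
  qed
qed

text \<open>The coefficients of the partial derivative in direction \<open>i\<close>, evaluated at \<open>x / 2\<close>.\<close>

definition half_derivative :: "'i \<Rightarrow> ('i set \<Rightarrow> real) \<Rightarrow> 'i set \<Rightarrow> real" where
  "half_derivative i a T = (if i \<in> T then 0 else a (insert i T) / 2 ^ card T)"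

section \<open>Gradients of bounded polynomials\<close>

lemma sum_containing:
  assumes "finite I" "i \<in> I"
  shows "(\<Sum>S\<in>Pow I. if i \<in> S then F S else 0) = (\<Sum>T\<in>Pow I. if i \<in> T then 0 else F (insert i T))"
proof -
  have I: "I = insert i (I - {i})" using assms by auto
  have f: "finite (I - {i})" "i \<notin> I - {i}" using assms by auto
  have "(\<Sum>T\<in>Pow (I - {i}). if i \<in> T then F T else 0) = 0" by (intro sum.neutral) auto
  moreover have "(\<Sum>T\<in>Pow (I - {i}). if i \<in> T then 0 else F (insert i T))
      = (\<Sum>T\<in>Pow (I - {i}). F (insert i T))" by (intro sum.cong) auto
  ultimately show ?thesis
    using sum_Pow_insert[OF f, of "\<lambda>S. if i \<in> S then F S else 0"]
      sum_Pow_insert[OF f, of "\<lambda>T. if i \<in> T then 0 else F (insert i T)"] assms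
    by (simp add: insert_absorb)
qed

text \<open>Restrict the polynomial to the line through \<open>x / 2\<close> whose direction
  consists of the signs of the partial derivatives there. For \<open>\<bar>t\<bar> \<le> 1/2\<close>
  the line stays in the cube, and the linear coefficient of the restriction is the l1 norm of the
  gradient, so \<open>linear_coeff_bound\<close> applies. Halving \<open>x\<close> is what leaves
  room for the direction.\<close>

lemma gradient_bound:
  "\<exists>C>0. \<forall>(I::'i set) a M x. finite I \<longrightarrow> degree_le k I a \<longrightarrow> cube_bounded I a M \<longrightarrow>
     (\<forall>i\<in>I. \<bar>x i\<bar> \<le> 1) \<longrightarrow> (\<Sum>i\<in>I. \<bar>multilinear I (half_derivative i a) x\<bar>) \<le> C * M"
proof -
  obtain C where C: "C > 0"
    "\<And>p M. degree p \<le> k \<Longrightarrow> (\<forall>t::real. \<bar>t\<bar> \<le> 1/2 \<longrightarrow> \<bar>poly p t\<bar> \<le> M) \<Longrightarrow> \<bar>coeff p 1\<bar> \<le> C * M"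
    using linear_coeff_bound[of k] by blast
  have "(\<Sum>i\<in>I. \<bar>multilinear I (half_derivative i a) x\<bar>) \<le> C * M"
    if fin: "finite I" and deg: "degree_le k I a" and bd: "cube_bounded I a M"
      and x: "\<forall>i\<in>I. \<bar>x i\<bar> \<le> 1" for I :: "'i set" and a M x
  proof -
    \<comment> \<open>Signs, so that the directional derivative along \<open>y\<close> adds up the
      moduli of the partial derivatives.\<close>
    define y where "y i = sgn (multilinear I (half_derivative i a) x)" for i
    have y: "\<bar>y i\<bar> \<le> 1" for i unfolding y_def by (simp add: abs_sgn_eq)
    define p where "p = (\<Sum>S\<in>Pow I. Polynomial.smult (a S) (\<Prod>i\<in>S. [:x i / 2, y i:]))"
    have "degree p \<le> k"
      unfolding p_def
    proof (rule degree_sum_le)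
      show "finite (Pow I)" using fin by simp
      fix S assume S: "S \<in> Pow I"
      show "degree (Polynomial.smult (a S) (\<Prod>i\<in>S. [:x i / 2, y i:])) \<le> k"
      proof (cases "a S = 0")
        case False
        have "degree (\<Prod>i\<in>S. [:x i / 2, y i:]) \<le> (\<Sum>i\<in>S. degree [:x i / 2, y i:])"
          by (rule degree_prod_sum_le[unfolded o_def]) (use S fin finite_subset in auto)
        also have "\<dots> \<le> (\<Sum>i\<in>S. 1)" by (intro sum_mono) (auto simp: degree_pCons_eq_if)
        also have "\<dots> \<le> k" using False S deg unfolding degree_le_def by auto
        finally show ?thesis using False by simp
      qed simp
    qed
    moreover have "\<forall>t::real. \<bar>t\<bar> \<le> 1/2 \<longrightarrow> \<bar>poly p t\<bar> \<le> M"
    proof (intro allI impI)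
      fix t :: real assume t: "\<bar>t\<bar> \<le> 1/2"
      have "poly p t = multilinear I a (\<lambda>i. x i / 2 + t * y i)"
        unfolding p_def multilinear_def by (simp add: poly_sum poly_prod)
      moreover have "\<bar>x i / 2 + t * y i\<bar> \<le> 1" if "i \<in> I" for i
      proof -
        have "\<bar>x i / 2 + t * y i\<bar> \<le> \<bar>x i\<bar> / 2 + \<bar>t\<bar> * \<bar>y i\<bar>"
          by (rule order_trans[OF abs_triangle_ineq]) (simp add: abs_mult)
        also have "\<dots> \<le> 1 / 2 + 1/2 * 1" using x that t y by (intro add_mono mult_mono divide_right_mono) auto
        finally show ?thesis by simp
      qed
      ultimately show "\<bar>poly p t\<bar> \<le> M" using bd unfolding cube_bounded_def by auto
    qed
    ultimately have "\<bar>coeff p 1\<bar> \<le> C * M" by (rule C(2))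
    moreover have "coeff p 1 = (\<Sum>i\<in>I. \<bar>multilinear I (half_derivative i a) x\<bar>)"
    proof -
      have 1: "coeff (\<Prod>i\<in>S. [:x i / 2, y i:]) 1 = (\<Sum>i\<in>I. if i \<in> S then y i * (\<Prod>j\<in>S - {i}. x j / 2) else 0)"
        if "S \<in> Pow I" for S
      proof -
        have "coeff (\<Prod>i\<in>S. [:x i / 2, y i:]) 1 = poly (pderiv (\<Prod>i\<in>S. [:x i / 2, y i:])) 0"
          by (simp add: poly_0_coeff_0 coeff_pderiv)
        also have "\<dots> = (\<Sum>i\<in>S. y i * (\<Prod>j\<in>S - {i}. x j / 2))"
          by (simp add: pderiv_prod poly_sum poly_prod pderiv_pCons mult.commute)
        also have "\<dots> = (\<Sum>i\<in>I. if i \<in> S then y i * (\<Prod>j\<in>S - {i}. x j / 2) else 0)"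
          using that fin by (intro sum.mono_neutral_cong_left) auto
        finally show ?thesis .
      qed
      have "coeff p 1 = (\<Sum>S\<in>Pow I. a S * (\<Sum>i\<in>I. if i \<in> S then y i * (\<Prod>j\<in>S - {i}. x j / 2) else 0))"
        unfolding p_def coeff_sum coeff_smult by (intro sum.cong refl) (simp only: 1)
      also have "\<dots> = (\<Sum>i\<in>I. \<Sum>S\<in>Pow I. if i \<in> S then a S * (y i * (\<Prod>j\<in>S - {i}. x j / 2)) else 0)"
        unfolding sum_distrib_left by (subst sum.swap) (intro sum.cong refl, auto)
      also have "\<dots> = (\<Sum>i\<in>I. y i * multilinear I (half_derivative i a) x)"
      proof (intro sum.cong refl)
        fix i assume i: "i \<in> I"
        show "(\<Sum>S\<in>Pow I. if i \<in> S then a S * (y i * (\<Prod>j\<in>S - {i}. x j / 2)) else 0)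
            = y i * multilinear I (half_derivative i a) x"
          unfolding sum_containing[OF fin i] multilinear_def sum_distrib_left half_derivative_def
          by (intro sum.cong refl) (auto simp: prod_dividef insert_Diff_if)
      qed
      also have "\<dots> = (\<Sum>i\<in>I. \<bar>multilinear I (half_derivative i a) x\<bar>)"
        unfolding y_def by (simp add: abs_sgn mult.commute)
      finally show ?thesis .
    qed
    ultimately show ?thesis by linarith
  qed
  with C(1) show ?thesis by blast
qed

lemma degree_le_half_derivative:
  assumes "finite I" "i \<in> I" "degree_le (Suc k) I a"
  shows "degree_le k I (half_derivative i a)"
  unfolding degree_le_def
proof (intro allI impI)
  fix T assume T: "T \<subseteq> I" "half_derivative i a T \<noteq> 0"
  then have "i \<notin> T" "a (insert i T) \<noteq> 0" unfolding half_derivative_def by (auto split: if_splits)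
  then have "card (insert i T) \<le> Suc k" using assms T unfolding degree_le_def by blast
  then show "card T \<le> k" using \<open>i \<notin> T\<close> T(1) assms(1) by (metis Suc_le_mono card_insert_disjoint finite_subset)
qed

lemma degree_le_mono: "degree_le k I a \<Longrightarrow> k \<le> l \<Longrightarrow> degree_le l I a"
  unfolding degree_le_def by (meson order_trans)

text \<open>The average of \<open>gradient_bound\<close> over the vertices: the derivatives have
  degree at most \<open>k\<close>, so their L2 norms are comparable to their L1 norms. The constant
  is the same for all finite \<open>I\<close>, and this is the source of all bounds that do not
  depend on the number of qubits.\<close>

lemma gradient_L2_bound:
  "\<exists>C>0. \<forall>(I::'i set) a M. finite I \<longrightarrow> degree_le k I a \<longrightarrow> cube_bounded I a M \<longrightarrow>
     (\<Sum>i\<in>I. sqrt (\<Sum>T\<in>Pow I. (half_derivative i a T)\<^sup>2)) \<le> C * M"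
proof -
  obtain C where C: "C > 0" "\<And>(I::'i set) a M x. finite I \<Longrightarrow> degree_le k I a \<Longrightarrow> cube_bounded I a M \<Longrightarrow>
     (\<forall>i\<in>I. \<bar>x i\<bar> \<le> 1) \<Longrightarrow> (\<Sum>i\<in>I. \<bar>multilinear I (half_derivative i a) x\<bar>) \<le> C * M"
    using gradient_bound[of k] by blast
  have "(\<Sum>i\<in>I. sqrt (\<Sum>T\<in>Pow I. (half_derivative i a T)\<^sup>2)) \<le> (3 * 3 ^ k * C) * M"
    if fin: "finite I" and deg: "degree_le k I a" and bd: "cube_bounded I a M" for I :: "'i set" and a M
  proof -
    have "(\<Sum>i\<in>I. sqrt (\<Sum>T\<in>Pow I. (half_derivative i a T)\<^sup>2))
        \<le> (\<Sum>i\<in>I. 3 * 3 ^ k * cube_avg I (\<lambda>x. \<bar>multilinear I (half_derivative i a) x\<bar>))"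
    proof (rule sum_mono)
      fix i assume i: "i \<in> I"
      have "degree_le k I (half_derivative i a)"
        using fin i deg by (intro degree_le_half_derivative degree_le_mono[OF deg]) auto
      then show "sqrt (\<Sum>T\<in>Pow I. (half_derivative i a T)\<^sup>2)
          \<le> 3 * 3 ^ k * cube_avg I (\<lambda>x. \<bar>multilinear I (half_derivative i a) x\<bar>)"
        by (rule L2_le_L1[OF fin])
    qed
    also have "\<dots> = 3 * 3 ^ k * cube_avg I (\<lambda>x. \<Sum>i\<in>I. \<bar>multilinear I (half_derivative i a) x\<bar>)"
      by (simp add: sum_distrib_left cube_avg_sum)
    also have "\<dots> \<le> 3 * 3 ^ k * cube_avg I (\<lambda>x. C * M)"
      by (intro mult_left_mono cube_avg_mono C(2)[OF fin deg bd]) auto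
    finally show ?thesis using fin by (simp add: cube_avg_const)
  qed
  moreover have "3 * 3 ^ k * C > 0" using C(1) by simp
  ultimately show ?thesis by blast
qed

section \<open>From gradients back to coefficients\<close>

lemma bounded_const_coeff:
  assumes "finite I" "cube_bounded I a M"
  shows "\<bar>a {}\<bar> \<le> M"
proof -
  have "multilinear I a (\<lambda>_. 0) = (\<Sum>S\<in>Pow I. if S = {} then a {} else 0)"
    unfolding multilinear_def
  proof (intro sum.cong refl)
    fix S assume "S \<in> Pow I"
    then have "finite S" using assms(1) finite_subset by auto
    then show "a S * (\<Prod>i\<in>S. 0) = (if S = {} then a {} else 0)" by (auto simp: card_gt_0_iff)
  qed
  also have "\<dots> = a {}" using assms(1) by simp
  finally show ?thesis using assms(2) unfolding cube_bounded_def
    by (metis abs_zero zero_le_one)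
qed

lemma coeff_eq_half_derivative:
  assumes "finite I" "S \<subseteq> I" "i \<in> S"
  shows "a S = 2 ^ (card S - 1) * half_derivative i a (S - {i})"
proof -
  have "finite S" using assms finite_subset by auto
  then show ?thesis using assms by (simp add: half_derivative_def insert_absorb card_Diff_singleton)
qed

text \<open>A coefficient is at most \<open>2 ^ k\<close> times the norm of the derivative in the
  direction of any of its variables. If every variable occurs in at most \<open>D\<close> monomials,
  charging each monomial to its variables reduces the sum to \<open>gradient_L2_bound\<close>. The
  hypothesis on \<open>D\<close> reflects the bounded degree of an observable.\<close>

lemma sparse_l1_bound:
  "\<exists>C\<ge>0. \<forall>(I::'i set) a M. finite I \<longrightarrow> degree_le k I a \<longrightarrow> cube_bounded I a M \<longrightarrow>
     (\<forall>i\<in>I. card {S\<in>Pow I. i \<in> S \<and> a S \<noteq> 0} \<le> D) \<longrightarrow> (\<Sum>S\<in>Pow I. \<bar>a S\<bar>) \<le> C * M"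
proof -
  obtain C where C: "C > 0" "\<And>(I::'i set) a M. finite I \<Longrightarrow> degree_le k I a \<Longrightarrow> cube_bounded I a M \<Longrightarrow>
     (\<Sum>i\<in>I. sqrt (\<Sum>T\<in>Pow I. (half_derivative i a T)\<^sup>2)) \<le> C * M"
    using gradient_L2_bound[of k] by blast
  have "(\<Sum>S\<in>Pow I. \<bar>a S\<bar>) \<le> (1 + real D * 2 ^ k * C) * M"
    if fin: "finite I" and deg: "degree_le k I a" and bd: "cube_bounded I a M"
      and sparse: "\<forall>i\<in>I. card {S\<in>Pow I. i \<in> S \<and> a S \<noteq> 0} \<le> D" for I :: "'i set" and a M
  proof -
    have coeff: "\<bar>a S\<bar> \<le> 2 ^ k * sqrt (\<Sum>T\<in>Pow I. (half_derivative i a T)\<^sup>2)"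
      if S: "S \<in> Pow I" "i \<in> S" for i S
    proof (cases "a S = 0")
      case False
      then have "card S \<le> k" using S(1) deg unfolding degree_le_def by blast
      then have k: "card S - 1 \<le> k" by linarith
      have "(half_derivative i a (S - {i}))\<^sup>2 \<le> (\<Sum>T\<in>Pow I. (half_derivative i a T)\<^sup>2)"
        using S fin by (intro member_le_sum) auto
      then have "\<bar>half_derivative i a (S - {i})\<bar> \<le> sqrt (\<Sum>T\<in>Pow I. (half_derivative i a T)\<^sup>2)"
        by (intro real_le_rsqrt) simp
      then have "2 ^ (card S - 1) * \<bar>half_derivative i a (S - {i})\<bar>
          \<le> 2 ^ k * sqrt (\<Sum>T\<in>Pow I. (half_derivative i a T)\<^sup>2)"
        using k by (intro mult_mono power_increasing) simp_all
      then show ?thesis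
        unfolding coeff_eq_half_derivative[OF fin PowD[OF S(1)] S(2), of a] abs_mult by simp
    qed (simp add: sum_nonneg)
    have sq0: "0 \<le> (\<Sum>T\<in>Pow I. (half_derivative i a T)\<^sup>2)" for i by (simp add: sum_nonneg)
    have split: "(\<Sum>S\<in>Pow I. \<bar>a S\<bar>) = \<bar>a {}\<bar> + (\<Sum>S\<in>Pow I - {{}}. \<bar>a S\<bar>)"
      using fin by (subst sum.remove[of _ "{}"]) auto
    \<comment> \<open>Every nonempty set is charged to all of its elements; the overcounting only
      weakens the bound.\<close>
    have "(\<Sum>S\<in>Pow I - {{}}. \<bar>a S\<bar>) \<le> (\<Sum>S\<in>Pow I - {{}}. \<Sum>i\<in>I. if i \<in> S then \<bar>a S\<bar> else 0)"
    proof (rule sum_mono)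
      fix S assume "S \<in> Pow I - {{}}"
      then obtain i where "i \<in> S" "S \<subseteq> I" by auto
      then show "\<bar>a S\<bar> \<le> (\<Sum>i\<in>I. if i \<in> S then \<bar>a S\<bar> else 0)"
        using member_le_sum[of i I "\<lambda>i. if i \<in> S then \<bar>a S\<bar> else 0"] fin by auto
    qed
    also have "\<dots> \<le> (\<Sum>S\<in>Pow I. \<Sum>i\<in>I. if i \<in> S then \<bar>a S\<bar> else 0)"
      using fin by (intro sum_mono2) (auto intro: sum_nonneg)
    also have "\<dots> = (\<Sum>i\<in>I. \<Sum>S\<in>Pow I. if i \<in> S then \<bar>a S\<bar> else 0)" by (rule sum.swap)
    also have "\<dots> \<le> (\<Sum>i\<in>I. real D * (2 ^ k * sqrt (\<Sum>T\<in>Pow I. (half_derivative i a T)\<^sup>2)))"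
    proof (rule sum_mono)
      fix i assume i: "i \<in> I"
      have "(\<Sum>S\<in>Pow I. if i \<in> S then \<bar>a S\<bar> else 0) = (\<Sum>S\<in>{S\<in>Pow I. i \<in> S \<and> a S \<noteq> 0}. \<bar>a S\<bar>)"
        using fin by (intro sum.mono_neutral_cong_right) auto
      also have "\<dots> \<le> of_nat (card {S\<in>Pow I. i \<in> S \<and> a S \<noteq> 0}) * (2 ^ k * sqrt (\<Sum>T\<in>Pow I. (half_derivative i a T)\<^sup>2))"
        by (rule sum_bounded_above, rule coeff) simp_all
      also have "\<dots> \<le> real D * (2 ^ k * sqrt (\<Sum>T\<in>Pow I. (half_derivative i a T)\<^sup>2))"
        using sparse i sq0 by (intro mult_right_mono) auto
      finally show "(\<Sum>S\<in>Pow I. if i \<in> S then \<bar>a S\<bar> else 0) \<le> \<dots>" .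
    qed
    also have "\<dots> = real D * 2 ^ k * (\<Sum>i\<in>I. sqrt (\<Sum>T\<in>Pow I. (half_derivative i a T)\<^sup>2))"
      by (simp add: sum_distrib_left mult.assoc)
    also have "\<dots> \<le> real D * 2 ^ k * (C * M)"
      by (intro mult_left_mono C(2)[OF fin deg bd]) auto
    finally have "(\<Sum>S\<in>Pow I. \<bar>a S\<bar>) \<le> M + real D * 2 ^ k * (C * M)"
      using bounded_const_coeff[OF fin bd] split by linarith
    also have "\<dots> = (1 + real D * 2 ^ k * C) * M" by (simp add: distrib_right)
    finally show ?thesis .
  qed
  note main = this
  show ?thesis
  proof (intro exI[of _ "1 + real D * 2 ^ k * C"] conjI allI impI)
    show "0 \<le> 1 + real D * 2 ^ k * C" using C(1) by simp
  qed (rule main)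
qed

text \<open>A qualitative form of the Bohnenblust--Hille inequality: small coefficients carry little
  weight. The variables are divided into light and heavy ones, according to the norm of the
  partial derivative. By \<open>gradient_L2_bound\<close> the light ones contribute little, and there are only
  few heavy ones, to whose derivatives the induction hypothesis applies.\<close>

lemma small_coeffs:
  fixes \<eta> :: real
  assumes "\<eta> > 0"
  shows "\<exists>\<tau>>0. \<forall>(I::'i set) a. finite I \<longrightarrow> degree_le k I a \<longrightarrow> cube_bounded I a 1 \<longrightarrow>
     (\<Sum>S\<in>Pow I. if \<bar>a S\<bar> \<le> \<tau> then (a S)\<^sup>2 else 0) \<le> \<eta>"
  using assms
proof (induction k arbitrary: \<eta>)
  case 0
  show ?case
  proof (intro exI[of _ "min 1 \<eta>"] conjI allI impI)
    show "0 < min 1 \<eta>" using 0 by simp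
    fix I :: "'i set" and a
    assume fin: "finite I" and deg: "degree_le 0 I a" and "cube_bounded I a 1"
    have z: "a S = 0" if "S \<in> Pow I" "S \<noteq> {}" for S
    proof (rule ccontr)
      assume "a S \<noteq> 0"
      then have "card S = 0" using that(1) deg unfolding degree_le_def by auto
      then show False using that fin finite_subset by fastforce
    qed
    have "(\<Sum>S\<in>Pow I. if \<bar>a S\<bar> \<le> min 1 \<eta> then (a S)\<^sup>2 else 0)
        = (\<Sum>S\<in>{{}}. if \<bar>a S\<bar> \<le> min 1 \<eta> then (a S)\<^sup>2 else 0)"
      using fin by (intro sum.mono_neutral_right) (auto simp: z)
    also have "\<dots> \<le> \<eta>"
    proof (cases "\<bar>a {}\<bar> \<le> min 1 \<eta>")
      case True
      then have "\<bar>a {}\<bar> * \<bar>a {}\<bar> \<le> 1 * \<eta>" by (intro mult_mono) auto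
      then show ?thesis using True by (simp add: power2_eq_square)
    qed (use 0 in auto)
    finally show "(\<Sum>S\<in>Pow I. if \<bar>a S\<bar> \<le> min 1 \<eta> then (a S)\<^sup>2 else 0) \<le> \<eta>" .
  qed
next
  case (Suc k)
  obtain C where C: "C > 0" "\<And>(I::'i set) a M. finite I \<Longrightarrow> degree_le (Suc k) I a \<Longrightarrow> cube_bounded I a M \<Longrightarrow>
     (\<Sum>i\<in>I. sqrt (\<Sum>T\<in>Pow I. (half_derivative i a T)\<^sup>2)) \<le> C * M"
    using gradient_L2_bound[of "Suc k"] by blast
  obtain C' where C': "C' > 0" "\<And>(I::'i set) a M x. finite I \<Longrightarrow> degree_le (Suc k) I a \<Longrightarrow> cube_bounded I a M \<Longrightarrow>
     (\<forall>i\<in>I. \<bar>x i\<bar> \<le> 1) \<Longrightarrow> (\<Sum>i\<in>I. \<bar>multilinear I (half_derivative i a) x\<bar>) \<le> C' * M"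
    using gradient_bound[of "Suc k"] by blast
  \<comment> \<open>The light variables will cost \<open>C * 4 ^ k * \<theta> = \<eta> / 3\<close>
    and the heavy ones \<open>C * 4 ^ k * C'^2 * \<eta>' / \<theta> = \<eta> / 3\<close>. The last
    third is kept for the empty set.\<close>
  define \<theta> where "\<theta> = \<eta> / (3 * 4 ^ k * C)"
  define \<eta>' where "\<eta>' = \<eta> * \<theta> / (3 * 4 ^ k * C * C'\<^sup>2)"
  have \<theta>: "\<theta> > 0" unfolding \<theta>_def using Suc.prems C by simp
  have \<eta>': "\<eta>' > 0" unfolding \<eta>'_def using Suc.prems C C' \<theta> by simp
  obtain \<tau>' where \<tau>': "\<tau>' > 0" "\<And>(I::'i set) a. finite I \<Longrightarrow> degree_le k I a \<Longrightarrow> cube_bounded I a 1 \<Longrightarrow>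
     (\<Sum>S\<in>Pow I. if \<bar>a S\<bar> \<le> \<tau>' then (a S)\<^sup>2 else 0) \<le> \<eta>'"
    using Suc.IH[OF \<eta>'] by blast
  \<comment> \<open>The bounds 1 and \<open>\<eta> / 3\<close> make the square of the constant
    coefficient at most \<open>\<eta> / 3\<close>; the bound \<open>\<tau>' * C'\<close> passes
    smallness on to the coefficients of the rescaled derivatives.\<close>
  define \<tau> where "\<tau> = min (min 1 (\<eta> / 3)) (\<tau>' * C')"
  have \<tau>: "\<tau> > 0" "\<tau> \<le> 1" "\<tau> \<le> \<eta> / 3" "\<tau> / C' \<le> \<tau>'"
    unfolding \<tau>_def using \<tau>' C' Suc.prems by (auto simp: divide_le_eq)
  show ?case
  proof (intro exI[of _ \<tau>] conjI allI impI)
    show "0 < \<tau>" by (rule \<tau>(1))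
    fix I :: "'i set" and a
    assume fin: "finite I" and deg: "degree_le (Suc k) I a" and bd: "cube_bounded I a 1"
    define b where "b S = (if \<bar>a S\<bar> \<le> \<tau> then (a S)\<^sup>2 else 0)" for S
    define w where "w i = (\<Sum>T\<in>Pow I. (half_derivative i a T)\<^sup>2)" for i
    define v where "v i = (\<Sum>S\<in>Pow I. if i \<in> S then b S else 0)" for i
    have b0: "0 \<le> b S" for S unfolding b_def by simp
    have w0: "0 \<le> w i" for i unfolding w_def by (simp add: sum_nonneg)
    have sumw: "(\<Sum>i\<in>I. sqrt (w i)) \<le> C" using C(2)[OF fin deg bd] unfolding w_def by simp
    have v: "v i = (\<Sum>T\<in>Pow I. if i \<in> T then 0 else b (insert i T))" if "i \<in> I" for i
      unfolding v_def by (rule sum_containing[OF fin that])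
    have pw: "(a (insert i T))\<^sup>2 \<le> 4 ^ k * (half_derivative i a T)\<^sup>2"
      if "i \<in> I" "i \<notin> T" "T \<in> Pow I" for i T
    proof (cases "a (insert i T) = 0")
      case False
      then have "card T \<le> k" using degree_le_half_derivative[OF fin that(1) deg] that
        unfolding degree_le_def half_derivative_def by auto
      then have "(4::real) ^ card T \<le> 4 ^ k" by (intro power_increasing) auto
      moreover have "(a (insert i T))\<^sup>2 = 4 ^ card T * (half_derivative i a T)\<^sup>2"
        using that by (simp add: half_derivative_def power_divide power_even_eq[symmetric] power2_eq_square
            power_mult_distrib[symmetric])
      ultimately show ?thesis by (simp add: mult_right_mono)
    qed simp
    have light: "v i \<le> 4 ^ k * (\<theta> * sqrt (w i))" if i: "i \<in> I" and "sqrt (w i) \<le> \<theta>" for i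
    proof -
      have "v i \<le> (\<Sum>T\<in>Pow I. 4 ^ k * (half_derivative i a T)\<^sup>2)"
        unfolding v[OF i] by (intro sum_mono) (use pw i in \<open>auto simp: b_def\<close>)
      also have "\<dots> = 4 ^ k * (sqrt (w i) * sqrt (w i))" unfolding w_def using w0[of i]
        by (simp add: sum_distrib_left w_def)
      also have "\<dots> \<le> 4 ^ k * (\<theta> * sqrt (w i))" using that w0 by (intro mult_left_mono mult_right_mono) auto
      finally show ?thesis .
    qed
    have heavy: "v i \<le> 4 ^ k * (C'\<^sup>2 * \<eta>')" if i: "i \<in> I" for i
    proof -
      \<comment> \<open>By \<open>gradient_bound\<close> a single partial derivative is bounded by
        \<open>C'\<close> on the cube. Divided by \<open>C'\<close> it satisfies the hypotheses of
        the induction, with degree one less.\<close>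
      define c where "c T = half_derivative i a T / C'" for T
      have "cube_bounded I c 1"
        unfolding cube_bounded_def
      proof (intro allI impI)
        fix x :: "'i \<Rightarrow> real" assume x: "\<forall>i\<in>I. \<bar>x i\<bar> \<le> 1"
        have "\<bar>multilinear I (half_derivative i a) x\<bar> \<le> (\<Sum>i\<in>I. \<bar>multilinear I (half_derivative i a) x\<bar>)"
          using fin i by (intro member_le_sum) auto
        also have "\<dots> \<le> C'" using C'(2)[OF fin deg bd x] by simp
        finally have "\<bar>multilinear I (half_derivative i a) x\<bar> / C' \<le> 1" using C'(1) by simp
        moreover have "multilinear I c x = multilinear I (half_derivative i a) x / C'"
          unfolding multilinear_def c_def by (simp add: sum_divide_distrib)
        ultimately show "\<bar>multilinear I c x\<bar> \<le> 1" using C'(1) by simp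
      qed
      moreover have "degree_le k I c"
        using degree_le_half_derivative[OF fin i deg] C'(1) unfolding degree_le_def c_def by auto
      ultimately have c: "(\<Sum>S\<in>Pow I. if \<bar>c S\<bar> \<le> \<tau>' then (c S)\<^sup>2 else 0) \<le> \<eta>'" using \<tau>'(2)[OF fin] by blast
      have "v i \<le> (\<Sum>T\<in>Pow I. 4 ^ k * (C'\<^sup>2 * (if \<bar>c T\<bar> \<le> \<tau>' then (c T)\<^sup>2 else 0)))"
        unfolding v[OF i]
      proof (rule sum_mono)
        fix T assume T: "T \<in> Pow I"
        show "(if i \<in> T then 0 else b (insert i T)) \<le> 4 ^ k * (C'\<^sup>2 * (if \<bar>c T\<bar> \<le> \<tau>' then (c T)\<^sup>2 else 0))"
        proof (cases "i \<notin> T \<and> \<bar>a (insert i T)\<bar> \<le> \<tau>")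
          case True
          have "\<bar>a (insert i T)\<bar> / 2 ^ card T \<le> \<bar>a (insert i T)\<bar> / 1" by (intro divide_left_mono) auto
          then have "\<bar>half_derivative i a T\<bar> \<le> \<tau>" using True by (simp add: half_derivative_def)
          then have "\<bar>c T\<bar> \<le> \<tau> / C'" unfolding c_def using C'(1) by (simp add: divide_right_mono)
          then have "\<bar>c T\<bar> \<le> \<tau>'" using \<tau>(4) by linarith
          then show ?thesis using True pw[OF i _ T] C'(1) by (simp add: b_def c_def power_divide)
        qed (auto simp: b_def)
      qed
      also have "\<dots> = 4 ^ k * (C'\<^sup>2 * (\<Sum>S\<in>Pow I. if \<bar>c S\<bar> \<le> \<tau>' then (c S)\<^sup>2 else 0))"
        by (simp only: sum_distrib_left)
      also have "\<dots> \<le> 4 ^ k * (C'\<^sup>2 * \<eta>')" by (intro mult_left_mono c) auto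
      finally show ?thesis .
    qed
    \<comment> \<open>Markov's inequality in disguise: a heavy variable has
      \<open>1 < sqrt (w i) / \<theta>\<close>, so its bound may be multiplied by this factor. Both
      kinds of variables are then summed against \<open>sqrt (w i)\<close>, and no explicit count of
      the heavy ones is made.\<close>
    have vi: "v i \<le> sqrt (w i) * (4 ^ k * (\<theta> + C'\<^sup>2 * \<eta>' / \<theta>))" if i: "i \<in> I" for i
    proof (cases "sqrt (w i) \<le> \<theta>")
      case True
      then have "v i \<le> sqrt (w i) * (4 ^ k * \<theta>)" using light[OF i] by (simp add: mult_ac)
      also have "\<dots> \<le> sqrt (w i) * (4 ^ k * (\<theta> + C'\<^sup>2 * \<eta>' / \<theta>))"
        using w0[of i] \<eta>' \<theta> by (intro mult_left_mono) auto
      finally show ?thesis .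
    next
      case False
      have "v i \<le> 1 * (4 ^ k * (C'\<^sup>2 * \<eta>'))" using heavy[OF i] by simp
      also have "\<dots> \<le> (sqrt (w i) / \<theta>) * (4 ^ k * (C'\<^sup>2 * \<eta>'))"
        using False \<theta> \<eta>' by (intro mult_right_mono) auto
      also have "\<dots> = sqrt (w i) * (4 ^ k * (C'\<^sup>2 * \<eta>' / \<theta>))" by simp
      also have "\<dots> \<le> sqrt (w i) * (4 ^ k * (\<theta> + C'\<^sup>2 * \<eta>' / \<theta>))"
        using w0[of i] \<theta> by (intro mult_left_mono) auto
      finally show ?thesis .
    qed
    have split: "(\<Sum>S\<in>Pow I. b S) = b {} + (\<Sum>S\<in>Pow I - {{}}. b S)"
      using fin by (subst sum.remove[of _ "{}"]) auto
    have "(\<Sum>S\<in>Pow I - {{}}. b S) \<le> (\<Sum>S\<in>Pow I - {{}}. \<Sum>i\<in>I. if i \<in> S then b S else 0)"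
    proof (rule sum_mono)
      fix S assume "S \<in> Pow I - {{}}"
      then obtain i where "i \<in> S" "S \<subseteq> I" by auto
      then show "b S \<le> (\<Sum>i\<in>I. if i \<in> S then b S else 0)"
        using member_le_sum[of i I "\<lambda>i. if i \<in> S then b S else 0"] fin b0 by auto
    qed
    also have "\<dots> \<le> (\<Sum>S\<in>Pow I. \<Sum>i\<in>I. if i \<in> S then b S else 0)"
      using fin b0 by (intro sum_mono2) (auto intro: sum_nonneg)
    also have "\<dots> = (\<Sum>i\<in>I. v i)" unfolding v_def by (rule sum.swap)
    also have "\<dots> \<le> (\<Sum>i\<in>I. sqrt (w i)) * (4 ^ k * (\<theta> + C'\<^sup>2 * \<eta>' / \<theta>))"
      unfolding sum_distrib_right by (intro sum_mono vi)
    also have "\<dots> \<le> C * (4 ^ k * (\<theta> + C'\<^sup>2 * \<eta>' / \<theta>))"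
      using \<theta> \<eta>' by (intro mult_right_mono sumw) auto
    also have "\<dots> = \<eta> / 3 + \<eta> / 3"
    proof -
      have "C * (4 ^ k * \<theta>) = \<eta> / 3" unfolding \<theta>_def using C(1) by simp
      moreover have "C * (4 ^ k * (C'\<^sup>2 * \<eta>' / \<theta>)) = \<eta> / 3" unfolding \<eta>'_def using C(1) C'(1) \<theta> by simp
      ultimately show ?thesis by (simp add: distrib_left)
    qed
    finally have "(\<Sum>S\<in>Pow I - {{}}. b S) \<le> \<eta> / 3 + \<eta> / 3" .
    moreover have "b {} \<le> \<eta> / 3"
    proof (cases "\<bar>a {}\<bar> \<le> \<tau>")
      case True
      then have "\<bar>a {}\<bar> * \<bar>a {}\<bar> \<le> 1 * (\<eta> / 3)" using \<tau> by (intro mult_mono) auto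
      then show ?thesis using True by (simp add: b_def power2_eq_square)
    qed (use Suc.prems in \<open>auto simp: b_def\<close>)
    ultimately show "(\<Sum>S\<in>Pow I. if \<bar>a S\<bar> \<le> \<tau> then (a S)\<^sup>2 else 0) \<le> \<eta>"
      using split unfolding b_def by linarith
  qed
qed


section \<open>The prediction program\<close>

definition steps :: "com \<Rightarrow> nat \<Rightarrow> store \<Rightarrow> (store \<Rightarrow> bool) \<Rightarrow> bool" where
  "steps c T s Q \<longleftrightarrow> (\<exists>t s'. exec c s t s' \<and> t \<le> T \<and> Q s')"

lemma steps_mono: "steps c T s Q \<Longrightarrow> T \<le> T' \<Longrightarrow> (\<And>s'. Q s' \<Longrightarrow> Q' s') \<Longrightarrow> steps c T' s Q'"
  unfolding steps_def using le_trans by blast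

lemma steps_Skip: "Q s \<Longrightarrow> 1 \<le> T \<Longrightarrow> steps Skip T s Q"
  unfolding steps_def using exec.Skip by blast

lemma steps_Assign: "Q (s(x := expr_val a s)) \<Longrightarrow> 1 \<le> T \<Longrightarrow> steps (Assign x a) T s Q"
  unfolding steps_def using exec.Assign by blast

text \<open>The postcondition of the first command is itself a \<open>steps\<close> statement about
  the second, so that correctness proofs follow the program text.\<close>

lemma steps_Seq:
  assumes "steps c1 T1 s (\<lambda>s'. steps c2 T2 s' Q)"
  shows "steps (Seq c1 c2) (T1 + T2) s Q"
proof -
  from assms obtain t1 s1 t2 s2 where "exec c1 s t1 s1" "t1 \<le> T1" "exec c2 s1 t2 s2" "t2 \<le> T2" "Q s2"
    unfolding steps_def by blast
  then show ?thesis unfolding steps_def by (intro exI[of _ "t1 + t2"] exI[of _ s2]) (auto intro: exec.Seq)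
qed

lemma steps_Seq_Assign:
  assumes "steps c T (s(x := expr_val a s)) Q"
  shows "steps (Seq (Assign x a) c) (Suc T) s Q"
  using steps_Seq[of "Assign x a" 1 s c T Q] assms by (simp add: steps_Assign)

lemma steps_Cond:
  assumes "test_val b s \<Longrightarrow> steps c1 T s Q" "\<not> test_val b s \<Longrightarrow> steps c2 T s Q"
  shows "steps (Cond b c1 c2) (Suc T) s Q"
proof (cases "test_val b s")
  case True
  from assms(1)[OF this] obtain t s' where "exec c1 s t s'" "t \<le> T" "Q s'" unfolding steps_def by blast
  with exec.CondTrue[OF True this(1)] show ?thesis unfolding steps_def
    by (intro exI[of _ "t + 1"] exI[of _ s']) auto
next
  case False
  from assms(2)[OF this] obtain t s' where "exec c2 s t s'" "t \<le> T" "Q s'" unfolding steps_def by blast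
  with exec.CondFalse[OF False this(1)] show ?thesis unfolding steps_def
    by (intro exI[of _ "t + 1"] exI[of _ s']) auto
qed

text \<open>The invariant is indexed by the number of remaining iterations and so serves as the
  variant, too; every iteration pays one unit for its test.\<close>

lemma steps_While:
  assumes "\<And>m s. I (Suc m) s \<Longrightarrow> test_val b s \<and> steps c B s (I m)"
    and "\<And>s. I 0 s \<Longrightarrow> \<not> test_val b s"
    and "I m s"
  shows "steps (While b c) (m * (B + 1) + 1) s (I 0)"
  using assms(3)
proof (induction m arbitrary: s)
  case 0
  then show ?case unfolding steps_def
    using exec.WhileFalse[OF assms(2)[OF 0]] by (intro exI[of _ 1] exI[of _ s]) simp
next
  case (Suc m)
  from assms(1)[OF Suc.prems] obtain t1 s1
    where 1: "test_val b s" "exec c s t1 s1" "t1 \<le> B" "I m s1" unfolding steps_def by blast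
  from Suc.IH[OF 1(4)] obtain t2 s2
    where 2: "exec (While b c) s1 t2 s2" "t2 \<le> m * (B + 1) + 1" "I 0 s2" unfolding steps_def by blast
  have "exec (While b c) s (t1 + t2 + 1) s2" by (rule exec.WhileTrue[OF 1(1,2) 2(1)])
  then show ?case unfolding steps_def using 1(3) 2(2,3)
    by (intro exI[of _ "t1 + t2 + 1"] exI[of _ s2]) simp
qed

lemma encode_list_simps [simp]:
  "encode_list f [] = Null" "encode_list f (x # xs) = Node (f x) (encode_list f xs)"
  unfolding encode_list_def by simp_all

definition for_each :: "nat \<Rightarrow> com \<Rightarrow> com" where
  "for_each x c = While (IsNode (Var x)) (Seq c (Assign x (Right (Var x))))"

text \<open>The parameter of the invariant is a ghost variable, the value of a fold over the part of
  the list already processed. By the second assumption the invariant must not depend on the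
  iterator, which the loop itself advances.\<close>

lemma steps_for_each:
  assumes body: "\<And>y ys a s. y \<in> set xs \<Longrightarrow> I a s \<Longrightarrow> s x = Node (f y) (encode_list f ys)
      \<Longrightarrow> steps c B s (\<lambda>s'. I (g a y) s' \<and> s' x = s x)"
    and upd: "\<And>a s v. I a s \<Longrightarrow> I a (s(x := v))"
    and "I a s" "s x = encode_list f xs"
  shows "steps (for_each x c) (length xs * (B + 2) + 1) s (I (foldl g a xs))"
proof -
  define J where "J m s \<longleftrightarrow> (\<exists>ys zs. xs = ys @ zs \<and> length zs = m \<and> I (foldl g a ys) s \<and> s x = encode_list f zs)" for m s
  have "steps (for_each x c) (length xs * ((B + 1) + 1) + 1) s (J 0)"
    unfolding for_each_def
  proof (rule steps_While)
    fix m s assume "J (Suc m) s"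
    then obtain ys zs' where z': "xs = ys @ zs'" "length zs' = Suc m" "I (foldl g a ys) s"
      "s x = encode_list f zs'" unfolding J_def by blast
    then obtain z zs where "zs' = z # zs" by (cases zs') auto
    with z' have z: "xs = ys @ z # zs" "length zs = m" "I (foldl g a ys) s"
      "s x = Node (f z) (encode_list f zs)" by simp_all
    have "steps c B s (\<lambda>s'. I (g (foldl g a ys) z) s' \<and> s' x = s x)"
      by (rule body[OF _ z(3,4)]) (simp add: z(1))
    then have "steps c B s (\<lambda>s'. steps (Assign x (Right (Var x))) 1 s' (J m))"
    proof (rule steps_mono[OF _ order_refl])
      fix s' assume s': "I (g (foldl g a ys) z) s' \<and> s' x = s x"
      have "J m (s'(x := encode_list f zs))"
        unfolding J_def
      proof (intro exI conjI)
        show "xs = (ys @ [z]) @ zs" "length zs = m" using z by simp_all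
        show "I (foldl g a (ys @ [z])) (s'(x := encode_list f zs))" using s' upd by simp
      qed simp
      then show "steps (Assign x (Right (Var x))) 1 s' (J m)"
        by (intro steps_Assign) (use s' z(4) in simp_all)
    qed
    then show "test_val (IsNode (Var x)) s \<and> steps (Seq c (Assign x (Right (Var x)))) (B + 1) s (J m)"
      using z(4) by (auto intro: steps_Seq simp del: One_nat_def add_Suc_right)
  next
    fix s assume "J 0 s"
    then show "\<not> test_val (IsNode (Var x)) s" unfolding J_def by auto
  next
    show "J (length xs) s" unfolding J_def using assms(3,4) by (intro exI[of _ "[]"] exI[of _ xs]) simp
  qed
  then show ?thesis by (rule steps_mono) (auto simp: J_def)
qed

text \<open>The classical shadow of one qubit: with the projector onto \<open>s\<close> written as
  \<open>\<Pi>\<close>, the value is \<open>tr (p * (3 * \<Pi> - 1))\<close>.\<close>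

fun shadow :: "pauli \<Rightarrow> stab \<Rightarrow> real" where
  "shadow PI _ = 1"
| "shadow PX XPlus = 3" | "shadow PX XMinus = - 3"
| "shadow PY YPlus = 3" | "shadow PY YMinus = - 3"
| "shadow PZ Z0 = 3" | "shadow PZ Z1 = - 3"
| "shadow _ _ = 0"

definition shadow_prod :: "pauli list \<Rightarrow> stab list \<Rightarrow> real" where
  "shadow_prod P ss = prod_list (map2 shadow P ss)"

definition sample_value :: "pauli list \<Rightarrow> pauli list \<Rightarrow> sample \<Rightarrow> real" where
  "sample_value P Q s = shadow_prod P (fst s) * shadow_prod Q (snd s)"

text \<open>Here \<open>a\<close> is the code of the eigenstate with eigenvalue 1, and its successor
  encodes the one with eigenvalue -1. The only numerical test is a strict comparison of reals, so
  codes are separated at half-integers.\<close>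

definition sign_factor :: "nat \<Rightarrow> expr \<Rightarrow> rat \<Rightarrow> com" where
  "sign_factor y s a =
     Cond (Less s (Const (a - 1/2))) (Assign y (Const 0))
       (Cond (Less s (Const (a + 1/2))) (Assign y (Mul (Const 3) (Var y)))
         (Cond (Less s (Const (a + 3/2))) (Assign y (Mul (Const (- 3)) (Var y))) (Assign y (Const 0))))"

definition shadow_factor :: "nat \<Rightarrow> expr \<Rightarrow> expr \<Rightarrow> com" where
  "shadow_factor y p s =
     Cond (Less p (Const (1/2))) Skip
       (Cond (Less p (Const (3/2))) (sign_factor y s 2)
         (Cond (Less p (Const (5/2))) (sign_factor y s 4) (sign_factor y s 0)))"

fun stab_code :: "stab \<Rightarrow> nat" where
  "stab_code Z0 = 0" | "stab_code Z1 = 1" | "stab_code XPlus = 2" | "stab_code XMinus = 3"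
| "stab_code YPlus = 4" | "stab_code YMinus = 5"

lemma steps_sign_factor:
  assumes "num_of (expr_val e s) = real m" "s y = Num r"
    and "Q (s(y := Num (r * (if m = a then 3 else if m = Suc a then - 3 else 0))))"
  shows "steps (sign_factor y e (of_nat a)) 4 s Q"
proof -
  have c: "real_of_rat (of_nat a - 1/2) = real a - 1/2" "real_of_rat (of_nat a + 1/2) = real a + 1/2"
    "real_of_rat (of_nat a + 3/2) = real a + 3/2" "real_of_rat (- 3) = - 3"
    by (simp_all add: of_rat_divide of_rat_add of_rat_diff of_rat_minus)
  have 4: "4 = Suc (Suc (Suc 1))" by simp
  have "Q (s(y := Num 0))" if "real m < real a - 1/2 \<or> \<not> real m < real a + 3/2"
    using that assms(3) by (auto split: if_splits)
  moreover have "Q (s(y := Num (3 * r)))" if "\<not> real m < real a - 1/2" "real m < real a + 1/2"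
  proof -
    have "m = a" using that by linarith
    then show ?thesis using assms(3) by (simp add: mult.commute)
  qed
  moreover have "Q (s(y := Num (- 3 * r)))" if "\<not> real m < real a + 1/2" "real m < real a + 3/2"
  proof -
    have "m = Suc a" using that by linarith
    then show ?thesis using assms(3) by (simp add: mult.commute)
  qed
  ultimately show ?thesis
    unfolding sign_factor_def 4
    by (intro steps_Cond steps_Assign) (simp_all add: c assms(1,2))
qed

lemma steps_shadow_factor:
  assumes "expr_val p s = encode_pauli P" "expr_val e s = encode_stab S" "s y = Num r"
    and "Q (s(y := Num (r * shadow P S)))"
  shows "steps (shadow_factor y p e) 7 s Q"
proof -
  have c: "real_of_rat (3/2) = 3/2" "real_of_rat (5/2) = 5/2" "real_of_rat (1/2) = 1/2"
    by (simp_all add: of_rat_divide)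
  have s: "s(y := Num r) = s" using assms(3) by auto
  have m: "num_of (expr_val e s) = real (stab_code S)" unfolding assms(2) by (cases S) auto
  have 7: "7 = Suc (Suc (Suc 4))" by simp
  show ?thesis
  proof (cases P)
    case PI
    then have "Q s" using assms(4) s by simp
    then show ?thesis
      unfolding shadow_factor_def 7 by (intro steps_Cond steps_Skip) (simp_all add: assms(1) PI c)
  next
    case PX
    have "steps (sign_factor y e 2) 4 s Q"
      using steps_sign_factor[OF m assms(3), of Q 2] assms(4) PX by (cases S) auto
    then show ?thesis
      unfolding shadow_factor_def 7
      by (intro steps_Cond) (auto simp: assms(1) PX c elim: steps_mono)
  next
    case PY
    have "steps (sign_factor y e 4) 4 s Q"
      using steps_sign_factor[OF m assms(3), of Q 4] assms(4) PY by (cases S) auto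
    then show ?thesis
      unfolding shadow_factor_def 7 by (intro steps_Cond) (simp_all add: assms(1) PY c)
  next
    case PZ
    have "steps (sign_factor y e 0) 4 s Q"
      using steps_sign_factor[OF m assms(3), of Q 0] assms(4) PZ by (cases S) auto
    then show ?thesis
      unfolding shadow_factor_def 7 by (intro steps_Cond) (simp_all add: assms(1) PZ c)
  qed
qed

text \<open>The binary logarithm rounded up, described as the number of doublings that take 1 to at
  least \<open>n\<close>. This is how a program without rounding and logarithms computes it.\<close>

definition log_steps :: "nat \<Rightarrow> nat" where
  "log_steps n = (LEAST j. n \<le> 2 ^ j)"

lemma log_steps_le: "n \<le> 2 ^ log_steps n"
  unfolding log_steps_def by (rule LeastI[of _ n]) (simp add: less_imp_le)

lemma log_steps_iff: "n \<le> 2 ^ j \<longleftrightarrow> log_steps n \<le> j"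
proof
  show "n \<le> 2 ^ j \<Longrightarrow> log_steps n \<le> j" unfolding log_steps_def by (rule Least_le)
  assume "log_steps n \<le> j"
  then have "(2::nat) ^ log_steps n \<le> 2 ^ j" by (intro power_increasing) auto
  then show "n \<le> 2 ^ j" using log_steps_le[of n] by linarith
qed

lemma log_steps_le_self: "log_steps n \<le> n"
  unfolding log_steps_iff[symmetric] by (simp add: less_imp_le)

definition estimate :: "sample list \<Rightarrow> pauli list list \<Rightarrow> (pauli list \<Rightarrow> real) \<Rightarrow> pauli list \<Rightarrow> real" where
  "estimate S Qs b P = (\<Sum>Q\<leftarrow>Qs. b Q * (\<Sum>s\<leftarrow>S. sample_value P Q s)) / real (length S)"

text \<open>The constants of the analysis are not computed by the program: they enter the threshold only
  through the number \<open>N\<close> of samples.\<close>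

definition keep :: "nat \<Rightarrow> nat \<Rightarrow> real \<Rightarrow> bool" where
  "keep n N \<alpha> \<longleftrightarrow> real (log_steps n + 1) < \<alpha> * \<alpha> * \<alpha> * \<alpha> * real N"

definition prediction :: "nat \<Rightarrow> sample list \<Rightarrow> pauli list list \<Rightarrow> (pauli list \<Rightarrow> real) \<Rightarrow>
    pauli list list \<Rightarrow> (pauli list \<Rightarrow> real) \<Rightarrow> real" where
  "prediction n S Ps v Qs b = (\<Sum>P\<leftarrow>Ps. if keep n (length S) (estimate S Qs b P)
     then estimate S Qs b P * v P else 0)"

abbreviation encode_term :: "(pauli list \<Rightarrow> real) \<Rightarrow> pauli list \<Rightarrow> data" where
  "encode_term b \<equiv> \<lambda>P. Node (encode_list encode_pauli P) (Num (b P))"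

text \<open>
  Variables of the program: samples (1), terms of the observable (2), iterators over the terms of
  the state (3), of the observable (8) and over the samples (10), prediction (4), number of
  samples (5), threshold (6), power of two (7), estimated coefficient (9), sum over the
  samples (11), iterators over the qubits (12--15), product over the qubits (16).
\<close>

definition qubit_loop :: com where
  "qubit_loop = While (IsNode (Var 12))
     (Seq (shadow_factor 16 (Left (Var 14)) (Left (Var 12)))
     (Seq (shadow_factor 16 (Left (Var 15)) (Left (Var 13)))
     (Seq (Assign 12 (Right (Var 12)))
     (Seq (Assign 13 (Right (Var 13)))
     (Seq (Assign 14 (Right (Var 14)))
          (Assign 15 (Right (Var 15))))))))"

definition sample_loop :: com where
  "sample_loop = for_each 10
     (Seq (Assign 12 (Left (Left (Var 10))))
     (Seq (Assign 13 (Right (Left (Var 10))))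
     (Seq (Assign 14 (Left (Left (Var 3))))
     (Seq (Assign 15 (Left (Left (Var 8))))
     (Seq (Assign 16 (Const 1))
     (Seq qubit_loop
          (Assign 11 (Add (Var 11) (Var 16)))))))))"

definition observable_loop :: com where
  "observable_loop = for_each 8
     (Seq (Assign 10 (Var 1))
     (Seq (Assign 11 (Const 0))
     (Seq sample_loop
          (Assign 9 (Add (Var 9) (Mul (Right (Left (Var 8))) (Var 11)))))))"

definition state_loop :: com where
  "state_loop = for_each 3
     (Seq (Assign 8 (Var 2))
     (Seq (Assign 9 (Const 0))
     (Seq observable_loop
     (Seq (Assign 9 (Div (Var 9) (Var 5)))
          (Cond (Less (Var 6) (Mul (Mul (Mul (Mul (Var 9) (Var 9)) (Var 9)) (Var 9)) (Var 5)))
             (Assign 4 (Add (Var 4) (Mul (Var 9) (Right (Left (Var 3))))))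
             Skip)))))"

definition predictor :: com where
  "predictor =
     Seq (Assign 1 (Right (Right (Right (Left (Var 0))))))
    (Seq (Assign 2 (Right (Right (Var 0))))
    (Seq (Assign 3 (Left (Right (Var 0))))
    (Seq (Assign 4 (Const 0))
    (Seq (Assign 5 (Const 0))
    (Seq (Assign 6 (Const 1))
    (Seq (Assign 7 (Const 1))
    (Seq (Assign 10 (Var 1))
    (Seq (for_each 10 (Assign 5 (Add (Var 5) (Const 1))))
    (Seq (While (Less (Var 7) (Left (Left (Var 0))))
            (Seq (Assign 7 (Add (Var 7) (Var 7))) (Assign 6 (Add (Var 6) (Const 1)))))
    (Seq state_loop
         (Assign 0 (Var 4))))))))))))"

text \<open>The frame condition: inner loops write only to variables with larger numbers, so a
  single bound describes what they leave alone.\<close>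

definition agree_below :: "nat \<Rightarrow> store \<Rightarrow> store \<Rightarrow> bool" where
  "agree_below m s s' \<longleftrightarrow> (\<forall>x<m. s' x = s x)"

lemma agree_below_refl: "agree_below m s s" unfolding agree_below_def by simp

lemma agree_below_upd: "agree_below m s s' \<Longrightarrow> m \<le> x \<Longrightarrow> agree_below m s (s'(x := v))"
  unfolding agree_below_def by simp

section \<open>Correctness and running time of the program\<close>

lemma steps_qubit_loop:
  assumes "length P = n" "length Q = n" "length xs = n" "length ys = n"
    and "s 12 = encode_list encode_stab xs" "s 13 = encode_list encode_stab ys"
    and "s 14 = encode_list encode_pauli P" "s 15 = encode_list encode_pauli Q" "s 16 = Num r"
  shows "steps qubit_loop (19 * n + 1) s
    (\<lambda>s'. agree_below 12 s s' \<and> s' 16 = Num (r * (shadow_prod P xs * shadow_prod Q ys)))"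
proof -
  \<comment> \<open>The product accumulated so far times the products over the remaining qubits does
    not change.\<close>
  define J where "J m s' \<longleftrightarrow> agree_below 12 s s' \<and> (\<exists>P' Q' xs' ys' r'.
      length P' = m \<and> length Q' = m \<and> length xs' = m \<and> length ys' = m \<and>
      s' 12 = encode_list encode_stab xs' \<and> s' 13 = encode_list encode_stab ys' \<and>
      s' 14 = encode_list encode_pauli P' \<and> s' 15 = encode_list encode_pauli Q' \<and> s' 16 = Num r' \<and>
      r' * (shadow_prod P' xs' * shadow_prod Q' ys') = r * (shadow_prod P xs * shadow_prod Q ys))" for m s'
  have "steps qubit_loop (n * (18 + 1) + 1) s (J 0)"
    unfolding qubit_loop_def
  proof (rule steps_While)
    fix m s1 assume "J (Suc m) s1"
    then obtain P' Q' xs' ys' r' where 1: "length P' = Suc m" "length Q' = Suc m" "length xs' = Suc m" "length ys' = Suc m"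
      "s1 12 = encode_list encode_stab xs'" "s1 13 = encode_list encode_stab ys'"
      "s1 14 = encode_list encode_pauli P'" "s1 15 = encode_list encode_pauli Q'" "s1 16 = Num r'"
      "r' * (shadow_prod P' xs' * shadow_prod Q' ys') = r * (shadow_prod P xs * shadow_prod Q ys)"
      "agree_below 12 s s1" unfolding J_def by blast
    obtain p P'' where p: "P' = p # P''" using 1 by (cases P') auto
    obtain q Q'' where q: "Q' = q # Q''" using 1 by (cases Q') auto
    obtain x xs'' where x: "xs' = x # xs''" using 1 by (cases xs') auto
    obtain y ys'' where y: "ys' = y # ys''" using 1 by (cases ys') auto
    have "steps (Seq (shadow_factor 16 (Left (Var 14)) (Left (Var 12)))
     (Seq (shadow_factor 16 (Left (Var 15)) (Left (Var 13)))
     (Seq (Assign 12 (Right (Var 12)))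
     (Seq (Assign 13 (Right (Var 13)))
     (Seq (Assign 14 (Right (Var 14)))
          (Assign 15 (Right (Var 15)))))))) (7 + (7 + Suc (Suc (Suc 1)))) s1 (J m)"
    proof (rule steps_Seq, rule steps_shadow_factor[of _ _ p _ x _ r'], goal_cases)
      case 4
      show ?case
      proof (rule steps_Seq, rule steps_shadow_factor[of _ _ q _ y _ "r' * shadow p x"], goal_cases)
        case 4
        have "J m (s1(16 := Num (r' * shadow p x), 16 := Num (r' * shadow p x * shadow q y),
            12 := encode_list encode_stab xs'', 13 := encode_list encode_stab ys'',
            14 := encode_list encode_pauli P'', 15 := encode_list encode_pauli Q''))"
          unfolding J_def
        proof (intro conjI exI)
          show "r' * shadow p x * shadow q y * (shadow_prod P'' xs'' * shadow_prod Q'' ys'')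
              = r * (shadow_prod P xs * shadow_prod Q ys)"
            unfolding 1(10)[symmetric] p q x y by (simp add: shadow_prod_def)
          show "agree_below 12 s (s1(16 := Num (r' * shadow p x), 16 := Num (r' * shadow p x * shadow q y),
            12 := encode_list encode_stab xs'', 13 := encode_list encode_stab ys'',
            14 := encode_list encode_pauli P'', 15 := encode_list encode_pauli Q''))"
            by (intro agree_below_upd 1(11)) auto
        qed (use 1(1-4) p q x y in simp_all)
        then show ?case
          by (intro steps_Seq_Assign steps_Assign) (simp_all add: 1 p q x y)
      qed (simp_all add: 1 p q x y)
    qed (simp_all add: 1 p q x y)
    then show "test_val (IsNode (Var 12)) s1 \<and> steps (Seq (shadow_factor 16 (Left (Var 14)) (Left (Var 12)))
     (Seq (shadow_factor 16 (Left (Var 15)) (Left (Var 13)))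
     (Seq (Assign 12 (Right (Var 12)))
     (Seq (Assign 13 (Right (Var 13)))
     (Seq (Assign 14 (Right (Var 14)))
          (Assign 15 (Right (Var 15)))))))) 18 s1 (J m)"
      using 1(5) x by simp
  next
    fix s1 assume "J 0 s1"
    then show "\<not> test_val (IsNode (Var 12)) s1" unfolding J_def by auto
  next
    show "J n s" unfolding J_def using assms by (intro conjI exI agree_below_refl) auto
  qed
  then show ?thesis by (rule steps_mono) (auto simp: J_def shadow_prod_def)
qed

lemma foldl_add_sum_list: "foldl (\<lambda>a y. a + g y) a xs = a + (\<Sum>y\<leftarrow>xs. g y)" for a :: real
  by (induction xs arbitrary: a) auto

lemma steps_sample_loop:
  assumes "length P = n" "length Q = n" "S \<in> training_sets n N"
    and "s 3 = Node (encode_term v P) D3" "s 8 = Node (encode_term b Q) D8"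
    and "s 10 = encode_list encode_sample S" "s 11 = Num 0"
  shows "steps sample_loop (N * (19 * n + 9) + 1) s
    (\<lambda>s'. agree_below 10 s s' \<and> s' 11 = Num (\<Sum>x\<leftarrow>S. sample_value P Q x))"
proof -
  define I where "I a s' \<longleftrightarrow> agree_below 10 s s' \<and> s' 11 = Num a" for a s'
  have "steps sample_loop (length S * ((19 * n + 7) + 2) + 1) s
      (I (foldl (\<lambda>a y. a + sample_value P Q y) 0 S))"
    unfolding sample_loop_def
  proof (rule steps_for_each)
    show "I 0 s" unfolding I_def using assms agree_below_refl by auto
    fix y ys a s1
    assume y: "y \<in> set S" and I: "I a s1" and s1: "s1 10 = Node (encode_sample y) (encode_list encode_sample ys)"
    obtain y1 y2 where y12: "y = (y1, y2)" by (cases y)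
    have len: "length y1 = n" "length y2 = n" using assms(3) y y12 unfolding training_sets_def by auto
    have s3: "s1 3 = s 3" "s1 8 = s 8" using I unfolding I_def agree_below_def by auto
    define s2 where "s2 = s1(12 := encode_list encode_stab y1, 13 := encode_list encode_stab y2,
       14 := encode_list encode_pauli P, 15 := encode_list encode_pauli Q, 16 := Num 1)"
    have q: "steps qubit_loop (19 * n + 1) s2
      (\<lambda>s'. agree_below 12 s2 s' \<and> s' 16 = Num (1 * (shadow_prod P y1 * shadow_prod Q y2)))"
      by (rule steps_qubit_loop) (use assms len in \<open>simp_all add: s2_def\<close>)
    have "steps (Seq qubit_loop (Assign 11 (Add (Var 11) (Var 16)))) (19 * n + 1 + 1) s2
       (\<lambda>s'. I (a + sample_value P Q y) s' \<and> s' 10 = s1 10)"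
    proof (rule steps_Seq, rule steps_mono[OF q order_refl])
      fix s' assume s': "agree_below 12 s2 s' \<and> s' 16 = Num (1 * (shadow_prod P y1 * shadow_prod Q y2))"
      have eq: "s' x = s1 x" if "x < 12" for x
        using s' that unfolding agree_below_def s2_def by auto
      have "I (a + sample_value P Q y) (s'(11 := Num (a + sample_value P Q y)))"
        unfolding I_def using I eq unfolding I_def agree_below_def by auto
      then show "steps (Assign 11 (Add (Var 11) (Var 16))) 1 s'
         (\<lambda>s'. I (a + sample_value P Q y) s' \<and> s' 10 = s1 10)"
        using s' eq[of 11] eq[of 10] I
        by (intro steps_Assign) (auto simp: I_def y12 sample_value_def)
    qed
    then have "steps (Seq (Assign 12 (Left (Left (Var 10))))
     (Seq (Assign 13 (Right (Left (Var 10))))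
     (Seq (Assign 14 (Left (Left (Var 3))))
     (Seq (Assign 15 (Left (Left (Var 8))))
     (Seq (Assign 16 (Const 1))
     (Seq qubit_loop
          (Assign 11 (Add (Var 11) (Var 16))))))))) (Suc (Suc (Suc (Suc (Suc (19 * n + 1 + 1)))))) s1
       (\<lambda>s'. I (a + sample_value P Q y) s' \<and> s' 10 = s1 10)"
      unfolding s2_def
      by (intro steps_Seq_Assign) (simp add: s1 s3 assms y12 encode_sample_def)
    then show "steps (Seq (Assign 12 (Left (Left (Var 10))))
     (Seq (Assign 13 (Right (Left (Var 10))))
     (Seq (Assign 14 (Left (Left (Var 3))))
     (Seq (Assign 15 (Left (Left (Var 8))))
     (Seq (Assign 16 (Const 1))
     (Seq qubit_loop
          (Assign 11 (Add (Var 11) (Var 16))))))))) (19 * n + 7) s1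
       (\<lambda>s'. I (a + sample_value P Q y) s' \<and> s' 10 = s1 10)"
      by (rule steps_mono) auto
  next
    show "I a (s(10 := v))" if "I a s" for a s v
      using that unfolding I_def by (simp add: agree_below_upd)
  qed (rule assms)
  then show ?thesis
    by (rule steps_mono) (use assms(3) in \<open>auto simp: I_def training_sets_def foldl_add_sum_list\<close>)
qed

lemma steps_observable_loop:
  assumes "length P = n" "\<And>Q. Q \<in> set Qs \<Longrightarrow> length Q = n" "S \<in> training_sets n N"
    and "s 1 = encode_list encode_sample S" "s 3 = Node (encode_term v P) D3"
    and "s 8 = encode_list (encode_term b) Qs" "s 9 = Num 0"
  shows "steps observable_loop (length Qs * (N * (19 * n + 9) + 6) + 1) s
    (\<lambda>s'. agree_below 8 s s' \<and> s' 9 = Num (\<Sum>Q\<leftarrow>Qs. b Q * (\<Sum>x\<leftarrow>S. sample_value P Q x)))"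
proof -
  define I where "I a s' \<longleftrightarrow> agree_below 8 s s' \<and> s' 9 = Num a" for a s'
  have "steps observable_loop (length Qs * ((N * (19 * n + 9) + 4) + 2) + 1) s
      (I (foldl (\<lambda>a Q. a + b Q * (\<Sum>x\<leftarrow>S. sample_value P Q x)) 0 Qs))"
    unfolding observable_loop_def
  proof (rule steps_for_each)
    show "I 0 s" unfolding I_def using assms agree_below_refl by auto
    fix Q ys a s1
    assume Q: "Q \<in> set Qs" and I: "I a s1"
      and s1: "s1 8 = Node (encode_term b Q) (encode_list (encode_term b) ys)"
    have s3: "s1 3 = s 3" "s1 1 = s 1" using I unfolding I_def agree_below_def by auto
    define s2 where "s2 = s1(10 := encode_list encode_sample S, 11 := Num 0)"
    have q: "steps sample_loop (N * (19 * n + 9) + 1) s2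
      (\<lambda>s'. agree_below 10 s2 s' \<and> s' 11 = Num (\<Sum>x\<leftarrow>S. sample_value P Q x))"
      by (rule steps_sample_loop[where v = v and b = b])
        (use assms Q s1 s3 in \<open>simp_all add: s2_def\<close>)
    have "steps (Seq sample_loop (Assign 9 (Add (Var 9) (Mul (Right (Left (Var 8))) (Var 11)))))
       (N * (19 * n + 9) + 1 + 1) s2
       (\<lambda>s'. I (a + b Q * (\<Sum>x\<leftarrow>S. sample_value P Q x)) s' \<and> s' 8 = s1 8)"
    proof (rule steps_Seq, rule steps_mono[OF q order_refl])
      fix s' assume s': "agree_below 10 s2 s' \<and> s' 11 = Num (\<Sum>x\<leftarrow>S. sample_value P Q x)"
      have eq: "s' x = s1 x" if "x < 10" for x
        using s' that unfolding agree_below_def s2_def by auto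
      have "I r (s'(9 := Num r))" for r
        unfolding I_def using I eq unfolding I_def agree_below_def by auto
      then show "steps (Assign 9 (Add (Var 9) (Mul (Right (Left (Var 8))) (Var 11)))) 1 s'
         (\<lambda>s'. I (a + b Q * (\<Sum>x\<leftarrow>S. sample_value P Q x)) s' \<and> s' 8 = s1 8)"
        using s' eq[of 9] eq[of 8] I s1
        by (intro steps_Assign) (auto simp: I_def)
    qed
    then have "steps (Seq (Assign 10 (Var 1)) (Seq (Assign 11 (Const 0)) (Seq sample_loop
         (Assign 9 (Add (Var 9) (Mul (Right (Left (Var 8))) (Var 11)))))))
       (Suc (Suc (N * (19 * n + 9) + 1 + 1))) s1
       (\<lambda>s'. I (a + b Q * (\<Sum>x\<leftarrow>S. sample_value P Q x)) s' \<and> s' 8 = s1 8)"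
      unfolding s2_def
      by (intro steps_Seq_Assign) (simp add: s1 s3 assms del: One_nat_def)
    then show "steps (Seq (Assign 10 (Var 1)) (Seq (Assign 11 (Const 0)) (Seq sample_loop
         (Assign 9 (Add (Var 9) (Mul (Right (Left (Var 8))) (Var 11)))))))
       (N * (19 * n + 9) + 4) s1
       (\<lambda>s'. I (a + b Q * (\<Sum>x\<leftarrow>S. sample_value P Q x)) s' \<and> s' 8 = s1 8)"
      by (rule steps_mono) auto
  next
    show "I a (s(8 := v))" if "I a s" for a s v
      using that unfolding I_def by (simp add: agree_below_upd)
  qed (rule assms)
  then show ?thesis
    by (rule steps_mono) (auto simp: I_def foldl_add_sum_list)
qed

lemma steps_state_loop:
  assumes "\<And>P. P \<in> set Ps \<Longrightarrow> length P = n" "\<And>Q. Q \<in> set Qs \<Longrightarrow> length Q = n" "S \<in> training_sets n N"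
    and "s 1 = encode_list encode_sample S" "s 2 = encode_list (encode_term b) Qs"
    and "s 3 = encode_list (encode_term v) Ps" "s 4 = Num 0" "s 5 = Num (real N)"
    and "s 6 = Num (real (log_steps n + 1))"
  shows "steps state_loop (length Ps * (length Qs * (N * (19 * n + 9) + 6) + 8) + 1) s
    (\<lambda>s'. s' 4 = Num (prediction n S Ps v Qs b))"
proof -
  define I where "I a s' \<longleftrightarrow> agree_below 3 s s' \<and> s' 4 = Num a \<and> s' 5 = s 5 \<and> s' 6 = s 6" for a s'
  define e where "e = estimate S Qs b"
  define g where "g P = (if keep n (length S) (e P) then e P * v P else 0)" for P
  have N: "N = length S" using assms(3) unfolding training_sets_def by auto
  have "steps state_loop (length Ps * ((length Qs * (N * (19 * n + 9) + 6) + 6) + 2) + 1) s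
      (I (foldl (\<lambda>a P. a + g P) 0 Ps))"
    unfolding state_loop_def
  proof (rule steps_for_each)
    show "I 0 s" unfolding I_def using assms agree_below_refl by auto
    fix P ys a s1
    assume P: "P \<in> set Ps" and I: "I a s1"
      and s1: "s1 3 = Node (encode_term v P) (encode_list (encode_term v) ys)"
    have s3: "s1 1 = s 1" "s1 2 = s 2" using I unfolding I_def agree_below_def by auto
    define s2 where "s2 = s1(8 := encode_list (encode_term b) Qs, 9 := Num 0)"
    define B where "B = length Qs * (N * (19 * n + 9) + 6)"
    let ?rest = "Seq (Assign 9 (Div (Var 9) (Var 5)))
          (Cond (Less (Var 6) (Mul (Mul (Mul (Mul (Var 9) (Var 9)) (Var 9)) (Var 9)) (Var 5)))
             (Assign 4 (Add (Var 4) (Mul (Var 9) (Right (Left (Var 3))))))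
             Skip)"
    have q: "steps observable_loop (B + 1) s2
      (\<lambda>s'. agree_below 8 s2 s' \<and> s' 9 = Num (\<Sum>Q\<leftarrow>Qs. b Q * (\<Sum>x\<leftarrow>S. sample_value P Q x)))"
      unfolding B_def
      by (rule steps_observable_loop[where v = v])
        (use assms P s1 s3 in \<open>simp_all add: s2_def\<close>)
    have "steps (Seq observable_loop ?rest) (B + 1 + Suc (Suc 1)) s2
       (\<lambda>s'. I (a + g P) s' \<and> s' 3 = s1 3)"
    proof (rule steps_Seq, rule steps_mono[OF q order_refl])
      fix s' assume s': "agree_below 8 s2 s' \<and> s' 9 = Num (\<Sum>Q\<leftarrow>Qs. b Q * (\<Sum>x\<leftarrow>S. sample_value P Q x))"
      have eq: "s' x = s1 x" if "x < 8" for x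
        using s' that unfolding agree_below_def s2_def by auto
      have div: "expr_val (Div (Var 9) (Var 5)) s' = Num (e P)"
        using s' eq[of 5] I assms(8) unfolding I_def e_def estimate_def by (simp add: N)
      have c: "test_val (Less (Var 6) (Mul (Mul (Mul (Mul (Var 9) (Var 9)) (Var 9)) (Var 9)) (Var 5)))
          (s'(9 := Num (e P))) \<longleftrightarrow> keep n (length S) (e P)"
        using eq[of 5] eq[of 6] I assms(8,9) unfolding I_def keep_def by (simp add: N)
      have upd: "I r (s'(9 := x, 4 := Num r))" for r and x :: data
        unfolding I_def using I eq unfolding I_def agree_below_def by auto
      have same: "I a (s'(9 := x))" for x :: data
        unfolding I_def using I eq unfolding I_def agree_below_def by auto
      show "steps ?rest (Suc (Suc 1)) s' (\<lambda>s'. I (a + g P) s' \<and> s' 3 = s1 3)"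
      proof (rule steps_Seq_Assign, rule steps_Cond, goal_cases)
        case 1
        then have k: "keep n (length S) (e P)" unfolding div c .
        have "expr_val (Add (Var 4) (Mul (Var 9) (Right (Left (Var 3))))) (s'(9 := Num (e P))) = Num (a + g P)"
          using eq[of 3] eq[of 4] s1 I k unfolding I_def g_def by simp
        then show ?case unfolding div using upd[of "a + g P" "Num (e P)"] eq[of 3]
          by (intro steps_Assign) simp_all
      next
        case 2
        then have k: "\<not> keep n (length S) (e P)" unfolding div c .
        show ?case unfolding div using same eq[of 3] k
          by (intro steps_Skip) (simp_all add: g_def)
      qed
    qed
    then have "steps (Seq (Assign 8 (Var 2)) (Seq (Assign 9 (Const 0)) (Seq observable_loop ?rest)))
       (Suc (Suc (B + 1 + Suc (Suc 1)))) s1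
       (\<lambda>s'. I (a + g P) s' \<and> s' 3 = s1 3)"
      unfolding s2_def
      by (intro steps_Seq_Assign) (simp add: s1 s3 assms)
    then show "steps (Seq (Assign 8 (Var 2)) (Seq (Assign 9 (Const 0)) (Seq observable_loop ?rest)))
       (length Qs * (N * (19 * n + 9) + 6) + 6) s1
       (\<lambda>s'. I (a + g P) s' \<and> s' 3 = s1 3)"
      unfolding B_def by (rule steps_mono) auto
  next
    show "I a (s(3 := v))" if "I a s" for a s v
      using that unfolding I_def by (simp add: agree_below_upd)
  qed (rule assms)
  then show ?thesis
    unfolding prediction_def e_def[symmetric] g_def[symmetric]
    by (rule steps_mono) (auto simp: I_def foldl_add_sum_list)
qed

definition predictor_time :: "nat \<Rightarrow> nat \<Rightarrow> nat \<Rightarrow> nat \<Rightarrow> nat" where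
  "predictor_time n N K L = K * (L * (N * (19 * n + 9) + 6) + 8) + 3 * N + 3 * n + 12"

lemma runs_predictor:
  assumes "\<And>P. P \<in> set Ps \<Longrightarrow> length P = n" "\<And>Q. Q \<in> set Qs \<Longrightarrow> length Q = n" "S \<in> training_sets n N"
  shows "\<exists>t \<le> predictor_time n N (length Ps) (length Qs).
    runs predictor (Node (train_input n \<epsilon> \<epsilon>' S)
       (Node (encode_list (encode_term v) Ps) (encode_list (encode_term b) Qs)))
      t (Num (prediction n S Ps v Qs b))"
proof -
  define inp where "inp = Node (train_input n \<epsilon> \<epsilon>' S)
       (Node (encode_list (encode_term v) Ps) (encode_list (encode_term b) Qs))"
  define s0 :: store where "s0 = (\<lambda>_. Null)(0 := inp)"
  have N: "N = length S" using assms(3) unfolding training_sets_def by auto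
  define I where "I a s \<longleftrightarrow> s 0 = inp \<and> s 1 = encode_list encode_sample S \<and>
    s 2 = encode_list (encode_term b) Qs \<and> s 3 = encode_list (encode_term v) Ps \<and> s 4 = Num 0 \<and>
    s 5 = Num a \<and> s 6 = Num 1 \<and> s 7 = Num 1" for a and s :: store
  \<comment> \<open>Here \<open>m\<close> counts the doublings still to come. Variable 6 starts at 1
    and grows with each doubling, hence ends at the threshold
    \<open>log_steps n + 1\<close>.\<close>
  define J where "J m s \<longleftrightarrow> m \<le> log_steps n \<and> s 0 = inp \<and> s 1 = encode_list encode_sample S \<and>
    s 2 = encode_list (encode_term b) Qs \<and> s 3 = encode_list (encode_term v) Ps \<and> s 4 = Num 0 \<and>
    s 5 = Num (real N) \<and> s 6 = Num (real (log_steps n - m) + 1) \<and> s 7 = Num (2 ^ (log_steps n - m))" for m and s :: store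
  let ?lw = "While (Less (Var 7) (Left (Left (Var 0))))
            (Seq (Assign 7 (Add (Var 7) (Var 7))) (Assign 6 (Add (Var 6) (Const 1))))"
  let ?TS = "length Ps * (length Qs * (N * (19 * n + 9) + 6) + 8) + 1"
  have final: "steps (Seq state_loop (Assign 0 (Var 4))) (?TS + 1) s
      (\<lambda>s. s 0 = Num (prediction n S Ps v Qs b))" if J: "J 0 s" for s
  proof (rule steps_Seq, rule steps_mono)
    show "steps state_loop ?TS s (\<lambda>s'. s' 4 = Num (prediction n S Ps v Qs b))"
      by (rule steps_state_loop) (use assms J in \<open>auto simp: J_def\<close>)
  qed (auto intro: steps_Assign)
  have log: "steps ?lw (log_steps n * (Suc 1 + 1) + 1) s (J 0)" if J0: "J (log_steps n) s" for s
  proof (rule steps_While[where I = J])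
    show "J (log_steps n) s" by (rule J0)
  next
    fix m s assume J: "J (Suc m) s"
    define j where "j = log_steps n - Suc m"
    have j: "log_steps n - m = Suc j" "j < log_steps n" using J unfolding J_def j_def by auto
    then have "(2::nat) ^ j < n" using log_steps_iff[of n j] by linarith
    then have "real (2 ^ j) < real n" by (simp only: of_nat_less_iff)
    then have "2 ^ j < real n" by simp
    then have t: "test_val (Less (Var 7) (Left (Left (Var 0)))) s"
      using J unfolding J_def j_def[symmetric] inp_def train_input_def by simp
    have "J m (s(7 := Num (2 ^ Suc j), 6 := Num (real (Suc j) + 1)))"
      using J j unfolding J_def by auto
    then show "test_val (Less (Var 7) (Left (Left (Var 0)))) s \<and>
        steps (Seq (Assign 7 (Add (Var 7) (Var 7))) (Assign 6 (Add (Var 6) (Const 1)))) (Suc 1) s (J m)"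
    proof (intro conjI t steps_Seq_Assign steps_Assign)
      have v: "s 6 = Num (real j + 1)" "s 7 = Num (2 ^ j)"
        using J unfolding J_def j_def by auto
      have "(2::real) ^ j + 2 ^ j = 2 ^ Suc j" "real j + 1 + 1 = real (Suc j) + 1" by simp_all
      then show "J m (s(7 := expr_val (Add (Var 7) (Var 7)) s,
          6 := expr_val (Add (Var 6) (Const 1)) (s(7 := expr_val (Add (Var 7) (Var 7)) s))))"
        using \<open>J m _\<close> v by simp
    qed simp
  next
    fix s assume J: "J 0 s"
    have "real n \<le> real (2 ^ log_steps n)"
      using log_steps_le[of n] by (simp only: of_nat_le_iff)
    then show "\<not> test_val (Less (Var 7) (Left (Left (Var 0)))) s"
      using J unfolding J_def inp_def train_input_def by simp
  qed
  have count: "steps (for_each 10 (Assign 5 (Add (Var 5) (Const 1)))) (length S * (1 + 2) + 1) s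
      (I (foldl (\<lambda>a y. a + 1) 0 S))" if "I 0 s" "s 10 = encode_list encode_sample S" for s
  proof (rule steps_for_each[where f = encode_sample])
    fix y ys a s assume "I a s"
    then show "steps (Assign 5 (Add (Var 5) (Const 1))) 1 s (\<lambda>s'. I (a + 1) s' \<and> s' 10 = s 10)"
      by (intro steps_Assign) (auto simp: I_def)
  qed (use that in \<open>auto simp: I_def\<close>)
  have cnt: "foldl (\<lambda>a y. a + 1) 0 S = real N"
    using foldl_add_sum_list[of "\<lambda>_. 1" 0 S] by (simp add: N sum_list_triv)
  define s1 where "s1 = s0(1 := encode_list encode_sample S, 2 := encode_list (encode_term b) Qs,
    3 := encode_list (encode_term v) Ps, 4 := Num 0, 5 := Num 0, 6 := Num 1, 7 := Num 1,
    10 := encode_list encode_sample S)"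
  have "steps (Seq (for_each 10 (Assign 5 (Add (Var 5) (Const 1)))) (Seq ?lw (Seq state_loop (Assign 0 (Var 4)))))
      ((length S * (1 + 2) + 1) + ((log_steps n * (Suc 1 + 1) + 1) + (?TS + 1))) s1
      (\<lambda>s. s 0 = Num (prediction n S Ps v Qs b))"
  proof (rule steps_Seq, rule steps_mono[OF count order_refl])
    show "I 0 s1" "s1 10 = encode_list encode_sample S" unfolding I_def s1_def s0_def by simp_all
    fix s assume "I (foldl (\<lambda>a y. a + 1) 0 S) s"
    then have "J (log_steps n) s" unfolding cnt unfolding I_def J_def by simp
    then show "steps (Seq ?lw (Seq state_loop (Assign 0 (Var 4))))
       ((log_steps n * (Suc 1 + 1) + 1) + (?TS + 1)) s (\<lambda>s. s 0 = Num (prediction n S Ps v Qs b))"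
      by (intro steps_Seq steps_mono[OF log order_refl] final)
  qed
  then have "steps predictor (Suc (Suc (Suc (Suc (Suc (Suc (Suc (Suc
      ((length S * (1 + 2) + 1) + ((log_steps n * (Suc 1 + 1) + 1) + (?TS + 1))))))))))) s0
      (\<lambda>s. s 0 = Num (prediction n S Ps v Qs b))"
    unfolding predictor_def s1_def
    by (intro steps_Seq_Assign) (simp add: s0_def inp_def train_input_def)
  then have "steps predictor (predictor_time n N (length Ps) (length Qs)) s0
      (\<lambda>s. s 0 = Num (prediction n S Ps v Qs b))"
    by (rule steps_mono) (use log_steps_le_self[of n] in \<open>auto simp: predictor_time_def N\<close>)
  then show ?thesis unfolding steps_def runs_def s0_def inp_def by blast
qed


section \<open>Tensor products and Pauli matrices\<close>

lemma adjoint_dim [simp]: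
  "dim_row (mat_adjoint A) = dim_col A" "dim_col (mat_adjoint A) = dim_row A"
  unfolding mat_adjoint_def by simp_all

lemma adjoint_carrier [simp]: "A \<in> carrier_mat m k \<Longrightarrow> mat_adjoint A \<in> carrier_mat k m"
  by auto

lemma adjoint_index [simp]:
  "i < dim_col A \<Longrightarrow> j < dim_row A \<Longrightarrow> mat_adjoint A $$ (i, j) = cnj (A $$ (j, i))" for A :: "complex mat"
  unfolding mat_adjoint_def by (simp add: mat_of_rows_def)

lemma adjoint_adjoint [simp]: "mat_adjoint (mat_adjoint A) = A" for A :: "complex mat"
  by (rule eq_matI) auto

lemma mult_mat_index:
  assumes "A \<in> carrier_mat m k" "B \<in> carrier_mat k l" "i < m" "j < l"
  shows "(A * B) $$ (i, j) = (\<Sum>r<k. A $$ (i, r) * B $$ (r, j))"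
  using assms by (auto simp: scalar_prod_def atLeast0LessThan)

lemma adjoint_mult:
  fixes A :: "complex mat"
  assumes "A \<in> carrier_mat m k" "B \<in> carrier_mat k l"
  shows "mat_adjoint (A * B) = mat_adjoint B * mat_adjoint A"
proof (rule eq_matI)
  show "dim_row (mat_adjoint (A * B)) = dim_row (mat_adjoint B * mat_adjoint A)"
    "dim_col (mat_adjoint (A * B)) = dim_col (mat_adjoint B * mat_adjoint A)" using assms by simp_all
  fix i j assume "i < dim_row (mat_adjoint B * mat_adjoint A)" "j < dim_col (mat_adjoint B * mat_adjoint A)"
  then have ij: "i < l" "j < m" using assms by auto
  have "mat_adjoint (A * B) $$ (i, j) = cnj ((A * B) $$ (j, i))" using ij assms by simp
  also have "\<dots> = (\<Sum>r<k. cnj (A $$ (j, r)) * cnj (B $$ (r, i)))"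
    using ij by (subst mult_mat_index[OF assms]) simp_all
  also have "\<dots> = (mat_adjoint B * mat_adjoint A) $$ (i, j)"
    using ij assms by (subst mult_mat_index[OF adjoint_carrier[OF assms(2)] adjoint_carrier[OF assms(1)]])
      (auto intro!: sum.cong)
  finally show "mat_adjoint (A * B) $$ (i, j) = (mat_adjoint B * mat_adjoint A) $$ (i, j)" .
qed

lemma trace_mult:
  assumes "A \<in> carrier_mat m k" "B \<in> carrier_mat k m"
  shows "mat_trace (A * B) = (\<Sum>i<m. \<Sum>j<k. A $$ (i, j) * B $$ (j, i))"
  unfolding mat_trace_def using assms by (intro sum.cong) (auto simp: mult_mat_index[OF assms] simp del: index_mult_mat(1))

lemma trace_mult_comm:
  assumes "A \<in> carrier_mat m k" "B \<in> carrier_mat k m"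
  shows "mat_trace (A * B) = mat_trace (B * A)"
  unfolding trace_mult[OF assms] trace_mult[OF assms(2,1)] by (subst sum.swap) (simp add: mult.commute)

lemma trace_add:
  "A \<in> carrier_mat m m \<Longrightarrow> B \<in> carrier_mat m m \<Longrightarrow> mat_trace (A + B) = mat_trace A + mat_trace B"
  unfolding mat_trace_def by (auto simp: sum.distrib)

lemma trace_smult: "A \<in> carrier_mat m m \<Longrightarrow> mat_trace (c \<cdot>\<^sub>m A) = c * mat_trace A"
  unfolding mat_trace_def by (auto simp: sum_distrib_left)

section \<open>Sums over indices and over strings\<close>

lemma sum_lessThan_add: "(\<Sum>i<m + k. f i) = (\<Sum>i<m. f i) + (\<Sum>i<k. f (m + i))"
  for f :: "nat \<Rightarrow> 'a::comm_monoid_add"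
  by (induction k) (simp_all add: add.assoc)

lemma not_bit_less_power: "i < 2 ^ n \<Longrightarrow> n \<le> q \<Longrightarrow> \<not> bit i q" for i :: nat
proof -
  assume "i < 2 ^ n" "n \<le> q"
  then have "i < 2 ^ q" by (meson less_le_trans one_le_numeral power_increasing)
  then show ?thesis by (simp add: bit_iff_odd)
qed

lemma index_eq_iff_bits: "i < 2 ^ n \<Longrightarrow> j < 2 ^ n \<Longrightarrow> i = j \<longleftrightarrow> (\<forall>q<n. bit i q = bit j q)" for i j :: nat
  by (metis bit_eq_iff not_bit_less_power not_le)

lemma prod_of_bool_bits:
  fixes i j :: nat
  assumes "i < 2 ^ n" "j < 2 ^ n"
  shows "(\<Prod>q<n. if bit i q = bit j q then c q else 0) = (if i = j then \<Prod>q<n. c q else (0::'a::{comm_semiring_1}))"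
proof (cases "i = j")
  case False
  then obtain q where "q < n" "bit i q \<noteq> bit j q" using index_eq_iff_bits[OF assms] by blast
  then have "(\<Prod>q<n. if bit i q = bit j q then c q else 0) = 0"
    by (intro prod_zero) auto
  then show ?thesis using False by simp
qed simp

text \<open>An index below \<open>2 ^ n\<close> is a free choice of \<open>n\<close> bits, so a sum
  of products over the qubits factorizes. With its counterparts for strings of Paulis and of
  stabilizer states, this reduces identities about tensor products to a case distinction on one
  qubit.\<close>

lemma sum_bits:
  fixes g :: "nat \<Rightarrow> bool \<Rightarrow> 'a::comm_semiring_1"
  shows "(\<Sum>i<2 ^ n. \<Prod>q<n. g q (bit (i::nat) q)) = (\<Prod>q<n. g q False + g q True)"
proof (induction n)
  case (Suc n)
  have low: "(\<Prod>q<Suc n. g q (bit i q)) = (\<Prod>q<n. g q (bit i q)) * g n False" if "i < 2 ^ n" for i :: nat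
    using not_bit_less_power[OF that, of n] by simp
  have high: "(\<Prod>q<Suc n. g q (bit (2 ^ n + i) q)) = (\<Prod>q<n. g q (bit i q)) * g n True" if "i < 2 ^ n" for i :: nat
  proof -
    have "2 ^ n + i = set_bit n i" using not_bit_less_power[OF that, of n] by (simp add: set_bit_eq)
    then have "bit (2 ^ n + i) q \<longleftrightarrow> q = n \<or> bit i q" for q by (auto simp: bit_set_bit_iff)
    then show ?thesis by simp
  qed
  have two: "(2::nat) ^ Suc n = 2 ^ n + 2 ^ n" by simp
  have "(\<Sum>i<2 ^ Suc n. \<Prod>q<Suc n. g q (bit (i::nat) q))
      = (\<Sum>i<2 ^ n. \<Prod>q<Suc n. g q (bit (i::nat) q)) + (\<Sum>i<2 ^ n. \<Prod>q<Suc n. g q (bit (2 ^ n + i :: nat) q))"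
    unfolding two by (rule sum_lessThan_add)
  also have "\<dots> = (\<Sum>i<2 ^ n. (\<Prod>q<n. g q (bit (i::nat) q)) * g n False)
      + (\<Sum>i<2 ^ n. (\<Prod>q<n. g q (bit (i::nat) q)) * g n True)"
    by (intro arg_cong2[where f="(+)"] sum.cong refl) (simp_all only: low high lessThan_iff)
  also have "\<dots> = (\<Prod>q<Suc n. g q False + g q True)"
    by (simp add: sum_distrib_right[symmetric] Suc.IH distrib_left)
  finally show ?case .
qed simp

lemma sum_lists:
  fixes g :: "nat \<Rightarrow> 'b \<Rightarrow> 'a::comm_semiring_1"
  assumes "finite A"
  shows "(\<Sum>xs\<in>{xs. set xs \<subseteq> A \<and> length xs = n}. \<Prod>q<n. g q (xs ! q)) = (\<Prod>q<n. \<Sum>a\<in>A. g q a)"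
proof (induction n arbitrary: g)
  case (Suc n)
  have inj: "inj_on (\<lambda>(xs, a). a # xs) ({xs. set xs \<subseteq> A \<and> length xs = n} \<times> A)" by (auto simp: inj_on_def)
  have "(\<Sum>xs\<in>{xs. set xs \<subseteq> A \<and> length xs = Suc n}. \<Prod>q<Suc n. g q (xs ! q))
      = (\<Sum>(xs, a)\<in>{xs. set xs \<subseteq> A \<and> length xs = n} \<times> A. \<Prod>q<Suc n. g q ((a # xs) ! q))"
    unfolding lists_length_Suc_eq sum.reindex[OF inj] by (simp add: case_prod_unfold)
  also have "\<dots> = (\<Sum>xs\<in>{xs. set xs \<subseteq> A \<and> length xs = n}. \<Sum>a\<in>A. g 0 a * (\<Prod>q<n. g (Suc q) (xs ! q)))"
    unfolding sum.cartesian_product[symmetric] by (simp only: prod.lessThan_Suc_shift) simp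
  also have "\<dots> = (\<Prod>q<Suc n. \<Sum>a\<in>A. g q a)"
    unfolding sum_distrib_right[symmetric] sum_distrib_left[symmetric] prod.lessThan_Suc_shift
    by (simp add: Suc.IH[of "\<lambda>q. g (Suc q)"])
  finally show ?case .
next
  case 0
  have "{xs. set xs \<subseteq> A \<and> length xs = 0} = {[]}" by auto
  then show ?case by simp
qed

lemma set_paulis: "set (paulis n) = {P. length P = n}"
proof -
  have "p \<in> {PI, PX, PY, PZ}" for p by (cases p) auto
  then show ?thesis unfolding paulis_def set_n_lists by auto
qed

lemma finite_paulis: "finite {P :: pauli list. length P = n}"
  unfolding set_paulis[symmetric] by simp

lemma sum_paulis:
  fixes g :: "nat \<Rightarrow> pauli \<Rightarrow> 'a::comm_semiring_1"
  shows "(\<Sum>P | length P = n. \<Prod>q<n. g q (P ! q)) = (\<Prod>q<n. g q PI + g q PX + g q PY + g q PZ)"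
proof -
  have "p \<in> {PI, PX, PY, PZ}" for p by (cases p) auto
  then have "{P. length P = n} = {P. set P \<subseteq> {PI, PX, PY, PZ} \<and> length P = n}" by blast
  then show ?thesis by (simp only:) (subst sum_lists, simp_all add: add.assoc)
qed

lemma sum_stabs:
  fixes g :: "nat \<Rightarrow> stab \<Rightarrow> 'a::comm_semiring_1"
  shows "(\<Sum>ss | length ss = n. \<Prod>q<n. g q (ss ! q))
    = (\<Prod>q<n. g q Z0 + g q Z1 + g q XPlus + g q XMinus + g q YPlus + g q YMinus)"
proof -
  have "s \<in> {Z0, Z1, XPlus, XMinus, YPlus, YMinus}" for s by (cases s) auto
  then have "{ss. length ss = n} = {ss. set ss \<subseteq> {Z0, Z1, XPlus, XMinus, YPlus, YMinus} \<and> length ss = n}" by blast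
  then show ?thesis by (simp only:) (subst sum_lists, simp_all add: add.assoc)
qed

lemma finite_stabs: "finite {ss :: stab list. length ss = n}"
proof -
  have "s \<in> {Z0, Z1, XPlus, XMinus, YPlus, YMinus}" for s by (cases s) auto
  then have "{ss. length ss = n} = {ss. set ss \<subseteq> {Z0, Z1, XPlus, XMinus, YPlus, YMinus} \<and> length ss = n}" by blast
  then show ?thesis by (simp add: finite_lists_length_eq)
qed

section \<open>Tensor products\<close>

definition entry :: "complex mat \<Rightarrow> bool \<Rightarrow> bool \<Rightarrow> complex" where
  "entry A a b = A $$ (of_bool a, of_bool b)"

lemma tensor_carrier: "tensor As \<in> operators (length As)"
  unfolding tensor_def by simp

lemma tensor_index:
  "length As = n \<Longrightarrow> i < 2 ^ n \<Longrightarrow> j < 2 ^ n \<Longrightarrow>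
   tensor As $$ (i, j) = (\<Prod>q<n. entry (As ! q) (bit i q) (bit j q))"
  unfolding tensor_def entry_def by simp

lemma entry_mult:
  assumes "A \<in> carrier_mat 2 2" "B \<in> carrier_mat 2 2"
  shows "entry (A * B) a b = entry A a False * entry B False b + entry A a True * entry B True b"
proof -
  have "(of_bool a :: nat) < 2" "(of_bool b :: nat) < 2" by simp_all
  then show ?thesis unfolding entry_def mult_mat_index[OF assms] by (simp add: numeral_2_eq_2 mult_mat_index[OF assms])
qed

lemma entry_adjoint: "A \<in> carrier_mat 2 2 \<Longrightarrow> entry (mat_adjoint A) a b = cnj (entry A b a)"
  unfolding entry_def by (subst adjoint_index) auto

lemma entry_smult: "A \<in> carrier_mat 2 2 \<Longrightarrow> entry (c \<cdot>\<^sub>m A) a b = c * entry A a b"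
  unfolding entry_def by auto

lemma tensor_mult:
  assumes "length As = n" "length Bs = n" "set As \<subseteq> carrier_mat 2 2" "set Bs \<subseteq> carrier_mat 2 2"
  shows "tensor As * tensor Bs = tensor (map2 (*) As Bs)"
proof (rule eq_matI)
  have c: "tensor As \<in> operators n" "tensor Bs \<in> operators n" "tensor (map2 (*) As Bs) \<in> operators n"
    using tensor_carrier[of As] tensor_carrier[of Bs] tensor_carrier[of "map2 (*) As Bs"] assms(1,2) by simp_all
  then show "dim_row (tensor As * tensor Bs) = dim_row (tensor (map2 (*) As Bs))"
    "dim_col (tensor As * tensor Bs) = dim_col (tensor (map2 (*) As Bs))" by auto
  fix i j assume "i < dim_row (tensor (map2 (*) As Bs))" "j < dim_col (tensor (map2 (*) As Bs))"
  then have ij: "i < 2 ^ n" "j < 2 ^ n" using c by auto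
  have AB: "As ! q \<in> carrier_mat 2 2" "Bs ! q \<in> carrier_mat 2 2" if "q < n" for q
    using subsetD[OF assms(3) nth_mem] subsetD[OF assms(4) nth_mem] that assms(1,2) by simp_all
  have "(tensor As * tensor Bs) $$ (i, j) = (\<Sum>r<2 ^ n. tensor As $$ (i, r) * tensor Bs $$ (r, j))"
    by (rule mult_mat_index[OF c(1,2) ij])
  also have "\<dots> = (\<Sum>r<2 ^ n. \<Prod>q<n. entry (As ! q) (bit i q) (bit (r::nat) q) * entry (Bs ! q) (bit r q) (bit j q))"
    by (intro sum.cong refl)
      (simp only: tensor_index[OF assms(1)] tensor_index[OF assms(2)] ij lessThan_iff prod.distrib)
  also have "\<dots> = (\<Prod>q<n. entry (As ! q * Bs ! q) (bit i q) (bit j q))"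
    by (subst sum_bits[where g = "\<lambda>q b. entry (As ! q) (bit i q) b * entry (Bs ! q) b (bit j q)"])
      (intro prod.cong refl, simp only: entry_mult AB lessThan_iff)
  also have "\<dots> = tensor (map2 (*) As Bs) $$ (i, j)"
  proof -
    have "(map2 (*) As Bs) ! q = As ! q * Bs ! q" if "q < n" for q using assms(1,2) that by simp
    then have "(\<Prod>q<n. entry (As ! q * Bs ! q) (bit i q) (bit j q))
        = (\<Prod>q<n. entry ((map2 (*) As Bs) ! q) (bit i q) (bit j q))" by (intro prod.cong refl) simp
    moreover have len: "length (map2 (*) As Bs) = n" using assms(1,2) by simp
    ultimately show ?thesis by (simp only: tensor_index[OF len ij])
  qed
  finally show "(tensor As * tensor Bs) $$ (i, j) = tensor (map2 (*) As Bs) $$ (i, j)" .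
qed

lemma tensor_adjoint:
  assumes "set As \<subseteq> carrier_mat 2 2"
  shows "mat_adjoint (tensor As) = tensor (map mat_adjoint As)"
proof (rule eq_matI)
  let ?n = "length As"
  have c: "tensor As \<in> operators ?n" "tensor (map mat_adjoint As) \<in> operators ?n"
    using tensor_carrier[of As] tensor_carrier[of "map mat_adjoint As"] by auto
  then show "dim_row (mat_adjoint (tensor As)) = dim_row (tensor (map mat_adjoint As))"
    "dim_col (mat_adjoint (tensor As)) = dim_col (tensor (map mat_adjoint As))" by auto
  fix i j assume "i < dim_row (tensor (map mat_adjoint As))" "j < dim_col (tensor (map mat_adjoint As))"
  then have ij: "i < 2 ^ ?n" "j < 2 ^ ?n" using c by auto
  have A: "As ! q \<in> carrier_mat 2 2" if "q < ?n" for q using assms that nth_mem by blast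
  have "mat_adjoint (tensor As) $$ (i, j) = cnj (tensor As $$ (j, i))"
    using c ij by (intro adjoint_index) auto
  also have "\<dots> = (\<Prod>q<?n. entry (mat_adjoint (As ! q)) (bit i q) (bit j q))"
    by (simp add: tensor_index[OF refl] ij entry_adjoint A)
  also have "\<dots> = tensor (map mat_adjoint As) $$ (i, j)"
    by (subst tensor_index[of _ ?n]) (use ij in auto)
  finally show "mat_adjoint (tensor As) $$ (i, j) = tensor (map mat_adjoint As) $$ (i, j)" .
qed

lemma trace_entry: "A \<in> carrier_mat 2 2 \<Longrightarrow> mat_trace A = entry A False False + entry A True True"
  by (auto simp: mat_trace_def entry_def numeral_2_eq_2)

lemma trace_tensor:
  assumes "length As = n" "set As \<subseteq> carrier_mat 2 2"
  shows "mat_trace (tensor As) = (\<Prod>q<n. mat_trace (As ! q))"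
proof -
  have A: "As ! q \<in> carrier_mat 2 2" if "q < n" for q using assms that nth_mem by blast
  have "mat_trace (tensor As) = (\<Sum>i<2 ^ n. \<Prod>q<n. entry (As ! q) (bit (i::nat) q) (bit i q))"
    unfolding mat_trace_def using tensor_carrier[of As] assms(1)
    by (intro sum.cong) (auto simp: tensor_index[OF assms(1)])
  also have "\<dots> = (\<Prod>q<n. mat_trace (As ! q))"
    by (subst sum_bits[where g = "\<lambda>q b. entry (As ! q) b b"])
      (intro prod.cong refl, simp add: trace_entry A)
  finally show ?thesis .
qed

lemma entry_one: "entry (1\<^sub>m 2) a b = (if a = b then 1 else 0)"
  unfolding entry_def by (cases a; cases b) auto

lemma tensor_one: "tensor (replicate n (1\<^sub>m 2)) = 1\<^sub>m (2 ^ n)"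
proof (rule eq_matI)
  show "dim_row (tensor (replicate n (1\<^sub>m 2))) = dim_row (1\<^sub>m (2 ^ n))"
    "dim_col (tensor (replicate n (1\<^sub>m 2))) = dim_col (1\<^sub>m (2 ^ n))" unfolding tensor_def by auto
  fix i j assume "i < dim_row (1\<^sub>m (2 ^ n) :: complex mat)" "j < dim_col (1\<^sub>m (2 ^ n) :: complex mat)"
  then have ij: "i < 2 ^ n" "j < 2 ^ n" by auto
  then show "tensor (replicate n (1\<^sub>m 2)) $$ (i, j) = 1\<^sub>m (2 ^ n) $$ (i, j)"
    using prod_of_bool_bits[OF ij, of "\<lambda>_. 1::complex"] by (simp add: tensor_index[of _ n] entry_one)
qed

section \<open>Pauli matrices as an orthogonal basis\<close>

lemma pauli1_carrier [simp]: "pauli1 p \<in> carrier_mat 2 2"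
  by (cases p) (auto simp: mat_of_rows_list_def)

lemma entry_pauli1:
  "entry (pauli1 PI) a b = (if a = b then 1 else 0)"
  "entry (pauli1 PX) a b = (if a = b then 0 else 1)"
  "entry (pauli1 PY) a b = (if a = b then 0 else if a then \<i> else - \<i>)"
  "entry (pauli1 PZ) a b = (if a = b then if a then - 1 else 1 else 0)"
  unfolding entry_def by (cases a; cases b; simp add: mat_of_rows_list_def)+

lemma pauli_mat_carrier: "length P = n \<Longrightarrow> pauli_mat P \<in> operators n"
  unfolding pauli_mat_def using tensor_carrier[of "map pauli1 P"] by simp

lemma pauli_mat_index:
  "length P = n \<Longrightarrow> i < 2 ^ n \<Longrightarrow> j < 2 ^ n \<Longrightarrow>
   pauli_mat P $$ (i, j) = (\<Prod>q<n. entry (pauli1 (P ! q)) (bit i q) (bit j q))"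
  unfolding pauli_mat_def by (subst tensor_index[of _ n]) auto

lemma trace_pauli1_mult: "mat_trace (pauli1 p * pauli1 r) = (if p = r then 2 else 0)"
proof -
  have "mat_trace (pauli1 p * pauli1 r) = entry (pauli1 p * pauli1 r) False False + entry (pauli1 p * pauli1 r) True True"
    by (rule trace_entry, rule mult_carrier_mat[OF pauli1_carrier pauli1_carrier])
  also have "\<dots> = (if p = r then 2 else 0)"
    unfolding entry_mult[OF pauli1_carrier pauli1_carrier] by (cases p; cases r) (simp_all add: entry_pauli1 del: pauli1.simps)
  finally show ?thesis .
qed

lemma trace_pauli_mult:
  assumes "length P = n" "length Q = n"
  shows "mat_trace (pauli_mat P * pauli_mat Q) = (if P = Q then 2 ^ n else 0)"
proof -
  have "mat_trace (pauli_mat P * pauli_mat Q) = (\<Prod>q<n. mat_trace (pauli1 (P ! q) * pauli1 (Q ! q)))"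
  proof -
    have "set (map2 (*) (map pauli1 P) (map pauli1 Q)) \<subseteq> carrier_mat 2 2"
      by (auto simp: set_zip intro!: mult_carrier_mat[of _ 2 2])
    then show ?thesis
      unfolding pauli_mat_def
      by (subst tensor_mult[of _ n], use assms in \<open>auto\<close>, subst trace_tensor[of _ n]) auto
  qed
  also have "\<dots> = (if P = Q then 2 ^ n else 0)"
  proof (cases "P = Q")
    case False
    then obtain q where "q < n" "P ! q \<noteq> Q ! q" using assms nth_equalityI[of P Q] by auto
    then have "(\<Prod>q<n. mat_trace (pauli1 (P ! q) * pauli1 (Q ! q))) = 0"
      by (intro prod_zero) (auto simp: trace_pauli1_mult)
    then show ?thesis using False by simp
  qed (simp add: trace_pauli1_mult)
  finally show ?thesis .
qed

text \<open>On one qubit the sum over the four Pauli matrices is 2 if both pairs of indices agree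
  and 0 otherwise. The general case is a product of such factors.\<close>

lemma pauli_completeness:
  assumes "i < 2 ^ n" "j < 2 ^ n" "k < 2 ^ n" "l < 2 ^ n"
  shows "(\<Sum>P | length P = n. pauli_mat P $$ (i, j) * cnj (pauli_mat P $$ (k, l))) = (if i = k \<and> j = l then 2 ^ n else 0)"
proof -
  have 1: "(\<Sum>p\<leftarrow>[PI, PX, PY, PZ]. entry (pauli1 p) a b * cnj (entry (pauli1 p) c d))
      = (if a = c then if b = d then 2 else 0 else 0)" for a b c d
    by (cases a; cases b; cases c; cases d) (simp_all add: entry_pauli1 del: pauli1.simps)
  have "(\<Sum>P | length P = n. pauli_mat P $$ (i, j) * cnj (pauli_mat P $$ (k, l)))
      = (\<Sum>P | length P = n. \<Prod>q<n. entry (pauli1 (P ! q)) (bit i q) (bit j q) * cnj (entry (pauli1 (P ! q)) (bit k q) (bit l q)))"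
    by (intro sum.cong refl) (simp add: pauli_mat_index assms prod.distrib)
  also have "\<dots> = (\<Prod>q<n. if bit i q = bit k q then if bit j q = bit l q then 2 else 0 else 0)"
    by (subst sum_paulis[where g = "\<lambda>q p. entry (pauli1 p) (bit i q) (bit j q) * cnj (entry (pauli1 p) (bit k q) (bit l q))"])
      (use 1 in \<open>simp add: add.assoc del: pauli1.simps\<close>)
  also have "\<dots> = (if i = k \<and> j = l then 2 ^ n else 0)"
  proof -
    have "(\<Prod>q<n. if bit i q = bit k q then if bit j q = bit l q then 2 else 0 else 0)
       = (\<Prod>q<n. (if bit i q = bit k q then 1 else 0) * (if bit j q = bit l q then 2 else (0::complex)))"
      by (intro prod.cong) auto
    then show ?thesis unfolding prod.distrib
      using prod_of_bool_bits[OF assms(1,3), of "\<lambda>_. 1::complex"] prod_of_bool_bits[OF assms(2,4), of "\<lambda>_. 2::complex"]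
      by simp
  qed
  finally show ?thesis .
qed

lemma pauli_mat_hermitian: "hermitian (pauli_mat P)"
proof -
  have "mat_adjoint (pauli1 p) = pauli1 p" for p
  proof (rule eq_matI)
    have c: "pauli1 p \<in> carrier_mat 2 2" by simp
    then show "dim_row (mat_adjoint (pauli1 p)) = dim_row (pauli1 p)"
      "dim_col (mat_adjoint (pauli1 p)) = dim_col (pauli1 p)"
      unfolding adjoint_dim by (simp_all only: carrier_matD)
    fix i j assume "i < dim_row (pauli1 p)" "j < dim_col (pauli1 p)"
    then have "i < 2" "j < 2" using c by auto
    then have "i = of_bool (i = 1)" "j = of_bool (j = 1)" by auto
    moreover have "entry (mat_adjoint (pauli1 p)) a b = entry (pauli1 p) a b" for a b
      by (subst entry_adjoint[OF c], cases p; cases a; cases b) (simp_all add: entry_pauli1 del: pauli1.simps)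
    ultimately show "mat_adjoint (pauli1 p) $$ (i, j) = pauli1 p $$ (i, j)"
      unfolding entry_def by metis
  qed
  then have "map mat_adjoint (map pauli1 P) = map pauli1 P" by (induction P) simp_all
  moreover have "set (map pauli1 P) \<subseteq> carrier_mat 2 2" by (auto simp del: carrier_matI)
  ultimately show ?thesis unfolding hermitian_def pauli_mat_def by (simp only: tensor_adjoint)
qed

lemma pauli_mat_cnj: "length P = n \<Longrightarrow> i < 2 ^ n \<Longrightarrow> j < 2 ^ n \<Longrightarrow> cnj (pauli_mat P $$ (i, j)) = pauli_mat P $$ (j, i)"
  using pauli_mat_hermitian[of P] pauli_mat_carrier[of P n] unfolding hermitian_def
  by (metis adjoint_index carrier_matD)

lemma pauli_sum_carrier: "pauli_sum n \<alpha> \<in> operators n"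
  unfolding pauli_sum_def by simp

lemma pauli_sum_index:
  "i < 2 ^ n \<Longrightarrow> j < 2 ^ n \<Longrightarrow> pauli_sum n \<alpha> $$ (i, j) = (\<Sum>P | length P = n. \<alpha> P * pauli_mat P $$ (i, j))"
  unfolding pauli_sum_def by (simp add: set_paulis)

lemma trace_mult_pauli_sum:
  assumes "B \<in> operators n"
  shows "mat_trace (B * pauli_sum n \<alpha>) = (\<Sum>P | length P = n. \<alpha> P * mat_trace (B * pauli_mat P))"
proof -
  have "mat_trace (B * pauli_sum n \<alpha>) = (\<Sum>i<2 ^ n. \<Sum>j<2 ^ n. \<Sum>P | length P = n. \<alpha> P * (B $$ (i, j) * pauli_mat P $$ (j, i)))"
    unfolding trace_mult[OF assms pauli_sum_carrier]
    by (intro sum.cong refl) (simp add: pauli_sum_index sum_distrib_left mult_ac)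
  also have "\<dots> = (\<Sum>i<2 ^ n. \<Sum>P | length P = n. \<Sum>j<2 ^ n. \<alpha> P * (B $$ (i, j) * pauli_mat P $$ (j, i)))"
    by (intro sum.cong refl) (rule sum.swap)
  also have "\<dots> = (\<Sum>P | length P = n. \<Sum>i<2 ^ n. \<Sum>j<2 ^ n. \<alpha> P * (B $$ (i, j) * pauli_mat P $$ (j, i)))"
    by (rule sum.swap)
  also have "\<dots> = (\<Sum>P | length P = n. \<alpha> P * mat_trace (B * pauli_mat P))"
    by (intro sum.cong refl) (simp add: trace_mult[OF assms pauli_mat_carrier] sum_distrib_left)
  finally show ?thesis .
qed

lemma pauli_expansion:
  assumes A: "A \<in> operators n"
  shows "pauli_sum n (\<lambda>P. if length P = n then mat_trace (pauli_mat P * A) / 2 ^ n else 0) = A"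
proof (rule eq_matI)
  fix i j assume "i < dim_row A" "j < dim_col A"
  then have ij: "i < 2 ^ n" "j < 2 ^ n" using A by auto
  have "pauli_sum n (\<lambda>P. if length P = n then mat_trace (pauli_mat P * A) / 2 ^ n else 0) $$ (i, j)
      = (\<Sum>P | length P = n. (\<Sum>k<2 ^ n. \<Sum>l<2 ^ n. pauli_mat P $$ (k, l) * A $$ (l, k)) / 2 ^ n * pauli_mat P $$ (i, j))"
    unfolding pauli_sum_index[OF ij] by (intro sum.cong refl) (simp add: trace_mult[OF pauli_mat_carrier A])
  also have "\<dots> = (\<Sum>P | length P = n. \<Sum>k<2 ^ n. \<Sum>l<2 ^ n. A $$ (l, k) / 2 ^ n * (pauli_mat P $$ (i, j) * cnj (pauli_mat P $$ (l, k))))"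
    unfolding sum_divide_distrib sum_distrib_right
    by (intro sum.cong refl) (simp add: pauli_mat_cnj)
  also have "\<dots> = (\<Sum>k<2 ^ n. \<Sum>P | length P = n. \<Sum>l<2 ^ n. A $$ (l, k) / 2 ^ n * (pauli_mat P $$ (i, j) * cnj (pauli_mat P $$ (l, k))))"
    by (rule sum.swap)
  also have "\<dots> = (\<Sum>k<2 ^ n. \<Sum>l<2 ^ n. \<Sum>P | length P = n. A $$ (l, k) / 2 ^ n * (pauli_mat P $$ (i, j) * cnj (pauli_mat P $$ (l, k))))"
    by (intro sum.cong refl) (rule sum.swap)
  also have "\<dots> = (\<Sum>k<2 ^ n. \<Sum>l<2 ^ n. if l = i then if k = j then A $$ (l, k) else 0 else 0)"
    unfolding sum_distrib_left[symmetric]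
    by (intro sum.cong refl) (simp add: pauli_completeness ij)
  also have "\<dots> = A $$ (i, j)" using ij by simp
  finally show "pauli_sum n (\<lambda>P. if length P = n then mat_trace (pauli_mat P * A) / 2 ^ n else 0) $$ (i, j) = A $$ (i, j)" .
qed (use A pauli_sum_carrier in auto)

text \<open>This resolves the definite description: the expansion gives existence, and trace
  orthogonality of the Pauli matrices gives uniqueness.\<close>

lemma pauli_coeffs_eq:
  assumes A: "A \<in> operators n"
  shows "pauli_coeffs n A = (\<lambda>P. if length P = n then mat_trace (pauli_mat P * A) / 2 ^ n else 0)"
  unfolding pauli_coeffs_def
proof (rule the_equality)
  show "(\<forall>P. P \<notin> set (paulis n) \<longrightarrow> (if length P = n then mat_trace (pauli_mat P * A) / 2 ^ n else 0) = 0) \<and>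
    A = pauli_sum n (\<lambda>P. if length P = n then mat_trace (pauli_mat P * A) / 2 ^ n else 0)"
    using pauli_expansion[OF A] by (auto simp: set_paulis)
  fix \<alpha> assume \<alpha>: "(\<forall>P. P \<notin> set (paulis n) \<longrightarrow> \<alpha> P = 0) \<and> A = pauli_sum n \<alpha>"
  show "\<alpha> = (\<lambda>P. if length P = n then mat_trace (pauli_mat P * A) / 2 ^ n else 0)"
  proof
    fix P
    show "\<alpha> P = (if length P = n then mat_trace (pauli_mat P * A) / 2 ^ n else 0)"
    proof (cases "length P = n")
      case True
      have "mat_trace (pauli_mat P * A) = (\<Sum>Q | length Q = n. \<alpha> Q * mat_trace (pauli_mat P * pauli_mat Q))"
        using \<alpha> trace_mult_pauli_sum[OF pauli_mat_carrier[OF True]] by metis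
      also have "\<dots> = (\<Sum>Q | length Q = n. if Q = P then \<alpha> P * 2 ^ n else 0)"
        by (intro sum.cong refl) (use True in \<open>auto simp: trace_pauli_mult\<close>)
      also have "\<dots> = \<alpha> P * 2 ^ n" using finite_paulis True by simp
      finally show ?thesis using True by simp
    qed (use \<alpha> in \<open>simp add: set_paulis\<close>)
  qed
qed

lemma pauli_Parseval:
  assumes A: "A \<in> operators n"
  shows "(\<Sum>P | length P = n. (cmod (pauli_coeffs n A P))\<^sup>2) = (\<Sum>i<2 ^ n. \<Sum>j<2 ^ n. (cmod (A $$ (i, j)))\<^sup>2) / 2 ^ n"
proof -
  let ?\<alpha> = "pauli_coeffs n A"
  have e: "A = pauli_sum n ?\<alpha>" unfolding pauli_coeffs_eq[OF A] by (rule pauli_expansion[OF A, symmetric])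
  have idx: "(\<Sum>P | length P = n. ?\<alpha> P * pauli_mat P $$ (i, j)) = A $$ (i, j)" if "i < 2 ^ n" "j < 2 ^ n" for i j
    unfolding pauli_sum_index[OF that, symmetric] by (simp only: e[symmetric])
  have t: "cnj (mat_trace (pauli_mat P * A)) = (\<Sum>i<2 ^ n. \<Sum>j<2 ^ n. pauli_mat P $$ (i, j) * cnj (A $$ (i, j)))"
    if "length P = n" for P
  proof -
    have "cnj (mat_trace (pauli_mat P * A)) = (\<Sum>i<2 ^ n. \<Sum>j<2 ^ n. pauli_mat P $$ (j, i) * cnj (A $$ (j, i)))"
      unfolding trace_mult[OF pauli_mat_carrier[OF that] A] by (simp add: pauli_mat_cnj[OF that])
    then show ?thesis by (subst sum.swap) simp
  qed
  have "complex_of_real (\<Sum>P | length P = n. (cmod (?\<alpha> P))\<^sup>2) = (\<Sum>P | length P = n. ?\<alpha> P * cnj (?\<alpha> P))"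
    by (simp only: of_real_sum complex_norm_square)
  also have "\<dots> = (\<Sum>P | length P = n. ?\<alpha> P * ((\<Sum>i<2 ^ n. \<Sum>j<2 ^ n. pauli_mat P $$ (i, j) * cnj (A $$ (i, j))) / 2 ^ n))"
    by (intro sum.cong refl) (simp add: pauli_coeffs_eq[OF A] t)
  also have "\<dots> = (\<Sum>P | length P = n. \<Sum>i<2 ^ n. \<Sum>j<2 ^ n. cnj (A $$ (i, j)) / 2 ^ n * (?\<alpha> P * pauli_mat P $$ (i, j)))"
    unfolding sum_divide_distrib sum_distrib_left
    by (intro sum.cong refl) simp
  also have "\<dots> = (\<Sum>i<2 ^ n. \<Sum>P | length P = n. \<Sum>j<2 ^ n. cnj (A $$ (i, j)) / 2 ^ n * (?\<alpha> P * pauli_mat P $$ (i, j)))"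
    by (rule sum.swap)
  also have "\<dots> = (\<Sum>i<2 ^ n. \<Sum>j<2 ^ n. \<Sum>P | length P = n. cnj (A $$ (i, j)) / 2 ^ n * (?\<alpha> P * pauli_mat P $$ (i, j)))"
    by (intro sum.cong refl) (rule sum.swap)
  also have "\<dots> = (\<Sum>i<2 ^ n. \<Sum>j<2 ^ n. cnj (A $$ (i, j)) / 2 ^ n * A $$ (i, j))"
    by (intro sum.cong refl) (simp only: sum_distrib_left[symmetric] idx lessThan_iff)
  also have "\<dots> = complex_of_real ((\<Sum>i<2 ^ n. \<Sum>j<2 ^ n. (cmod (A $$ (i, j)))\<^sup>2) / 2 ^ n)"
    by (simp only: of_real_divide of_real_sum complex_norm_square sum_divide_distrib)
      (simp only: of_real_power of_real_numeral times_divide_eq_left times_divide_eq_right mult.commute)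
  finally show ?thesis by (simp only: of_real_eq_iff)
qed


section \<open>Positive semidefinite matrices and the spectral norm\<close>

text \<open>Forms take functions as arguments, for entries as well as for vectors. Test vectors with
  one or two nonzero coordinates are then easily written down, and rank-one parts can be split off
  without changing the dimension.\<close>

definition form :: "nat \<Rightarrow> (nat \<Rightarrow> nat \<Rightarrow> complex) \<Rightarrow> (nat \<Rightarrow> complex) \<Rightarrow> complex" where
  "form m a f = (\<Sum>i<m. \<Sum>j<m. cnj (f i) * a i j * f j)"

abbreviation entries :: "complex mat \<Rightarrow> nat \<Rightarrow> nat \<Rightarrow> complex" where
  "entries A \<equiv> \<lambda>i j. A $$ (i, j)"

definition psd_form :: "nat \<Rightarrow> (nat \<Rightarrow> nat \<Rightarrow> complex) \<Rightarrow> bool" where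
  "psd_form m a \<longleftrightarrow> (\<forall>f. 0 \<le> form m a f)"

lemma mult_vec_form:
  assumes "A \<in> carrier_mat m m" "v \<in> carrier_vec m"
  shows "(A *\<^sub>v v) \<bullet>c v = form m (entries A) (\<lambda>i. v $ i)"
  using assms
  by (auto simp: form_def scalar_prod_def atLeast0LessThan sum_distrib_left mult_ac intro!: sum.cong)

lemma form_cong: "(\<And>i. i < m \<Longrightarrow> f i = g i) \<Longrightarrow> form m a f = form m a g"
  unfolding form_def by (intro sum.cong refl) simp

lemma psd_iff_form: "psd m A \<longleftrightarrow> A \<in> carrier_mat m m \<and> psd_form m (entries A)"
proof (cases "A \<in> carrier_mat m m")
  case True
  have "(\<forall>v \<in> carrier_vec m. 0 \<le> form m (entries A) (\<lambda>i. v $ i)) \<longleftrightarrow> (\<forall>f. 0 \<le> form m (entries A) f)"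
  proof
    assume *: "\<forall>v \<in> carrier_vec m. 0 \<le> form m (entries A) (\<lambda>i. v $ i)"
    show "\<forall>f. 0 \<le> form m (entries A) f"
    proof
      fix f
      have "form m (entries A) (\<lambda>i. vec m f $ i) = form m (entries A) f" by (rule form_cong) simp
      then show "0 \<le> form m (entries A) f" using *[rule_format, of "vec m f"] by simp
    qed
  qed simp
  then show ?thesis using True mult_vec_form[OF True] unfolding psd_def psd_form_def by auto
qed (simp add: psd_def)

lemma form_two:
  assumes "i < m" "j < m" "i \<noteq> j"
  shows "form m a (\<lambda>k. if k = i then s else if k = j then t else 0)
    = cnj s * a i i * s + cnj s * a i j * t + cnj t * a j i * s + cnj t * a j j * t"
proof -
  let ?f = "\<lambda>k. if k = i then s else if k = j then t else 0"
  have 1: "(\<Sum>k<m. g k * ?f k) = g i * s + g j * t" for g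
  proof -
    have "(\<Sum>k<m. g k * ?f k) = (\<Sum>k\<in>{i, j}. g k * ?f k)"
      using assms by (intro sum.mono_neutral_right) auto
    then show ?thesis using assms by simp
  qed
  have 2: "(\<Sum>k<m. cnj (?f k) * g k) = cnj s * g i + cnj t * g j" for g
  proof -
    have "(\<Sum>k<m. cnj (?f k) * g k) = (\<Sum>k\<in>{i, j}. cnj (?f k) * g k)"
      using assms by (intro sum.mono_neutral_right) auto
    then show ?thesis using assms by simp
  qed
  have "form m a ?f = (\<Sum>k<m. cnj (?f k) * (\<Sum>l<m. a k l * ?f l))"
    unfolding form_def by (simp only: sum_distrib_left mult.assoc)
  also have "\<dots> = cnj s * (a i i * s + a i j * t) + cnj t * (a j i * s + a j j * t)"
    unfolding 1 2 ..
  finally show ?thesis by (simp add: distrib_left mult.assoc add.assoc)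
qed

lemma form_one:
  assumes "i < m"
  shows "form m a (\<lambda>k. if k = i then s else 0) = cnj s * a i i * s"
proof -
  have "form m a (\<lambda>k. if k = i then s else 0) = (\<Sum>k<m. if k = i then cnj s * a i i * s else 0)"
    unfolding form_def
  proof (intro sum.cong refl)
    fix k
    have "(\<Sum>j<m. cnj (if k = i then s else 0) * a k j * (if j = i then s else 0))
        = (\<Sum>j<m. if j = i then (if k = i then cnj s * a i i * s else 0) else 0)"
      by (intro sum.cong refl) auto
    then show "(\<Sum>j<m. cnj (if k = i then s else 0) * a k j * (if j = i then s else 0))
        = (if k = i then cnj s * a i i * s else 0)" using assms by simp
  qed
  then show ?thesis using assms by simp
qed

text \<open>Polarization: the test vectors \<open>e_i + e_j\<close> and
  \<open>e_i + \<i> e_j\<close> determine the imaginary and the real part of the difference.\<close>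

lemma real_form_hermitian:
  assumes real: "\<And>f. Im (form m a f) = 0" and "i < m" "j < m"
  shows "a j i = cnj (a i j)"
proof (cases "i = j")
  case True
  have "Im (a i i) = 0" using real[of "\<lambda>k. if k = i then 1 else 0"] form_one[OF assms(2), of a 1] by simp
  then show ?thesis using True by (simp add: complex_eq_iff)
next
  case False
  have d: "Im (a k k) = 0" if "k < m" for k
    using real[of "\<lambda>l. if l = k then 1 else 0"] form_one[OF that, of a 1] by simp
  have "Im (a i j) + Im (a j i) = 0"
    using real[of "\<lambda>k. if k = i then 1 else if k = j then 1 else 0"] form_two[OF assms(2,3) False, of a 1 1]
      d[OF assms(2)] d[OF assms(3)] by simp
  moreover have "Re (a i j) - Re (a j i) = 0"
    using real[of "\<lambda>k. if k = i then 1 else if k = j then \<i> else 0"] form_two[OF assms(2,3) False, of a 1 \<i>]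
      d[OF assms(2)] d[OF assms(3)] by simp
  ultimately show ?thesis by (simp add: complex_eq_iff)
qed

lemma psd_form_facts:
  assumes "psd_form m a"
  shows "\<And>i. i < m \<Longrightarrow> Im (a i i) = 0" "\<And>i. i < m \<Longrightarrow> 0 \<le> Re (a i i)"
    "\<And>i j. i < m \<Longrightarrow> j < m \<Longrightarrow> a j i = cnj (a i j)"
    "\<And>i j. i < m \<Longrightarrow> j < m \<Longrightarrow> (cmod (a i j))\<^sup>2 \<le> Re (a i i) * Re (a j j)"
proof -
  have pos: "0 \<le> form m a f" for f using assms unfolding psd_form_def by blast
  have real: "Im (form m a f) = 0" for f using pos[of f] by (simp add: less_eq_complex_def)
  show d: "Im (a i i) = 0" "0 \<le> Re (a i i)" if "i < m" for i
    using pos[of "\<lambda>k. if k = i then 1 else 0"] form_one[OF that, of a 1] by (simp_all add: less_eq_complex_def)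
  show h: "a j i = cnj (a i j)" if "i < m" "j < m" for i j
    by (rule real_form_hermitian[OF real that])
  show "(cmod (a i j))\<^sup>2 \<le> Re (a i i) * Re (a j j)" if ij: "i < m" "j < m" for i j
  proof (cases "i = j")
    case True
    then have "a i j = complex_of_real (Re (a i i))" using d(1)[OF ij(1)] by (simp add: complex_eq_iff)
    then have "cmod (a i j) = \<bar>Re (a i i)\<bar>" by (metis norm_of_real)
    then show ?thesis using True by (simp add: power2_eq_square)
  next
    case False
    define z where "z = a i j"
    have two: "0 \<le> Re (cnj s * a i i * s + cnj s * z * t + cnj t * cnj z * s + cnj t * a j j * t)" for s t
      using pos[of "\<lambda>k. if k = i then s else if k = j then t else 0"]
      unfolding form_two[OF ij False] h[OF ij] z_def by (simp add: less_eq_complex_def)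
    define x where "x = Re (a i i)"
    define y where "y = Re (a j j)"
    have xy: "a i i = of_real x" "a j j = of_real y" "0 \<le> x" "0 \<le> y"
      unfolding x_def y_def using d ij by (auto simp: complex_eq_iff)
    \<comment> \<open>The form at the vector with coordinates \<open>r\<close> and
      \<open>- cnj z\<close> is a real quadratic polynomial in \<open>r\<close>.\<close>
    have q: "0 \<le> x * r\<^sup>2 - 2 * r * (cmod z)\<^sup>2 + y * (cmod z)\<^sup>2" for r :: real
    proof -
      have "cnj (of_real r) * a i i * of_real r + cnj (of_real r) * z * (- cnj z)
          + cnj (- cnj z) * cnj z * of_real r + cnj (- cnj z) * a j j * (- cnj z)
        = of_real (x * r\<^sup>2) - 2 * of_real r * (z * cnj z) + of_real y * (z * cnj z)"
        unfolding xy by (simp add: power2_eq_square)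
      also have "\<dots> = of_real (x * r\<^sup>2 - 2 * r * (cmod z)\<^sup>2 + y * (cmod z)\<^sup>2)"
        unfolding complex_norm_square[symmetric] by simp
      finally show ?thesis using two[of "of_real r" "- cnj z"] by (simp only: Re_complex_of_real)
    qed
    show ?thesis
    \<comment> \<open>If the leading coefficient vanishes, the polynomial is affine in
      \<open>r\<close>, and \<open>r = y + 1\<close> forces \<open>z = 0\<close>. Otherwise the
      minimizer \<open>r = (cmod z)^2 / x\<close> is inserted.\<close>
    proof (cases "x = 0")
      case True
      have "0 \<le> x * (y + 1)\<^sup>2 - 2 * (y + 1) * (cmod z)\<^sup>2 + y * (cmod z)\<^sup>2" by (rule q)
      then have "(y + 2) * (cmod z)\<^sup>2 \<le> 0" using True by (simp add: algebra_simps)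
      then have "(cmod z)\<^sup>2 \<le> 0" using xy(4) by (simp add: mult_le_0_iff)
      then show ?thesis using True unfolding z_def x_def by simp
    next
      case False
      then have "0 < x" using xy(3) by simp
      define r where "r = (cmod z)\<^sup>2 / x"
      have "x * r\<^sup>2 = r * (cmod z)\<^sup>2" unfolding r_def using \<open>0 < x\<close> by (simp add: power2_eq_square)
      then have "0 \<le> (y - r) * (cmod z)\<^sup>2" using q[of r] by (simp add: algebra_simps)
      then have "r \<le> y \<or> (cmod z)\<^sup>2 = 0" by (auto simp: zero_le_mult_iff)
      then show ?thesis unfolding r_def x_def[symmetric] y_def[symmetric] z_def[symmetric]
        using \<open>0 < x\<close> xy(4) by (auto simp: divide_le_eq mult.commute)
    qed
  qed
qed

text \<open>The factorization is obtained by splitting off one rank-one operator per row.\<close>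

lemma psd_form_factor:
  assumes "psd_form m a" "K \<le> m" "\<And>i j. i < m \<Longrightarrow> j < m \<Longrightarrow> K \<le> i \<or> K \<le> j \<Longrightarrow> a i j = 0"
  shows "\<exists>b. \<forall>i<m. \<forall>j<m. a i j = (\<Sum>r<K. b i r * cnj (b j r))"
  using assms
proof (induction K arbitrary: a)
  case 0
  then show ?case by auto
next
  case (Suc K)
  note facts = psd_form_facts[OF Suc.prems(1)]
  have K: "K < m" using Suc.prems by simp
  define d where "d = Re (a K K)"
  have d: "a K K = of_real d" "0 \<le> d" unfolding d_def using facts(1,2)[OF K] by (auto simp: complex_eq_iff)
  \<comment> \<open>For \<open>d = 0\<close> nothing has to be split off: by Cauchy-Schwarz for
    positive forms, the whole row and column \<open>K\<close> vanish.\<close>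
  define w where "w i = (if d = 0 then 0 else a i K / of_real (sqrt d))" for i
  define a' where "a' i j = a i j - w i * cnj (w j)" for i j
  have a0: "a i K = 0" "a K i = 0" if "d = 0" "i < m" for i
  proof -
    have "(cmod (a i K))\<^sup>2 \<le> 0" using facts(4)[OF that(2) K] d that by simp
    then show "a i K = 0" by simp
    then show "a K i = 0" using facts(3)[OF that(2) K] by simp
  qed
  have ww: "w i * cnj (w j) = a i K * a K j / of_real d" if "d \<noteq> 0" "i < m" "j < m" for i j
  proof -
    have "cnj (a j K) = a K j" using facts(3)[OF that(3) K] by simp
    moreover have "of_real (sqrt d) * of_real (sqrt d) = complex_of_real d"
      using d by (simp only: of_real_mult[symmetric] real_sqrt_mult_self abs_of_nonneg)
    ultimately show ?thesis unfolding w_def using that by simp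
  qed
  have supp: "a' i j = 0" if "i < m" "j < m" "K \<le> i \<or> K \<le> j" for i j
  proof (cases "d = 0")
    case True
    then show ?thesis using that a0 Suc.prems(3)[OF that(1,2)] unfolding a'_def w_def
      by (cases "i = K"; cases "j = K") auto
  next
    case False
    have "a' i j = a i j - a i K * a K j / of_real d" unfolding a'_def ww[OF False that(1,2)] ..
    also have "\<dots> = 0"
    proof (cases "i = K \<or> j = K")
      case True
      then show ?thesis using False d by auto
    next
      case F: False
      then have "Suc K \<le> i \<or> Suc K \<le> j" using that by auto
      then show ?thesis using Suc.prems(3)[OF that(1,2)] Suc.prems(3)[OF that(1) K] Suc.prems(3)[OF K that(2)] by auto
    qed
    finally show ?thesis .
  qed
  have "psd_form m a'"
  proof (cases "d = 0")
    case True
    then have "a' = a" unfolding a'_def w_def by auto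
    then show ?thesis using Suc.prems(1) by simp
  next
    case False
    show ?thesis unfolding psd_form_def
    proof
      fix f
      define c where "c = (\<Sum>j<m. a K j * f j)"
      \<comment> \<open>The Schur complement: shifting coordinate \<open>K\<close> of
        \<open>f\<close> by \<open>l\<close>, which completes the square, turns the form of
        \<open>a\<close> into that of \<open>a'\<close>. So positivity is inherited.\<close>
      define l where "l = - c / of_real d"
      define g where "g i = f i + (if i = K then l else 0)" for i
      have cc: "(\<Sum>i<m. cnj (f i) * a i K) = cnj c"
        unfolding c_def by (simp add: facts(3)[OF K] mult.commute)
      have sp: "(\<Sum>i<m. h i * (if i = K then l else 0)) = h K * l"
        "(\<Sum>i<m. cnj (if i = K then l else 0) * h i) = cnj l * h K" for h
      proof -
        have "(\<Sum>i<m. h i * (if i = K then l else 0)) = (\<Sum>i<m. if i = K then h K * l else 0)"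
          by (intro sum.cong) auto
        then show "(\<Sum>i<m. h i * (if i = K then l else 0)) = h K * l" using K by simp
        have "(\<Sum>i<m. cnj (if i = K then l else 0) * h i) = (\<Sum>i<m. if i = K then cnj l * h K else 0)"
          by (intro sum.cong) auto
        then show "(\<Sum>i<m. cnj (if i = K then l else 0) * h i) = cnj l * h K" using K by simp
      qed
      have inner: "(\<Sum>j<m. a i j * g j) = (\<Sum>j<m. a i j * f j) + a i K * l" for i
        unfolding g_def distrib_left sum.distrib sp ..
      have "form m a g = (\<Sum>i<m. cnj (g i) * (\<Sum>j<m. a i j * g j))"
        unfolding form_def by (simp only: sum_distrib_left mult.assoc)
      also have "\<dots> = (\<Sum>i<m. cnj (f i) * (\<Sum>j<m. a i j * g j)) + cnj l * (\<Sum>j<m. a K j * g j)"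
        unfolding g_def[of "_::nat"] by (simp only: complex_cnj_add distrib_right sum.distrib sp)
      also have "\<dots> = (\<Sum>i<m. cnj (f i) * (\<Sum>j<m. a i j * f j)) + (\<Sum>i<m. cnj (f i) * a i K) * l
          + cnj l * (c + a K K * l)"
        unfolding inner c_def[symmetric] by (simp only: distrib_left sum.distrib sum_distrib_right mult.assoc)
      also have "\<dots> = form m a f + cnj c * l + cnj l * (c + a K K * l)"
        unfolding cc form_def by (simp only: sum_distrib_left mult.assoc)
      also have "\<dots> = form m a f - c * cnj c / of_real d"
        unfolding l_def d using False by simp
      also have "\<dots> = form m a' f"
      proof -
        have "form m a' f = form m a f - (\<Sum>i<m. \<Sum>j<m. cnj (f i) * (a i K * a K j / of_real d) * f j)"
          unfolding form_def sum_subtractf[symmetric]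
          by (intro sum.cong refl) (simp add: a'_def ww[OF False] algebra_simps)
        also have "(\<Sum>i<m. \<Sum>j<m. cnj (f i) * (a i K * a K j / of_real d) * f j)
            = (\<Sum>i<m. cnj (f i) * a i K) * (\<Sum>j<m. a K j * f j) / of_real d"
          unfolding sum_product sum_divide_distrib by (intro sum.cong refl) simp
        finally show ?thesis unfolding cc c_def[symmetric] by (simp add: mult.commute)
      qed
      finally show "0 \<le> form m a' f" using Suc.prems(1) unfolding psd_form_def by metis
    qed
  qed
  from Suc.IH[OF this _ supp] K obtain b where b: "\<forall>i<m. \<forall>j<m. a' i j = (\<Sum>r<K. b i r * cnj (b j r))" by auto
  show ?case
  proof (intro exI[of _ "\<lambda>i r. if r = K then w i else b i r"] allI impI)
    fix i j assume ij: "i < m" "j < m"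
    have "a i j = a' i j + w i * cnj (w j)" unfolding a'_def by simp
    also have "a' i j = (\<Sum>r<K. b i r * cnj (b j r))" using b ij by blast
    finally show "a i j = (\<Sum>r<Suc K. (if r = K then w i else b i r) * cnj (if r = K then w j else b j r))"
      by simp
  qed
qed

lemma mult_adjoint_index:
  fixes B :: "complex mat"
  assumes "B \<in> carrier_mat m k" "i < m" "j < m"
  shows "(B * mat_adjoint B) $$ (i, j) = (\<Sum>r<k. B $$ (i, r) * cnj (B $$ (j, r)))"
  unfolding mult_mat_index[OF assms(1) adjoint_carrier[OF assms(1)] assms(2,3)]
  using assms by (intro sum.cong refl) auto

lemma psd_factor:
  assumes "psd m A"
  obtains B where "B \<in> carrier_mat m m" "A = B * mat_adjoint B"
proof -
  have A: "A \<in> carrier_mat m m" "psd_form m (entries A)" using assms psd_iff_form by auto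
  then obtain b where b: "\<forall>i<m. \<forall>j<m. A $$ (i, j) = (\<Sum>r<m. b i r * cnj (b j r))"
    using psd_form_factor[OF A(2) order_refl] by auto
  define B where "B = mat m m (\<lambda>(i, r). b i r)"
  have B: "B \<in> carrier_mat m m" unfolding B_def by simp
  have "A = B * mat_adjoint B"
  proof (rule eq_matI)
    fix i j assume "i < dim_row (B * mat_adjoint B)" "j < dim_col (B * mat_adjoint B)"
    then have ij: "i < m" "j < m" using B by auto
    show "A $$ (i, j) = (B * mat_adjoint B) $$ (i, j)"
      unfolding mult_adjoint_index[OF B ij] using b ij by (simp add: B_def)
  qed (use A B in auto)
  with B show ?thesis by (rule that)
qed

lemma trace_mult_adjoint:
  assumes "A \<in> carrier_mat m m" "B \<in> carrier_mat m k"
  shows "mat_trace (A * (B * mat_adjoint B)) = (\<Sum>r<k. form m (entries A) (\<lambda>i. B $$ (i, r)))"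
proof -
  have c: "B * mat_adjoint B \<in> carrier_mat m m" using assms by auto
  have "mat_trace (A * (B * mat_adjoint B)) = (\<Sum>i<m. \<Sum>j<m. \<Sum>r<k. cnj (B $$ (i, r)) * A $$ (i, j) * B $$ (j, r))"
    unfolding trace_mult[OF assms(1) c]
    by (intro sum.cong refl) (simp add: mult_adjoint_index[OF assms(2)] sum_distrib_left mult_ac del: index_mult_mat(1))
  also have "\<dots> = (\<Sum>i<m. \<Sum>r<k. \<Sum>j<m. cnj (B $$ (i, r)) * A $$ (i, j) * B $$ (j, r))"
    by (rule sum.cong[OF refl], rule sum.swap)
  also have "\<dots> = (\<Sum>r<k. form m (entries A) (\<lambda>i. B $$ (i, r)))"
    unfolding form_def by (rule sum.swap)
  finally show ?thesis .
qed

lemma trace_self_adjoint: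
  assumes "B \<in> carrier_mat m k"
  shows "mat_trace (B * mat_adjoint B) = of_real (\<Sum>r<k. \<Sum>i<m. (cmod (B $$ (i, r)))\<^sup>2)"
proof -
  have "mat_trace (B * mat_adjoint B) = (\<Sum>i<m. \<Sum>r<k. B $$ (i, r) * cnj (B $$ (i, r)))"
    unfolding mat_trace_def using assms
    by (intro sum.cong) (auto simp: mult_adjoint_index[OF assms] simp del: index_mult_mat(1))
  also have "\<dots> = of_real (\<Sum>r<k. \<Sum>i<m. (cmod (B $$ (i, r)))\<^sup>2)"
    by (subst sum.swap) (simp only: of_real_sum complex_norm_square)
  finally show ?thesis .
qed

lemma psd_self_adjoint:
  assumes "B \<in> carrier_mat m k"
  shows "psd m (B * mat_adjoint B)"
  unfolding psd_iff_form psd_form_def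
proof (intro conjI allI)
  show "B * mat_adjoint B \<in> carrier_mat m m" using assms by auto
  fix f
  have "form m (entries (B * mat_adjoint B)) f = (\<Sum>i<m. \<Sum>j<m. \<Sum>r<k. (cnj (f i) * B $$ (i, r)) * cnj (cnj (f j) * B $$ (j, r)))"
    unfolding form_def
    by (intro sum.cong refl) (simp add: mult_adjoint_index[OF assms] sum_distrib_left sum_distrib_right mult_ac del: index_mult_mat(1))
  also have "\<dots> = (\<Sum>i<m. \<Sum>r<k. \<Sum>j<m. (cnj (f i) * B $$ (i, r)) * cnj (cnj (f j) * B $$ (j, r)))"
    by (rule sum.cong[OF refl], rule sum.swap)
  also have "\<dots> = (\<Sum>r<k. \<Sum>i<m. \<Sum>j<m. (cnj (f i) * B $$ (i, r)) * cnj (cnj (f j) * B $$ (j, r)))"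
    by (rule sum.swap)
  also have "\<dots> = (\<Sum>r<k. (\<Sum>i<m. cnj (f i) * B $$ (i, r)) * cnj (\<Sum>i<m. cnj (f i) * B $$ (i, r)))"
    by (simp only: sum_product cnj_sum)
  also have "\<dots> = of_real (\<Sum>r<k. (cmod (\<Sum>i<m. cnj (f i) * B $$ (i, r)))\<^sup>2)"
    by (simp only: of_real_sum complex_norm_square)
  also have "0 \<le> \<dots>" by (simp add: less_eq_complex_def sum_nonneg)
  finally show "0 \<le> form m (entries (B * mat_adjoint B)) f" .
qed

lemma psd_trace_mult_nonneg:
  assumes "psd m A" "psd m \<sigma>"
  shows "0 \<le> mat_trace (A * \<sigma>)"
proof -
  obtain B where B: "B \<in> carrier_mat m m" "\<sigma> = B * mat_adjoint B" using psd_factor[OF assms(2)] .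
  have A: "A \<in> carrier_mat m m" "psd_form m (entries A)" using assms(1) psd_iff_form by auto
  show ?thesis
    unfolding B(2) trace_mult_adjoint[OF A(1) B(1)] using A(2) unfolding psd_form_def by (auto intro: sum_nonneg)
qed

section \<open>The spectral norm\<close>

lemma euclidean_norm_L2_set: "v \<in> carrier_vec m \<Longrightarrow> euclidean_norm v = L2_set (\<lambda>i. cmod (v $ i)) {..<m}"
proof -
  assume v: "v \<in> carrier_vec m"
  have "v \<bullet>c v = (\<Sum>i<m. v $ i * cnj (v $ i))"
    using v by (auto simp: scalar_prod_def atLeast0LessThan intro!: sum.cong)
  also have "\<dots> = of_real (\<Sum>i<m. (cmod (v $ i))\<^sup>2)" by (simp only: of_real_sum complex_norm_square)
  finally show ?thesis unfolding euclidean_norm_def L2_set_def by simp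
qed

lemma spectral_norm_bound:
  assumes A: "A \<in> carrier_mat m m" and v: "v \<in> carrier_vec m"
  shows "euclidean_norm (A *\<^sub>v v) \<le> spectral_norm A * euclidean_norm v"
proof -
  have Av: "A *\<^sub>v u \<in> carrier_vec m" for u using A by (intro carrier_vecI) auto
  have idx: "(A *\<^sub>v u) $ i = (\<Sum>j<m. A $$ (i, j) * u $ j)" if "u \<in> carrier_vec m" "i < m" for u i
    using A that by (auto simp: scalar_prod_def atLeast0LessThan intro!: sum.cong)
  \<comment> \<open>The spectral norm is a supremum of reals, which bounds the elements of its set
    only once the set is known to be bounded above. The sum of the moduli of the entries is a crude
    bound.\<close>
  have bdd: "bdd_above {euclidean_norm (A *\<^sub>v v) | v. v \<in> carrier_vec (dim_col A) \<and> euclidean_norm v = 1}"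
  proof (rule bdd_aboveI[of _ "\<Sum>i<m. \<Sum>j<m. cmod (A $$ (i, j))"], clarify)
    fix u assume u: "u \<in> carrier_vec (dim_col A)" "euclidean_norm u = 1"
    then have um: "u \<in> carrier_vec m" using A by auto
    have u1: "cmod (u $ j) \<le> 1" if "j < m" for j
      using member_le_L2_set[of "{..<m}" j "\<lambda>i. cmod (u $ i)"] that u(2) euclidean_norm_L2_set[OF um] by simp
    have "euclidean_norm (A *\<^sub>v u) \<le> (\<Sum>i<m. cmod ((A *\<^sub>v u) $ i))"
      unfolding euclidean_norm_L2_set[OF Av] by (rule L2_set_le_sum) simp
    also have "\<dots> \<le> (\<Sum>i<m. \<Sum>j<m. cmod (A $$ (i, j)))"
    proof (rule sum_mono)
      fix i assume i: "i \<in> {..<m}"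
      have "cmod ((A *\<^sub>v u) $ i) \<le> (\<Sum>j<m. cmod (A $$ (i, j)) * cmod (u $ j))"
        using i um by (simp only: idx lessThan_iff) (rule order_trans[OF norm_sum], simp add: norm_mult)
      also have "\<dots> \<le> (\<Sum>j<m. cmod (A $$ (i, j)) * 1)"
        by (intro sum_mono mult_left_mono) (use u1 in auto)
      finally show "cmod ((A *\<^sub>v u) $ i) \<le> (\<Sum>j<m. cmod (A $$ (i, j)))" by simp
    qed
    finally show "euclidean_norm (A *\<^sub>v u) \<le> (\<Sum>i<m. \<Sum>j<m. cmod (A $$ (i, j)))" .
  qed
  define c where "c = euclidean_norm v"
  have scale: "euclidean_norm (of_real r \<cdot>\<^sub>v u) = \<bar>r\<bar> * euclidean_norm u" if "u \<in> carrier_vec m" for r u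
  proof -
    have "L2_set (\<lambda>i. cmod ((of_real r \<cdot>\<^sub>v u) $ i)) {..<m} = L2_set (\<lambda>i. \<bar>r\<bar> * cmod (u $ i)) {..<m}"
      using that by (intro L2_set_cong) (auto simp: norm_mult)
    also have "\<dots> = \<bar>r\<bar> * L2_set (\<lambda>i. cmod (u $ i)) {..<m}" by (simp add: L2_set_right_distrib)
    finally show ?thesis using that euclidean_norm_L2_set[of "of_real r \<cdot>\<^sub>v u" m] euclidean_norm_L2_set[OF that] by simp
  qed
  have c0: "0 \<le> c" unfolding c_def euclidean_norm_L2_set[OF v] by simp
  show ?thesis
  proof (cases "c = 0")
    case True
    then have "v $ i = 0" if "i < m" for i
      using that unfolding c_def euclidean_norm_L2_set[OF v] by (simp add: L2_set_eq_0_iff)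
    then have "cmod ((A *\<^sub>v v) $ i) = 0" if "i < m" for i
      using that v by (simp add: idx del: index_mult_mat_vec)
    then have "euclidean_norm (A *\<^sub>v v) = 0"
      unfolding euclidean_norm_L2_set[OF Av] by (subst L2_set_eq_0_iff) auto
    then show ?thesis using True c_def by simp
  next
    case False
    then have cp: "0 < c" using c0 by simp
    define u where "u = of_real (1 / c) \<cdot>\<^sub>v v"
    have u: "u \<in> carrier_vec m" using v unfolding u_def by simp
    have u1: "euclidean_norm u = 1" unfolding u_def scale[OF v] c_def[symmetric] using cp by simp
    have "v = of_real c \<cdot>\<^sub>v u" unfolding u_def using cp by (simp add: smult_smult_assoc)
    then have "A *\<^sub>v v = of_real c \<cdot>\<^sub>v (A *\<^sub>v u)" using A u by (simp add: mult_mat_vec)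
    then have "euclidean_norm (A *\<^sub>v v) = c * euclidean_norm (A *\<^sub>v u)" using scale[OF Av] cp by simp
    also have "\<dots> \<le> c * spectral_norm A"
    proof (rule mult_left_mono)
      show "euclidean_norm (A *\<^sub>v u) \<le> spectral_norm A" unfolding spectral_norm_def
        by (rule cSup_upper[OF _ bdd]) (use u u1 A in auto)
    qed (rule c0)
    finally show ?thesis by (simp add: c_def mult.commute)
  qed
qed

lemma form_spectral_norm:
  assumes "A \<in> carrier_mat m m"
  shows "cmod (form m (entries A) f) \<le> spectral_norm A * (\<Sum>i<m. (cmod (f i))\<^sup>2)"
proof -
  define v where "v = vec m f"
  have v: "v \<in> carrier_vec m" unfolding v_def by simp
  have Av: "A *\<^sub>v v \<in> carrier_vec m" using assms by (intro carrier_vecI) auto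
  have nv: "L2_set (\<lambda>i. cmod (v $ i)) {..<m} * L2_set (\<lambda>i. cmod (v $ i)) {..<m} = (\<Sum>i<m. (cmod (f i))\<^sup>2)"
    unfolding L2_set_def v_def by (simp add: sum_nonneg)
  have "form m (entries A) f = (A *\<^sub>v v) \<bullet>c v"
    unfolding mult_vec_form[OF assms v] by (rule form_cong) (simp add: v_def)
  also have "\<dots> = (\<Sum>i<m. (A *\<^sub>v v) $ i * cnj (v $ i))"
    using v by (auto simp: scalar_prod_def atLeast0LessThan intro!: sum.cong)
  also have "cmod \<dots> \<le> (\<Sum>i<m. \<bar>cmod ((A *\<^sub>v v) $ i)\<bar> * \<bar>cmod (v $ i)\<bar>)"
    by (rule order_trans[OF norm_sum]) (simp add: norm_mult)
  also have "\<dots> \<le> L2_set (\<lambda>i. cmod ((A *\<^sub>v v) $ i)) {..<m} * L2_set (\<lambda>i. cmod (v $ i)) {..<m}"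
    by (rule L2_set_mult_ineq)
  also have "\<dots> \<le> (spectral_norm A * L2_set (\<lambda>i. cmod (v $ i)) {..<m}) * L2_set (\<lambda>i. cmod (v $ i)) {..<m}"
    using spectral_norm_bound[OF assms v] unfolding euclidean_norm_L2_set[OF v] euclidean_norm_L2_set[OF Av]
    by (rule mult_right_mono) simp
  finally show ?thesis using nv by (simp add: mult.assoc)
qed

text \<open>Factorize \<open>\<sigma>\<close> as \<open>B * mat_adjoint B\<close>: the trace is the
  sum of the values of the form of \<open>A\<close> at the columns of \<open>B\<close>, and the
  squared lengths of these columns add up to the trace of \<open>\<sigma>\<close>.\<close>

lemma psd_trace_bound:
  assumes "A \<in> carrier_mat m m" "psd m \<sigma>"
  shows "cmod (mat_trace (A * \<sigma>)) \<le> spectral_norm A * Re (mat_trace \<sigma>)"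
proof -
  obtain B where B: "B \<in> carrier_mat m m" "\<sigma> = B * mat_adjoint B" using psd_factor[OF assms(2)] .
  have "cmod (mat_trace (A * \<sigma>)) \<le> (\<Sum>r<m. cmod (form m (entries A) (\<lambda>i. B $$ (i, r))))"
    unfolding B(2) trace_mult_adjoint[OF assms(1) B(1)] by (rule norm_sum)
  also have "\<dots> \<le> (\<Sum>r<m. spectral_norm A * (\<Sum>i<m. (cmod (B $$ (i, r)))\<^sup>2))"
    by (intro sum_mono form_spectral_norm assms)
  also have "\<dots> = spectral_norm A * Re (mat_trace \<sigma>)"
    unfolding B(2) trace_self_adjoint[OF B(1)] Re_complex_of_real by (simp only: sum_distrib_left)
  finally show ?thesis .
qed

lemma psd_hermitian: "psd m A \<Longrightarrow> hermitian A"
proof -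
  assume A: "psd m A"
  then have c: "A \<in> carrier_mat m m" "psd_form m (entries A)" using psd_iff_form by auto
  show ?thesis unfolding hermitian_def
  proof (rule eq_matI)
    fix i j assume "i < dim_row A" "j < dim_col A"
    then have ij: "i < m" "j < m" using c(1) by auto
    then have "mat_adjoint A $$ (i, j) = cnj (A $$ (j, i))" using c(1) by (intro adjoint_index) auto
    then show "mat_adjoint A $$ (i, j) = A $$ (i, j)" using psd_form_facts(3)[OF c(2) ij(2,1)] by simp
  qed (use c(1) in \<open>simp_all only: adjoint_dim carrier_matD\<close>)
qed

lemma trace_hermitian_real:
  assumes "A \<in> carrier_mat m m" "B \<in> carrier_mat m m" "hermitian A" "hermitian B"
  shows "Im (mat_trace (A * B)) = 0"
proof -
  have "cnj (A $$ (i, j) * B $$ (j, i)) = A $$ (j, i) * B $$ (i, j)" if "i < m" "j < m" for i j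
  proof -
    have "cnj (A $$ (i, j)) = A $$ (j, i)" "cnj (B $$ (j, i)) = B $$ (i, j)"
      using adjoint_index[of j A i] adjoint_index[of i B j] assms that unfolding hermitian_def by auto
    then show ?thesis by simp
  qed
  then have "cnj (mat_trace (A * B)) = (\<Sum>i<m. \<Sum>j<m. A $$ (j, i) * B $$ (i, j))"
    unfolding trace_mult[OF assms(1,2)] cnj_sum by (intro sum.cong refl) simp
  also have "\<dots> = mat_trace (A * B)" unfolding trace_mult[OF assms(1,2)] by (rule sum.swap)
  finally show ?thesis by (simp add: complex_eq_iff)
qed


section \<open>Channels in the Heisenberg picture\<close>

definition matrix_unit :: "nat \<Rightarrow> nat \<Rightarrow> nat \<Rightarrow> complex mat" where
  "matrix_unit m i j = mat m m (\<lambda>(k, l). if k = i \<and> l = j then 1 else 0)"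

lemma matrix_unit_carrier [simp]: "matrix_unit m i j \<in> carrier_mat m m"
  unfolding matrix_unit_def by simp

text \<open>The functional is an arbitrary function that is known to be linear only on matrices of
  the right dimension, so the matrix is assembled entry by entry inside that carrier.\<close>

lemma linear_expansion:
  fixes L :: "complex mat \<Rightarrow> complex"
  assumes add: "\<And>A B. A \<in> carrier_mat m m \<Longrightarrow> B \<in> carrier_mat m m \<Longrightarrow> L (A + B) = L A + L B"
    and smult: "\<And>A c. A \<in> carrier_mat m m \<Longrightarrow> L (c \<cdot>\<^sub>m A) = c * L A"
    and A: "A \<in> carrier_mat m m"
  shows "L A = (\<Sum>i<m. \<Sum>j<m. A $$ (i, j) * L (matrix_unit m i j))"
proof -
  define R where "R S = mat m m (\<lambda>ij. if ij \<in> S then A $$ ij else 0)" for S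
  have R: "R S \<in> carrier_mat m m" for S unfolding R_def by simp
  have step: "L (R S) = (\<Sum>ij\<in>S. A $$ ij * L (matrix_unit m (fst ij) (snd ij)))" if "finite S" for S
    using that
  proof (induction S rule: finite_induct)
    case empty
    \<comment> \<open>The value at the zero matrix comes from homogeneity with the scalar 0.\<close>
    have "R {} = 0 \<cdot>\<^sub>m R {}" by (rule eq_matI) (auto simp: R_def)
    then have "L (R {}) = 0 * L (R {})" using smult[OF R, of 0] by metis
    then show ?case by simp
  next
    case (insert ij S)
    have "R (insert ij S) = R S + A $$ ij \<cdot>\<^sub>m matrix_unit m (fst ij) (snd ij)"
      by (rule eq_matI) (use insert.hyps in \<open>auto simp: R_def matrix_unit_def\<close>)
    then have "L (R (insert ij S)) = L (R S) + A $$ ij * L (matrix_unit m (fst ij) (snd ij))"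
      using add[OF R, of "A $$ ij \<cdot>\<^sub>m matrix_unit m (fst ij) (snd ij)"]
        smult[OF matrix_unit_carrier, of "A $$ ij"] by simp
    then show ?case using insert by simp
  qed
  have "A = R ({..<m} \<times> {..<m})" by (rule eq_matI) (use A in \<open>auto simp: R_def\<close>)
  then have "L A = (\<Sum>ij\<in>{..<m} \<times> {..<m}. A $$ ij * L (matrix_unit m (fst ij) (snd ij)))"
    using step[of "{..<m} \<times> {..<m}"] by simp
  then show ?thesis by (simp add: sum.cartesian_product case_prod_unfold)
qed

lemma trace_mult_add:
  assumes "A \<in> carrier_mat m m" "B \<in> carrier_mat m m" "C \<in> carrier_mat m m"
  shows "mat_trace (A * (B + C)) = mat_trace (A * B) + mat_trace (A * C)"
proof -
  have "A * (B + C) = A * B + A * C" by (rule mult_add_distrib_mat[OF assms])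
  then show ?thesis using trace_add[of "A * B" m "A * C"] assms by simp
qed

lemma trace_mult_smult:
  assumes "A \<in> carrier_mat m m" "B \<in> carrier_mat m m"
  shows "mat_trace (A * (c \<cdot>\<^sub>m B)) = c * mat_trace (A * B)"
proof -
  have "A * (c \<cdot>\<^sub>m B) = c \<cdot>\<^sub>m (A * B)" by (rule mult_smult_distrib[OF assms])
  then show ?thesis using trace_smult[of "A * B" m c] assms by simp
qed

lemma trace_mult_matrix_unit:
  assumes "A \<in> carrier_mat m m" "i < m" "j < m"
  shows "mat_trace (A * matrix_unit m j i) = A $$ (i, j)"
proof -
  have "mat_trace (A * matrix_unit m j i) = (\<Sum>k<m. \<Sum>l<m. if l = j then if k = i then A $$ (k, l) else 0 else 0)"
    unfolding trace_mult[OF assms(1) matrix_unit_carrier]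
    by (intro sum.cong refl) (auto simp: matrix_unit_def)
  then show ?thesis using assms by simp
qed

lemma trace_eq_imp_eq:
  assumes "A \<in> carrier_mat m m" "B \<in> carrier_mat m m"
    and "\<And>\<rho>. \<rho> \<in> carrier_mat m m \<Longrightarrow> mat_trace (A * \<rho>) = mat_trace (B * \<rho>)"
  shows "A = B"
proof (rule eq_matI)
  fix i j assume "i < dim_row B" "j < dim_col B"
  then have ij: "i < m" "j < m" using assms by auto
  show "A $$ (i, j) = B $$ (i, j)"
    using assms(3)[OF matrix_unit_carrier, of j i] ij by (simp add: trace_mult_matrix_unit assms(1,2))
qed (use assms in auto)

section \<open>Channels and their duals\<close>

locale channel =
  fixes n :: nat and \<E> :: "complex mat \<Rightarrow> complex mat"
  assumes cptp: "cptp n \<E>"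

lemma (in channel) carrier: "A \<in> operators n \<Longrightarrow> \<E> A \<in> operators n"
  and add: "A \<in> operators n \<Longrightarrow> B \<in> operators n \<Longrightarrow> \<E> (A + B) = \<E> A + \<E> B"
  and smult: "A \<in> operators n \<Longrightarrow> \<E> (c \<cdot>\<^sub>m A) = c \<cdot>\<^sub>m \<E> A"
  and trace: "A \<in> operators n \<Longrightarrow> mat_trace (\<E> A) = mat_trace A"
  using cptp unfolding cptp_def by blast+

text \<open>Complete positivity with an ancilla of dimension 1.\<close>

lemma (in channel) psd:
  assumes "psd (2 ^ n) A"
  shows "psd (2 ^ n) (\<E> A)"
proof -
  have A: "A \<in> operators n" using assms psd_def by blast
  have b: "block n A 0 0 = A" by (rule eq_matI) (use A in \<open>auto simp: block_def\<close>)
  have "ampliation 1 n \<E> A = \<E> A"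
  proof (rule eq_matI)
    fix i j assume "i < dim_row (\<E> A)" "j < dim_col (\<E> A)"
    then have "i < 2 ^ n" "j < 2 ^ n" using carrier[OF A] by auto
    then show "ampliation 1 n \<E> A $$ (i, j) = \<E> A $$ (i, j)"
      unfolding ampliation_def by (simp add: b)
  qed (use carrier[OF A] in \<open>auto simp: ampliation_def\<close>)
  moreover have "psd (1 * 2 ^ n) (ampliation 1 n \<E> A)"
  proof -
    have "\<forall>m A. psd (m * 2 ^ n) A \<longrightarrow> psd (m * 2 ^ n) (ampliation m n \<E> A)"
      using cptp unfolding cptp_def by blast
    moreover have "psd (1 * 2 ^ n) A" using assms by simp
    ultimately show ?thesis by blast
  qed
  ultimately show ?thesis by simp
qed

definition (in channel) heisenberg :: "complex mat \<Rightarrow> complex mat" where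
  "heisenberg Obs = mat (2 ^ n) (2 ^ n) (\<lambda>(i, j). mat_trace (Obs * \<E> (matrix_unit (2 ^ n) j i)))"

lemma (in channel) heisenberg_carrier [simp]: "heisenberg Obs \<in> operators n"
  unfolding heisenberg_def by simp

lemma (in channel) trace_linear:
  assumes "Obs \<in> operators n" "A \<in> operators n"
  shows "mat_trace (Obs * \<E> A) = (\<Sum>i<2 ^ n. \<Sum>j<2 ^ n. A $$ (i, j) * mat_trace (Obs * \<E> (matrix_unit (2 ^ n) i j)))"
  by (rule linear_expansion[of "2 ^ n" "\<lambda>A. mat_trace (Obs * \<E> A)", OF _ _ assms(2)])
    (simp_all only: add smult trace_mult_add[OF assms(1) carrier carrier] trace_mult_smult[OF assms(1) carrier])

lemma (in channel) trace_heisenberg: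
  assumes "Obs \<in> operators n" "A \<in> operators n"
  shows "mat_trace (heisenberg Obs * A) = mat_trace (Obs * \<E> A)"
proof -
  have "mat_trace (heisenberg Obs * A) = (\<Sum>j<2 ^ n. \<Sum>i<2 ^ n. heisenberg Obs $$ (i, j) * A $$ (j, i))"
    unfolding trace_mult[OF heisenberg_carrier assms(2)] by (rule sum.swap)
  also have "\<dots> = mat_trace (Obs * \<E> A)"
    unfolding trace_linear[OF assms] by (intro sum.cong refl) (simp add: heisenberg_def mult.commute)
  finally show ?thesis .
qed

lemma (in channel) dual_map_eq:
  assumes "Obs \<in> operators n"
  shows "dual_map n \<E> Obs = heisenberg Obs"
  unfolding dual_map_def
proof (rule the_equality)
  show "heisenberg Obs \<in> operators n \<and> (\<forall>\<rho>\<in>operators n. mat_trace (Obs * \<E> \<rho>) = mat_trace (heisenberg Obs * \<rho>))"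
    using trace_heisenberg[OF assms] by simp
  fix A assume A: "A \<in> operators n \<and> (\<forall>\<rho>\<in>operators n. mat_trace (Obs * \<E> \<rho>) = mat_trace (A * \<rho>))"
  show "A = heisenberg Obs"
    by (rule trace_eq_imp_eq[where m = "2 ^ n"]) (use A trace_heisenberg[OF assms] in auto)
qed

text \<open>The form of the evolved observable at \<open>f\<close> is the value of
  \<open>Obs\<close> on the image of the rank-one operator of \<open>f\<close>. That image is
  positive with trace the squared length of \<open>f\<close>, so Hermiticity and norm bounds pass
  from \<open>Obs\<close> to the evolved observable.\<close>

lemma (in channel) heisenberg_form:
  assumes "Obs \<in> operators n"
  obtains \<sigma> where "psd (2 ^ n) \<sigma>" "mat_trace \<sigma> = of_real (\<Sum>i<2 ^ n. (cmod (f i))\<^sup>2)"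
    "form (2 ^ n) (entries (heisenberg Obs)) f = mat_trace (Obs * \<sigma>)"
proof -
  define B where "B = mat (2 ^ n) 1 (\<lambda>(i, _). f i)"
  have B: "B \<in> carrier_mat (2 ^ n) 1" unfolding B_def by simp
  have p: "psd (2 ^ n) (B * mat_adjoint B)" by (rule psd_self_adjoint[OF B])
  then have c: "B * mat_adjoint B \<in> operators n" using psd_def by blast
  have "form (2 ^ n) (entries (heisenberg Obs)) f = form (2 ^ n) (entries (heisenberg Obs)) (\<lambda>i. B $$ (i, 0))"
    by (rule form_cong) (simp add: B_def)
  also have "\<dots> = mat_trace (heisenberg Obs * (B * mat_adjoint B))"
    unfolding trace_mult_adjoint[OF heisenberg_carrier B] by simp
  also have "\<dots> = mat_trace (Obs * \<E> (B * mat_adjoint B))" by (rule trace_heisenberg[OF assms c])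
  finally have f: "form (2 ^ n) (entries (heisenberg Obs)) f = mat_trace (Obs * \<E> (B * mat_adjoint B))" .
  have "mat_trace (\<E> (B * mat_adjoint B)) = of_real (\<Sum>i<2 ^ n. (cmod (f i))\<^sup>2)"
    unfolding trace[OF c] trace_self_adjoint[OF B] by (simp add: B_def)
  with psd[OF p] show ?thesis using f by (rule that)
qed

lemma (in channel) heisenberg_hermitian:
  assumes "Obs \<in> operators n" "hermitian Obs"
  shows "hermitian (heisenberg Obs)"
proof -
  have "Im (form (2 ^ n) (entries (heisenberg Obs)) f) = 0" for f
  proof -
    obtain \<sigma> where \<sigma>: "psd (2 ^ n) \<sigma>" "form (2 ^ n) (entries (heisenberg Obs)) f = mat_trace (Obs * \<sigma>)"
      by (rule heisenberg_form[OF assms(1), of f])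
    have "\<sigma> \<in> operators n" using \<sigma>(1) psd_def by blast
    then show ?thesis unfolding \<sigma>(2) by (rule trace_hermitian_real[OF assms(1) _ assms(2) psd_hermitian[OF \<sigma>(1)]])
  qed
  note h = real_form_hermitian[OF this]
  have c: "dim_row (heisenberg Obs) = 2 ^ n" "dim_col (heisenberg Obs) = 2 ^ n" unfolding heisenberg_def by simp_all
  show ?thesis unfolding hermitian_def
  proof (rule eq_matI)
    fix i j assume "i < dim_row (heisenberg Obs)" "j < dim_col (heisenberg Obs)"
    then have ij: "i < 2 ^ n" "j < 2 ^ n" using c by simp_all
    then have "mat_adjoint (heisenberg Obs) $$ (i, j) = cnj (heisenberg Obs $$ (j, i))"
      using c by (intro adjoint_index) auto
    then show "mat_adjoint (heisenberg Obs) $$ (i, j) = heisenberg Obs $$ (i, j)" using h[OF ij(2,1)] by simp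
  qed (simp_all only: adjoint_dim c)
qed

text \<open>A Hermitian form that is bounded by the squared norm is a contraction: polarize
  \<open>\<langle>H v, w\<rangle>\<close> at \<open>w = H v\<close>.\<close>

lemma (in channel) heisenberg_column:
  assumes Obs: "Obs \<in> operators n" "hermitian Obs" "spectral_norm Obs \<le> 1" and j: "j < 2 ^ n"
  shows "(\<Sum>i<2 ^ n. (cmod (heisenberg Obs $$ (i, j)))\<^sup>2) \<le> 1"
proof -
  define H where "H = entries (heisenberg Obs)"
  let ?m = "(2::nat) ^ n"
  have bound: "\<bar>Re (form ?m H f)\<bar> \<le> (\<Sum>i<?m. (cmod (f i))\<^sup>2)" for f
  proof -
    obtain \<sigma> where \<sigma>: "psd ?m \<sigma>" "mat_trace \<sigma> = of_real (\<Sum>i<?m. (cmod (f i))\<^sup>2)"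
      "form ?m H f = mat_trace (Obs * \<sigma>)"
      unfolding H_def by (rule heisenberg_form[OF Obs(1), of f])
    have "\<bar>Re (form ?m H f)\<bar> \<le> cmod (mat_trace (Obs * \<sigma>))" unfolding \<sigma>(3) by (rule abs_Re_le_cmod)
    also have "\<dots> \<le> spectral_norm Obs * (\<Sum>i<?m. (cmod (f i))\<^sup>2)"
      using psd_trace_bound[OF Obs(1) \<sigma>(1)] unfolding \<sigma>(2) Re_complex_of_real .
    also have "\<dots> \<le> 1 * (\<Sum>i<?m. (cmod (f i))\<^sup>2)"
      by (intro mult_right_mono Obs(3)) (simp add: sum_nonneg)
    finally show ?thesis by simp
  qed
  have herm: "H l k = cnj (H k l)" if "k < ?m" "l < ?m" for k l
  proof -
    have "mat_adjoint (heisenberg Obs) $$ (l, k) = cnj (heisenberg Obs $$ (k, l))"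
      by (rule adjoint_index) (simp_all add: heisenberg_def that)
    then show ?thesis using heisenberg_hermitian[OF Obs(1,2)] by (simp only: H_def hermitian_def)
  qed
  \<comment> \<open>The basis vector \<open>e_j\<close> and its image \<open>H e_j\<close>, which is
    column \<open>j\<close>. The difference of the forms at \<open>f + g\<close> and
    \<open>f - g\<close> is \<open>4 * s\<close>, while the bound on forms gives at most
    \<open>2 * 1 + 2 * s\<close>.\<close>
  define f where "f i = (if i = j then 1 else 0 :: complex)" for i
  define g where "g i = H i j" for i
  define s where "s = (\<Sum>i<?m. (cmod (H i j))\<^sup>2)"
  have parallelogram: "(cmod (z + w))\<^sup>2 + (cmod (z - w))\<^sup>2 = 2 * (cmod z)\<^sup>2 + 2 * (cmod w)\<^sup>2" for z w
    unfolding cmod_power2 by (simp add: power2_sum power2_diff)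
  have gf: "(\<Sum>i<?m. \<Sum>k<?m. cnj (g i) * H i k * f k) = of_real s"
  proof -
    have "(\<Sum>i<?m. \<Sum>k<?m. cnj (g i) * H i k * f k) = (\<Sum>i<?m. \<Sum>k<?m. if k = j then H i j * cnj (H i j) else 0)"
      unfolding f_def g_def by (intro sum.cong refl) auto
    also have "\<dots> = (\<Sum>i<?m. H i j * cnj (H i j))" using j by simp
    finally show ?thesis unfolding s_def by (simp only: of_real_sum complex_norm_square)
  qed
  have fg: "(\<Sum>i<?m. \<Sum>k<?m. cnj (f i) * H i k * g k) = of_real s"
  proof -
    have "(\<Sum>i<?m. \<Sum>k<?m. cnj (f i) * H i k * g k) = (\<Sum>k<?m. \<Sum>i<?m. cnj (f i) * H i k * g k)" by (rule sum.swap)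
    also have "\<dots> = (\<Sum>k<?m. \<Sum>i<?m. if i = j then H k j * cnj (H k j) else 0)"
      unfolding f_def g_def using herm[OF j] by (intro sum.cong refl) simp
    also have "\<dots> = (\<Sum>k<?m. H k j * cnj (H k j))" using j by simp
    finally show ?thesis unfolding s_def by (simp only: of_real_sum complex_norm_square)
  qed
  have "form ?m H (\<lambda>i. f i + g i) - form ?m H (\<lambda>i. f i - g i)
      = (\<Sum>i<?m. \<Sum>k<?m. 2 * (cnj (g i) * H i k * f k) + 2 * (cnj (f i) * H i k * g k))"
    unfolding form_def sum_subtractf[symmetric]
    by (intro sum.cong refl) (simp add: distrib_left distrib_right left_diff_distrib right_diff_distrib)
  also have "\<dots> = 2 * of_real s + 2 * of_real s"
    unfolding sum.distrib sum_distrib_left[symmetric] gf fg ..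
  finally have "form ?m H (\<lambda>i. f i + g i) - form ?m H (\<lambda>i. f i - g i) = 2 * of_real s + 2 * of_real s" .
  from arg_cong[OF this, of Re]
  have "4 * s = Re (form ?m H (\<lambda>i. f i + g i)) - Re (form ?m H (\<lambda>i. f i - g i))" by simp
  also have "\<dots> \<le> (\<Sum>i<?m. (cmod (f i + g i))\<^sup>2) + (\<Sum>i<?m. (cmod (f i - g i))\<^sup>2)"
    using bound[of "\<lambda>i. f i + g i"] bound[of "\<lambda>i. f i - g i"] by linarith
  also have "\<dots> = (\<Sum>i<?m. 2 * (cmod (f i))\<^sup>2 + 2 * (cmod (g i))\<^sup>2)"
    unfolding sum.distrib[symmetric]
    by (intro sum.cong refl parallelogram)
  also have "\<dots> = 2 * (\<Sum>i<?m. (cmod (f i))\<^sup>2) + 2 * s"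
    unfolding s_def g_def by (simp add: sum.distrib sum_distrib_left)
  finally have "4 * s \<le> 2 * (\<Sum>i<?m. (cmod (f i))\<^sup>2) + 2 * s" .
  moreover have "(\<Sum>i<?m. (cmod (f i))\<^sup>2) = (\<Sum>i<?m. if i = j then 1 else 0)"
    unfolding f_def by (intro sum.cong) auto
  moreover have "\<dots> = (1::real)" using j by simp
  ultimately show ?thesis unfolding s_def H_def by linarith
qed

text \<open>Each of the \<open>2 ^ n\<close> columns has squared length at most 1, and the Parseval
  identity for Pauli coefficients divides their sum by \<open>2 ^ n\<close>.\<close>

lemma (in channel) heisenberg_coeffs:
  assumes Obs: "Obs \<in> operators n" "hermitian Obs" "spectral_norm Obs \<le> 1"
  shows "(\<Sum>P | length P = n. (cmod (pauli_coeffs n (heisenberg Obs) P))\<^sup>2) \<le> 1"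
proof -
  have "(\<Sum>i<2 ^ n. \<Sum>j<2 ^ n. (cmod (heisenberg Obs $$ (i, j)))\<^sup>2)
      = (\<Sum>j<2 ^ n. \<Sum>i<2 ^ n. (cmod (heisenberg Obs $$ (i, j)))\<^sup>2)" by (rule sum.swap)
  also have "\<dots> \<le> (\<Sum>j<(2::nat) ^ n. 1)" by (rule sum_mono) (simp add: heisenberg_column[OF Obs])
  finally show ?thesis unfolding pauli_Parseval[OF heisenberg_carrier] by simp
qed

text \<open>The Pauli transfer matrix of the channel. Its entries are the means of the sample
  values, and the coefficients of the evolved observable are linear in them.\<close>

definition (in channel) transfer :: "pauli list \<Rightarrow> pauli list \<Rightarrow> real" where
  "transfer P Q = Re (mat_trace (pauli_mat Q * \<E> (pauli_mat P))) / 2 ^ n"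

lemma (in channel) trace_pauli_channel:
  assumes "length P = n" "length Q = n"
  shows "mat_trace (pauli_mat Q * \<E> (pauli_mat P)) = of_real (2 ^ n * transfer P Q)"
proof -
  have "mat_trace (pauli_mat Q * \<E> (pauli_mat P)) = mat_trace (heisenberg (pauli_mat Q) * pauli_mat P)"
    by (rule trace_heisenberg[symmetric]) (simp_all add: pauli_mat_carrier assms)
  moreover have "Im (mat_trace (heisenberg (pauli_mat Q) * pauli_mat P)) = 0"
    by (rule trace_hermitian_real[of _ "2 ^ n"])
      (simp_all add: pauli_mat_carrier assms pauli_mat_hermitian heisenberg_hermitian)
  ultimately show ?thesis unfolding transfer_def by (simp add: complex_eq_iff)
qed

lemma pauli_coeffs_real:
  assumes "A \<in> operators n" "hermitian A"
  shows "pauli_coeffs n A P = of_real (Re (pauli_coeffs n A P))"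
proof (cases "length P = n")
  case True
  have "Im (mat_trace (pauli_mat P * A)) = 0"
    by (rule trace_hermitian_real[OF pauli_mat_carrier[OF True] assms(1) pauli_mat_hermitian assms(2)])
  then show ?thesis using True by (simp add: pauli_coeffs_eq[OF assms(1)] complex_eq_iff)
qed (simp add: pauli_coeffs_eq[OF assms(1)])

lemma trace_mult_expansion:
  assumes A: "A \<in> operators n" and B: "B \<in> operators n"
  shows "mat_trace (A * B) = (\<Sum>P | length P = n. pauli_coeffs n A P * mat_trace (pauli_mat P * B))"
proof -
  have "mat_trace (A * B) = mat_trace (B * pauli_sum n (pauli_coeffs n A))"
    unfolding pauli_coeffs_eq[OF A] pauli_expansion[OF A] by (rule trace_mult_comm[OF A B])
  also have "\<dots> = (\<Sum>P | length P = n. pauli_coeffs n A P * mat_trace (pauli_mat P * B))"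
    unfolding trace_mult_pauli_sum[OF B]
    by (intro sum.cong refl) (simp add: trace_mult_comm[OF B pauli_mat_carrier])
  finally show ?thesis .
qed

lemma (in channel) heisenberg_coeff_expansion:
  assumes Obs: "Obs \<in> operators n" "hermitian Obs" and P: "length P = n"
  shows "Re (pauli_coeffs n (heisenberg Obs) P) = (\<Sum>Q | length Q = n. Re (pauli_coeffs n Obs Q) * transfer P Q)"
proof -
  have Pc: "pauli_mat P \<in> operators n" by (rule pauli_mat_carrier[OF P])
  have "mat_trace (pauli_mat P * heisenberg Obs) = mat_trace (Obs * \<E> (pauli_mat P))"
    using trace_mult_comm[OF Pc heisenberg_carrier] trace_heisenberg[OF Obs(1) Pc] by simp
  also have "\<dots> = (\<Sum>Q | length Q = n. pauli_coeffs n Obs Q * of_real (2 ^ n * transfer P Q))"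
    unfolding trace_mult_expansion[OF Obs(1) carrier[OF Pc]]
    by (intro sum.cong refl) (simp add: trace_pauli_channel P)
  also have "\<dots> = of_real (\<Sum>Q | length Q = n. Re (pauli_coeffs n Obs Q) * (2 ^ n * transfer P Q))"
    unfolding of_real_sum by (intro sum.cong refl) (subst pauli_coeffs_real[OF Obs], simp)
  finally have "Re (mat_trace (pauli_mat P * heisenberg Obs)) = (\<Sum>Q | length Q = n. Re (pauli_coeffs n Obs Q) * (2 ^ n * transfer P Q))"
    by (simp only: Re_complex_of_real)
  also have "\<dots> = (\<Sum>Q | length Q = n. Re (pauli_coeffs n Obs Q) * transfer P Q) * 2 ^ n"
    unfolding sum_distrib_right by (intro sum.cong refl) simp
  finally have "Re (mat_trace (pauli_mat P * heisenberg Obs)) = (\<Sum>Q | length Q = n. Re (pauli_coeffs n Obs Q) * transfer P Q) * 2 ^ n" .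
  moreover have "pauli_coeffs n (heisenberg Obs) P = mat_trace (pauli_mat P * heisenberg Obs) / of_real (2 ^ n)"
    using P by (simp add: pauli_coeffs_eq[OF heisenberg_carrier])
  ultimately show ?thesis by (simp only: Re_divide_of_real) simp
qed

section \<open>Stabilizer states and the shadow identity\<close>

abbreviation projector :: "stab \<Rightarrow> complex mat" where
  "projector s \<equiv> ket s * mat_adjoint (ket s)"

lemma ket_carrier [simp]: "ket s \<in> carrier_mat 2 1"
  by (cases s) (auto simp: mat_of_rows_list_def)

lemma projector_carrier [simp]: "projector s \<in> carrier_mat 2 2"
  by (rule mult_carrier_mat[OF ket_carrier adjoint_carrier[OF ket_carrier]])

lemma entry_projector_ket: "entry (projector s) a b = ket s $$ (of_bool a, 0) * cnj (ket s $$ (of_bool b, 0))"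
  unfolding entry_def by (subst mult_adjoint_index[OF ket_carrier]) auto

lemma inv_sqrt2_square: "complex_of_real (1 / sqrt 2) * complex_of_real (1 / sqrt 2) = 1 / 2"
  unfolding of_real_mult[symmetric] by simp

lemma entry_projector:
  "entry (projector Z0) a b = (if a \<or> b then 0 else 1)"
  "entry (projector Z1) a b = (if a \<and> b then 1 else 0)"
  "entry (projector XPlus) a b = 1 / 2"
  "entry (projector XMinus) a b = (if a = b then 1 / 2 else - 1 / 2)"
  "entry (projector YPlus) a b = (if a = b then 1 / 2 else if a then \<i> / 2 else - \<i> / 2)"
  "entry (projector YMinus) a b = (if a = b then 1 / 2 else if a then - \<i> / 2 else \<i> / 2)"
proof -
  define r where "r = complex_of_real (1 / sqrt 2)"
  have r: "r * r = 1 / 2" "cnj r = r" unfolding r_def inv_sqrt2_square by simp_all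
  have k: "ket XPlus $$ (of_bool c, 0) = r" "ket XMinus $$ (of_bool c, 0) = (if c then - r else r)"
    "ket YPlus $$ (of_bool c, 0) = (if c then \<i> * r else r)" "ket YMinus $$ (of_bool c, 0) = (if c then - \<i> * r else r)"
    "ket Z0 $$ (of_bool c, 0) = (if c then 0 else 1)" "ket Z1 $$ (of_bool c, 0) = (if c then 1 else 0)" for c
    unfolding r_def by (cases c; simp add: mat_of_rows_list_def)+
  show "entry (projector Z0) a b = (if a \<or> b then 0 else 1)"
    "entry (projector Z1) a b = (if a \<and> b then 1 else 0)"
    "entry (projector XPlus) a b = 1 / 2"
    "entry (projector XMinus) a b = (if a = b then 1 / 2 else - 1 / 2)"
    "entry (projector YPlus) a b = (if a = b then 1 / 2 else if a then \<i> / 2 else - \<i> / 2)"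
    "entry (projector YMinus) a b = (if a = b then 1 / 2 else if a then - \<i> / 2 else \<i> / 2)"
    unfolding entry_projector_ket k using r
    by (cases a; cases b; simp add: mult.assoc mult.left_commute[of r "\<i>"])+
qed

text \<open>For \<open>p\<close> other than the identity only its two eigenstates contribute, and
  three times the difference of their projectors is \<open>3 p\<close>. For the identity the six
  projectors form three orthonormal bases.\<close>

lemma shadow_projector:
  "shadow p Z0 * entry (projector Z0) a b + shadow p Z1 * entry (projector Z1) a b
   + shadow p XPlus * entry (projector XPlus) a b + shadow p XMinus * entry (projector XMinus) a b
   + shadow p YPlus * entry (projector YPlus) a b + shadow p YMinus * entry (projector YMinus) a b
   = 3 * entry (pauli1 p) a b"
  by (cases p; cases a; cases b) (simp_all add: entry_projector entry_pauli1 del: ket.simps pauli1.simps)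

lemma trace_pauli1_projector:
  "mat_trace (pauli1 p * projector s) = (if p = PI then 1 else of_real (shadow p s / 3))"
proof -
  have "mat_trace (pauli1 p * projector s) = entry (pauli1 p * projector s) False False + entry (pauli1 p * projector s) True True"
    by (rule trace_entry, rule mult_carrier_mat[OF pauli1_carrier projector_carrier])
  also have "\<dots> = (if p = PI then 1 else of_real (shadow p s / 3))"
    unfolding entry_mult[OF pauli1_carrier projector_carrier]
    by (cases p; cases s) (simp_all add: entry_projector entry_pauli1 del: ket.simps pauli1.simps)
  finally show ?thesis .
qed

lemma shadow_prod_eq: "length P = n \<Longrightarrow> length ss = n \<Longrightarrow> shadow_prod P ss = (\<Prod>q<n. shadow (P ! q) (ss ! q))"
  unfolding shadow_prod_def prod.list_conv_set_nth by (simp add: atLeast0LessThan)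

lemma stab_state_carrier: "length ss = n \<Longrightarrow> stab_state ss \<in> operators n"
  unfolding stab_state_def using tensor_carrier[of "map projector ss"] by simp

lemma stab_state_index:
  "length ss = n \<Longrightarrow> i < 2 ^ n \<Longrightarrow> j < 2 ^ n \<Longrightarrow>
   stab_state ss $$ (i, j) = (\<Prod>q<n. entry (projector (ss ! q)) (bit i q) (bit j q))"
  unfolding stab_state_def by (subst tensor_index[of _ n]) auto

text \<open>The state is a Hermitian idempotent, since each of its factors is; hence it is the
  product of itself with its adjoint.\<close>

lemma stab_state_psd: "length ss = n \<Longrightarrow> psd (2 ^ n) (stab_state ss)"
proof -
  assume n: "length ss = n"
  have adj: "mat_adjoint (projector s) = projector s" for s
    by (subst adjoint_mult[OF ket_carrier adjoint_carrier[OF ket_carrier]]) simp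
  have entry_eqI: "A = B" if "A \<in> carrier_mat 2 2" "B \<in> carrier_mat 2 2" "\<And>a b. entry A a b = entry B a b" for A B
  proof (rule eq_matI)
    fix i j assume "i < dim_row B" "j < dim_col B"
    then have "i = of_bool (i = 1)" "j = of_bool (j = 1)" using that by auto
    then show "A $$ (i, j) = B $$ (i, j)" using that(3)[of "i = 1" "j = 1"] unfolding entry_def by simp
  qed (use that in auto)
  have idem: "projector s * projector s = projector s" for s
  proof (rule entry_eqI)
    fix a b show "entry (projector s * projector s) a b = entry (projector s) a b"
      unfolding entry_mult[OF projector_carrier projector_carrier]
      by (cases s; cases a; cases b) (simp_all add: entry_projector del: ket.simps)
  qed (simp_all only: projector_carrier mult_carrier_mat[OF projector_carrier projector_carrier])
  define As where "As = map projector ss"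
  have As: "set As \<subseteq> carrier_mat 2 2" unfolding As_def by (auto simp del: carrier_matI)
  have len: "length As = n" using n by (simp add: As_def)
  have "map mat_adjoint As = As" unfolding As_def by (induction ss) (simp_all add: adj)
  then have "mat_adjoint (tensor As) = tensor As" by (simp only: tensor_adjoint[OF As])
  moreover have "map2 (*) As As = As" unfolding As_def by (induction ss) (simp_all add: idem)
  then have "tensor As * tensor As = tensor As" by (simp only: tensor_mult[OF len len As As])
  ultimately have "stab_state ss = tensor As * mat_adjoint (tensor As)"
    by (simp only: stab_state_def As_def[symmetric])
  moreover have "tensor As \<in> operators n" using tensor_carrier[of As] n by (simp add: As_def)
  ultimately show ?thesis using psd_self_adjoint by metis
qed

lemma stab_state_trace: "length ss = n \<Longrightarrow> mat_trace (stab_state ss) = 1"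
proof -
  assume n: "length ss = n"
  have "mat_trace (projector s) = 1" for s
    unfolding trace_entry[OF projector_carrier] by (cases s) (simp_all add: entry_projector del: ket.simps)
  moreover have "set (map projector ss) \<subseteq> carrier_mat 2 2" by (auto simp del: carrier_matI)
  ultimately show ?thesis unfolding stab_state_def by (subst trace_tensor[of _ n]) (simp_all add: n)
qed

lemma sum_shadow_stab_state:
  assumes "length P = n" "i < 2 ^ n" "j < 2 ^ n"
  shows "(\<Sum>ss | length ss = n. shadow_prod P ss * stab_state ss $$ (i, j)) = 3 ^ n * pauli_mat P $$ (i, j)"
proof -
  have "(\<Sum>ss | length ss = n. complex_of_real (shadow_prod P ss) * stab_state ss $$ (i, j))
      = (\<Sum>ss | length ss = n. \<Prod>q<n. shadow (P ! q) (ss ! q) * entry (projector (ss ! q)) (bit i q) (bit j q))"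
    by (intro sum.cong refl) (simp add: shadow_prod_eq stab_state_index assms prod.distrib)
  also have "\<dots> = (\<Prod>q<n. 3 * entry (pauli1 (P ! q)) (bit i q) (bit j q))"
    by (subst sum_stabs[where g = "\<lambda>q s. complex_of_real (shadow (P ! q) s) * entry (projector s) (bit i q) (bit j q)"])
      (simp only: shadow_projector)
  also have "\<dots> = 3 ^ n * pauli_mat P $$ (i, j)" by (simp add: prod.distrib pauli_mat_index assms)
  finally show ?thesis .
qed

lemma sum_shadow_linear:
  fixes L :: "complex mat \<Rightarrow> complex"
  assumes add: "\<And>A B. A \<in> operators n \<Longrightarrow> B \<in> operators n \<Longrightarrow> L (A + B) = L A + L B"
    and smult: "\<And>A c. A \<in> operators n \<Longrightarrow> L (c \<cdot>\<^sub>m A) = c * L A"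
    and P: "length P = n"
  shows "(\<Sum>ss | length ss = n. shadow_prod P ss * L (stab_state ss)) = 3 ^ n * L (pauli_mat P)"
proof -
  let ?l = "\<lambda>i j. L (matrix_unit (2 ^ n) i j)"
  have "(\<Sum>ss | length ss = n. complex_of_real (shadow_prod P ss) * L (stab_state ss))
      = (\<Sum>ss | length ss = n. \<Sum>i<2 ^ n. \<Sum>j<2 ^ n. shadow_prod P ss * stab_state ss $$ (i, j) * ?l i j)"
    by (rule sum.cong[OF refl], subst linear_expansion[of "2 ^ n" L, OF add smult])
      (simp_all add: stab_state_carrier sum_distrib_left mult.assoc)
  also have "\<dots> = (\<Sum>i<2 ^ n. \<Sum>ss | length ss = n. \<Sum>j<2 ^ n. shadow_prod P ss * stab_state ss $$ (i, j) * ?l i j)"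
    by (rule sum.swap)
  also have "\<dots> = (\<Sum>i<2 ^ n. \<Sum>j<2 ^ n. \<Sum>ss | length ss = n. shadow_prod P ss * stab_state ss $$ (i, j) * ?l i j)"
    by (rule sum.cong[OF refl], rule sum.swap)
  also have "\<dots> = (\<Sum>i<2 ^ n. \<Sum>j<2 ^ n. 3 ^ n * pauli_mat P $$ (i, j) * ?l i j)"
    by (intro sum.cong refl) (simp add: sum_distrib_right[symmetric] sum_shadow_stab_state P)
  also have "\<dots> = 3 ^ n * L (pauli_mat P)"
    by (subst linear_expansion[of "2 ^ n" L, OF add smult pauli_mat_carrier[OF P]])
      (simp_all add: sum_distrib_left mult.assoc)
  finally show ?thesis .
qed


section \<open>Purity and single-qubit Clifford gates\<close>

definition pauli_value :: "pauli list \<Rightarrow> complex mat \<Rightarrow> real" where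
  "pauli_value P \<rho> = Re (mat_trace (pauli_mat P * \<rho>))"

lemma density_facts:
  assumes "\<rho> \<in> density n"
  shows "\<rho> \<in> operators n" "psd (2 ^ n) \<rho>" "mat_trace \<rho> = 1"
  using assms unfolding density_def by auto

lemma trace_pauli_density:
  assumes "\<rho> \<in> density n" "length P = n"
  shows "mat_trace (pauli_mat P * \<rho>) = of_real (pauli_value P \<rho>)"
proof -
  have "Im (mat_trace (pauli_mat P * \<rho>)) = 0"
    by (rule trace_hermitian_real[OF pauli_mat_carrier[OF assms(2)] density_facts(1)[OF assms(1)] pauli_mat_hermitian
          psd_hermitian[OF density_facts(2)[OF assms(1)]]])
  then show ?thesis unfolding pauli_value_def by (simp add: complex_eq_iff)
qed

lemma pauli_value_bound:
  assumes "\<rho> \<in> density n" "length P = n"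
  shows "\<bar>pauli_value P \<rho>\<bar> \<le> spectral_norm (pauli_mat P)"
proof -
  have "\<bar>pauli_value P \<rho>\<bar> \<le> cmod (mat_trace (pauli_mat P * \<rho>))"
    unfolding pauli_value_def by (rule abs_Re_le_cmod)
  also have "\<dots> \<le> spectral_norm (pauli_mat P) * Re (mat_trace \<rho>)"
    by (rule psd_trace_bound[OF pauli_mat_carrier[OF assms(2)] density_facts(2)[OF assms(1)]])
  finally show ?thesis using density_facts(3)[OF assms(1)] by simp
qed

text \<open>The sum is \<open>2 ^ card A\<close> times the purity of the reduced state on
  \<open>A\<close>. No partial trace is formed: when the squares are expanded into matrix entries,
  the sum over \<open>P\<close> becomes a nonnegative kernel \<open>W\<close>. The entries of \<rho>
  are then bounded by its diagonal, and the sums of \<open>W\<close> are evaluated qubit by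
  qubit.\<close>

lemma purity_bound:
  assumes \<rho>: "\<rho> \<in> density n" and A: "A \<subseteq> {..<n}"
  shows "(\<Sum>P | length P = n \<and> (\<forall>q<n. q \<notin> A \<longrightarrow> P ! q = PI). (pauli_value P \<rho>)\<^sup>2) \<le> 2 ^ card A"
proof -
  let ?m = "(2::nat) ^ n"
  let ?S = "{P. length P = n \<and> (\<forall>q<n. q \<notin> A \<longrightarrow> P ! q = PI)}"
  define r where "r i j = \<rho> $$ (i, j)" for i j
  have psd: "psd_form ?m r" using density_facts(2)[OF \<rho>] unfolding psd_iff_form r_def by auto
  note facts = psd_form_facts[OF psd]
  define x where "x i = Re (r i i)" for i
  have x0: "0 \<le> x i" if "i < ?m" for i unfolding x_def by (rule facts(2)[OF that])
  have x1: "(\<Sum>i<?m. x i) = 1"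
  proof -
    have "(\<Sum>i<?m. x i) = Re (mat_trace \<rho>)"
      using density_facts(1)[OF \<rho>] unfolding mat_trace_def x_def r_def by auto
    then show ?thesis using density_facts(3)[OF \<rho>] by simp
  qed
  \<comment> \<open>On a qubit of \<open>A\<close> all four Paulis are summed, which gives
    completeness; outside \<open>A\<close> only the identity remains.\<close>
  define K where "K q a b c d = (if q \<in> A then if a = c \<and> b = d then 2 else 0 else if a = b \<and> c = d then 1 else 0 :: real)"
    for q and a b c d :: bool
  define W where "W i j k l = (\<Prod>q<n. K q (bit i q) (bit j q) (bit k q) (bit l q))" for i j k l :: nat
  have W0: "0 \<le> W i j k l" for i j k l unfolding W_def K_def by (intro prod_nonneg) auto
  have fin: "finite ?S" by (rule finite_subset[OF _ finite_paulis[of n]]) auto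
  have PP: "(\<Sum>P\<in>?S. pauli_mat P $$ (i, j) * cnj (pauli_mat P $$ (k, l))) = of_real (W i j k l)"
    if "i < ?m" "j < ?m" "k < ?m" "l < ?m" for i j k l
  proof -
    let ?e = "\<lambda>q p. entry (pauli1 p) (bit i q) (bit j q) * cnj (entry (pauli1 p) (bit k q) (bit l q))"
    have "(\<Sum>P\<in>?S. pauli_mat P $$ (i, j) * cnj (pauli_mat P $$ (k, l)))
        = (\<Sum>P\<in>?S. \<Prod>q<n. if q \<in> A \<or> P ! q = PI then ?e q (P ! q) else 0)"
    proof (rule sum.cong[OF refl])
      fix P assume "P \<in> ?S"
      then have P: "length P = n" "\<And>q. q < n \<Longrightarrow> q \<in> A \<or> P ! q = PI" by auto
      have "pauli_mat P $$ (i, j) * cnj (pauli_mat P $$ (k, l)) = (\<Prod>q<n. ?e q (P ! q))"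
        unfolding pauli_mat_index[OF P(1) that(1,2)] pauli_mat_index[OF P(1) that(3,4)] cnj_prod prod.distrib ..
      also have "\<dots> = (\<Prod>q<n. if q \<in> A \<or> P ! q = PI then ?e q (P ! q) else 0)"
        by (rule prod.cong[OF refl]) (simp only: lessThan_iff P(2) if_True)
      finally show "pauli_mat P $$ (i, j) * cnj (pauli_mat P $$ (k, l))
        = (\<Prod>q<n. if q \<in> A \<or> P ! q = PI then ?e q (P ! q) else 0)" .
    qed
    also have "\<dots> = (\<Sum>P | length P = n. \<Prod>q<n. if q \<in> A \<or> P ! q = PI then ?e q (P ! q) else 0)"
    proof (rule sum.mono_neutral_left[OF finite_paulis])
      show "\<forall>P\<in>{P. length P = n} - ?S. (\<Prod>q<n. if q \<in> A \<or> P ! q = PI then ?e q (P ! q) else 0) = 0"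
      proof
        fix P assume "P \<in> {P. length P = n} - ?S"
        then obtain q where "q < n" "\<not> (q \<in> A \<or> P ! q = PI)" by auto
        then show "(\<Prod>q<n. if q \<in> A \<or> P ! q = PI then ?e q (P ! q) else 0) = 0"
          by (intro prod_zero[OF finite_lessThan] bexI[of _ q]) (simp_all only: if_False lessThan_iff)
      qed
    qed auto
    also have "\<dots> = (\<Prod>q<n. of_real (K q (bit i q) (bit j q) (bit k q) (bit l q)))"
    proof (subst sum_paulis[where g = "\<lambda>q p. if q \<in> A \<or> p = PI then ?e q p else 0"], rule prod.cong[OF refl])
      fix q
      show "(if q \<in> A \<or> PI = PI then ?e q PI else 0) + (if q \<in> A \<or> PX = PI then ?e q PX else 0)
        + (if q \<in> A \<or> PY = PI then ?e q PY else 0) + (if q \<in> A \<or> PZ = PI then ?e q PZ else 0)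
        = of_real (K q (bit i q) (bit j q) (bit k q) (bit l q))"
        unfolding K_def
        by (cases "bit i q"; cases "bit j q"; cases "bit k q"; cases "bit l q"; cases "q \<in> A")
          (simp_all add: entry_pauli1 del: pauli1.simps)
    qed
    finally show ?thesis unfolding W_def by simp
  qed
  \<comment> \<open>Given \<open>i\<close> and \<open>l\<close>, each qubit leaves one choice for
    the bits of \<open>j\<close> and \<open>k\<close>: on \<open>A\<close> they follow
    \<open>l\<close> and \<open>i\<close>, with weight 2; outside \<open>A\<close> they follow
    \<open>i\<close> and \<open>l\<close>, with weight 1.\<close>
  have jk: "(\<Sum>j<?m. \<Sum>k<?m. W i j k l) = 2 ^ card A" for i l
  proof -
    have "(\<Sum>j<?m. \<Sum>k<?m. W i j k l) = (\<Sum>j<?m. \<Prod>q<n. K q (bit i q) (bit j q) False (bit l q) + K q (bit i q) (bit j q) True (bit l q))"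
      unfolding W_def
      by (rule sum.cong[OF refl], rule sum_bits[where g = "\<lambda>q b. K q (bit i q) (bit _ q) b (bit l q)"])
    also have "\<dots> = (\<Prod>q<n. (K q (bit i q) False False (bit l q) + K q (bit i q) False True (bit l q))
        + (K q (bit i q) True False (bit l q) + K q (bit i q) True True (bit l q)))"
      by (rule sum_bits[where g = "\<lambda>q b. K q (bit i q) b False (bit l q) + K q (bit i q) b True (bit l q)"])
    also have "\<dots> = (\<Prod>q<n. if q \<in> A then 2 else 1)"
      unfolding K_def by (intro prod.cong refl) auto
    also have "\<dots> = 2 ^ card A"
      using A by (subst prod.If_cases) (auto simp: Int_absorb1)
    finally show ?thesis .
  qed
  have il: "(\<Sum>i<?m. \<Sum>l<?m. W i j k l) = 2 ^ card A" for j k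
  proof -
    have "(\<Sum>i<?m. \<Sum>l<?m. W i j k l) = (\<Sum>i<?m. \<Prod>q<n. K q (bit i q) (bit j q) (bit k q) False + K q (bit i q) (bit j q) (bit k q) True)"
      unfolding W_def
      by (rule sum.cong[OF refl], rule sum_bits[where g = "\<lambda>q b. K q (bit _ q) (bit j q) (bit k q) b"])
    also have "\<dots> = (\<Prod>q<n. (K q False (bit j q) (bit k q) False + K q False (bit j q) (bit k q) True)
        + (K q True (bit j q) (bit k q) False + K q True (bit j q) (bit k q) True))"
      by (rule sum_bits[where g = "\<lambda>q b. K q b (bit j q) (bit k q) False + K q b (bit j q) (bit k q) True"])
    also have "\<dots> = (\<Prod>q<n. if q \<in> A then 2 else 1)"
      unfolding K_def by (intro prod.cong refl) auto
    also have "\<dots> = 2 ^ card A"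
      using A by (subst prod.If_cases) (auto simp: Int_absorb1)
    finally show ?thesis .
  qed
  have tr: "of_real (pauli_value P \<rho>) = (\<Sum>i<?m. \<Sum>j<?m. pauli_mat P $$ (i, j) * r j i)" if "length P = n" for P
    unfolding trace_pauli_density[OF \<rho> that, symmetric] r_def
    by (rule trace_mult[OF pauli_mat_carrier[OF that] density_facts(1)[OF \<rho>]])
  have "complex_of_real (\<Sum>P\<in>?S. (pauli_value P \<rho>)\<^sup>2)
      = (\<Sum>P\<in>?S. \<Sum>i<?m. \<Sum>j<?m. \<Sum>k<?m. \<Sum>l<?m. pauli_mat P $$ (i, j) * cnj (pauli_mat P $$ (k, l)) * (r j i * cnj (r l k)))"
    unfolding of_real_sum
  proof (rule sum.cong[OF refl])
    fix P assume "P \<in> ?S"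
    then have P: "length P = n" by simp
    have "complex_of_real ((pauli_value P \<rho>)\<^sup>2) = of_real (pauli_value P \<rho>) * cnj (of_real (pauli_value P \<rho>))"
      by (simp add: power2_eq_square)
    also have "\<dots> = (\<Sum>i<?m. \<Sum>j<?m. \<Sum>k<?m. \<Sum>l<?m. (pauli_mat P $$ (i, j) * r j i) * cnj (pauli_mat P $$ (k, l) * r l k))"
      unfolding tr[OF P] cnj_sum by (simp only: sum_distrib_right) (simp only: sum_distrib_left)
    also have "\<dots> = (\<Sum>i<?m. \<Sum>j<?m. \<Sum>k<?m. \<Sum>l<?m. pauli_mat P $$ (i, j) * cnj (pauli_mat P $$ (k, l)) * (r j i * cnj (r l k)))"
      by (intro sum.cong refl) simp
    finally show "complex_of_real ((pauli_value P \<rho>)\<^sup>2)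
      = (\<Sum>i<?m. \<Sum>j<?m. \<Sum>k<?m. \<Sum>l<?m. pauli_mat P $$ (i, j) * cnj (pauli_mat P $$ (k, l)) * (r j i * cnj (r l k)))" .
  qed
  also have "\<dots> = (\<Sum>i<?m. \<Sum>j<?m. \<Sum>k<?m. \<Sum>l<?m. \<Sum>P\<in>?S. pauli_mat P $$ (i, j) * cnj (pauli_mat P $$ (k, l)) * (r j i * cnj (r l k)))"
    by (subst sum.swap, rule sum.cong[OF refl], subst sum.swap, rule sum.cong[OF refl],
        subst sum.swap, rule sum.cong[OF refl], rule sum.swap)
  also have "\<dots> = (\<Sum>i<?m. \<Sum>j<?m. \<Sum>k<?m. \<Sum>l<?m. of_real (W i j k l) * (r j i * cnj (r l k)))"
    by (intro sum.cong refl) (simp only: sum_distrib_right[symmetric] PP lessThan_iff)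
  finally have eq: "complex_of_real (\<Sum>P\<in>?S. (pauli_value P \<rho>)\<^sup>2) = \<dots>" .
  have half: "(\<Sum>i<?m. \<Sum>l<?m. x i * x l / 2 * c) = c / 2" for c
  proof -
    have inner: "(\<Sum>l<?m. x i * x l / 2 * c) = x i * (c / 2)" for i
    proof -
      have "(\<Sum>l<?m. x i * x l / 2 * c) = (\<Sum>l<?m. x i * c / 2 * x l)" by (intro sum.cong refl) simp
      then show ?thesis unfolding sum_distrib_left[symmetric] x1 by simp
    qed
    have "(\<Sum>i<?m. \<Sum>l<?m. x i * x l / 2 * c) = (\<Sum>i<?m. x i * (c / 2))" by (simp only: inner)
    also have "\<dots> = (\<Sum>i<?m. x i) * (c / 2)" by (rule sum_distrib_right[symmetric])
    finally show ?thesis unfolding x1 by simp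
  qed
  \<comment> \<open>The four diagonal entries are grouped as \<open>x i * x l\<close> and
    \<open>x j * x k\<close> because, with either pair of indices fixed, \<open>W\<close> sums to
    \<open>2 ^ card A\<close> over the other pair. Each half then contributes
    \<open>2 ^ card A / 2\<close>.\<close>
  have pt: "cmod (of_real (W i j k l) * (r j i * cnj (r l k))) \<le> W i j k l * ((x i * x l + x j * x k) / 2)"
    if "i < ?m" "j < ?m" "k < ?m" "l < ?m" for i j k l
  proof -
    have 1: "cmod (r j i) \<le> sqrt (x j * x i)" "cmod (r l k) \<le> sqrt (x l * x k)"
      using facts(4)[OF that(2,1)] facts(4)[OF that(4,3)] unfolding x_def by (auto intro: real_le_rsqrt)
    have "cmod (r j i) * cmod (r l k) \<le> sqrt (x j * x i) * sqrt (x l * x k)"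
      by (intro mult_mono 1) (simp_all add: x0 that)
    also have "\<dots> = sqrt ((x i * x l) * (x j * x k))" by (simp add: real_sqrt_mult[symmetric] mult_ac)
    also have "\<dots> \<le> (x i * x l + x j * x k) / 2" by (rule arith_geo_mean_sqrt) (simp_all add: x0 that)
    finally have "W i j k l * (cmod (r j i) * cmod (r l k)) \<le> W i j k l * ((x i * x l + x j * x k) / 2)"
      by (rule mult_left_mono[OF _ W0])
    then show ?thesis by (simp only: norm_mult norm_of_real complex_mod_cnj abs_of_nonneg[OF W0])
  qed
  have "(\<Sum>P\<in>?S. (pauli_value P \<rho>)\<^sup>2) = cmod (complex_of_real (\<Sum>P\<in>?S. (pauli_value P \<rho>)\<^sup>2))"
    by (simp only: norm_of_real) (simp add: sum_nonneg)
  also have "\<dots> \<le> (\<Sum>i<?m. \<Sum>j<?m. \<Sum>k<?m. \<Sum>l<?m. cmod (of_real (W i j k l) * (r j i * cnj (r l k))))"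
    unfolding eq
    by (intro order_trans[OF norm_sum] sum_mono order_refl)
  also have "\<dots> \<le> (\<Sum>i<?m. \<Sum>j<?m. \<Sum>k<?m. \<Sum>l<?m. W i j k l * ((x i * x l + x j * x k) / 2))"
    by (intro sum_mono pt) simp_all
  also have "\<dots> = (\<Sum>i<?m. \<Sum>j<?m. \<Sum>k<?m. \<Sum>l<?m. x i * x l / 2 * W i j k l)
      + (\<Sum>i<?m. \<Sum>j<?m. \<Sum>k<?m. \<Sum>l<?m. x j * x k / 2 * W i j k l)"
    unfolding sum.distrib[symmetric] by (intro sum.cong refl) (simp add: field_simps)
  also have "(\<Sum>i<?m. \<Sum>j<?m. \<Sum>k<?m. \<Sum>l<?m. x i * x l / 2 * W i j k l)
      = (\<Sum>i<?m. \<Sum>l<?m. x i * x l / 2 * (\<Sum>j<?m. \<Sum>k<?m. W i j k l))"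
  proof (rule sum.cong[OF refl])
    fix i
    have "(\<Sum>j<?m. \<Sum>k<?m. \<Sum>l<?m. x i * x l / 2 * W i j k l) = (\<Sum>j<?m. \<Sum>l<?m. \<Sum>k<?m. x i * x l / 2 * W i j k l)"
      by (rule sum.cong[OF refl], rule sum.swap)
    also have "\<dots> = (\<Sum>l<?m. \<Sum>j<?m. \<Sum>k<?m. x i * x l / 2 * W i j k l)" by (rule sum.swap)
    finally show "(\<Sum>j<?m. \<Sum>k<?m. \<Sum>l<?m. x i * x l / 2 * W i j k l)
        = (\<Sum>l<?m. x i * x l / 2 * (\<Sum>j<?m. \<Sum>k<?m. W i j k l))" by (simp only: sum_distrib_left)
  qed
  also have "\<dots> = 2 ^ card A / 2" unfolding jk by (rule half)
  also have "(\<Sum>i<?m. \<Sum>j<?m. \<Sum>k<?m. \<Sum>l<?m. x j * x k / 2 * W i j k l)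
      = (\<Sum>j<?m. \<Sum>k<?m. x j * x k / 2 * (\<Sum>i<?m. \<Sum>l<?m. W i j k l))"
  proof -
    have "(\<Sum>i<?m. \<Sum>j<?m. \<Sum>k<?m. \<Sum>l<?m. x j * x k / 2 * W i j k l)
        = (\<Sum>j<?m. \<Sum>i<?m. \<Sum>k<?m. \<Sum>l<?m. x j * x k / 2 * W i j k l)" by (rule sum.swap)
    also have "\<dots> = (\<Sum>j<?m. \<Sum>k<?m. \<Sum>i<?m. \<Sum>l<?m. x j * x k / 2 * W i j k l)"
      by (rule sum.cong[OF refl], rule sum.swap)
    finally show ?thesis by (simp only: sum_distrib_left)
  qed
  also have "\<dots> = 2 ^ card A / 2" unfolding il by (rule half)
  finally show ?thesis by simp
qed

section \<open>Single-qubit Clifford gates\<close>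

lemma eq_mat2I:
  assumes "A \<in> carrier_mat 2 2" "B \<in> carrier_mat 2 2" "\<And>a b. entry A a b = entry B a b"
  shows "A = B"
proof (rule eq_matI)
  fix i j assume "i < dim_row B" "j < dim_col B"
  then have "i = of_bool (i = 1)" "j = of_bool (j = 1)" using assms by auto
  then show "A $$ (i, j) = B $$ (i, j)" using assms(3)[of "i = 1" "j = 1"] unfolding entry_def by simp
qed (use assms in auto)

text \<open>The gates used for twirling are Hermitian, so conjugation is multiplication by
  \<open>V\<close> on both sides. The Pauli matrices supply the signs, and two axis swaps supply the
  permutations.\<close>

definition pauli_gate :: "complex mat \<Rightarrow> (pauli \<Rightarrow> real) \<Rightarrow> (pauli \<Rightarrow> pauli) \<Rightarrow> bool" where
  "pauli_gate V sg \<pi> \<longleftrightarrow> V \<in> carrier_mat 2 2 \<and> mat_adjoint V = V \<and> V * V = 1\<^sub>m 2 \<and>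
     (\<forall>p. sg p \<in> {1, - 1} \<and> V * pauli1 p * V = complex_of_real (sg p) \<cdot>\<^sub>m pauli1 (\<pi> p))"

lemma pauli_gateI:
  assumes V: "V \<in> carrier_mat 2 2" and adj: "\<And>a b. cnj (entry V b a) = entry V a b"
    and inv: "\<And>a b. entry V a False * entry V False b + entry V a True * entry V True b = (if a = b then 1 else 0)"
    and sg: "\<And>p. sg p \<in> {1, - 1}"
    and conj: "\<And>p a b. (entry V a False * entry (pauli1 p) False False + entry V a True * entry (pauli1 p) True False) * entry V False b
      + (entry V a False * entry (pauli1 p) False True + entry V a True * entry (pauli1 p) True True) * entry V True b
      = complex_of_real (sg p) * entry (pauli1 (\<pi> p)) a b"
  shows "pauli_gate V sg \<pi>"
  unfolding pauli_gate_def
proof (intro conjI allI)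
  show "mat_adjoint V = V"
    by (rule eq_mat2I) (simp_all only: entry_adjoint[OF V] adj V adjoint_carrier[OF V])
  show "V * V = 1\<^sub>m 2"
    by (rule eq_mat2I) (simp_all only: entry_mult[OF V V] entry_one inv mult_carrier_mat[OF V V] one_carrier_mat)
  fix p
  have Vp: "V * pauli1 p \<in> carrier_mat 2 2" by (rule mult_carrier_mat[OF V pauli1_carrier])
  show "V * pauli1 p * V = complex_of_real (sg p) \<cdot>\<^sub>m pauli1 (\<pi> p)"
    by (rule eq_mat2I)
      (simp_all only: entry_mult[OF Vp V] entry_mult[OF V pauli1_carrier] entry_smult[OF pauli1_carrier] conj
        mult_carrier_mat[OF Vp V] smult_carrier_mat[OF pauli1_carrier])
qed (rule V, rule sg)

lemma pauli_gate_pauli: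
  "pauli_gate (pauli1 r) (\<lambda>p. if p = PI \<or> r = PI \<or> p = r then 1 else - 1) (\<lambda>p. p)"
proof (rule pauli_gateI)
  fix p a b
  show "cnj (entry (pauli1 r) b a) = entry (pauli1 r) a b"
    by (cases r; cases a; cases b) (simp_all add: entry_pauli1 del: pauli1.simps)
  show "entry (pauli1 r) a False * entry (pauli1 r) False b + entry (pauli1 r) a True * entry (pauli1 r) True b = (if a = b then 1 else 0)"
    by (cases r; cases a; cases b) (simp_all add: entry_pauli1 del: pauli1.simps)
  show "(entry (pauli1 r) a False * entry (pauli1 p) False False + entry (pauli1 r) a True * entry (pauli1 p) True False) * entry (pauli1 r) False b
      + (entry (pauli1 r) a False * entry (pauli1 p) False True + entry (pauli1 r) a True * entry (pauli1 p) True True) * entry (pauli1 r) True b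
      = complex_of_real (if p = PI \<or> r = PI \<or> p = r then 1 else - 1) * entry (pauli1 p) a b"
    by (cases r; cases p; cases a; cases b) (simp_all add: entry_pauli1 del: pauli1.simps)
qed (auto simp del: pauli1.simps)

text \<open>The Hadamard gate \<open>(X + Z) / sqrt 2\<close>.\<close>

definition swap_XZ :: "complex mat" where
  "swap_XZ = mat 2 2 (\<lambda>(i, j). if i = 1 \<and> j = 1 then - complex_of_real (1 / sqrt 2) else complex_of_real (1 / sqrt 2))"

text \<open>The matrix \<open>(X + Y) / sqrt 2\<close>, a Hermitian Clifford gate.\<close>

definition swap_XY :: "complex mat" where
  "swap_XY = mat 2 2 (\<lambda>(i, j). if i = j then 0 else if i = 0 then complex_of_real (1 / sqrt 2) * (1 - \<i>)
     else complex_of_real (1 / sqrt 2) * (1 + \<i>))"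

lemma pauli_gate_swap_XZ:
  "pauli_gate swap_XZ (\<lambda>p. if p = PY then - 1 else 1) (\<lambda>p. if p = PX then PZ else if p = PZ then PX else p)"
proof -
  define r where "r = complex_of_real (1 / sqrt 2)"
  have r: "r * r = 1 / 2" "cnj r = r" "r * (r * z) = z / 2" for z
    using inv_sqrt2_square unfolding r_def[symmetric] mult.assoc[symmetric] by (simp_all add: r_def)
  have e: "entry swap_XZ a b = (if a \<and> b then - r else r)" for a b
    unfolding entry_def swap_XZ_def r_def by (cases a; cases b) simp_all
  show ?thesis
  proof (rule pauli_gateI)
    fix p a b
    show "cnj (entry swap_XZ b a) = entry swap_XZ a b" unfolding e by (simp add: r)
    show "entry swap_XZ a False * entry swap_XZ False b + entry swap_XZ a True * entry swap_XZ True b = (if a = b then 1 else 0)"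
      unfolding e by (cases a; cases b) (simp_all add: r)
    show "(entry swap_XZ a False * entry (pauli1 p) False False + entry swap_XZ a True * entry (pauli1 p) True False) * entry swap_XZ False b
      + (entry swap_XZ a False * entry (pauli1 p) False True + entry swap_XZ a True * entry (pauli1 p) True True) * entry swap_XZ True b
      = complex_of_real (if p = PY then - 1 else 1) * entry (pauli1 (if p = PX then PZ else if p = PZ then PX else p)) a b"
      unfolding e by (cases p; cases a; cases b) (simp_all add: entry_pauli1 algebra_simps r del: pauli1.simps)
  qed (auto simp: swap_XZ_def)
qed

lemma pauli_gate_swap_XY:
  "pauli_gate swap_XY (\<lambda>p. if p = PZ then - 1 else 1) (\<lambda>p. if p = PX then PY else if p = PY then PX else p)"
proof -
  define r where "r = complex_of_real (1 / sqrt 2)"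
  have r: "r * r = 1 / 2" "cnj r = r" "r * (r * z) = z / 2" for z
    using inv_sqrt2_square unfolding r_def[symmetric] mult.assoc[symmetric] by (simp_all add: r_def)
  have e: "entry swap_XY a b = (if a = b then 0 else if a then r * (1 + \<i>) else r * (1 - \<i>))" for a b
    unfolding entry_def swap_XY_def r_def by (cases a; cases b) simp_all
  show ?thesis
  proof (rule pauli_gateI)
    fix p a b
    show "cnj (entry swap_XY b a) = entry swap_XY a b" unfolding e by (simp add: r)
    show "entry swap_XY a False * entry swap_XY False b + entry swap_XY a True * entry swap_XY True b = (if a = b then 1 else 0)"
      unfolding e by (cases a; cases b) (simp_all add: algebra_simps r)
    show "(entry swap_XY a False * entry (pauli1 p) False False + entry swap_XY a True * entry (pauli1 p) True False) * entry swap_XY False b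
      + (entry swap_XY a False * entry (pauli1 p) False True + entry swap_XY a True * entry (pauli1 p) True True) * entry swap_XY True b
      = complex_of_real (if p = PZ then - 1 else 1) * entry (pauli1 (if p = PX then PY else if p = PY then PX else p)) a b"
      unfolding e by (cases p; cases a; cases b) (simp_all add: entry_pauli1 algebra_simps r del: pauli1.simps)
  qed (auto simp: swap_XY_def)
qed

lemma pauli_gate_clifford: "pauli_gate V sg \<pi> \<Longrightarrow> clifford1 V"
  unfolding pauli_gate_def clifford1_def by fastforce

lemma tensor_update_smult:
  assumes "length As = n" "q < n" "M \<in> carrier_mat 2 2"
  shows "tensor (As[q := c \<cdot>\<^sub>m M]) = c \<cdot>\<^sub>m tensor (As[q := M])"
proof (rule eq_matI)
  have c: "tensor (As[q := M]) \<in> operators n" "tensor (As[q := c \<cdot>\<^sub>m M]) \<in> operators n"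
    using tensor_carrier[of "As[q := M]"] tensor_carrier[of "As[q := c \<cdot>\<^sub>m M]"] assms by auto
  then show "dim_row (tensor (As[q := c \<cdot>\<^sub>m M])) = dim_row (c \<cdot>\<^sub>m tensor (As[q := M]))"
    "dim_col (tensor (As[q := c \<cdot>\<^sub>m M])) = dim_col (c \<cdot>\<^sub>m tensor (As[q := M]))" by auto
  fix i j assume "i < dim_row (c \<cdot>\<^sub>m tensor (As[q := M]))" "j < dim_col (c \<cdot>\<^sub>m tensor (As[q := M]))"
  then have ij: "i < 2 ^ n" "j < 2 ^ n" using c by auto
  have rest: "(\<Prod>k\<in>{..<n} - {q}. entry (As[q := X] ! k) (bit i k) (bit j k))
      = (\<Prod>k\<in>{..<n} - {q}. entry (As ! k) (bit i k) (bit j k))" for X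
    by (intro prod.cong) auto
  have "tensor (As[q := X]) $$ (i, j) = entry X (bit i q) (bit j q) * (\<Prod>k\<in>{..<n} - {q}. entry (As ! k) (bit i k) (bit j k))" for X
    using assms(1,2) ij by (subst tensor_index[of _ n]) (simp_all add: prod.remove[of "{..<n}" q] rest)
  then show "tensor (As[q := c \<cdot>\<^sub>m M]) $$ (i, j) = (c \<cdot>\<^sub>m tensor (As[q := M])) $$ (i, j)"
    using ij c by (simp add: entry_smult[OF assms(3)])
qed

lemma gate_facts:
  assumes V: "pauli_gate V sg \<pi>" and q: "q < n"
  defines "G \<equiv> single_qubit_gate n q V"
  shows "G \<in> operators n" "mat_adjoint G = G" "G * G = 1\<^sub>m (2 ^ n)"
    "\<And>P. length P = n \<Longrightarrow> G * pauli_mat P * G = complex_of_real (sg (P ! q)) \<cdot>\<^sub>m pauli_mat (P[q := \<pi> (P ! q)])"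
proof -
  let ?L = "(replicate n (1\<^sub>m 2))[q := V]"
  have V: "V \<in> carrier_mat 2 2" "mat_adjoint V = V" "V * V = 1\<^sub>m 2"
    "\<And>p. V * pauli1 p * V = complex_of_real (sg p) \<cdot>\<^sub>m pauli1 (\<pi> p)"
    using V unfolding pauli_gate_def by auto
  have L: "length ?L = n" "set ?L \<subseteq> carrier_mat 2 2"
    using V(1) set_update_subset_insert[of "replicate n (1\<^sub>m 2)" q V] by (auto simp: set_replicate_conv_if split: if_splits)
  have G: "G = tensor ?L" unfolding G_def single_qubit_gate_def ..
  show "G \<in> operators n" using tensor_carrier[of ?L] unfolding G by simp
  have one: "mat_adjoint (1\<^sub>m 2 :: complex mat) = 1\<^sub>m 2"
    by (rule eq_mat2I) (simp_all add: entry_adjoint entry_one)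
  have "map mat_adjoint ?L = ?L" using V(2) one by (simp add: map_update)
  then show "mat_adjoint G = G" unfolding G by (simp only: tensor_adjoint[OF L(2)])
  have "map2 (*) ?L ?L = replicate n (1\<^sub>m 2)"
    by (rule nth_equalityI) (auto simp: nth_list_update V(3) q)
  then show "G * G = 1\<^sub>m (2 ^ n)" unfolding G by (simp only: tensor_mult[OF L(1,1,2,2)] tensor_one)
  fix P :: "pauli list" assume P: "length P = n"
  let ?P = "map pauli1 P"
  have Ps: "length ?P = n" "set ?P \<subseteq> carrier_mat 2 2" using P by (auto simp del: carrier_matI)
  have LP: "length (map2 (*) ?L ?P) = n" "set (map2 (*) ?L ?P) \<subseteq> carrier_mat 2 2"
    using L Ps by (auto simp: set_zip intro!: mult_carrier_mat[of _ 2 2] simp del: map_map)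
  have "map2 (*) (map2 (*) ?L ?P) ?L = ?P[q := complex_of_real (sg (P ! q)) \<cdot>\<^sub>m pauli1 (\<pi> (P ! q))]"
  proof (rule nth_equalityI)
    fix k assume "k < length (map2 (*) (map2 (*) ?L ?P) ?L)"
    then have k: "k < n" using P by simp
    have one: "1\<^sub>m 2 * pauli1 (P ! k) * 1\<^sub>m 2 = pauli1 (P ! k)"
      by (simp only: left_mult_one_mat[OF pauli1_carrier] right_mult_one_mat[OF pauli1_carrier])
    show "map2 (*) (map2 (*) ?L ?P) ?L ! k = ?P[q := complex_of_real (sg (P ! q)) \<cdot>\<^sub>m pauli1 (\<pi> (P ! q))] ! k"
      using k P one V(4)[of "P ! q"] by (cases "k = q") (simp_all add: nth_list_update del: pauli1.simps)
  qed (use P in simp)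
  then have "G * pauli_mat P * G = tensor (?P[q := complex_of_real (sg (P ! q)) \<cdot>\<^sub>m pauli1 (\<pi> (P ! q))])"
    unfolding G pauli_mat_def by (simp only: tensor_mult[OF L(1) Ps(1) L(2) Ps(2)] tensor_mult[OF LP(1) L(1) LP(2) L(2)])
  also have "\<dots> = complex_of_real (sg (P ! q)) \<cdot>\<^sub>m pauli_mat (P[q := \<pi> (P ! q)])"
    unfolding pauli_mat_def map_update by (rule tensor_update_smult[OF Ps(1) q pauli1_carrier])
  finally show "G * pauli_mat P * G = complex_of_real (sg (P ! q)) \<cdot>\<^sub>m pauli_mat (P[q := \<pi> (P ! q)])" .
qed

lemma pauli_value_conj:
  assumes V: "pauli_gate V sg \<pi>" and q: "q < n" and P: "length P = n" and \<rho>: "\<rho> \<in> operators n"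
  defines "G \<equiv> single_qubit_gate n q V"
  shows "pauli_value P (G * \<rho> * mat_adjoint G) = sg (P ! q) * pauli_value (P[q := \<pi> (P ! q)]) \<rho>"
proof -
  note G = gate_facts[OF V q, folded G_def]
  have Pc: "pauli_mat P \<in> operators n" "pauli_mat (P[q := \<pi> (P ! q)]) \<in> operators n"
    by (simp_all add: pauli_mat_carrier P)
  have c: "G * \<rho> \<in> operators n" "pauli_mat P * G \<in> operators n" using G(1) \<rho> Pc by auto
  have "mat_trace (pauli_mat P * (G * \<rho> * G)) = mat_trace (pauli_mat P * G * \<rho> * G)"
    using assoc_mult_mat[OF Pc(1) c(1) G(1)] assoc_mult_mat[OF Pc(1) G(1) \<rho>] by simp
  also have "\<dots> = mat_trace (G * (pauli_mat P * G * \<rho>))"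
    by (rule trace_mult_comm[of _ "2 ^ n" "2 ^ n"]) (use c \<rho> G(1) in auto)
  also have "G * (pauli_mat P * G * \<rho>) = G * pauli_mat P * G * \<rho>"
    using assoc_mult_mat[OF G(1) c(2) \<rho>] assoc_mult_mat[OF G(1) Pc(1) G(1)] by simp
  also have "mat_trace \<dots> = complex_of_real (sg (P ! q)) * mat_trace (pauli_mat (P[q := \<pi> (P ! q)]) * \<rho>)"
    unfolding G(4)[OF P] mult_smult_assoc_mat[OF Pc(2) \<rho>] using trace_smult[of _ "2 ^ n"] Pc(2) \<rho> by simp
  finally show ?thesis unfolding pauli_value_def G(2) by simp
qed

lemma density_conj:
  assumes G: "G \<in> operators n" "mat_adjoint G * G = 1\<^sub>m (2 ^ n)" and \<rho>: "\<rho> \<in> density n"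
  shows "G * \<rho> * mat_adjoint G \<in> density n"
proof -
  note d = density_facts[OF \<rho>]
  obtain B where B: "B \<in> operators n" "\<rho> = B * mat_adjoint B" using psd_factor[OF d(2)] .
  have a: "mat_adjoint B \<in> operators n" "mat_adjoint G \<in> operators n" using B G by auto
  have "G * \<rho> * mat_adjoint G = (G * B) * mat_adjoint (G * B)"
    unfolding adjoint_mult[OF G(1) B(1)] B(2)
    using assoc_mult_mat[OF G(1) B(1) a(1)] assoc_mult_mat[OF mult_carrier_mat[OF G(1) B(1)] a] by simp
  moreover have "psd (2 ^ n) ((G * B) * mat_adjoint (G * B))" by (rule psd_self_adjoint[OF mult_carrier_mat[OF G(1) B(1)]])
  moreover have "mat_trace (G * \<rho> * mat_adjoint G) = 1"
  proof -
    have "mat_trace (G * \<rho> * mat_adjoint G) = mat_trace (mat_adjoint G * (G * \<rho>))"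
      by (rule trace_mult_comm[of _ "2 ^ n" "2 ^ n"]) (use G(1) d(1) in auto)
    also have "mat_adjoint G * (G * \<rho>) = \<rho>"
      using assoc_mult_mat[OF a(2) G(1) d(1)] G(2) left_mult_one_mat[OF d(1)] by simp
    finally show ?thesis using d(3) by simp
  qed
  moreover have "G * \<rho> * mat_adjoint G \<in> operators n" using G(1) d(1) a by auto
  ultimately show ?thesis unfolding density_def by simp
qed


section \<open>Second moments under Clifford invariance\<close>

lemma space_state_space: "space (state_space n) = density n"
  unfolding state_space_def by simp

lemma entry_measurable:
  assumes "i < 2 ^ n" "j < 2 ^ n"
  shows "(\<lambda>\<rho>. \<rho> $$ (i, j)) \<in> borel_measurable (state_space n)"
proof -
  let ?I = "{..<2 ^ n} \<times> {..<2 ^ n} :: (nat \<times> nat) set"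
  let ?F = "\<lambda>\<rho>::complex mat. \<lambda>ij \<in> ?I. \<rho> $$ ij"
  have F: "?F \<in> state_space n \<rightarrow>\<^sub>M (\<Pi>\<^sub>M ij \<in> ?I. borel)"
    unfolding state_space_def by (rule measurable_vimage_algebra1) (auto simp: space_PiM)
  have "(\<lambda>\<rho>. ?F \<rho> (i, j)) \<in> borel_measurable (state_space n)"
    by (rule measurable_compose[OF F measurable_component_singleton]) (use assms in auto)
  then show ?thesis using assms by simp
qed

lemma pauli_value_measurable:
  assumes "length P = n"
  shows "pauli_value P \<in> borel_measurable (state_space n)"
proof -
  have sum: "(\<lambda>\<rho>. \<Sum>i<2 ^ n. \<Sum>j<2 ^ n. pauli_mat P $$ (i, j) * \<rho> $$ (j, i)) \<in> borel_measurable (state_space n)"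
    by (intro borel_measurable_sum borel_measurable_times borel_measurable_const entry_measurable) auto
  have Re: "Re \<in> borel_measurable borel"
    by (rule borel_measurable_continuous_onI) (intro continuous_intros)
  have eq: "pauli_value P \<rho> = Re (\<Sum>i<2 ^ n. \<Sum>j<2 ^ n. pauli_mat P $$ (i, j) * \<rho> $$ (j, i))"
    if "\<rho> \<in> space (state_space n)" for \<rho>
  proof -
    have "\<rho> \<in> operators n" using that density_facts(1) unfolding space_state_space by blast
    then show ?thesis unfolding pauli_value_def by (simp only: trace_mult[OF pauli_mat_carrier[OF assms]])
  qed
  show ?thesis by (rule measurable_cong[THEN iffD2, OF eq measurable_compose[OF sum Re]])
qed

lemma conj_measurable:
  assumes G: "G \<in> operators n" "mat_adjoint G * G = 1\<^sub>m (2 ^ n)"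
  shows "(\<lambda>\<rho>. G * \<rho> * mat_adjoint G) \<in> state_space n \<rightarrow>\<^sub>M state_space n"
proof -
  let ?I = "{..<2 ^ n} \<times> {..<2 ^ n} :: (nat \<times> nat) set"
  have 1: "(\<lambda>\<rho>. G * \<rho> * mat_adjoint G) \<in> space (state_space n) \<rightarrow> density n"
    using density_conj[OF G] by (auto simp: space_state_space)
  have 2: "(\<lambda>\<rho>. \<lambda>ij\<in>?I. (G * \<rho> * mat_adjoint G) $$ ij) \<in> state_space n \<rightarrow>\<^sub>M (\<Pi>\<^sub>M ij \<in> ?I. borel)"
  proof (rule measurable_restrict)
    fix ij assume "ij \<in> ?I"
    then obtain i j where ij: "ij = (i, j)" "i < 2 ^ n" "j < 2 ^ n" by auto
    have a: "mat_adjoint G \<in> operators n" using G(1) by simp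
    have meas: "(\<lambda>\<rho>. \<Sum>l<2 ^ n. (\<Sum>k<2 ^ n. G $$ (i, k) * \<rho> $$ (k, l)) * mat_adjoint G $$ (l, j)) \<in> borel_measurable (state_space n)"
      by (intro borel_measurable_sum borel_measurable_times borel_measurable_const entry_measurable) auto
    have eq: "(G * \<rho> * mat_adjoint G) $$ ij = (\<Sum>l<2 ^ n. (\<Sum>k<2 ^ n. G $$ (i, k) * \<rho> $$ (k, l)) * mat_adjoint G $$ (l, j))"
      if "\<rho> \<in> space (state_space n)" for \<rho>
    proof -
      have \<rho>: "\<rho> \<in> operators n" using that density_facts(1) unfolding space_state_space by blast
      show ?thesis
        unfolding ij(1) mult_mat_index[OF mult_carrier_mat[OF G(1) \<rho>] a ij(2,3)]
        by (rule sum.cong[OF refl]) (simp only: mult_mat_index[OF G(1) \<rho> ij(2)] lessThan_iff)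
    qed
    show "(\<lambda>\<rho>. (G * \<rho> * mat_adjoint G) $$ ij) \<in> borel_measurable (state_space n)"
      by (rule measurable_cong[THEN iffD2, OF eq meas])
  qed
  have "(\<lambda>\<rho>. G * \<rho> * mat_adjoint G) \<in> state_space n \<rightarrow>\<^sub>M
      vimage_algebra (density n) (\<lambda>\<rho>. \<lambda>ij \<in> ?I. \<rho> $$ ij) (\<Pi>\<^sub>M ij \<in> ?I. borel)"
    by (rule measurable_vimage_algebra2[OF 1 2])
  then show ?thesis by (simp only: state_space_def[of n, symmetric])
qed

section \<open>Twirling\<close>

locale clifford_distribution =
  fixes n :: nat and D :: "complex mat measure"
  assumes distribution: "state_distribution n D" and invariant: "clifford_invariant n D"

lemma (in clifford_distribution) prob: "prob_space D"
  using distribution unfolding state_distribution_def by blast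

lemma (in clifford_distribution) sets_D: "sets D = sets (state_space n)"
  using distribution unfolding state_distribution_def by blast

lemma (in clifford_distribution) space_D: "space D = density n"
  using sets_eq_imp_space_eq[OF sets_D] space_state_space by simp

lemma (in clifford_distribution) measurable_D: "f \<in> borel_measurable D \<longleftrightarrow> f \<in> borel_measurable (state_space n)"
  using measurable_cong_sets[OF sets_D refl] by blast

lemma (in clifford_distribution) integrable_product:
  assumes "length P = n" "length Q = n"
  shows "integrable D (\<lambda>\<rho>. pauli_value P \<rho> * pauli_value Q \<rho>)"
proof (rule finite_measure.integrable_const_bound)
  show "finite_measure D" using prob prob_space.finite_measure by blast
  show "(\<lambda>\<rho>. pauli_value P \<rho> * pauli_value Q \<rho>) \<in> borel_measurable D"
    unfolding measurable_D by (intro borel_measurable_times pauli_value_measurable assms)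
  show "AE \<rho> in D. norm (pauli_value P \<rho> * pauli_value Q \<rho>) \<le> spectral_norm (pauli_mat P) * spectral_norm (pauli_mat Q)"
  proof (rule AE_I2)
    fix \<rho> assume "\<rho> \<in> space D"
    then have \<rho>: "\<rho> \<in> density n" unfolding space_D .
    show "norm (pauli_value P \<rho> * pauli_value Q \<rho>) \<le> spectral_norm (pauli_mat P) * spectral_norm (pauli_mat Q)"
      unfolding real_norm_def abs_mult
      by (intro mult_mono pauli_value_bound[OF \<rho>] assms abs_ge_zero
          order_trans[OF abs_ge_zero pauli_value_bound[OF \<rho> assms(1)]])
  qed
qed

lemma (in clifford_distribution) gate_invariance:
  assumes V: "pauli_gate V sg \<pi>" and q: "q < n" and P: "length P = n" and Q: "length Q = n"
  shows "(\<integral>\<rho>. pauli_value P \<rho> * pauli_value Q \<rho> \<partial>D)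
    = sg (P ! q) * sg (Q ! q) * (\<integral>\<rho>. pauli_value (P[q := \<pi> (P ! q)]) \<rho> * pauli_value (Q[q := \<pi> (Q ! q)]) \<rho> \<partial>D)"
proof -
  define G where "G = single_qubit_gate n q V"
  define T where "T = (\<lambda>\<rho>. G * \<rho> * mat_adjoint G)"
  let ?f = "\<lambda>\<rho>. pauli_value P \<rho> * pauli_value Q \<rho>"
  note G = gate_facts[OF V q, folded G_def]
  have "T \<in> state_space n \<rightarrow>\<^sub>M state_space n"
    unfolding T_def by (rule conj_measurable) (simp_all only: G)
  then have T: "T \<in> D \<rightarrow>\<^sub>M state_space n" using measurable_cong_sets[OF sets_D refl] by blast
  have f: "?f \<in> borel_measurable (state_space n)"
    by (intro borel_measurable_times pauli_value_measurable P Q)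
  have inv: "distr D (state_space n) T = D"
    using invariant q pauli_gate_clifford[OF V] unfolding clifford_invariant_def T_def G_def by blast
  have "(\<integral>\<rho>. ?f \<rho> \<partial>D) = (\<integral>\<rho>. ?f \<rho> \<partial>(distr D (state_space n) T))" unfolding inv ..
  also have "\<dots> = (\<integral>\<rho>. ?f (T \<rho>) \<partial>D)" by (rule integral_distr[OF T f])
  also have "\<dots> = (\<integral>\<rho>. sg (P ! q) * sg (Q ! q) * (pauli_value (P[q := \<pi> (P ! q)]) \<rho> * pauli_value (Q[q := \<pi> (Q ! q)]) \<rho>) \<partial>D)"
  proof (rule Bochner_Integration.integral_cong[OF refl])
    fix \<rho> assume "\<rho> \<in> space D"
    then have \<rho>: "\<rho> \<in> operators n" using density_facts(1) unfolding space_D by blast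
    show "?f (T \<rho>) = sg (P ! q) * sg (Q ! q) * (pauli_value (P[q := \<pi> (P ! q)]) \<rho> * pauli_value (Q[q := \<pi> (Q ! q)]) \<rho>)"
      unfolding T_def G_def pauli_value_conj[OF V q P \<rho>] pauli_value_conj[OF V q Q \<rho>] by simp
  qed
  finally show ?thesis by simp
qed

text \<open>At a site where the strings differ, some Pauli gate commutes with one of the two factors
  and anticommutes with the other. Invariance under it makes the integral equal to its own
  negative.\<close>

lemma (in clifford_distribution) orthogonal:
  assumes P: "length P = n" and Q: "length Q = n" and "P \<noteq> Q"
  shows "(\<integral>\<rho>. pauli_value P \<rho> * pauli_value Q \<rho> \<partial>D) = 0"
proof -
  obtain q where q: "q < n" "P ! q \<noteq> Q ! q" using assms nth_equalityI[of P Q] by auto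
  obtain r where r: "(if P ! q = PI \<or> r = PI \<or> P ! q = r then 1 else - 1) *
      (if Q ! q = PI \<or> r = PI \<or> Q ! q = r then 1 else - 1) = (- 1::real)"
  proof -
    define s where "s = (\<lambda>r. (if P ! q = PI \<or> r = PI \<or> P ! q = r then 1 else - 1) *
      (if Q ! q = PI \<or> r = PI \<or> Q ! q = r then 1 else - 1) :: real)"
    have "s PX = - 1 \<or> s PY = - 1 \<or> s PZ = - 1"
      using q(2) unfolding s_def by (cases "P ! q"; cases "Q ! q") auto
    then show ?thesis using that unfolding s_def by metis
  qed
  show ?thesis
    using gate_invariance[OF pauli_gate_pauli q(1) P Q, of r] unfolding r list_update_id by simp
qed

lemma (in clifford_distribution) second_moment_gate:
  assumes V: "pauli_gate V sg \<pi>" and q: "q < n" and P: "length P = n"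
  shows "(\<integral>\<rho>. (pauli_value (P[q := \<pi> p]) \<rho>)\<^sup>2 \<partial>D) = (\<integral>\<rho>. (pauli_value (P[q := p]) \<rho>)\<^sup>2 \<partial>D)"
proof -
  have "sg p \<in> {1, - 1}" using V unfolding pauli_gate_def by blast
  then have sg: "sg p * sg p = 1" by auto
  have len: "length (P[q := p]) = n" and nth: "P[q := p] ! q = p" using P q by simp_all
  show ?thesis
    unfolding power2_eq_square gate_invariance[OF V q len len] nth list_update_overwrite sg by simp
qed

text \<open>The two axis swaps connect the three nontrivial Paulis at a site; their signs disappear
  in the square.\<close>

lemma (in clifford_distribution) second_moment_update:
  assumes P: "length P = n" and q: "q < n" "P ! q \<noteq> PI" "a \<noteq> PI"
  shows "(\<integral>\<rho>. (pauli_value (P[q := a]) \<rho>)\<^sup>2 \<partial>D) = (\<integral>\<rho>. (pauli_value P \<rho>)\<^sup>2 \<partial>D)"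
proof -
  define m where "m b = (\<integral>\<rho>. (pauli_value (P[q := b]) \<rho>)\<^sup>2 \<partial>D)" for b
  have "m PZ = m PX" "m PY = m PX"
    using second_moment_gate[OF pauli_gate_swap_XZ q(1) P, of PX] second_moment_gate[OF pauli_gate_swap_XY q(1) P, of PX]
    unfolding m_def by simp_all
  then have all: "m b = m PX" if "b \<noteq> PI" for b using that by (cases b) simp_all
  have "m a = m (P ! q)" unfolding all[OF q(3)] all[OF q(2)] ..
  then show ?thesis unfolding m_def list_update_id .
qed

lemma (in clifford_distribution) second_moment_support:
  assumes P: "length P = n" and Q: "length Q = n" and supp: "\<And>q. q < n \<Longrightarrow> P ! q = PI \<longleftrightarrow> Q ! q = PI"
  shows "(\<integral>\<rho>. (pauli_value Q \<rho>)\<^sup>2 \<partial>D) = (\<integral>\<rho>. (pauli_value P \<rho>)\<^sup>2 \<partial>D)"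
proof -
  define m where "m R = (\<integral>\<rho>. (pauli_value R \<rho>)\<^sup>2 \<partial>D)" for R
  \<comment> \<open>Hybrid strings: the sites of \<open>P\<close> are replaced by those of
    \<open>Q\<close> one at a time.\<close>
  have "m (take k Q @ drop k P) = m P" if "k \<le> n" for k
    using that
  proof (induction k)
    case (Suc k)
    let ?R = "take k Q @ drop k P"
    have len: "length ?R = n" using Suc.prems P Q by simp
    have R: "take (Suc k) Q @ drop (Suc k) P = ?R[k := Q ! k]"
      using Suc.prems P Q by (simp add: take_Suc_conv_app_nth list_update_append Cons_nth_drop_Suc[symmetric])
    have Rk: "?R ! k = P ! k" using Suc.prems P Q by (simp add: nth_append)
    show ?case
    proof (cases "P ! k = PI")
      case True
      then have "?R[k := Q ! k] = ?R" using supp[of k] Suc.prems Rk by (metis Suc_le_eq list_update_id)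
      then show ?thesis using Suc R by simp
    next
      case False
      then have "m (?R[k := Q ! k]) = m ?R"
        unfolding m_def using supp[of k] Suc.prems Rk by (intro second_moment_update[OF len]) auto
      then show ?thesis using Suc R by simp
    qed
  qed simp
  from this[of n] show ?thesis using P Q unfolding m_def by simp
qed

lemma weight_eq_card: "weight P = card {q. q < length P \<and> P ! q \<noteq> PI}"
  unfolding weight_def length_filter_conv_card ..

lemma card_same_support:
  assumes "length P = n"
  shows "card {Q. length Q = n \<and> (\<forall>q<n. P ! q = PI \<longleftrightarrow> Q ! q = PI)} = 3 ^ weight P"
proof -
  have "(\<Sum>Q | length Q = n. \<Prod>q<n. if P ! q = PI \<longleftrightarrow> Q ! q = PI then 1 else 0)
      = (\<Sum>Q | length Q = n. if \<forall>q<n. P ! q = PI \<longleftrightarrow> Q ! q = PI then 1 else (0::nat))"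
  proof (rule sum.cong[OF refl])
    fix Q
    show "(\<Prod>q<n. if P ! q = PI \<longleftrightarrow> Q ! q = PI then 1 else 0)
        = (if \<forall>q<n. P ! q = PI \<longleftrightarrow> Q ! q = PI then 1 else (0::nat))"
    proof (cases "\<forall>q<n. P ! q = PI \<longleftrightarrow> Q ! q = PI")
      case False
      then obtain q where "q < n" "\<not> (P ! q = PI \<longleftrightarrow> Q ! q = PI)" by blast
      then have "(\<Prod>q<n. if P ! q = PI \<longleftrightarrow> Q ! q = PI then 1 else (0::nat)) = 0"
        by (intro prod_zero[OF finite_lessThan] bexI[of _ q]) auto
      then show ?thesis using False by simp
    qed simp
  qed
  also have "\<dots> = card {Q. length Q = n \<and> (\<forall>q<n. P ! q = PI \<longleftrightarrow> Q ! q = PI)}"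
    using finite_paulis by (subst sum.If_cases) (auto simp: Collect_conj_eq)
  finally have "card {Q. length Q = n \<and> (\<forall>q<n. P ! q = PI \<longleftrightarrow> Q ! q = PI)}
      = (\<Sum>Q | length Q = n. \<Prod>q<n. if P ! q = PI \<longleftrightarrow> Q ! q = PI then 1 else 0)" ..
  also have "\<dots> = (\<Prod>q<n. if P ! q \<noteq> PI then 3 else 1)"
    by (subst sum_paulis[where g = "\<lambda>q p. if P ! q = PI \<longleftrightarrow> p = PI then 1 else 0"], rule prod.cong[OF refl]) simp
  also have "\<dots> = 3 ^ weight P"
    unfolding weight_eq_card using assms
    by (subst prod.If_cases) (auto simp: Collect_conj_eq Int_commute lessThan_def)
  finally show ?thesis .
qed

text \<open>The \<open>3 ^ weight P\<close> strings with the same support as \<open>P\<close> have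
  equal second moments, and by the purity bound these add up to at most
  \<open>2 ^ weight P\<close>.\<close>

lemma (in clifford_distribution) second_moment_bound:
  assumes P: "length P = n"
  shows "(\<integral>\<rho>. (pauli_value P \<rho>)\<^sup>2 \<partial>D) \<le> (2 / 3) ^ weight P"
proof -
  let ?m = "\<lambda>R. (\<integral>\<rho>. (pauli_value R \<rho>)\<^sup>2 \<partial>D)"
  let ?A = "{q. q < n \<and> P ! q \<noteq> PI}"
  let ?S = "{Q. length Q = n \<and> (\<forall>q<n. P ! q = PI \<longleftrightarrow> Q ! q = PI)}"
  have fin: "finite ?S" "finite {Q. length Q = n \<and> (\<forall>q<n. q \<notin> ?A \<longrightarrow> Q ! q = PI)}"
    by (rule finite_subset[OF _ finite_paulis[of n]], blast)+
  have int: "integrable D (\<lambda>\<rho>. (pauli_value Q \<rho>)\<^sup>2)" if "Q \<in> ?S" for Q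
    using integrable_product[of Q Q] that by (simp add: power2_eq_square)
  have "3 ^ weight P * ?m P = (\<Sum>Q\<in>?S. ?m P)" using card_same_support[OF P] by simp
  also have "\<dots> = (\<Sum>Q\<in>?S. ?m Q)"
    by (rule sum.cong[OF refl]) (use second_moment_support[OF P] in simp)
  also have "\<dots> = (\<integral>\<rho>. (\<Sum>Q\<in>?S. (pauli_value Q \<rho>)\<^sup>2) \<partial>D)"
    by (rule Bochner_Integration.integral_sum[OF int, symmetric])
  also have "\<dots> \<le> (\<integral>\<rho>. 2 ^ weight P \<partial>D)"
  proof (rule integral_mono)
    show "integrable D (\<lambda>\<rho>. \<Sum>Q\<in>?S. (pauli_value Q \<rho>)\<^sup>2)" by (rule Bochner_Integration.integrable_sum[OF int])
    show "integrable D (\<lambda>\<rho>. 2 ^ weight P :: real)"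
      using prob prob_space.finite_measure finite_measure.integrable_const by blast
    fix \<rho> assume "\<rho> \<in> space D"
    then have \<rho>: "\<rho> \<in> density n" unfolding space_D .
    have "(\<Sum>Q\<in>?S. (pauli_value Q \<rho>)\<^sup>2) \<le> (\<Sum>Q | length Q = n \<and> (\<forall>q<n. q \<notin> ?A \<longrightarrow> Q ! q = PI). (pauli_value Q \<rho>)\<^sup>2)"
      by (rule sum_mono2[OF fin(2)]) auto
    also have "\<dots> \<le> 2 ^ card ?A" by (rule purity_bound[OF \<rho>]) auto
    finally show "(\<Sum>Q\<in>?S. (pauli_value Q \<rho>)\<^sup>2) \<le> 2 ^ weight P" unfolding weight_eq_card P .
  qed
  also have "\<dots> = 2 ^ weight P" using prob_space.prob_space[OF prob] by simp
  finally show ?thesis by (simp add: power_divide field_simps)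
qed

text \<open>Orthogonality leaves only the diagonal terms. The mean squared prediction error thus
  becomes a weighted l2 error of Pauli coefficients, with weights that decay in the degree.\<close>

lemma (in clifford_distribution) L2_bound:
  shows "integrable D (\<lambda>\<rho>. (\<Sum>P | length P = n. \<gamma> P * pauli_value P \<rho>)\<^sup>2)" (is ?int)
    and "(\<integral>\<rho>. (\<Sum>P | length P = n. \<gamma> P * pauli_value P \<rho>)\<^sup>2 \<partial>D) \<le> (\<Sum>P | length P = n. (\<gamma> P)\<^sup>2 * (2 / 3) ^ weight P)" (is ?le)
proof -
  let ?S = "{P :: pauli list. length P = n}"
  have sq: "(\<Sum>P\<in>?S. \<gamma> P * pauli_value P \<rho>)\<^sup>2 = (\<Sum>P\<in>?S. \<Sum>Q\<in>?S. \<gamma> P * \<gamma> Q * (pauli_value P \<rho> * pauli_value Q \<rho>))" for \<rho>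
    unfolding power2_eq_square sum_product by (intro sum.cong refl) simp
  have int: "integrable D (\<lambda>\<rho>. \<gamma> P * \<gamma> Q * (pauli_value P \<rho> * pauli_value Q \<rho>))" if "P \<in> ?S" "Q \<in> ?S" for P Q
    using integrable_product that by simp
  show ?int unfolding sq by (intro Bochner_Integration.integrable_sum int)
  have "(\<integral>\<rho>. (\<Sum>P\<in>?S. \<gamma> P * pauli_value P \<rho>)\<^sup>2 \<partial>D)
      = (\<Sum>P\<in>?S. \<Sum>Q\<in>?S. \<gamma> P * \<gamma> Q * (\<integral>\<rho>. pauli_value P \<rho> * pauli_value Q \<rho> \<partial>D))"
    unfolding sq
    by (subst Bochner_Integration.integral_sum, intro Bochner_Integration.integrable_sum int, assumption+,
        rule sum.cong[OF refl], subst Bochner_Integration.integral_sum, intro int, assumption+) simp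
  also have "\<dots> = (\<Sum>P\<in>?S. \<Sum>Q\<in>?S. if Q = P then (\<gamma> P)\<^sup>2 * (\<integral>\<rho>. (pauli_value P \<rho>)\<^sup>2 \<partial>D) else 0)"
    by (intro sum.cong refl) (auto simp: orthogonal power2_eq_square)
  also have "\<dots> = (\<Sum>P\<in>?S. (\<gamma> P)\<^sup>2 * (\<integral>\<rho>. (pauli_value P \<rho>)\<^sup>2 \<partial>D))"
    using finite_paulis by (intro sum.cong refl) simp
  also have "\<dots> \<le> (\<Sum>P\<in>?S. (\<gamma> P)\<^sup>2 * (2 / 3) ^ weight P)"
    by (intro sum_mono mult_left_mono second_moment_bound) auto
  finally show ?le .
qed


section \<open>Concentration of shadow estimates\<close>

lemma pmf_replicate_pmf:
  "pmf (replicate_pmf n p) xs = (if length xs = n then \<Prod>x\<leftarrow>xs. pmf p x else 0)"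
proof (induction n arbitrary: xs)
  case 0
  then show ?case by (cases xs) simp_all
next
  case (Suc n)
  have rep: "replicate_pmf (Suc n) p = bind_pmf p (\<lambda>x. map_pmf ((#) x) (replicate_pmf n p))"
    by (simp add: map_pmf_def)
  show ?case
  proof (cases xs)
    case Nil
    have "pmf (map_pmf ((#) x) (replicate_pmf n p)) [] = 0" for x
      by (auto simp: pmf_eq_0_set_pmf)
    then show ?thesis unfolding rep pmf_bind Nil by simp
  next
    case (Cons y ys)
    have "pmf (map_pmf ((#) x) (replicate_pmf n p)) (y # ys) = pmf (replicate_pmf n p) ys * indicator {y} x" for x
    proof (cases "x = y")
      case True
      then show ?thesis using pmf_map_inj'[of "(#) y" "replicate_pmf n p" ys] by (simp add: inj_def)
    next
      case False
      then show ?thesis by (auto simp: pmf_eq_0_set_pmf)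
    qed
    then have "pmf (replicate_pmf (Suc n) p) xs = pmf (replicate_pmf n p) ys * pmf p y"
      unfolding rep pmf_bind Cons by (simp add: measure_pmf_single)
    then show ?thesis unfolding Suc.IH Cons by simp
  qed
qed

text \<open>Independence of the repetitions, stated for nonnegative integrals so that no
  integrability has to be carried through the induction.\<close>

lemma nn_integral_replicate_pmf:
  assumes "\<And>x. 0 \<le> g x"
  shows "(\<integral>\<^sup>+xs. ennreal (\<Prod>x\<leftarrow>xs. g x) \<partial>replicate_pmf N p) = (\<integral>\<^sup>+x. ennreal (g x) \<partial>p) ^ N"
proof (induction N)
  case (Suc N)
  have pos: "0 \<le> (\<Prod>x\<leftarrow>xs. g x)" for xs by (induction xs) (simp_all add: assms)
  have "(\<integral>\<^sup>+xs. ennreal (\<Prod>x\<leftarrow>xs. g x) \<partial>replicate_pmf (Suc N) p)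
      = (\<integral>\<^sup>+x. \<integral>\<^sup>+xs. ennreal (g x) * ennreal (\<Prod>x\<leftarrow>xs. g x) \<partial>replicate_pmf N p \<partial>p)"
    using assms pos by (simp add: ennreal_mult'')
  also have "\<dots> = (\<integral>\<^sup>+x. ennreal (g x) * (\<integral>\<^sup>+xs. ennreal (\<Prod>x\<leftarrow>xs. g x) \<partial>replicate_pmf N p) \<partial>p)"
    by (simp add: nn_integral_cmult)
  also have "\<dots> = (\<integral>\<^sup>+x. ennreal (g x) \<partial>p) * (\<integral>\<^sup>+xs. ennreal (\<Prod>x\<leftarrow>xs. g x) \<partial>replicate_pmf N p)"
    by (simp add: nn_integral_multc)
  finally show ?case unfolding Suc.IH by simp
qed simp

lemma exp_sum_list: "(\<Prod>x\<leftarrow>xs. exp (f x)) = exp (\<Sum>x\<leftarrow>xs. f x)" for f :: "'a \<Rightarrow> real"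
  by (induction xs) (simp_all add: exp_add)

lemma chernoff_upper:
  fixes Y :: "'a \<Rightarrow> real"
  assumes Y: "\<And>x. x \<in> set_pmf p \<Longrightarrow> \<bar>Y x\<bar> \<le> B" and B: "0 < B" and \<delta>: "0 < \<delta>"
  shows "measure_pmf.prob (replicate_pmf N p)
      {xs. real N * \<delta> \<le> (\<Sum>x\<leftarrow>xs. Y x - measure_pmf.expectation p Y)} \<le> exp (- (real N * \<delta>\<^sup>2 / (2 * B\<^sup>2)))"
proof -
  define \<mu> where "\<mu> = measure_pmf.expectation p Y"
  \<comment> \<open>The minimizer of the exponent \<open>- l * \<delta> + l^2 * B^2 / 2\<close> that
    Hoeffding's lemma and the exponential Markov inequality give per sample.\<close>
  define l where "l = \<delta> / B\<^sup>2"
  have l: "0 < l" unfolding l_def using B \<delta> by simp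
  interpret interval_bounded_random_variable "measure_pmf p" Y "- B" B
    by unfold_locales (auto simp: AE_measure_pmf_iff dest: Y)
  let ?S = "\<lambda>xs. \<Sum>x\<leftarrow>xs. Y x - \<mu>"
  have hoeff: "(\<integral>\<^sup>+x. ennreal (exp (l * (Y x - \<mu>))) \<partial>p) \<le> ennreal (exp (l\<^sup>2 * B\<^sup>2 / 2))"
  proof -
    have "l\<^sup>2 * (B - - B)\<^sup>2 / 8 = l\<^sup>2 * B\<^sup>2 / 2" by (simp add: power2_eq_square)
    then show ?thesis using Hoeffdings_lemma_nn_integral[OF l] unfolding \<mu>_def by (simp only:)
  qed
  have scale: "(\<Sum>x\<leftarrow>xs. l * (Y x - \<mu>)) = l * ?S xs" for xs by (rule sum_list_const_mult)
  have "emeasure (replicate_pmf N p) {xs. real N * \<delta> \<le> ?S xs}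
      \<le> (\<integral>\<^sup>+xs. ennreal (exp (- (l * real N * \<delta>))) * ennreal (\<Prod>x\<leftarrow>xs. exp (l * (Y x - \<mu>))) \<partial>replicate_pmf N p)"
  proof -
    have "emeasure (replicate_pmf N p) {xs. real N * \<delta> \<le> ?S xs}
        = (\<integral>\<^sup>+xs. indicator {xs. real N * \<delta> \<le> ?S xs} xs \<partial>replicate_pmf N p)" by simp
    also have "\<dots> \<le> (\<integral>\<^sup>+xs. ennreal (exp (- (l * real N * \<delta>))) * ennreal (\<Prod>x\<leftarrow>xs. exp (l * (Y x - \<mu>))) \<partial>replicate_pmf N p)"
    proof (rule nn_integral_mono)
      fix xs
      show "indicator {xs. real N * \<delta> \<le> ?S xs} xs \<le> ennreal (exp (- (l * real N * \<delta>))) * ennreal (\<Prod>x\<leftarrow>xs. exp (l * (Y x - \<mu>)))"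
      proof (cases "real N * \<delta> \<le> ?S xs")
        case True
        then have "l * (real N * \<delta>) \<le> l * ?S xs" using l by (intro mult_left_mono) auto
        then have "1 \<le> exp (- (l * real N * \<delta>)) * exp (l * ?S xs)"
          unfolding exp_add[symmetric] by (simp add: mult.assoc)
        then have "ennreal 1 \<le> ennreal (exp (- (l * real N * \<delta>)) * exp (l * ?S xs))" by (rule ennreal_leI)
        then show ?thesis using True unfolding exp_sum_list scale by (simp add: ennreal_mult)
      qed simp
    qed
    finally show ?thesis .
  qed
  also have "\<dots> = ennreal (exp (- (l * real N * \<delta>))) * (\<integral>\<^sup>+x. ennreal (exp (l * (Y x - \<mu>))) \<partial>p) ^ N"
    by (simp add: nn_integral_cmult nn_integral_replicate_pmf)
  also have "\<dots> \<le> ennreal (exp (- (l * real N * \<delta>))) * ennreal (exp (l\<^sup>2 * B\<^sup>2 / 2)) ^ N"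
    by (intro mult_left_mono power_mono hoeff) auto
  also have "\<dots> = ennreal (exp (- (l * real N * \<delta>)) * exp (l\<^sup>2 * B\<^sup>2 / 2) ^ N)"
    by (simp add: ennreal_power ennreal_mult)
  also have "exp (- (l * real N * \<delta>)) * exp (l\<^sup>2 * B\<^sup>2 / 2) ^ N = exp (- (real N * \<delta>\<^sup>2 / (2 * B\<^sup>2)))"
  proof -
    have "l * real N * \<delta> = 2 * (real N * \<delta>\<^sup>2 / (2 * B\<^sup>2))" "real N * (l\<^sup>2 * B\<^sup>2 / 2) = real N * \<delta>\<^sup>2 / (2 * B\<^sup>2)"
      unfolding l_def using B by (simp_all add: power2_eq_square)
    then show ?thesis unfolding exp_of_nat_mult[symmetric] exp_add[symmetric] by simp
  qed
  finally have "emeasure (replicate_pmf N p) {xs. real N * \<delta> \<le> ?S xs} \<le> ennreal (exp (- (real N * \<delta>\<^sup>2 / (2 * B\<^sup>2))))" .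
  then show ?thesis unfolding \<mu>_def[symmetric] measure_pmf.emeasure_eq_measure by simp
qed

lemma chernoff:
  fixes Y :: "'a \<Rightarrow> real"
  assumes Y: "\<And>x. x \<in> set_pmf p \<Longrightarrow> \<bar>Y x\<bar> \<le> B" and B: "0 < B" and \<delta>: "0 < \<delta>" and N: "0 < N"
  shows "measure_pmf.prob (replicate_pmf N p)
      {xs. \<delta> \<le> \<bar>(\<Sum>x\<leftarrow>xs. Y x) / real N - measure_pmf.expectation p Y\<bar>} \<le> 2 * exp (- (real N * \<delta>\<^sup>2 / (2 * B\<^sup>2)))"
proof -
  let ?P = "measure_pmf.prob (replicate_pmf N p)"
  define \<mu> where "\<mu> = measure_pmf.expectation p Y"
  let ?A = "{xs. real N * \<delta> \<le> (\<Sum>x\<leftarrow>xs. Y x - \<mu>)}" and ?B = "{xs. real N * \<delta> \<le> (\<Sum>x\<leftarrow>xs. - Y x - (- \<mu>))}"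
  have diff: "(\<Sum>x\<leftarrow>xs. Y x - c) = (\<Sum>x\<leftarrow>xs. Y x) - real (length xs) * c" for xs Y and c :: real
    by (induction xs) (simp_all add: algebra_simps)
  have neg: "(\<Sum>x\<leftarrow>xs. - Y x) = - (\<Sum>x\<leftarrow>xs. Y x)" for xs by (induction xs) simp_all
  have "?P {xs. \<delta> \<le> \<bar>(\<Sum>x\<leftarrow>xs. Y x) / real N - \<mu>\<bar>} \<le> ?P (?A \<union> ?B)"
  proof (rule measure_pmf.finite_measure_mono_AE)
    show "AE xs in replicate_pmf N p. xs \<in> {xs. \<delta> \<le> \<bar>(\<Sum>x\<leftarrow>xs. Y x) / real N - \<mu>\<bar>} \<longrightarrow> xs \<in> ?A \<union> ?B"
      unfolding AE_measure_pmf_iff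
    proof (intro ballI impI)
      fix xs assume "xs \<in> set_pmf (replicate_pmf N p)" and d: "xs \<in> {xs. \<delta> \<le> \<bar>(\<Sum>x\<leftarrow>xs. Y x) / real N - \<mu>\<bar>}"
      then have len: "length xs = N" by (simp add: set_replicate_pmf)
      have "(\<Sum>x\<leftarrow>xs. Y x) / real N - \<mu> = ((\<Sum>x\<leftarrow>xs. Y x) - real N * \<mu>) / real N" using N by (simp add: field_simps)
      with d have "\<delta> \<le> \<bar>(\<Sum>x\<leftarrow>xs. Y x) - real N * \<mu>\<bar> / real N" by simp
      then have "real N * \<delta> \<le> \<bar>(\<Sum>x\<leftarrow>xs. Y x) - real N * \<mu>\<bar>" using N by (simp add: field_simps)
      then show "xs \<in> ?A \<union> ?B" 
        by (simp only: Un_iff mem_Collect_eq diff neg len mult_minus_right) linarith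
    qed
  qed simp
  also have "\<dots> \<le> ?P ?A + ?P ?B" by (rule measure_Un_le) simp_all
  also have "?P ?A \<le> exp (- (real N * \<delta>\<^sup>2 / (2 * B\<^sup>2)))"
    unfolding \<mu>_def by (rule chernoff_upper[OF Y B \<delta>])
  also have "?P ?B \<le> exp (- (real N * \<delta>\<^sup>2 / (2 * B\<^sup>2)))"
    using chernoff_upper[of p "\<lambda>x. - Y x" B \<delta> N] Y B \<delta> unfolding \<mu>_def by simp
  finally show ?thesis unfolding \<mu>_def by simp
qed

section \<open>Size and mean of the sample values\<close>

lemma shadow_prod_bound: "\<bar>shadow_prod P ss\<bar> \<le> 3 ^ weight P"
proof (induction P arbitrary: ss)
  case Nil
  then show ?case by (simp add: shadow_prod_def)
next
  case (Cons p P)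
  show ?case
  proof (cases ss)
    case Nil
    then show ?thesis by (simp add: shadow_prod_def)
  next
    case (Cons s ss')
    have "\<bar>shadow p s\<bar> \<le> (if p = PI then 1 else 3)" by (cases p; cases s) simp_all
    then have "\<bar>shadow p s\<bar> * \<bar>shadow_prod P ss'\<bar> \<le> (if p = PI then 1 else 3) * 3 ^ weight P"
      using Cons.IH[of ss'] by (intro mult_mono) auto
    then show ?thesis using Cons by (cases "p = PI") (simp_all add: shadow_prod_def weight_def abs_mult)
  qed
qed

lemma sample_value_bound: "\<bar>sample_value P Q s\<bar> \<le> 3 ^ (weight P + weight Q)"
  unfolding sample_value_def abs_mult power_add
  by (intro mult_mono shadow_prod_bound) auto

lemma pauli_mat_identity: "pauli_mat (replicate n PI) = 1\<^sub>m (2 ^ n)"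
proof -
  have "pauli1 PI = 1\<^sub>m 2" by (rule eq_matI) (auto simp: mat_of_rows_list_def less_2_cases_iff)
  then show ?thesis unfolding pauli_mat_def by (simp add: tensor_one map_replicate)
qed

lemma shadow_prod_identity: "length ss = n \<Longrightarrow> shadow_prod (replicate n PI) ss = 1"
  by (simp add: shadow_prod_eq)

lemma sum_shadow_trace:
  assumes "\<sigma> \<in> operators n" "length P = n"
  shows "(\<Sum>ss | length ss = n. shadow_prod P ss * mat_trace (stab_state ss * \<sigma>)) = 3 ^ n * mat_trace (pauli_mat P * \<sigma>)"
proof -
  have "(\<Sum>ss | length ss = n. shadow_prod P ss * mat_trace (\<sigma> * stab_state ss)) = 3 ^ n * mat_trace (\<sigma> * pauli_mat P)"
    by (rule sum_shadow_linear[where L = "\<lambda>A. mat_trace (\<sigma> * A)"])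
      (simp_all only: trace_mult_add[OF assms(1)] trace_mult_smult[OF assms(1)] assms(2))
  moreover have "mat_trace (\<sigma> * stab_state ss) = mat_trace (stab_state ss * \<sigma>)" if "length ss = n" for ss
    by (rule trace_mult_comm[OF assms(1) stab_state_carrier[OF that]])
  moreover have "mat_trace (\<sigma> * pauli_mat P) = mat_trace (pauli_mat P * \<sigma>)"
    by (rule trace_mult_comm[OF assms(1) pauli_mat_carrier[OF assms(2)]])
  ultimately show ?thesis by simp
qed

lemma Re_power3_mult: "Re (3 ^ n * z) = 3 ^ n * Re z"
proof -
  have "(3::complex) ^ n = of_real (3 ^ n)" by simp
  then have "Re (3 ^ n * z) = Re (of_real (3 ^ n) * z)" by (simp only:)
  then show ?thesis by (simp del: of_real_power)
qed

text \<open>The embedding of a function as a probability mass function has the intended values only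
  if the function is nonnegative with total mass 1. The total mass is the shadow identity for the
  all-identity string.\<close>

lemma pmf_pauli_measurement:
  assumes "\<sigma> \<in> density n"
  shows "pmf (pauli_measurement n \<sigma>) ss = (if length ss = n then Re (mat_trace (stab_state ss * \<sigma>)) / 3 ^ n else 0)"
  unfolding pauli_measurement_def
proof (rule pmf_embed_pmf)
  let ?f = "\<lambda>ss. if length ss = n then Re (mat_trace (stab_state ss * \<sigma>)) / 3 ^ n else 0"
  have \<sigma>: "\<sigma> \<in> operators n" "psd (2 ^ n) \<sigma>" "mat_trace \<sigma> = 1" using assms unfolding density_def by auto
  show pos: "0 \<le> ?f ss" for ss
    using psd_trace_mult_nonneg[OF stab_state_psd \<sigma>(2)] by (auto simp: less_eq_complex_def)
  have "(\<integral>\<^sup>+ss. ennreal (?f ss) \<partial>count_space UNIV) = (\<Sum>ss | length ss = n. ennreal (?f ss))"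
    by (rule nn_integral_count_space') (auto simp: finite_stabs)
  also have "\<dots> = ennreal (\<Sum>ss | length ss = n. ?f ss)" by (rule sum_ennreal[OF pos])
  also have "(\<Sum>ss | length ss = n. ?f ss) = Re (\<Sum>ss | length ss = n. mat_trace (stab_state ss * \<sigma>)) / 3 ^ n"
    by (simp add: sum_divide_distrib)
  also have "(\<Sum>ss | length ss = n. mat_trace (stab_state ss * \<sigma>)) = (\<Sum>ss | length ss = n. shadow_prod (replicate n PI) ss * mat_trace (stab_state ss * \<sigma>))"
    by (rule sum.cong[OF refl]) (simp add: shadow_prod_identity)
  also have "\<dots> = 3 ^ n"
    unfolding sum_shadow_trace[OF \<sigma>(1) length_replicate] pauli_mat_identity left_mult_one_mat[OF \<sigma>(1)] \<sigma>(3) by simp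
  also have "Re (3 ^ n) / 3 ^ n = 1" using Re_power3_mult[of n 1] by simp
  finally show "(\<integral>\<^sup>+ss. ennreal (?f ss) \<partial>count_space UNIV) = 1" by simp
qed

lemma set_pauli_measurement:
  "\<sigma> \<in> density n \<Longrightarrow> set_pmf (pauli_measurement n \<sigma>) \<subseteq> {ss. length ss = n}"
  by (auto simp: set_pmf_eq pmf_pauli_measurement split: if_splits)

lemma expectation_pauli_measurement:
  assumes "\<sigma> \<in> density n" "length Q = n"
  shows "measure_pmf.expectation (pauli_measurement n \<sigma>) (shadow_prod Q) = Re (mat_trace (pauli_mat Q * \<sigma>))"
proof -
  have \<sigma>: "\<sigma> \<in> operators n" using assms unfolding density_def by auto
  have "measure_pmf.expectation (pauli_measurement n \<sigma>) (shadow_prod Q)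
      = (\<Sum>ss | length ss = n. shadow_prod Q ss * pmf (pauli_measurement n \<sigma>) ss)"
    by (rule integral_measure_pmf_real[OF finite_stabs]) (use set_pauli_measurement[OF assms(1)] in auto)
  also have "\<dots> = Re (\<Sum>ss | length ss = n. shadow_prod Q ss * mat_trace (stab_state ss * \<sigma>)) / 3 ^ n"
    by (simp add: pmf_pauli_measurement[OF assms(1)] sum_divide_distrib)
  also have "\<dots> = Re (mat_trace (pauli_mat Q * \<sigma>))"
    unfolding sum_shadow_trace[OF \<sigma> assms(2)] Re_power3_mult by simp
  finally show ?thesis .
qed

lemma stab_state_density: "length ss = n \<Longrightarrow> stab_state ss \<in> density n"
  unfolding density_def by (simp add: stab_state_carrier stab_state_psd stab_state_trace)

lemma (in channel) density: "\<rho> \<in> density n \<Longrightarrow> \<E> \<rho> \<in> density n"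
  unfolding density_def by (simp add: carrier psd trace)

lemma pmf_input: "length ss = n \<Longrightarrow>
  pmf (replicate_pmf n (pmf_of_set {Z0, Z1, XPlus, XMinus, YPlus, YMinus})) ss = 1 / 6 ^ n"
proof -
  have "s \<in> {Z0, Z1, XPlus, XMinus, YPlus, YMinus}" for s by (cases s) auto
  then have "pmf (pmf_of_set {Z0, Z1, XPlus, XMinus, YPlus, YMinus}) s = 1 / 6" for s
    by (subst pmf_of_set) auto
  then have "(\<Prod>s\<leftarrow>ss. pmf (pmf_of_set {Z0, Z1, XPlus, XMinus, YPlus, YMinus}) s) = 1 / 6 ^ length ss"
    by (induction ss) simp_all
  then show "length ss = n \<Longrightarrow> ?thesis" by (simp only: pmf_replicate_pmf refl if_True)
qed

lemma (in channel) set_experiment_pmf: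
  "set_pmf (experiment_pmf n \<E>) \<subseteq> {(s_in, s_out). length s_in = n \<and> length s_out = n}"
  unfolding experiment_pmf_def using set_pauli_measurement[OF density[OF stab_state_density]]
  by (auto simp: set_replicate_pmf)

text \<open>The shadow identity is used twice. Averaging over the outcome gives
  \<open>tr (Q \<E>(s))\<close> for an input \<open>s\<close>; averaging over the uniform inputs
  turns \<open>s\<close> into \<open>P\<close> with the factor
  \<open>3 ^ n / 6 ^ n = 1 / 2 ^ n\<close>, the normalization of \<open>transfer\<close>.\<close>

lemma (in channel) expectation_sample_value:
  assumes P: "length P = n" and Q: "length Q = n"
  shows "measure_pmf.expectation (experiment_pmf n \<E>) (sample_value P Q) = transfer P Q"
proof -
  let ?in = "replicate_pmf n (pmf_of_set {Z0, Z1, XPlus, XMinus, YPlus, YMinus})"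
  have QE: "mat_trace (pauli_mat Q * \<E> A) = mat_trace (heisenberg (pauli_mat Q) * A)" if "A \<in> operators n" for A
    by (rule trace_heisenberg[OF pauli_mat_carrier[OF Q] that, symmetric])
  have "measure_pmf.expectation (experiment_pmf n \<E>) (sample_value P Q)
      = (\<Sum>s | length s = n. pmf ?in s *\<^sub>R measure_pmf.expectation
           (map_pmf (\<lambda>s_out. (s, s_out)) (pauli_measurement n (\<E> (stab_state s)))) (sample_value P Q))"
    unfolding experiment_pmf_def
  proof (rule pmf_expectation_bind[OF finite_stabs])
    fix s :: "stab list" assume "s \<in> {s. length s = n}"
    then have "set_pmf (pauli_measurement n (\<E> (stab_state s))) \<subseteq> {ss. length ss = n}"
      using set_pauli_measurement[OF density[OF stab_state_density]] by simp
    then show "finite (set_pmf (map_pmf (\<lambda>s_out. (s, s_out)) (pauli_measurement n (\<E> (stab_state s)))))"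
      using finite_subset[OF _ finite_stabs] by simp
  qed (auto simp: set_replicate_pmf)
  also have "\<dots> = (\<Sum>s | length s = n. shadow_prod P s * Re (mat_trace (pauli_mat Q * \<E> (stab_state s))) / 6 ^ n)"
  proof (rule sum.cong[OF refl])
    fix s :: "stab list" assume "s \<in> {s. length s = n}"
    then have s: "length s = n" by simp
    have "measure_pmf.expectation (map_pmf (\<lambda>s_out. (s, s_out)) (pauli_measurement n (\<E> (stab_state s)))) (sample_value P Q)
        = shadow_prod P s * measure_pmf.expectation (pauli_measurement n (\<E> (stab_state s))) (shadow_prod Q)"
      by (simp add: sample_value_def)
    also have "\<dots> = shadow_prod P s * Re (mat_trace (pauli_mat Q * \<E> (stab_state s)))"
      unfolding expectation_pauli_measurement[OF density[OF stab_state_density[OF s]] Q] ..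
    finally show "pmf ?in s *\<^sub>R measure_pmf.expectation
           (map_pmf (\<lambda>s_out. (s, s_out)) (pauli_measurement n (\<E> (stab_state s)))) (sample_value P Q)
        = shadow_prod P s * Re (mat_trace (pauli_mat Q * \<E> (stab_state s))) / 6 ^ n"
      by (simp add: pmf_input[OF s])
  qed
  also have "\<dots> = Re (\<Sum>s | length s = n. shadow_prod P s * mat_trace (stab_state s * heisenberg (pauli_mat Q))) / 6 ^ n"
    unfolding sum_divide_distrib[symmetric] Re_sum
    by (rule arg_cong2[where f = "(/)", OF sum.cong[OF refl] refl])
      (simp add: QE stab_state_carrier trace_mult_comm[OF stab_state_carrier heisenberg_carrier])
  also have "\<dots> = Re (3 ^ n * mat_trace (pauli_mat Q * \<E> (pauli_mat P))) / 6 ^ n"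
    unfolding sum_shadow_trace[OF heisenberg_carrier P] QE[OF pauli_mat_carrier[OF P]]
      trace_mult_comm[OF pauli_mat_carrier[OF P] heisenberg_carrier] ..
  also have "\<dots> = transfer P Q"
  proof -
    have "(6::real) ^ n = 3 ^ n * 2 ^ n" unfolding power_mult_distrib[symmetric] by simp
    then show ?thesis unfolding transfer_def Re_power3_mult by simp
  qed
  finally show ?thesis .
qed


section \<open>Pauli sums as polynomials on the cube\<close>

definition cube_index :: "nat \<Rightarrow> (nat \<times> pauli) set" where
  "cube_index n = {..<n} \<times> {PX, PY, PZ}"

definition pauli_set :: "pauli list \<Rightarrow> (nat \<times> pauli) set" where
  "pauli_set P = (\<lambda>q. (q, P ! q)) ` {q. q < length P \<and> P ! q \<noteq> PI}"

text \<open>As \<open>pauli_set\<close> is injective on strings of length \<open>n\<close>, the sum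
  has at most one term. It is 0 for sets that contain two axes of one qubit. The power of 3 is due
  to the random choice of an axis at each qubit.\<close>

definition cube_coeff :: "nat \<Rightarrow> (pauli list \<Rightarrow> real) \<Rightarrow> (nat \<times> pauli) set \<Rightarrow> real" where
  "cube_coeff n \<alpha> T = (\<Sum>P | length P = n \<and> pauli_set P = T. \<alpha> P / 3 ^ weight P)"

lemma finite_cube_index: "finite (cube_index n)"
  unfolding cube_index_def by simp

lemma pauli_set_subset: "length P = n \<Longrightarrow> pauli_set P \<subseteq> cube_index n"
proof -
  have "p \<in> {PX, PY, PZ}" if "p \<noteq> PI" for p using that by (cases p) auto
  then show "length P = n \<Longrightarrow> ?thesis" unfolding pauli_set_def cube_index_def by auto
qed

lemma card_pauli_set: "card (pauli_set P) = weight P"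
  unfolding pauli_set_def weight_def length_filter_conv_card by (rule card_image) (auto simp: inj_on_def)

lemma mem_pauli_set: "(q, p) \<in> pauli_set P \<longleftrightarrow> q < length P \<and> P ! q = p \<and> p \<noteq> PI"
  unfolding pauli_set_def by auto

lemma pauli_set_inject:
  assumes "length P = n" "length Q = n" "pauli_set P = pauli_set Q"
  shows "P = Q"
proof (rule nth_equalityI)
  fix q assume "q < length P"
  then have "q < length P" "q < length Q" using assms by auto
  then show "P ! q = Q ! q"
    using mem_pauli_set[of q "P ! q" P] mem_pauli_set[of q "P ! q" Q] mem_pauli_set[of q "Q ! q" P]
      mem_pauli_set[of q "Q ! q" Q] assms(3) by metis
qed (use assms in simp)

lemma cube_coeff_pauli_set:
  assumes "length P = n"
  shows "cube_coeff n \<alpha> (pauli_set P) = \<alpha> P / 3 ^ weight P"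
proof -
  have "{Q. length Q = n \<and> pauli_set Q = pauli_set P} = {P}" using pauli_set_inject assms by blast
  then show ?thesis unfolding cube_coeff_def by simp
qed

lemma cube_coeff_nonzero:
  assumes "cube_coeff n \<alpha> T \<noteq> 0"
  obtains P where "length P = n" "pauli_set P = T" "\<alpha> P \<noteq> 0"
proof -
  obtain P where P: "length P = n" "pauli_set P = T"
    using assms sum.neutral[of "{P. length P = n \<and> pauli_set P = T}"] unfolding cube_coeff_def by blast
  moreover have "\<alpha> P \<noteq> 0" using assms cube_coeff_pauli_set[OF P(1)] unfolding P(2) by auto
  ultimately show ?thesis by (rule that)
qed

lemma degree_le_cube_coeff:
  assumes "\<And>P. length P = n \<Longrightarrow> \<alpha> P \<noteq> 0 \<Longrightarrow> weight P \<le> k"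
  shows "degree_le k (cube_index n) (cube_coeff n \<alpha>)"
  unfolding degree_le_def
proof (intro allI impI)
  fix T assume "cube_coeff n \<alpha> T \<noteq> 0"
  then obtain P where "length P = n" "pauli_set P = T" "\<alpha> P \<noteq> 0" by (rule cube_coeff_nonzero)
  then show "card T \<le> k" using assms card_pauli_set[of P] by auto
qed

text \<open>Only an inequality, as not every set of variables comes from a Pauli string.\<close>

lemma sum_cube_coeff_ge:
  fixes f :: "(nat \<times> pauli) set \<Rightarrow> real"
  assumes "\<And>T. 0 \<le> f T"
  shows "(\<Sum>P | length P = n. f (pauli_set P)) \<le> (\<Sum>T\<in>Pow (cube_index n). f T)"
proof -
  have inj: "inj_on pauli_set {P. length P = n}" using pauli_set_inject by (auto simp: inj_on_def)
  have "(\<Sum>P | length P = n. f (pauli_set P)) = (\<Sum>T\<in>pauli_set ` {P. length P = n}. f T)"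
    by (simp add: sum.reindex[OF inj])
  also have "\<dots> \<le> (\<Sum>T\<in>Pow (cube_index n). f T)"
    using assms finite_cube_index pauli_set_subset by (intro sum_mono2) auto
  finally show ?thesis .
qed

lemma multilinear_cube_coeff:
  "multilinear (cube_index n) (cube_coeff n \<alpha>) x
    = (\<Sum>P | length P = n. \<alpha> P * (\<Prod>q<n. if P ! q = PI then 1 else x (q, P ! q) / 3))"
proof -
  let ?S = "{P :: pauli list. length P = n}"
  let ?h = "\<lambda>P. \<alpha> P / 3 ^ weight P * (\<Prod>i\<in>pauli_set P. x i)"
  have "multilinear (cube_index n) (cube_coeff n \<alpha>) x
      = (\<Sum>T\<in>Pow (cube_index n). \<Sum>P\<in>{P. P \<in> ?S \<and> pauli_set P = T}. ?h P)"
    unfolding multilinear_def cube_coeff_def sum_distrib_right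
    by (rule sum.cong[OF refl], rule sum.cong) auto
  also have "\<dots> = (\<Sum>P\<in>?S. ?h P)"
    using finite_cube_index finite_paulis pauli_set_subset by (intro sum.group) auto
  also have "\<dots> = (\<Sum>P | length P = n. \<alpha> P * (\<Prod>q<n. if P ! q = PI then 1 else x (q, P ! q) / 3))"
  proof (rule sum.cong[OF refl])
    fix P assume "P \<in> ?S"
    then have P: "length P = n" by simp
    let ?A = "{q. q < length P \<and> P ! q \<noteq> PI}"
    have "(\<Prod>i\<in>pauli_set P. x i) = (\<Prod>q\<in>?A. x (q, P ! q))"
      unfolding pauli_set_def by (subst prod.reindex) (auto simp: inj_on_def)
    moreover have "(\<Prod>q<n. if P ! q = PI then 1 else x (q, P ! q) / 3) = (\<Prod>q\<in>?A. x (q, P ! q) / 3)"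
      using P by (intro prod.mono_neutral_cong_right) auto
    moreover have "weight P = card ?A" unfolding weight_def length_filter_conv_card ..
    ultimately show "?h P = \<alpha> P * (\<Prod>q<n. if P ! q = PI then 1 else x (q, P ! q) / 3)"
      by (simp add: prod_dividef)
  qed
  finally show ?thesis .
qed

text \<open>The multilinear polynomial of an operator is its expectation in a random product of
  stabilizer states: each qubit is in the eigenstate \<open>\<plusminus>\<close> of a uniformly random Pauli matrix \<open>p\<close>, with
  bias \<open>x (q, p)\<close>.\<close>

fun stab_weight :: "(pauli \<Rightarrow> real) \<Rightarrow> stab \<Rightarrow> real" where
  "stab_weight y XPlus = (1 + y PX) / 6"
| "stab_weight y XMinus = (1 - y PX) / 6"
| "stab_weight y YPlus = (1 + y PY) / 6"
| "stab_weight y YMinus = (1 - y PY) / 6"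
| "stab_weight y Z0 = (1 + y PZ) / 6"
| "stab_weight y Z1 = (1 - y PZ) / 6"

lemma trace_pauli_stab_state:
  assumes "length P = n" "length ss = n"
  shows "mat_trace (pauli_mat P * stab_state ss) = of_real (\<Prod>q<n. if P ! q = PI then 1 else shadow (P ! q) (ss ! q) / 3)"
proof -
  let ?A = "map pauli1 P" and ?B = "map projector ss"
  have A: "length ?A = n" "set ?A \<subseteq> carrier_mat 2 2" and B: "length ?B = n" "set ?B \<subseteq> carrier_mat 2 2"
    using assms by (auto simp del: carrier_matI)
  have c: "pauli1 p * projector s \<in> carrier_mat 2 2" for p s
    by (rule mult_carrier_mat[OF pauli1_carrier projector_carrier])
  have AB: "length (map2 (*) ?A ?B) = n" "set (map2 (*) ?A ?B) \<subseteq> carrier_mat 2 2"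
    using assms c by (auto simp: set_zip simp del: carrier_matI)
  have nth: "map2 (*) ?A ?B ! q = pauli1 (P ! q) * projector (ss ! q)" if "q < n" for q
    using that assms by simp
  have "mat_trace (pauli_mat P * stab_state ss) = (\<Prod>q<n. mat_trace (map2 (*) ?A ?B ! q))"
    unfolding pauli_mat_def stab_state_def tensor_mult[OF A(1) B(1) A(2) B(2)] by (rule trace_tensor[OF AB])
  also have "\<dots> = (\<Prod>q<n. of_real (if P ! q = PI then 1 else shadow (P ! q) (ss ! q) / 3))"
    by (rule prod.cong[OF refl]) (simp add: nth trace_pauli1_projector del: ket.simps pauli1.simps)
  finally show ?thesis by simp
qed

text \<open>At a point of the cube the weights \<open>W\<close> form a probability distribution on
  products of stabilizer states, under which a nontrivial \<open>P ! q\<close> has mean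
  \<open>x (q, P ! q) / 3\<close>. The polynomial is thus an average of expectations in states, each
  bounded by the spectral norm.\<close>

lemma cube_bounded_pauli_sum:
  "cube_bounded (cube_index n) (cube_coeff n \<alpha>) (spectral_norm (pauli_sum n (\<lambda>P. of_real (\<alpha> P))))"
  unfolding cube_bounded_def
proof (intro allI impI)
  fix x :: "nat \<times> pauli \<Rightarrow> real" assume x: "\<forall>i\<in>cube_index n. \<bar>x i\<bar> \<le> 1"
  define A where "A = pauli_sum n (\<lambda>P. of_real (\<alpha> P))"
  have A: "A \<in> operators n" unfolding A_def by (rule pauli_sum_carrier)
  let ?S = "{ss :: stab list. length ss = n}" and ?P = "{P :: pauli list. length P = n}"
  define w where "w q s = stab_weight (\<lambda>p. x (q, p)) s" for q s
  define W where "W ss = (\<Prod>q<n. w q (ss ! q))" for ss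
  have w0: "0 \<le> w q s" if "q < n" for q s
  proof -
    have "\<bar>x (q, p)\<bar> \<le> 1" if "p \<in> {PX, PY, PZ}" for p using x \<open>q < n\<close> that unfolding cube_index_def by blast
    from this[of PX] this[of PY] this[of PZ] show ?thesis unfolding w_def by (cases s) auto
  qed
  have W0: "0 \<le> W ss" for ss unfolding W_def by (intro prod_nonneg) (auto intro: w0)
  have W1: "(\<Sum>ss\<in>?S. W ss) = 1"
    unfolding W_def by (subst sum_stabs[where g = w], rule prod.neutral) (simp add: w_def field_simps)
  have Wp: "(\<Sum>ss\<in>?S. W ss * (\<Prod>q<n. if P ! q = PI then 1 else shadow (P ! q) (ss ! q) / 3))
      = (\<Prod>q<n. if P ! q = PI then 1 else x (q, P ! q) / 3)" for P
  proof -
    have "(\<Sum>ss\<in>?S. W ss * (\<Prod>q<n. if P ! q = PI then 1 else shadow (P ! q) (ss ! q) / 3))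
        = (\<Sum>ss\<in>?S. \<Prod>q<n. w q (ss ! q) * (if P ! q = PI then 1 else shadow (P ! q) (ss ! q) / 3))"
      unfolding W_def prod.distrib ..
    also have "\<dots> = (\<Prod>q<n. if P ! q = PI then 1 else x (q, P ! q) / 3)"
    proof (subst sum_stabs[where g = "\<lambda>q s. w q s * (if P ! q = PI then 1 else shadow (P ! q) s / 3)"], rule prod.cong[OF refl])
      fix q
      show "w q Z0 * (if P ! q = PI then 1 else shadow (P ! q) Z0 / 3) + w q Z1 * (if P ! q = PI then 1 else shadow (P ! q) Z1 / 3)
        + w q XPlus * (if P ! q = PI then 1 else shadow (P ! q) XPlus / 3) + w q XMinus * (if P ! q = PI then 1 else shadow (P ! q) XMinus / 3)
        + w q YPlus * (if P ! q = PI then 1 else shadow (P ! q) YPlus / 3) + w q YMinus * (if P ! q = PI then 1 else shadow (P ! q) YMinus / 3)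
        = (if P ! q = PI then 1 else x (q, P ! q) / 3)"
        unfolding w_def by (cases "P ! q") (simp_all add: field_simps)
    qed
    finally show ?thesis .
  qed
  have trA: "mat_trace (A * stab_state ss) = (\<Sum>P\<in>?P. of_real (\<alpha> P * (\<Prod>q<n. if P ! q = PI then 1 else shadow (P ! q) (ss ! q) / 3)))"
    if "length ss = n" for ss
  proof -
    have s: "stab_state ss \<in> operators n" by (rule stab_state_carrier[OF that])
    have "mat_trace (A * stab_state ss) = (\<Sum>P\<in>?P. of_real (\<alpha> P) * mat_trace (stab_state ss * pauli_mat P))"
      unfolding trace_mult_comm[OF A s] unfolding A_def by (rule trace_mult_pauli_sum[OF s])
    also have "\<dots> = (\<Sum>P\<in>?P. of_real (\<alpha> P * (\<Prod>q<n. if P ! q = PI then 1 else shadow (P ! q) (ss ! q) / 3)))"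
    proof (rule sum.cong[OF refl])
      fix P assume "P \<in> ?P"
      then have P: "length P = n" by simp
      show "of_real (\<alpha> P) * mat_trace (stab_state ss * pauli_mat P)
          = of_real (\<alpha> P * (\<Prod>q<n. if P ! q = PI then 1 else shadow (P ! q) (ss ! q) / 3))"
        unfolding trace_mult_comm[OF s pauli_mat_carrier[OF P]] trace_pauli_stab_state[OF P that] of_real_mult ..
    qed
    finally show ?thesis .
  qed
  have bound: "cmod (mat_trace (A * stab_state ss)) \<le> spectral_norm A" if "length ss = n" for ss
    using psd_trace_bound[OF A stab_state_psd[OF that]] stab_state_trace[OF that] by simp
  have "complex_of_real (multilinear (cube_index n) (cube_coeff n \<alpha>) x)
      = (\<Sum>P\<in>?P. of_real (\<alpha> P * (\<Sum>ss\<in>?S. W ss * (\<Prod>q<n. if P ! q = PI then 1 else shadow (P ! q) (ss ! q) / 3))))"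
    unfolding multilinear_cube_coeff Wp of_real_sum ..
  also have "\<dots> = (\<Sum>P\<in>?P. \<Sum>ss\<in>?S. of_real (W ss) * of_real (\<alpha> P * (\<Prod>q<n. if P ! q = PI then 1 else shadow (P ! q) (ss ! q) / 3)))"
    unfolding sum_distrib_left of_real_sum of_real_mult by (intro sum.cong refl) (rule mult.left_commute)
  also have "\<dots> = (\<Sum>ss\<in>?S. \<Sum>P\<in>?P. of_real (W ss) * of_real (\<alpha> P * (\<Prod>q<n. if P ! q = PI then 1 else shadow (P ! q) (ss ! q) / 3)))"
    by (rule sum.swap)
  also have "\<dots> = (\<Sum>ss\<in>?S. of_real (W ss) * mat_trace (A * stab_state ss))"
    by (rule sum.cong[OF refl]) (simp only: sum_distrib_left[symmetric] trA mem_Collect_eq)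
  finally have "\<bar>multilinear (cube_index n) (cube_coeff n \<alpha>) x\<bar> = cmod (\<Sum>ss\<in>?S. of_real (W ss) * mat_trace (A * stab_state ss))"
    by (metis norm_of_real)
  also have "\<dots> \<le> (\<Sum>ss\<in>?S. W ss * spectral_norm A)"
  proof (rule order_trans[OF norm_sum], rule sum_mono)
    fix ss assume "ss \<in> ?S"
    then show "cmod (of_real (W ss) * mat_trace (A * stab_state ss)) \<le> W ss * spectral_norm A"
      unfolding norm_mult norm_of_real abs_of_nonneg[OF W0] by (intro mult_left_mono[OF bound W0]) simp
  qed
  also have "\<dots> = spectral_norm A" unfolding sum_distrib_right[symmetric] W1 by simp
  finally show "\<bar>multilinear (cube_index n) (cube_coeff n \<alpha>) x\<bar> \<le> spectral_norm (pauli_sum n (\<lambda>P. of_real (\<alpha> P)))"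
    unfolding A_def .
qed

text \<open>\<open>small_coeffs\<close> applied to the polynomial divided by \<open>M\<close>. Small
  Pauli coefficients stay small, as the scaling divides them by \<open>3 ^ weight P * M\<close>,
  which is at least 1. Undoing it costs at most \<open>9 ^ k * M^2\<close> in the squares, hence the
  use of \<open>\<eta> / 9 ^ k\<close>.\<close>

lemma small_pauli_coeffs:
  fixes \<eta> :: real
  assumes "\<eta> > 0"
  shows "\<exists>\<tau>>0. \<forall>n \<alpha> M. (\<forall>P. length P = n \<longrightarrow> \<alpha> P \<noteq> 0 \<longrightarrow> weight P \<le> k) \<longrightarrow> 1 \<le> M \<longrightarrow>
     spectral_norm (pauli_sum n (\<lambda>P. of_real (\<alpha> P))) \<le> M \<longrightarrow>
     (\<Sum>P | length P = n. if \<bar>\<alpha> P\<bar> \<le> \<tau> then (\<alpha> P)\<^sup>2 else 0) \<le> \<eta> * M\<^sup>2"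
proof -
  have "0 < \<eta> / 9 ^ k" using assms by simp
  from small_coeffs[OF this, where k = k and ?'i = "nat \<times> pauli"] obtain \<tau> where
    \<tau>: "\<tau> > 0" "\<And>(I::(nat \<times> pauli) set) a. finite I \<Longrightarrow> degree_le k I a \<Longrightarrow> cube_bounded I a 1 \<Longrightarrow>
     (\<Sum>S\<in>Pow I. if \<bar>a S\<bar> \<le> \<tau> then (a S)\<^sup>2 else 0) \<le> \<eta> / 9 ^ k" by blast
  show ?thesis
  proof (intro exI[of _ \<tau>] conjI allI impI \<tau>(1))
    fix n \<alpha> M
    assume deg: "\<forall>P. length P = n \<longrightarrow> \<alpha> P \<noteq> 0 \<longrightarrow> weight P \<le> k" and M: "1 \<le> (M::real)"
      and norm: "spectral_norm (pauli_sum n (\<lambda>P. of_real (\<alpha> P))) \<le> M"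
    let ?I = "cube_index n"
    define c where "c T = cube_coeff n \<alpha> T / M" for T
    have "degree_le k ?I (cube_coeff n \<alpha>)" by (rule degree_le_cube_coeff) (use deg in blast)
    then have dc: "degree_le k ?I c" unfolding c_def degree_le_def by simp
    have bc: "cube_bounded ?I c 1"
      unfolding cube_bounded_def
    proof (intro allI impI)
      fix x :: "nat \<times> pauli \<Rightarrow> real" assume x: "\<forall>i\<in>?I. \<bar>x i\<bar> \<le> 1"
      have "\<bar>multilinear ?I (cube_coeff n \<alpha>) x\<bar> \<le> M"
        using cube_bounded_pauli_sum[of n \<alpha>] x norm unfolding cube_bounded_def by (meson order_trans)
      moreover have "multilinear ?I c x = multilinear ?I (cube_coeff n \<alpha>) x / M"
        unfolding multilinear_def c_def by (simp add: sum_divide_distrib)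
      ultimately show "\<bar>multilinear ?I c x\<bar> \<le> 1" using M by simp
    qed
    have "(\<Sum>P | length P = n. if \<bar>\<alpha> P\<bar> \<le> \<tau> then (\<alpha> P)\<^sup>2 else 0)
        \<le> (\<Sum>P | length P = n. 9 ^ k * M\<^sup>2 * (if \<bar>c (pauli_set P)\<bar> \<le> \<tau> then (c (pauli_set P))\<^sup>2 else 0))"
    proof (rule sum_mono)
      fix P assume "P \<in> {P :: pauli list. length P = n}"
      then have P: "length P = n" by simp
      have cP: "c (pauli_set P) = \<alpha> P / (3 ^ weight P * M)"
        unfolding c_def cube_coeff_pauli_set[OF P] by simp
      show "(if \<bar>\<alpha> P\<bar> \<le> \<tau> then (\<alpha> P)\<^sup>2 else 0)
          \<le> 9 ^ k * M\<^sup>2 * (if \<bar>c (pauli_set P)\<bar> \<le> \<tau> then (c (pauli_set P))\<^sup>2 else 0)"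
      proof (cases "\<bar>\<alpha> P\<bar> \<le> \<tau> \<and> \<alpha> P \<noteq> 0")
        case True
        then have w: "weight P \<le> k" using deg P by blast
        have "1 * 1 \<le> (3::real) ^ weight P * M" using M by (intro mult_mono) auto
        then have "\<bar>\<alpha> P\<bar> / (3 ^ weight P * M) \<le> \<bar>\<alpha> P\<bar> / 1" by (intro divide_left_mono) auto
        then have small: "\<bar>c (pauli_set P)\<bar> \<le> \<tau>" using True M unfolding cP by (simp add: abs_mult)
        have "\<alpha> P = 3 ^ weight P * (M * c (pauli_set P))" unfolding cP using M by simp
        then have "(\<alpha> P)\<^sup>2 = (3 ^ weight P)\<^sup>2 * (M\<^sup>2 * (c (pauli_set P))\<^sup>2)" by (simp only: power_mult_distrib)
        also have "\<dots> \<le> 9 ^ k * (M\<^sup>2 * (c (pauli_set P))\<^sup>2)"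
        proof (rule mult_right_mono)
          have "((3::real) ^ weight P)\<^sup>2 = (3\<^sup>2) ^ weight P" by (simp only: power_mult[symmetric] mult.commute)
          also have "\<dots> \<le> 9 ^ k" using w by (simp add: power_increasing)
          finally show "((3::real) ^ weight P)\<^sup>2 \<le> 9 ^ k" .
        qed simp
        finally show ?thesis using True small by (simp add: mult.assoc)
      qed auto
    qed
    also have "\<dots> = 9 ^ k * M\<^sup>2 * (\<Sum>P | length P = n. if \<bar>c (pauli_set P)\<bar> \<le> \<tau> then (c (pauli_set P))\<^sup>2 else 0)"
      by (rule sum_distrib_left[symmetric])
    also have "\<dots> \<le> 9 ^ k * M\<^sup>2 * (\<eta> / 9 ^ k)"
      by (intro mult_left_mono order_trans[OF sum_cube_coeff_ge \<tau>(2)[OF finite_cube_index dc bc]]) auto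
    finally show "(\<Sum>P | length P = n. if \<bar>\<alpha> P\<bar> \<le> \<tau> then (\<alpha> P)\<^sup>2 else 0) \<le> \<eta> * M\<^sup>2" by (simp add: mult.commute)
  qed
qed

section \<open>Locality of bounded-degree observables\<close>

lemma less_power_iff_bits: "i < 2 ^ n \<longleftrightarrow> (\<forall>r\<ge>n. \<not> bit i r)" for i :: nat
proof
  assume "\<forall>r\<ge>n. \<not> bit i r"
  then have "bit (take_bit n i) r = bit i r" for r
    by (cases "r < n") (simp_all add: bit_take_bit_iff)
  then have "take_bit n i = i" by (intro bit_eqI) simp
  then show "i < 2 ^ n" by (metis take_bit_nat_less_exp)
qed (use not_bit_less_power in blast)

lemma bit_flip: "bit (flip_bit q i) r \<longleftrightarrow> (if r = q then \<not> bit i q else bit i r)" for i :: nat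
  by (auto simp: bit_flip_bit_iff)

text \<open>Flip bit \<open>q\<close> in both indices of the trace sum. The entry of
  \<open>A\<close> is unchanged, and it vanishes where the two bits differ. Where they agree, a
  nontrivial Pauli has diagonal entries that change sign or are 0. So the trace equals its own
  negative.\<close>

lemma trace_pauli_acts_trivially:
  assumes A: "A \<in> operators n" and q: "q < n" "acts_trivially n q A" and Q: "length Q = n" "Q ! q \<noteq> PI"
  shows "mat_trace (pauli_mat Q * A) = 0"
proof -
  let ?m = "(2::nat) ^ n"
  define F where "F i j = pauli_mat Q $$ (i, j) * A $$ (j, i)" for i j
  have lt: "flip_bit q i < ?m" if "i < ?m" for i :: nat
    using that q(1) unfolding less_power_iff_bits by (auto simp: bit_flip)
  have inv: "flip_bit q (flip_bit q i) = i" for i :: nat by (rule bit_eqI) (simp add: bit_flip)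
  have unset: "unset_bit q (flip_bit q i) = unset_bit q i" for i :: nat
    by (rule bit_eqI) (auto simp: bit_unset_bit_iff bit_flip)
  have flip: "F (flip_bit q i) (flip_bit q j) = - F i j" if ij: "i < ?m" "j < ?m" for i j
  proof -
    have triv: "A $$ (l, k) = (if bit l q = bit k q then A $$ (unset_bit q l, unset_bit q k) else 0)"
      if "k < ?m" "l < ?m" for k l using q(2) that unfolding acts_trivially_def by blast
    have A': "A $$ (flip_bit q j, flip_bit q i) = A $$ (j, i)"
      unfolding triv[OF lt[OF ij(1)] lt[OF ij(2)]] triv[OF ij] unset by (simp add: bit_flip)
    define R where "R = (\<Prod>r\<in>{..<n} - {q}. entry (pauli1 (Q ! r)) (bit i r) (bit j r))"
    have Qij: "pauli_mat Q $$ (i, j) = entry (pauli1 (Q ! q)) (bit i q) (bit j q) * R"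
      unfolding pauli_mat_index[OF Q(1) ij] R_def using q(1) by (subst prod.remove[of _ q]) auto
    have "(\<Prod>r\<in>{..<n} - {q}. entry (pauli1 (Q ! r)) (bit (flip_bit q i) r) (bit (flip_bit q j) r)) = R"
      unfolding R_def by (intro prod.cong refl) (simp add: bit_flip)
    then have Qf: "pauli_mat Q $$ (flip_bit q i, flip_bit q j) = entry (pauli1 (Q ! q)) (\<not> bit i q) (\<not> bit j q) * R"
      unfolding pauli_mat_index[OF Q(1) lt[OF ij(1)] lt[OF ij(2)]] using q(1)
      by (subst prod.remove[of _ q]) (auto simp: bit_flip)
    show ?thesis
    proof (cases "bit i q = bit j q")
      case True
      then have "entry (pauli1 (Q ! q)) (\<not> bit i q) (\<not> bit j q) = - entry (pauli1 (Q ! q)) (bit i q) (bit j q)"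
        using Q(2) by (cases "Q ! q") (simp_all add: entry_pauli1 del: pauli1.simps)
      then show ?thesis unfolding F_def A' Qij Qf by simp
    next
      case False
      then have "A $$ (j, i) = 0" using triv[OF ij] by auto
      then show ?thesis unfolding F_def A' by simp
    qed
  qed
  have "(\<Sum>i<?m. \<Sum>j<?m. F i j) = (\<Sum>i<?m. \<Sum>j<?m. F (flip_bit q i) (flip_bit q j))"
  proof (rule sum.reindex_bij_witness[of _ "flip_bit q" "flip_bit q"])
    fix i assume "i \<in> {..<?m}"
    show "(\<Sum>j<?m. F (flip_bit q (flip_bit q i)) (flip_bit q j)) = (\<Sum>j<?m. F i j)"
      unfolding inv by (rule sum.reindex_bij_witness[of _ "flip_bit q" "flip_bit q"]) (auto simp: inv lt)
  qed (auto simp: inv lt)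
  also have "\<dots> = (\<Sum>i<?m. \<Sum>j<?m. - F i j)" by (intro sum.cong refl flip) simp_all
  also have "\<dots> = - (\<Sum>i<?m. \<Sum>j<?m. F i j)" by (simp add: sum_negf)
  finally have "(\<Sum>i<?m. \<Sum>j<?m. F i j) = 0" by simp
  then show ?thesis unfolding trace_mult[OF pauli_mat_carrier[OF Q(1)] A] F_def .
qed

lemma card_supported_paulis:
  assumes "B \<subseteq> {..<n}"
  shows "card {Q. length Q = n \<and> (\<forall>q<n. q \<notin> B \<longrightarrow> Q ! q = PI)} = 4 ^ card B"
proof -
  let ?g = "\<lambda>q p. if q \<in> B \<or> p = PI then 1 else (0::nat)"
  have "(\<Prod>q<n. ?g q (Q ! q)) = (if \<forall>q<n. q \<notin> B \<longrightarrow> Q ! q = PI then 1 else 0)" for Q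
  proof (cases "\<forall>q<n. q \<notin> B \<longrightarrow> Q ! q = PI")
    case False
    then obtain q where "q < n" "\<not> (q \<in> B \<or> Q ! q = PI)" by blast
    then have "(\<Prod>q<n. ?g q (Q ! q)) = 0" by (intro prod_zero[OF finite_lessThan] bexI[of _ q]) auto
    then show ?thesis using False by (simp only: if_False)
  next
    case True
    then have "(\<Prod>q<n. ?g q (Q ! q)) = 1" by (intro prod.neutral) auto
    then show ?thesis by (simp only: if_P[OF True])
  qed
  then have "card {Q. length Q = n \<and> (\<forall>q<n. q \<notin> B \<longrightarrow> Q ! q = PI)} = (\<Sum>Q | length Q = n. \<Prod>q<n. ?g q (Q ! q))"
    using finite_paulis by (simp add: sum.If_cases Collect_conj_eq)
  also have "\<dots> = (\<Prod>q<n. if q \<in> B then 4 else 1)"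
    by (subst sum_paulis[where g = ?g], rule prod.cong[OF refl]) simp
  also have "\<dots> = 4 ^ card B" using assms by (subst prod.If_cases) (auto simp: Int_absorb1)
  finally show ?thesis .
qed

text \<open>Reduces the decomposition of the observable to combinatorial data: the supports of the
  few-body terms and the fact that each contributing Pauli string lives on one of them.\<close>

lemma bounded_degree_coeffs:
  assumes "bounded_degree \<kappa> d n Obs"
  obtains m and B :: "nat \<Rightarrow> nat set"
  where "\<And>j. j < m \<Longrightarrow> B j \<subseteq> {..<n}" "\<And>j. j < m \<Longrightarrow> card (B j) \<le> \<kappa>"
    "\<And>q. q < n \<Longrightarrow> card {j. j < m \<and> q \<in> B j} \<le> d"
    "\<And>Q. pauli_coeffs n Obs Q \<noteq> 0 \<Longrightarrow> length Q = n \<and> (\<exists>j<m. \<forall>q<n. q \<notin> B j \<longrightarrow> Q ! q = PI)"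
proof -
  obtain m :: nat and A where Obs: "Obs \<in> operators n" "Obs = mat (2 ^ n) (2 ^ n) (\<lambda>ij. \<Sum>j<m. A j $$ ij)"
    and A: "\<And>j. j < m \<Longrightarrow> A j \<in> operators n \<and> hermitian (A j) \<and> card (support n (A j)) \<le> \<kappa>"
    and deg: "\<And>q. q < n \<Longrightarrow> card {j. j < m \<and> q \<in> support n (A j)} \<le> d"
  proof -
    note raw = assms[unfolded bounded_degree_def]
    have Obs: "Obs \<in> operators n" by (rule raw[THEN conjunct1])
    from raw[THEN conjunct2, THEN conjunct2] obtain m :: nat and A where
      mA: "(\<forall>j < m. A j \<in> operators n \<and> hermitian (A j) \<and> card (support n (A j)) \<le> \<kappa>) \<and>
        (\<forall>q < n. card {j. j < m \<and> q \<in> support n (A j)} \<le> d) \<and>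
        Obs = mat (2 ^ n) (2 ^ n) (\<lambda>ij. \<Sum>j<m. A j $$ ij)" by (elim exE) (rule that)
    show ?thesis
    proof (rule that[of A m])
      show "Obs = mat (2 ^ n) (2 ^ n) (\<lambda>ij. \<Sum>j<m. A j $$ ij)" using mA by (elim conjE)
    qed (use Obs mA in simp_all)
  qed
  have tr: "mat_trace (pauli_mat Q * Obs) = (\<Sum>j<m. mat_trace (pauli_mat Q * A j))" if Q: "length Q = n" for Q
  proof -
    have "mat_trace (pauli_mat Q * Obs) = (\<Sum>i<2 ^ n. \<Sum>k<2 ^ n. \<Sum>j<m. pauli_mat Q $$ (i, k) * A j $$ (k, i))"
      unfolding trace_mult[OF pauli_mat_carrier[OF Q] Obs(1)] sum_distrib_left[symmetric]
      by (intro sum.cong refl) (simp add: Obs(2))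
    also have "\<dots> = (\<Sum>i<2 ^ n. \<Sum>j<m. \<Sum>k<2 ^ n. pauli_mat Q $$ (i, k) * A j $$ (k, i))"
      by (rule sum.cong[OF refl], rule sum.swap)
    also have "\<dots> = (\<Sum>j<m. \<Sum>i<2 ^ n. \<Sum>k<2 ^ n. pauli_mat Q $$ (i, k) * A j $$ (k, i))" by (rule sum.swap)
    also have "\<dots> = (\<Sum>j<m. mat_trace (pauli_mat Q * A j))"
      by (rule sum.cong[OF refl], rule trace_mult[OF pauli_mat_carrier[OF Q], symmetric]) (use A in auto)
    finally show ?thesis .
  qed
  show ?thesis
  proof (rule that[of m "\<lambda>j. support n (A j)"])
    fix Q assume nz: "pauli_coeffs n Obs Q \<noteq> 0"
    then have Q: "length Q = n" unfolding pauli_coeffs_eq[OF Obs(1)] by (auto split: if_splits)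
    then have "(\<Sum>j<m. mat_trace (pauli_mat Q * A j)) \<noteq> 0"
      using nz unfolding pauli_coeffs_eq[OF Obs(1)] tr[OF Q, symmetric] by auto
    then obtain j where "j \<in> {..<m}" and trj: "mat_trace (pauli_mat Q * A j) \<noteq> 0"
      by (rule sum.not_neutral_contains_not_neutral)
    then have j: "j < m" "mat_trace (pauli_mat Q * A j) \<noteq> 0" by simp_all
    have "Q ! q = PI" if "q < n" "q \<notin> support n (A j)" for q
      using trace_pauli_acts_trivially[of "A j" n q Q] A[OF j(1)] j(2) Q that unfolding support_def by blast
    then show "length Q = n \<and> (\<exists>j<m. \<forall>q<n. q \<notin> support n (A j) \<longrightarrow> Q ! q = PI)" using Q j(1) by blast
  qed (use A deg in \<open>auto simp: support_def\<close>)
qed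

lemma bounded_degree_weight:
  assumes "bounded_degree \<kappa> d n Obs" "pauli_coeffs n Obs Q \<noteq> 0"
  shows "weight Q \<le> \<kappa>"
proof -
  obtain m and B :: "nat \<Rightarrow> nat set" where B: "\<And>j. j < m \<Longrightarrow> B j \<subseteq> {..<n}" "\<And>j. j < m \<Longrightarrow> card (B j) \<le> \<kappa>"
    "\<And>q. q < n \<Longrightarrow> card {j. j < m \<and> q \<in> B j} \<le> d"
    "\<And>Q. pauli_coeffs n Obs Q \<noteq> 0 \<Longrightarrow> length Q = n \<and> (\<exists>j<m. \<forall>q<n. q \<notin> B j \<longrightarrow> Q ! q = PI)"
    by (rule bounded_degree_coeffs[OF assms(1)]) blast
  obtain j where j: "length Q = n" "j < m" "\<forall>q<n. q \<notin> B j \<longrightarrow> Q ! q = PI" using B(4)[OF assms(2)] by blast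
  have "weight Q = card {q. q < n \<and> Q ! q \<noteq> PI}" unfolding weight_def length_filter_conv_card j(1) ..
  also have "\<dots> \<le> card (B j)" using j(3) B(1)[OF j(2)] by (intro card_mono) (auto intro: finite_subset)
  finally show ?thesis using B(2)[OF j(2)] by linarith
qed

text \<open>A qubit lies in at most \<open>d\<close> supports, and each of them carries at most
  \<open>4 ^ \<kappa>\<close> Pauli strings. So a variable occurs in at most
  \<open>d * 4 ^ \<kappa>\<close> monomials and \<open>sparse_l1_bound\<close> applies;
  \<open>3 ^ \<kappa>\<close> undoes the scaling of the coefficients.\<close>

lemma pauli_l1_bound:
  "\<exists>C\<ge>0. \<forall>n Obs. admissible_observable \<kappa> d n Obs \<longrightarrow> (\<Sum>Q | length Q = n. \<bar>Re (pauli_coeffs n Obs Q)\<bar>) \<le> C"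
proof -
  obtain C where C: "C \<ge> 0" "\<And>(I::(nat \<times> pauli) set) a M. finite I \<Longrightarrow> degree_le \<kappa> I a \<Longrightarrow> cube_bounded I a M \<Longrightarrow>
     (\<forall>i\<in>I. card {S\<in>Pow I. i \<in> S \<and> a S \<noteq> 0} \<le> d * 4 ^ \<kappa>) \<Longrightarrow> (\<Sum>S\<in>Pow I. \<bar>a S\<bar>) \<le> C * M"
    using sparse_l1_bound[where k = \<kappa> and D = "d * 4 ^ \<kappa>" and ?'i = "nat \<times> pauli"] by blast
  have "(\<Sum>Q | length Q = n. \<bar>Re (pauli_coeffs n Obs Q)\<bar>) \<le> 3 ^ \<kappa> * C"
    if "admissible_observable \<kappa> d n Obs" for n Obs
  proof -
    have bd: "bounded_degree \<kappa> d n Obs" and norm: "spectral_norm Obs \<le> 1"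
      using that unfolding admissible_observable_def by auto
    have Obs: "Obs \<in> operators n" "hermitian Obs" using bd unfolding bounded_degree_def by auto
    define a where "a Q = Re (pauli_coeffs n Obs Q)" for Q
    have nz: "pauli_coeffs n Obs Q \<noteq> 0" if "a Q \<noteq> 0" for Q using that unfolding a_def by auto
    obtain m and B :: "nat \<Rightarrow> nat set" where B: "\<And>j. j < m \<Longrightarrow> B j \<subseteq> {..<n}" "\<And>j. j < m \<Longrightarrow> card (B j) \<le> \<kappa>"
      "\<And>q. q < n \<Longrightarrow> card {j. j < m \<and> q \<in> B j} \<le> d"
      "\<And>Q. pauli_coeffs n Obs Q \<noteq> 0 \<Longrightarrow> length Q = n \<and> (\<exists>j<m. \<forall>q<n. q \<notin> B j \<longrightarrow> Q ! q = PI)"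
      by (rule bounded_degree_coeffs[OF bd]) blast
    let ?I = "cube_index n" and ?c = "cube_coeff n a"
    have "pauli_sum n (\<lambda>Q. of_real (a Q)) = pauli_sum n (pauli_coeffs n Obs)"
      unfolding a_def pauli_coeffs_real[OF Obs, symmetric] ..
    also have "\<dots> = Obs" unfolding pauli_coeffs_eq[OF Obs(1)] by (rule pauli_expansion[OF Obs(1)])
    finally have bc: "cube_bounded ?I ?c 1"
      using cube_bounded_pauli_sum[of n a] norm unfolding cube_bounded_def by (meson order_trans)
    have dc: "degree_le \<kappa> ?I ?c"
      by (rule degree_le_cube_coeff) (use bounded_degree_weight[OF bd] nz in blast)
    have "\<forall>i\<in>?I. card {S\<in>Pow ?I. i \<in> S \<and> ?c S \<noteq> 0} \<le> d * 4 ^ \<kappa>"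
    proof
      fix i assume i: "i \<in> ?I"
      then obtain q p where qp: "i = (q, p)" "q < n" unfolding cube_index_def by auto
      let ?R = "\<lambda>j. {Q. length Q = n \<and> (\<forall>q<n. q \<notin> B j \<longrightarrow> Q ! q = PI)}"
      let ?J = "{j. j < m \<and> q \<in> B j}"
      have finR: "finite (?R j)" for j by (rule finite_subset[OF _ finite_paulis[of n]]) auto
      have "{S\<in>Pow ?I. i \<in> S \<and> ?c S \<noteq> 0} \<subseteq> pauli_set ` (\<Union>j\<in>?J. ?R j)"
      proof
        fix S assume S: "S \<in> {S\<in>Pow ?I. i \<in> S \<and> ?c S \<noteq> 0}"
        then have "?c S \<noteq> 0" by simp
        then obtain Q where Q: "length Q = n" "pauli_set Q = S" "a Q \<noteq> 0" by (rule cube_coeff_nonzero)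
        obtain j where j: "j < m" "\<forall>q<n. q \<notin> B j \<longrightarrow> Q ! q = PI" using B(4)[OF nz[OF Q(3)]] by blast
        have "(q, p) \<in> pauli_set Q" using S Q(2) qp(1) by simp
        then have "Q ! q \<noteq> PI" unfolding mem_pauli_set by simp
        then have "q \<in> B j" using j(2) qp(2) by blast
        then show "S \<in> pauli_set ` (\<Union>j\<in>?J. ?R j)" using Q j by blast
      qed
      then have "card {S\<in>Pow ?I. i \<in> S \<and> ?c S \<noteq> 0} \<le> card (pauli_set ` (\<Union>j\<in>?J. ?R j))"
        using finR by (intro card_mono) auto
      also have "\<dots> \<le> card (\<Union>j\<in>?J. ?R j)" using finR by (intro card_image_le) auto
      also have "\<dots> \<le> (\<Sum>j\<in>?J. card (?R j))" by (rule card_UN_le) simp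
      also have "\<dots> \<le> (\<Sum>j\<in>?J. 4 ^ \<kappa>)"
      proof (rule sum_mono)
        fix j assume "j \<in> ?J"
        then have "j < m" by simp
        then show "card (?R j) \<le> 4 ^ \<kappa>"
          unfolding card_supported_paulis[OF B(1)[OF \<open>j < m\<close>]] by (intro power_increasing B(2)) auto
      qed
      also have "\<dots> \<le> d * 4 ^ \<kappa>" using B(3)[OF qp(2)] by simp
      finally show "card {S\<in>Pow ?I. i \<in> S \<and> ?c S \<noteq> 0} \<le> d * 4 ^ \<kappa>" .
    qed
    from C(2)[OF finite_cube_index dc bc this] have l1: "(\<Sum>S\<in>Pow ?I. \<bar>?c S\<bar>) \<le> C" by simp
    have "(\<Sum>Q | length Q = n. \<bar>a Q\<bar>) \<le> (\<Sum>Q | length Q = n. 3 ^ \<kappa> * \<bar>?c (pauli_set Q)\<bar>)"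
    proof (rule sum_mono)
      fix Q assume "Q \<in> {Q :: pauli list. length Q = n}"
      then have Q: "length Q = n" by simp
      show "\<bar>a Q\<bar> \<le> 3 ^ \<kappa> * \<bar>?c (pauli_set Q)\<bar>"
      proof (cases "a Q = 0")
        case False
        then have "weight Q \<le> \<kappa>" using bounded_degree_weight[OF bd nz] by blast
        then have "(3::real) ^ weight Q \<le> 3 ^ \<kappa>" by (intro power_increasing) auto
        then have "3 ^ weight Q * \<bar>?c (pauli_set Q)\<bar> \<le> 3 ^ \<kappa> * \<bar>?c (pauli_set Q)\<bar>" by (rule mult_right_mono) simp
        moreover have "3 ^ weight Q * \<bar>?c (pauli_set Q)\<bar> = \<bar>a Q\<bar>" unfolding cube_coeff_pauli_set[OF Q] by simp
        ultimately show ?thesis by simp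
      qed simp
    qed
    also have "\<dots> = 3 ^ \<kappa> * (\<Sum>Q | length Q = n. \<bar>?c (pauli_set Q)\<bar>)" by (rule sum_distrib_left[symmetric])
    also have "\<dots> \<le> 3 ^ \<kappa> * (\<Sum>S\<in>Pow ?I. \<bar>?c S\<bar>)" by (intro mult_left_mono sum_cube_coeff_ge) auto
    also have "\<dots> \<le> 3 ^ \<kappa> * C" by (intro mult_left_mono l1) auto
    finally show ?thesis unfolding a_def .
  qed
  note main = this
  show ?thesis
  proof (intro exI[of _ "3 ^ \<kappa> * C"] conjI allI impI)
    show "0 \<le> 3 ^ \<kappa> * C" using C(1) by simp
  qed (rule main)
qed


section \<open>Error of the predictor\<close>

text \<open>A string of weight at most \<open>Suc k\<close> arises from one of weight at most
  \<open>k\<close> by overwriting one of its \<open>n\<close> entries with one of four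
  Paulis.\<close>

lemma card_weight_le:
  assumes "1 \<le> n"
  shows "card {P. length P = n \<and> weight P \<le> k} \<le> (4 * n) ^ k"
proof (induction k)
  case 0
  have "{P. length P = n \<and> weight P \<le> 0} \<subseteq> {replicate n PI}"
    by (auto simp: weight_def filter_empty_conv intro: replicate_eqI)
  then have "card {P. length P = n \<and> weight P \<le> 0} \<le> card {replicate n PI}" by (intro card_mono) simp_all
  then show ?case by simp
next
  case (Suc k)
  let ?S = "\<lambda>k. {P. length P = n \<and> weight P \<le> k}"
  let ?U = "(\<lambda>((q, p), R). R[q := p]) ` (({..<n} \<times> {PI, PX, PY, PZ}) \<times> ?S k)"
  have fin: "finite (?S k)" by (rule finite_subset[OF _ finite_paulis[of n]]) auto
  have "?S (Suc k) \<subseteq> ?U"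
  proof
    fix P assume "P \<in> ?S (Suc k)"
    then have P: "length P = n" "weight P \<le> Suc k" by auto
    have p: "p \<in> {PI, PX, PY, PZ}" for p by (cases p) auto
    have "\<exists>q<n. weight (P[q := PI]) \<le> k"
    proof (cases "weight P = 0")
      case True
      then have "P = replicate n PI" using P(1)
        by (auto simp: weight_def filter_empty_conv intro: replicate_eqI)
      then have "P[0 := PI] = P" using assms by (simp add: list_update_same_conv)
      then show ?thesis using assms True by (intro exI[of _ 0]) auto
    next
      case False
      let ?A = "\<lambda>P. {q. q < length P \<and> P ! q \<noteq> PI}"
      have "?A P \<noteq> {}" using False unfolding weight_eq_card by (metis card.empty)
      then obtain q where q: "q < length P" "P ! q \<noteq> PI" by blast
      have "?A (P[q := PI]) = ?A P - {q}" using q by (auto simp: nth_list_update)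
      then have "weight (P[q := PI]) = weight P - 1"
        unfolding weight_eq_card using q by (simp add: card_Diff_singleton)
      then show ?thesis using P q by (intro exI[of _ q]) auto
    qed
    then obtain q where q: "q < n" "weight (P[q := PI]) \<le> k" by blast
    have "P = (P[q := PI])[q := P ! q]" by simp
    then show "P \<in> ?U" using P q p
      by (intro image_eqI[of _ _ "((q, P ! q), P[q := PI])"]) auto
  qed
  then have "card (?S (Suc k)) \<le> card ?U" using fin by (intro card_mono) auto
  also have "\<dots> \<le> card (({..<n} \<times> {PI, PX, PY, PZ}) \<times> ?S k)" using fin by (intro card_image_le) auto
  also have "\<dots> = 4 * n * card (?S k)" by (simp add: card_cartesian_product)
  also have "\<dots> \<le> (4 * n) ^ Suc k" using Suc.IH by simp
  finally show ?case .
qed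

lemma distinct_paulis: "distinct (paulis n)"
  unfolding paulis_def by (rule distinct_n_lists) simp

lemma length_filter_paulis:
  "length (filter Q (paulis n)) = card {P. length P = n \<and> Q P}"
proof -
  have "card (set (filter Q (paulis n))) = length (filter Q (paulis n))"
    by (rule distinct_card) (simp add: distinct_paulis)
  then show ?thesis by (simp add: set_paulis)
qed

lemma sum_list_filter_paulis:
  "(\<Sum>P\<leftarrow>filter Q (paulis n). f P) = (\<Sum>P | length P = n \<and> Q P. f P)" for f :: "pauli list \<Rightarrow> real"
  by (subst sum_list_distinct_conv_sum_set) (simp_all add: distinct_paulis set_paulis)

text \<open>With \<open>Skip\<close> as the training program, the learned function is represented by
  the training input itself, and all processing of samples is charged to prediction.\<close>

lemma runs_Skip: "runs Skip x 1 x"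
  unfolding runs_def by (intro exI conjI, rule exec.Skip) simp

lemma result_of_Skip: "result_of Skip x = x"
  by (rule result_of_eq[OF runs_Skip])

definition low_paulis :: "nat \<Rightarrow> int \<Rightarrow> pauli list list" where
  "low_paulis n k = filter (\<lambda>P. int (weight P) \<le> k) (paulis n)"

definition terms :: "nat \<Rightarrow> complex mat \<Rightarrow> pauli list list" where
  "terms n Obs = filter (\<lambda>P. pauli_coeffs n Obs P \<noteq> 0) (paulis n)"

lemma runs_predict_input:
  assumes "S \<in> training_sets n N"
  shows "\<exists>t \<le> predictor_time n N (length (low_paulis n (trunc_degree \<epsilon>))) (length (terms n Obs)).
    runs predictor (predict_input Skip n \<epsilon> \<epsilon>' S \<rho> Obs) t
      (Num (prediction n S (low_paulis n (trunc_degree \<epsilon>)) (\<lambda>P. pauli_value P \<rho>) (terms n Obs)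
        (\<lambda>Q. Re (pauli_coeffs n Obs Q))))"
  unfolding predict_input_def result_of_Skip encode_state_def encode_observable_def pauli_value_def
    low_paulis_def[symmetric] terms_def[symmetric]
  by (rule runs_predictor[OF _ _ assms]) (auto simp: low_paulis_def terms_def set_paulis)

lemma learned_function_eq:
  assumes "S \<in> training_sets n N"
  shows "learned_function Skip predictor n \<epsilon> \<epsilon>' S \<rho> Obs
    = prediction n S (low_paulis n (trunc_degree \<epsilon>)) (\<lambda>P. pauli_value P \<rho>) (terms n Obs)
        (\<lambda>Q. Re (pauli_coeffs n Obs Q))"
  using runs_predict_input[OF assms, of \<epsilon> Obs \<epsilon>' \<rho>] result_of_eq unfolding learned_function_def by fastforce

lemma predictor_time_mono: "K \<le> K' \<Longrightarrow> L \<le> L' \<Longrightarrow> predictor_time n N K L \<le> predictor_time n N K' L'"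
  unfolding predictor_time_def by (intro add_mono mult_le_mono) auto

lemma length_low_paulis:
  assumes "1 \<le> n"
  shows "length (low_paulis n k) \<le> (4 * n) ^ nat k"
proof -
  have "card {P. length P = n \<and> int (weight P) \<le> k} \<le> card {P. length P = n \<and> weight P \<le> nat k}"
    by (rule card_mono) (auto intro: finite_subset[OF _ finite_paulis[of n]])
  then show ?thesis unfolding low_paulis_def length_filter_paulis using card_weight_le[OF assms, of "nat k"] by linarith
qed

lemma length_terms:
  assumes "1 \<le> n" "admissible_observable \<kappa> d n Obs"
  shows "length (terms n Obs) \<le> (4 * n) ^ \<kappa>"
proof -
  have "card {P. length P = n \<and> pauli_coeffs n Obs P \<noteq> 0} \<le> card {P. length P = n \<and> weight P \<le> \<kappa>}"
    using bounded_degree_weight assms(2) unfolding admissible_observable_def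
    by (intro card_mono) (auto intro: finite_subset[OF _ finite_paulis[of n]])
  then show ?thesis unfolding terms_def length_filter_paulis using card_weight_le[OF assms(1), of \<kappa>] by linarith
qed

lemma time_bounded_predictor:
  assumes "1 \<le> n"
  shows "time_bounded \<kappa> d Skip predictor n \<epsilon> \<epsilon>' N
    (predictor_time n N ((4 * n) ^ nat (trunc_degree \<epsilon>)) ((4 * n) ^ \<kappa>))"
  unfolding time_bounded_def
proof (intro ballI conjI allI impI)
  fix S assume S: "S \<in> training_sets n N"
  have "1 \<le> predictor_time n N ((4 * n) ^ nat (trunc_degree \<epsilon>)) ((4 * n) ^ \<kappa>)" unfolding predictor_time_def by simp
  then show "halts_within Skip (train_input n \<epsilon> \<epsilon>' S) (predictor_time n N ((4 * n) ^ nat (trunc_degree \<epsilon>)) ((4 * n) ^ \<kappa>))"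
    unfolding halts_within_def using runs_Skip by blast
  fix \<rho> Obs assume "admissible_observable \<kappa> d n Obs"
  then have "predictor_time n N (length (low_paulis n (trunc_degree \<epsilon>))) (length (terms n Obs))
      \<le> predictor_time n N ((4 * n) ^ nat (trunc_degree \<epsilon>)) ((4 * n) ^ \<kappa>)"
    by (intro predictor_time_mono length_low_paulis length_terms assms)
  then show "halts_within predictor (predict_input Skip n \<epsilon> \<epsilon>' S \<rho> Obs)
      (predictor_time n N ((4 * n) ^ nat (trunc_degree \<epsilon>)) ((4 * n) ^ \<kappa>))"
    unfolding halts_within_def using runs_predict_input[OF S, of \<epsilon> Obs \<epsilon>' \<rho>] by (meson order_trans)
qed

text \<open>The weight is an integer above the degree, hence at least \<open>k + 1\<close>. The
  additional factor 2/3 is what leaves \<open>\<epsilon> / 3\<close> for the estimation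
  error.\<close>

lemma tail_weight:
  assumes "0 < \<epsilon>" "trunc_degree \<epsilon> < int w"
  shows "(2 / 3) ^ w \<le> 2 / 3 * \<epsilon>"
proof -
  define k where "k = trunc_degree \<epsilon>"
  have "log 1.5 (1 / \<epsilon>) \<le> k" unfolding k_def trunc_degree_def by linarith
  then have le: "1 / \<epsilon> \<le> 1.5 powr k" using assms by (subst (asm) log_le_iff) auto
  have "(2 / 3 :: real) ^ w = 1.5 powr (- real w)"
    by (simp add: powr_minus powr_realpow power_divide inverse_eq_divide)
  also have "\<dots> \<le> 1.5 powr (- (k + 1))" using assms(2) unfolding k_def[symmetric] by (intro powr_mono) auto
  also have "\<dots> = 2 / 3 * (1 / 1.5 powr k)"
  proof -
    have "real_of_int (- (k + 1)) = - 1 + - real_of_int k" by simp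
    then show ?thesis by (simp only: powr_add) (simp add: powr_minus_divide)
  qed
  also have "\<dots> \<le> 2 / 3 * \<epsilon>"
  proof -
    have "1 / 1.5 powr k \<le> \<epsilon>" using le assms(1) by (simp add: field_simps)
    then show ?thesis by simp
  qed
  finally show ?thesis .
qed

section \<open>From accurate coefficients to accurate predictions\<close>

definition truncated :: "int \<Rightarrow> (pauli list \<Rightarrow> real) \<Rightarrow> pauli list \<Rightarrow> real" where
  "truncated k \<alpha> P = (if int (weight P) \<le> k then \<alpha> P else 0)"

definition filtered :: "nat \<Rightarrow> nat \<Rightarrow> real \<Rightarrow> real" where
  "filtered n N a = (if keep n N a then a else 0)"

text \<open>The deterministic core shared by both regimes: for any coefficients of l2 norm at most 1
  and any estimates that are uniformly within \<open>e\<close>, filtering keeps the squared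
  low-degree error within its share of the bound. The remaining \<open>2/3 * \<epsilon>\<close> is
  reserved for high degrees.\<close>

definition accurate :: "nat \<Rightarrow> nat \<Rightarrow> real \<Rightarrow> real \<Rightarrow> real \<Rightarrow> bool" where
  "accurate n N \<epsilon> \<epsilon>' e \<longleftrightarrow> (\<forall>\<alpha> est. (\<Sum>P | length P = n. (\<alpha> P)\<^sup>2) \<le> 1 \<longrightarrow>
     (\<forall>P. length P = n \<longrightarrow> int (weight P) \<le> trunc_degree \<epsilon> \<longrightarrow> \<bar>est P - \<alpha> P\<bar> \<le> e) \<longrightarrow>
     (\<Sum>P | length P = n \<and> int (weight P) \<le> trunc_degree \<epsilon>. (filtered n N (est P) - \<alpha> P)\<^sup>2)
       \<le> \<epsilon> / 3 + max ((spectral_norm (pauli_sum n (\<lambda>P. of_real (truncated (trunc_degree \<epsilon>) \<alpha> P))))\<^sup>2) 1 * \<epsilon>')"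

definition empirical :: "sample list \<Rightarrow> pauli list \<Rightarrow> pauli list \<Rightarrow> real" where
  "empirical S P Q = (\<Sum>s\<leftarrow>S. sample_value P Q s) / real (length S)"

text \<open>Prediction minus true value is a Pauli sum in \<rho>, so \<open>L2_bound\<close> splits
  the error by degree: \<open>accurate\<close> covers weights up to \<open>k\<close>, and
  \<open>tail_weight\<close> together with the l2 norm of the coefficients covers the
  others.\<close>

lemma (in channel) predicts_well_if:
  assumes S: "S \<in> training_sets n N" and \<epsilon>: "0 < \<epsilon>"
    and C: "\<And>Obs. admissible_observable \<kappa> d n Obs \<Longrightarrow> (\<Sum>Q | length Q = n. \<bar>Re (pauli_coeffs n Obs Q)\<bar>) \<le> C"
    and \<delta>: "0 \<le> \<delta>" and good: "\<And>P Q. length P = n \<Longrightarrow> length Q = n \<Longrightarrow> int (weight P) \<le> trunc_degree \<epsilon> \<Longrightarrow> weight Q \<le> \<kappa> \<Longrightarrow>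
      \<bar>empirical S P Q - transfer P Q\<bar> \<le> \<delta>"
    and acc: "accurate n N \<epsilon> \<epsilon>' (C * \<delta>)"
  shows "predicts_well \<kappa> d n \<epsilon> \<epsilon>' \<E> (learned_function Skip predictor n \<epsilon> \<epsilon>' S)"
  unfolding predicts_well_def
proof (intro allI impI)
  fix D Obs
  assume "state_distribution n D \<and> clifford_invariant n D \<and> admissible_observable \<kappa> d n Obs"
  then have D: "state_distribution n D" "clifford_invariant n D" and adm: "admissible_observable \<kappa> d n Obs" by auto
  interpret clifford_distribution n D by unfold_locales (rule D)+
  have bd: "bounded_degree \<kappa> d n Obs" and norm: "spectral_norm Obs \<le> 1"
    using adm unfolding admissible_observable_def by auto
  have Obs: "Obs \<in> operators n" "hermitian Obs" using bd unfolding bounded_degree_def by auto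
  have lenS: "length S = N" using S unfolding training_sets_def by auto
  define k where "k = trunc_degree \<epsilon>"
  define h where "h = learned_function Skip predictor n \<epsilon> \<epsilon>' S"
  define H where "H = heisenberg Obs"
  have H: "H \<in> operators n" "hermitian H" unfolding H_def using heisenberg_hermitian[OF Obs] by simp_all
  define b where "b Q = Re (pauli_coeffs n Obs Q)" for Q
  define \<alpha> where "\<alpha> P = Re (pauli_coeffs n H P)" for P
  define est where "est P = estimate S (terms n Obs) b P" for P
  have coeffs: "pauli_coeffs n H P = of_real (\<alpha> P)" for P unfolding \<alpha>_def by (rule pauli_coeffs_real[OF H])
  have \<alpha>1: "(\<Sum>P | length P = n. (\<alpha> P)\<^sup>2) \<le> 1"
    using heisenberg_coeffs[OF Obs norm] unfolding H_def[symmetric] coeffs by simp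
  have b0: "b Q = 0" if "pauli_coeffs n Obs Q = 0" for Q using that unfolding b_def by simp
  have est: "est P = (\<Sum>Q | length Q = n. b Q * empirical S P Q)" for P
  proof -
    have "est P = (\<Sum>Q | length Q = n \<and> pauli_coeffs n Obs Q \<noteq> 0. b Q * empirical S P Q)"
      unfolding est_def estimate_def terms_def sum_list_filter_paulis sum_divide_distrib empirical_def by simp
    also have "\<dots> = (\<Sum>Q | length Q = n. b Q * empirical S P Q)"
      using b0 by (intro sum.mono_neutral_left finite_paulis) auto
    finally show ?thesis .
  qed
  \<comment> \<open>The errors of the transfer estimates are weighted by the moduli of the
    coefficients of the observable. Their l1 bound \<open>C\<close> keeps the number of its terms,
    which grows with \<open>n\<close>, out of the estimate.\<close>
  have est_err: "\<bar>est P - \<alpha> P\<bar> \<le> C * \<delta>" if P: "length P = n" "int (weight P) \<le> trunc_degree \<epsilon>" for P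
  proof -
    have "est P - \<alpha> P = (\<Sum>Q | length Q = n. b Q * (empirical S P Q - transfer P Q))"
      unfolding est \<alpha>_def H_def heisenberg_coeff_expansion[OF Obs P(1)] b_def right_diff_distrib sum_subtractf ..
    also have "\<bar>\<dots>\<bar> \<le> (\<Sum>Q | length Q = n. \<bar>b Q\<bar> * \<delta>)"
    proof (rule order_trans[OF sum_abs], rule sum_mono)
      fix Q :: "pauli list" assume "Q \<in> {Q. length Q = n}"
      then have Q: "length Q = n" by simp
      show "\<bar>b Q * (empirical S P Q - transfer P Q)\<bar> \<le> \<bar>b Q\<bar> * \<delta>"
      proof (cases "pauli_coeffs n Obs Q = 0")
        case False
        then have "\<bar>empirical S P Q - transfer P Q\<bar> \<le> \<delta>" by (intro good P Q bounded_degree_weight[OF bd])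
        then show ?thesis unfolding abs_mult by (rule mult_left_mono) simp
      qed (simp add: b0)
    qed
    also have "\<dots> = (\<Sum>Q | length Q = n. \<bar>b Q\<bar>) * \<delta>" by (rule sum_distrib_right[symmetric])
    also have "\<dots> \<le> C * \<delta>" using C[OF adm] \<delta> unfolding b_def by (rule mult_right_mono)
    finally show ?thesis .
  qed
  \<comment> \<open>Beyond degree \<open>k\<close> this is \<open>- \<alpha> P\<close>, since
    nothing is predicted there.\<close>
  define \<gamma> where "\<gamma> P = truncated k (\<lambda>P. filtered n N (est P)) P - \<alpha> P" for P
  have h: "h \<rho> Obs = (\<Sum>P | length P = n. truncated k (\<lambda>P. filtered n N (est P)) P * pauli_value P \<rho>)" for \<rho>
  proof -
    have "h \<rho> Obs = (\<Sum>P | length P = n \<and> int (weight P) \<le> k. filtered n N (est P) * pauli_value P \<rho>)"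
      unfolding h_def learned_function_eq[OF S] prediction_def low_paulis_def sum_list_filter_paulis k_def
        b_def[symmetric] est_def[symmetric] lenS by (intro sum.cong refl) (simp add: filtered_def)
    also have "\<dots> = (\<Sum>P | length P = n. truncated k (\<lambda>P. filtered n N (est P)) P * pauli_value P \<rho>)"
      by (intro sum.mono_neutral_cong_left finite_paulis) (auto simp: truncated_def)
    finally show ?thesis .
  qed
  have err: "(cmod (complex_of_real (h \<rho> Obs) - mat_trace (Obs * \<E> \<rho>)))\<^sup>2 = (\<Sum>P | length P = n. \<gamma> P * pauli_value P \<rho>)\<^sup>2"
    if "\<rho> \<in> space D" for \<rho>
  proof -
    have \<rho>: "\<rho> \<in> density n" using that unfolding space_D .
    have "mat_trace (Obs * \<E> \<rho>) = mat_trace (H * \<rho>)"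
      unfolding H_def by (rule trace_heisenberg[OF Obs(1) density_facts(1)[OF \<rho>], symmetric])
    also have "\<dots> = (\<Sum>P | length P = n. of_real (\<alpha> P) * of_real (pauli_value P \<rho>))"
      unfolding trace_mult_expansion[OF H(1) density_facts(1)[OF \<rho>]] coeffs
      by (intro sum.cong refl) (simp only: trace_pauli_density[OF \<rho>] mem_Collect_eq)
    finally have "complex_of_real (h \<rho> Obs) - mat_trace (Obs * \<E> \<rho>) = of_real (\<Sum>P | length P = n. \<gamma> P * pauli_value P \<rho>)"
      unfolding h \<gamma>_def left_diff_distrib sum_subtractf of_real_diff of_real_sum of_real_mult by simp
    then show ?thesis by (simp only: norm_of_real power2_abs)
  qed
  have "(\<Sum>P | length P = n. (\<gamma> P)\<^sup>2 * (2 / 3) ^ weight P)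
      \<le> (\<Sum>P | length P = n. (if int (weight P) \<le> k then (filtered n N (est P) - \<alpha> P)\<^sup>2 else 0) + 2 / 3 * \<epsilon> * (\<alpha> P)\<^sup>2)"
  proof (rule sum_mono)
    fix P :: "pauli list"
    show "(\<gamma> P)\<^sup>2 * (2 / 3) ^ weight P \<le> (if int (weight P) \<le> k then (filtered n N (est P) - \<alpha> P)\<^sup>2 else 0) + 2 / 3 * \<epsilon> * (\<alpha> P)\<^sup>2"
    proof (cases "int (weight P) \<le> k")
      case True
      have "(\<gamma> P)\<^sup>2 * (2 / 3) ^ weight P \<le> (\<gamma> P)\<^sup>2 * 1" by (intro mult_left_mono power_le_one) auto
      then show ?thesis using True \<epsilon> by (simp add: \<gamma>_def truncated_def add_increasing2)
    next
      case False
      then have "(2 / 3) ^ weight P \<le> 2 / 3 * \<epsilon>" using tail_weight[OF \<epsilon>] unfolding k_def by simp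
      then have "(\<alpha> P)\<^sup>2 * (2 / 3) ^ weight P \<le> (\<alpha> P)\<^sup>2 * (2 / 3 * \<epsilon>)" by (rule mult_left_mono) simp
      then show ?thesis using False by (simp add: \<gamma>_def truncated_def mult.commute)
    qed
  qed
  also have "\<dots> = (\<Sum>P | length P = n \<and> int (weight P) \<le> k. (filtered n N (est P) - \<alpha> P)\<^sup>2) + 2 / 3 * \<epsilon> * (\<Sum>P | length P = n. (\<alpha> P)\<^sup>2)"
    unfolding sum.distrib sum_distrib_left[symmetric] using finite_paulis
    by (simp add: sum.If_cases Collect_conj_eq)
  also have "\<dots> \<le> (\<epsilon> / 3 + max ((spectral_norm (pauli_sum n (\<lambda>P. of_real (truncated k \<alpha> P))))\<^sup>2) 1 * \<epsilon>') + 2 / 3 * \<epsilon> * 1"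
    by (intro add_mono mult_left_mono \<alpha>1 acc[unfolded accurate_def, rule_format, OF \<alpha>1 est_err, folded k_def]) (use \<epsilon> in auto)
  finally have le: "(\<Sum>P | length P = n. (\<gamma> P)\<^sup>2 * (2 / 3) ^ weight P)
      \<le> \<epsilon> + max ((spectral_norm (pauli_sum n (\<lambda>P. of_real (truncated k \<alpha> P))))\<^sup>2) 1 * \<epsilon>'" by simp
  have trunc: "truncation n (trunc_degree \<epsilon>) (dual_map n \<E> Obs) = pauli_sum n (\<lambda>P. of_real (truncated k \<alpha> P))"
    unfolding truncation_def dual_map_eq[OF Obs(1)] H_def[symmetric] coeffs truncated_def k_def
    by (rule arg_cong[where f = "pauli_sum n"]) auto
  show "integrable D (\<lambda>\<rho>. (cmod (complex_of_real (h \<rho> Obs) - mat_trace (Obs * \<E> \<rho>)))\<^sup>2) \<and>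
      (\<integral>\<rho>. (cmod (complex_of_real (h \<rho> Obs) - mat_trace (Obs * \<E> \<rho>)))\<^sup>2 \<partial>D)
        \<le> \<epsilon> + max ((spectral_norm (truncation n (trunc_degree \<epsilon>) (dual_map n \<E> Obs)))\<^sup>2) 1 * \<epsilon>'"
  proof
    show "integrable D (\<lambda>\<rho>. (cmod (complex_of_real (h \<rho> Obs) - mat_trace (Obs * \<E> \<rho>)))\<^sup>2)"
      using L2_bound(1)[of \<gamma>] by (subst Bochner_Integration.integrable_cong[OF refl err])
    have "(\<integral>\<rho>. (cmod (complex_of_real (h \<rho> Obs) - mat_trace (Obs * \<E> \<rho>)))\<^sup>2 \<partial>D)
        = (\<integral>\<rho>. (\<Sum>P | length P = n. \<gamma> P * pauli_value P \<rho>)\<^sup>2 \<partial>D)"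
      by (rule Bochner_Integration.integral_cong[OF refl err])
    then show "(\<integral>\<rho>. (cmod (complex_of_real (h \<rho> Obs) - mat_trace (Obs * \<E> \<rho>)))\<^sup>2 \<partial>D)
        \<le> \<epsilon> + max ((spectral_norm (truncation n (trunc_degree \<epsilon>) (dual_map n \<E> Obs)))\<^sup>2) 1 * \<epsilon>'"
      using L2_bound(2)[of \<gamma>] le unfolding trunc by linarith
  qed
qed

text \<open>A union bound over at most \<open>(4 * n) ^ (k + \<kappa>)\<close> pairs of strings,
  with sample values of modulus at most \<open>3 ^ (k + \<kappa>)\<close> in the Chernoff
  bound.\<close>

lemma (in channel) prob_good:
  assumes n: "1 \<le> n" and N: "0 < N" and \<delta>: "0 < \<delta>"
  shows "measure_pmf.prob (training_pmf n N \<E>)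
     {S. S \<in> training_sets n N \<and> (\<forall>P Q. length P = n \<longrightarrow> length Q = n \<longrightarrow> weight P \<le> k \<longrightarrow> weight Q \<le> \<kappa> \<longrightarrow>
        \<bar>empirical S P Q - transfer P Q\<bar> \<le> \<delta>)}
    \<ge> 1 - 2 * real (4 * n) ^ (k + \<kappa>) * exp (- (real N * \<delta>\<^sup>2 / (2 * 9 ^ (k + \<kappa>))))" 
proof -
  let ?P = "measure_pmf.prob (training_pmf n N \<E>)"
  let ?G = "{S. S \<in> training_sets n N \<and> (\<forall>P Q. length P = n \<longrightarrow> length Q = n \<longrightarrow> weight P \<le> k \<longrightarrow> weight Q \<le> \<kappa> \<longrightarrow>
        \<bar>empirical S P Q - transfer P Q\<bar> \<le> \<delta>)}"
  let ?b = "2 * real (4 * n) ^ (k + \<kappa>) * exp (- (real N * \<delta>\<^sup>2 / (2 * 9 ^ (k + \<kappa>))))"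
  let ?W = "\<lambda>k. {P :: pauli list. length P = n \<and> weight P \<le> k}"
  have fin: "finite (?W k)" for k by (rule finite_subset[OF _ finite_paulis[of n]]) auto
  define bad where "bad PQ = {S. \<delta> \<le> \<bar>(\<Sum>s\<leftarrow>S. sample_value (fst PQ) (snd PQ) s) / real N
      - measure_pmf.expectation (experiment_pmf n \<E>) (sample_value (fst PQ) (snd PQ))\<bar>}" for PQ
  let ?U = "\<Union>PQ\<in>?W k \<times> ?W \<kappa>. bad PQ"
  have one: "?P (bad PQ) \<le> 2 * exp (- (real N * \<delta>\<^sup>2 / (2 * 9 ^ (k + \<kappa>))))" if "PQ \<in> ?W k \<times> ?W \<kappa>" for PQ
  proof -
    have "\<bar>sample_value (fst PQ) (snd PQ) s\<bar> \<le> 3 ^ (k + \<kappa>)" for s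
      by (rule order_trans[OF sample_value_bound]) (use that in \<open>auto intro!: power_increasing add_mono\<close>)
    then have "?P (bad PQ) \<le> 2 * exp (- (real N * \<delta>\<^sup>2 / (2 * (3 ^ (k + \<kappa>))\<^sup>2)))"
      unfolding bad_def training_pmf_def by (intro chernoff \<delta> N) auto
    moreover have "((3::real) ^ (k + \<kappa>))\<^sup>2 = 9 ^ (k + \<kappa>)"
    proof -
      have "((3::real) ^ (k + \<kappa>))\<^sup>2 = (3\<^sup>2) ^ (k + \<kappa>)" by (simp only: power_mult[symmetric] mult.commute)
      then show ?thesis by simp
    qed
    ultimately show ?thesis by simp
  qed
  have "?P ?U \<le> (\<Sum>PQ\<in>?W k \<times> ?W \<kappa>. ?P (bad PQ))"
    by (rule measure_UNION_le) (use fin in auto)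
  also have "\<dots> \<le> real (card (?W k \<times> ?W \<kappa>)) * (2 * exp (- (real N * \<delta>\<^sup>2 / (2 * 9 ^ (k + \<kappa>)))))"
    by (rule sum_bounded_above[OF one])
  also have "\<dots> \<le> real (4 * n) ^ (k + \<kappa>) * (2 * exp (- (real N * \<delta>\<^sup>2 / (2 * 9 ^ (k + \<kappa>)))))"
  proof (rule mult_right_mono)
    have "card (?W k \<times> ?W \<kappa>) \<le> (4 * n) ^ k * (4 * n) ^ \<kappa>"
      unfolding card_cartesian_product by (intro mult_le_mono card_weight_le n)
    then have "real (card (?W k \<times> ?W \<kappa>)) \<le> real ((4 * n) ^ k * (4 * n) ^ \<kappa>)" by (simp only: of_nat_le_iff)
    then show "real (card (?W k \<times> ?W \<kappa>)) \<le> real (4 * n) ^ (k + \<kappa>)" by (simp add: power_add)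
  qed simp
  also have "\<dots> = ?b" by simp
  finally have bad: "?P ?U \<le> ?b" .
  have "1 - ?P ?U = ?P (- ?U)"
    using measure_pmf.prob_compl[of ?U "training_pmf n N \<E>"] by (simp add: Compl_eq_Diff_UNIV)
  also have "\<dots> \<le> ?P ?G"
  proof (rule measure_pmf.finite_measure_mono_AE)
    show "AE S in training_pmf n N \<E>. S \<in> - ?U \<longrightarrow> S \<in> ?G"
      unfolding AE_measure_pmf_iff
    proof (intro ballI impI)
      fix S assume S: "S \<in> set_pmf (training_pmf n N \<E>)" and nb: "S \<in> - ?U"
      then have len: "length S = N" and "set S \<subseteq> set_pmf (experiment_pmf n \<E>)"
        unfolding training_pmf_def set_replicate_pmf by auto
      then have T: "S \<in> training_sets n N" using set_experiment_pmf unfolding training_sets_def by auto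
      have "\<bar>empirical S P Q - transfer P Q\<bar> \<le> \<delta>"
        if "length P = n" "length Q = n" "weight P \<le> k" "weight Q \<le> \<kappa>" for P Q
      proof -
        have "S \<notin> bad (P, Q)" using nb that by blast
        then show ?thesis unfolding bad_def empirical_def len
          by (simp add: expectation_sample_value[OF that(1,2)])
      qed
      with T show "S \<in> ?G" by blast
    qed
  qed simp
  finally show ?thesis using bad by linarith
qed

lemma keep_iff:
  assumes "0 < N" "0 < \<tau>" "real N * \<tau> ^ 4 = real (log_steps n + 1)"
  shows "keep n N a \<longleftrightarrow> \<tau> < \<bar>a\<bar>"
proof -
  have "\<bar>a\<bar> ^ 4 = a * a * a * a" by (simp add: power4_eq_xxxx)
  then have "keep n N a \<longleftrightarrow> real N * \<tau> ^ 4 < real N * \<bar>a\<bar> ^ 4"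
    unfolding keep_def assms(3) by (simp only: mult.commute[of "real N"])
  also have "\<dots> \<longleftrightarrow> \<tau> ^ 4 < \<bar>a\<bar> ^ 4" using assms(1) by simp
  also have "\<dots> \<longleftrightarrow> \<tau> < \<bar>a\<bar>"
    using assms(2) by (meson abs_ge_zero less_imp_le linorder_not_le power_mono power_strict_mono zero_less_numeral)
  finally show ?thesis .
qed

text \<open>Here the filter does no harm: a discarded coefficient is at most
  \<open>2 * \<tau>\<close> and a kept estimate is off by at most \<tau>. The threshold is so small
  that the squares of all these errors can be added.\<close>

lemma accurate_fine:
  assumes n: "1 \<le> n" and N: "0 < N" and \<tau>: "0 < \<tau>" "real N * \<tau> ^ 4 = real (log_steps n + 1)"
    and e: "e \<le> \<tau>" and small: "real (4 * n) ^ nat (trunc_degree \<epsilon>) * (4 * \<tau>\<^sup>2) \<le> \<epsilon> / 3"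
  shows "accurate n N \<epsilon> 0 e"
  unfolding accurate_def
proof (intro allI impI)
  fix \<alpha> est
  assume est: "\<forall>P. length P = n \<longrightarrow> int (weight P) \<le> trunc_degree \<epsilon> \<longrightarrow> \<bar>est P - \<alpha> P\<bar> \<le> e"
  let ?S = "{P. length P = n \<and> int (weight P) \<le> trunc_degree \<epsilon>}"
  have "(\<Sum>P\<in>?S. (filtered n N (est P) - \<alpha> P)\<^sup>2) \<le> of_nat (card ?S) * (4 * \<tau>\<^sup>2)"
  proof (rule sum_bounded_above)
    fix P assume "P \<in> ?S"
    then have P: "length P = n" "int (weight P) \<le> trunc_degree \<epsilon>" by simp_all
    have le: "\<bar>est P - \<alpha> P\<bar> \<le> \<tau>" by (rule order_trans[OF est[rule_format, OF P] e])
    have "\<bar>filtered n N (est P) - \<alpha> P\<bar> \<le> 2 * \<tau>"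
    proof (cases "\<tau> < \<bar>est P\<bar>")
      case True
      then show ?thesis unfolding filtered_def keep_iff[OF N \<tau>] using le \<tau>(1) by (simp only: if_True)
    next
      case False
      then show ?thesis unfolding filtered_def keep_iff[OF N \<tau>] using le \<tau>(1) by (simp only: if_False)
    qed
    then have "\<bar>filtered n N (est P) - \<alpha> P\<bar>\<^sup>2 \<le> (2 * \<tau>)\<^sup>2" by (rule power_mono) simp
    then show "(filtered n N (est P) - \<alpha> P)\<^sup>2 \<le> 4 * \<tau>\<^sup>2" by (simp add: power_mult_distrib)
  qed
  also have "\<dots> \<le> real (4 * n) ^ nat (trunc_degree \<epsilon>) * (4 * \<tau>\<^sup>2)"
  proof (rule mult_right_mono)
    have "real (card ?S) \<le> real ((4 * n) ^ nat (trunc_degree \<epsilon>))"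
      using length_low_paulis[OF n, of "trunc_degree \<epsilon>"] unfolding low_paulis_def length_filter_paulis by (simp only: of_nat_le_iff)
    then show "of_nat (card ?S) \<le> real (4 * n) ^ nat (trunc_degree \<epsilon>)" by simp
  qed simp
  finally show "(\<Sum>P\<in>?S. (filtered n N (est P) - \<alpha> P)\<^sup>2)
      \<le> \<epsilon> / 3 + max ((spectral_norm (pauli_sum n (\<lambda>P. of_real (truncated (trunc_degree \<epsilon>) \<alpha> P))))\<^sup>2) 1 * 0"
    using small by simp
qed

text \<open>Coefficients that survive the filter are at least \<open>\<tau> / 2\<close>, so that their estimates have a
  small relative error; the others are at most \<open>2 * \<tau>\<close>.\<close>

lemma accurate_coarse:
  fixes \<epsilon>' :: real
  assumes "0 < \<epsilon>'"
  shows "\<exists>\<tau>\<^sub>0>0. \<forall>n N \<tau> \<eta> e. 0 < N \<longrightarrow> 0 < \<tau> \<longrightarrow> real N * \<tau> ^ 4 = real (log_steps n + 1) \<longrightarrow> 2 * \<tau> \<le> \<tau>\<^sub>0 \<longrightarrow>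
    0 \<le> \<eta> \<longrightarrow> \<eta> \<le> 1 / 2 \<longrightarrow> 4 * \<eta>\<^sup>2 \<le> \<epsilon> / 3 \<longrightarrow> e \<le> \<eta> * \<tau> \<longrightarrow> accurate n N \<epsilon> \<epsilon>' e"
proof -
  define k where "k = trunc_degree \<epsilon>"
  obtain \<tau>\<^sub>0 where \<tau>0: "\<tau>\<^sub>0 > 0" "\<And>n \<alpha> M. (\<forall>P. length P = n \<longrightarrow> \<alpha> P \<noteq> 0 \<longrightarrow> weight P \<le> nat k) \<Longrightarrow> 1 \<le> M \<Longrightarrow>
     spectral_norm (pauli_sum n (\<lambda>P. of_real (\<alpha> P))) \<le> M \<Longrightarrow>
     (\<Sum>P | length P = n. if \<bar>\<alpha> P\<bar> \<le> \<tau>\<^sub>0 then (\<alpha> P)\<^sup>2 else 0) \<le> \<epsilon>' * M\<^sup>2"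
    using small_pauli_coeffs[OF assms, of "nat k"] by blast
  show ?thesis
  proof (intro exI[of _ \<tau>\<^sub>0] conjI allI impI \<tau>0(1))
    fix n N :: nat and \<tau> \<eta> e :: real
    assume N: "0 < N" and \<tau>: "0 < \<tau>" "real N * \<tau> ^ 4 = real (log_steps n + 1)" and le: "2 * \<tau> \<le> \<tau>\<^sub>0"
      and \<eta>: "0 \<le> \<eta>" "\<eta> \<le> 1 / 2" "4 * \<eta>\<^sup>2 \<le> \<epsilon> / 3" and e: "e \<le> \<eta> * \<tau>"
    show "accurate n N \<epsilon> \<epsilon>' e"
      unfolding accurate_def k_def[symmetric]
    proof (intro allI impI)
      fix \<alpha> est
      assume \<alpha>1: "(\<Sum>P | length P = n. (\<alpha> P)\<^sup>2) \<le> 1"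
        and est: "\<forall>P. length P = n \<longrightarrow> int (weight P) \<le> k \<longrightarrow> \<bar>est P - \<alpha> P\<bar> \<le> e"
      define a where "a = truncated k \<alpha>"
      define M where "M = spectral_norm (pauli_sum n (\<lambda>P. of_real (a P)))"
      let ?S = "{P. length P = n \<and> int (weight P) \<le> k}"
      have "(\<Sum>P\<in>?S. (filtered n N (est P) - \<alpha> P)\<^sup>2)
          \<le> (\<Sum>P\<in>?S. 4 * \<eta>\<^sup>2 * (\<alpha> P)\<^sup>2 + (if \<bar>a P\<bar> \<le> \<tau>\<^sub>0 then (a P)\<^sup>2 else 0))"
      proof (rule sum_mono)
        fix P assume P: "P \<in> ?S"
        have aP: "a P = \<alpha> P" using P unfolding a_def truncated_def by simp
        have "length P = n" "int (weight P) \<le> k" using P by simp_all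
        then have err: "\<bar>est P - \<alpha> P\<bar> \<le> \<eta> * \<tau>" by (rule order_trans[OF est[rule_format] e])
        have "\<eta> * \<tau> \<le> 1 / 2 * \<tau>" using \<eta> \<tau> by (intro mult_right_mono) auto
        then have half: "\<eta> * \<tau> \<le> \<tau> / 2" by simp
        show "(filtered n N (est P) - \<alpha> P)\<^sup>2 \<le> 4 * \<eta>\<^sup>2 * (\<alpha> P)\<^sup>2 + (if \<bar>a P\<bar> \<le> \<tau>\<^sub>0 then (a P)\<^sup>2 else 0)"
        proof (cases "\<tau> < \<bar>est P\<bar>")
          case True
          then have "\<tau> \<le> 2 * \<bar>\<alpha> P\<bar>" using err half by linarith
          then have "\<eta> * \<tau> \<le> \<eta> * (2 * \<bar>\<alpha> P\<bar>)" using \<eta>(1) by (rule mult_left_mono)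
          then have "\<bar>est P - \<alpha> P\<bar> \<le> 2 * \<eta> * \<bar>\<alpha> P\<bar>" using err by linarith
          then have "\<bar>est P - \<alpha> P\<bar>\<^sup>2 \<le> (2 * \<eta> * \<bar>\<alpha> P\<bar>)\<^sup>2" by (rule power_mono) simp
          then have "(est P - \<alpha> P)\<^sup>2 \<le> 4 * \<eta>\<^sup>2 * (\<alpha> P)\<^sup>2" by (simp add: power_mult_distrib)
          then show ?thesis using True unfolding filtered_def keep_iff[OF N \<tau>] by (simp add: add_increasing2)
        next
          case False
          then have "\<bar>\<alpha> P\<bar> \<le> \<tau>\<^sub>0" using err half le \<tau>(1) by linarith
          then show ?thesis using False unfolding filtered_def keep_iff[OF N \<tau>] aP by simp
        qed
      qed
      also have "\<dots> \<le> (\<Sum>P | length P = n. 4 * \<eta>\<^sup>2 * (\<alpha> P)\<^sup>2 + (if \<bar>a P\<bar> \<le> \<tau>\<^sub>0 then (a P)\<^sup>2 else 0))"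
        by (intro sum_mono2 finite_paulis) auto
      also have "\<dots> = 4 * \<eta>\<^sup>2 * (\<Sum>P | length P = n. (\<alpha> P)\<^sup>2) + (\<Sum>P | length P = n. if \<bar>a P\<bar> \<le> \<tau>\<^sub>0 then (a P)\<^sup>2 else 0)"
        by (simp only: sum.distrib sum_distrib_left)
      \<comment> \<open>The maximum with 1 meets the requirement \<open>1 \<le> M\<close> of the
        bound on small coefficients; it reappears as the maximum in the error bound.\<close>
      also have "\<dots> \<le> 4 * \<eta>\<^sup>2 * 1 + \<epsilon>' * (max M 1)\<^sup>2"
      proof (intro add_mono mult_left_mono \<alpha>1)
        show "(\<Sum>P | length P = n. if \<bar>a P\<bar> \<le> \<tau>\<^sub>0 then (a P)\<^sup>2 else 0) \<le> \<epsilon>' * (max M 1)\<^sup>2"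
        proof (rule \<tau>0(2))
          show "\<forall>P. length P = n \<longrightarrow> a P \<noteq> 0 \<longrightarrow> weight P \<le> nat k" unfolding a_def truncated_def by auto
          show "spectral_norm (pauli_sum n (\<lambda>P. of_real (a P))) \<le> max M 1" unfolding M_def by simp
        qed simp
      qed simp
      also have "\<dots> \<le> \<epsilon> / 3 + max (M\<^sup>2) 1 * \<epsilon>'"
      proof -
        have "(max M 1)\<^sup>2 \<le> max (M\<^sup>2) 1" by (cases "1 \<le> M") (auto simp: max_def)
        then have "\<epsilon>' * (max M 1)\<^sup>2 \<le> \<epsilon>' * max (M\<^sup>2) 1" using assms by (intro mult_left_mono) auto
        then show ?thesis using \<eta>(3) by (simp add: mult.commute)
      qed
      finally show "(\<Sum>P\<in>?S. (filtered n N (est P) - \<alpha> P)\<^sup>2)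
          \<le> \<epsilon> / 3 + max ((spectral_norm (pauli_sum n (\<lambda>P. of_real (truncated k \<alpha> P))))\<^sup>2) 1 * \<epsilon>'"
        unfolding M_def a_def .
    qed
  qed
qed


section \<open>Sample size and running time\<close>

lemma learns_if:
  assumes n: "1 \<le> n" and N: "0 < N" and \<epsilon>: "0 < \<epsilon>" and \<delta>: "0 < \<delta>"
    and C: "\<And>Obs. admissible_observable \<kappa> d n Obs \<Longrightarrow> (\<Sum>Q | length Q = n. \<bar>Re (pauli_coeffs n Obs Q)\<bar>) \<le> C"
    and acc: "accurate n N \<epsilon> \<epsilon>' (C * \<delta>)"
    and fail: "2 * real (4 * n) ^ (nat (trunc_degree \<epsilon>) + \<kappa>) *
      exp (- (real N * \<delta>\<^sup>2 / (2 * 9 ^ (nat (trunc_degree \<epsilon>) + \<kappa>)))) \<le> 1 - p"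
  shows "learns \<kappa> d p Skip predictor n \<epsilon> \<epsilon>' N"
  unfolding learns_def
proof (intro allI impI)
  fix \<E> assume "cptp n \<E>"
  then interpret channel n \<E> by unfold_locales
  let ?K = "nat (trunc_degree \<epsilon>)"
  let ?G = "{S. S \<in> training_sets n N \<and> (\<forall>P Q. length P = n \<longrightarrow> length Q = n \<longrightarrow> weight P \<le> ?K \<longrightarrow> weight Q \<le> \<kappa> \<longrightarrow>
        \<bar>empirical S P Q - transfer P Q\<bar> \<le> \<delta>)}"
  let ?H = "{S. predicts_well \<kappa> d n \<epsilon> \<epsilon>' \<E> (learned_function Skip predictor n \<epsilon> \<epsilon>' S)}"
  have "?G \<subseteq> ?H"
  proof
    fix S assume "S \<in> ?G"
    then have S: "S \<in> training_sets n N" and good: "\<And>P Q. length P = n \<Longrightarrow> length Q = n \<Longrightarrow> weight P \<le> ?K \<Longrightarrow>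
        weight Q \<le> \<kappa> \<Longrightarrow> \<bar>empirical S P Q - transfer P Q\<bar> \<le> \<delta>" by simp_all
    have "predicts_well \<kappa> d n \<epsilon> \<epsilon>' \<E> (learned_function Skip predictor n \<epsilon> \<epsilon>' S)"
    proof (rule predicts_well_if[OF S \<epsilon> C less_imp_le[OF \<delta>] _ acc])
      fix P Q :: "pauli list"
      assume "length P = n" "length Q = n" "int (weight P) \<le> trunc_degree \<epsilon>" "weight Q \<le> \<kappa>"
      then show "\<bar>empirical S P Q - transfer P Q\<bar> \<le> \<delta>" by (intro good) linarith+
    qed
    then show "S \<in> ?H" by simp
  qed
  then have "measure_pmf.prob (training_pmf n N \<E>) ?G \<le> measure_pmf.prob (training_pmf n N \<E>) ?H"
    by (intro measure_pmf.finite_measure_mono) simp_all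
  then show "p \<le> measure_pmf.prob (training_pmf n N \<E>) ?H"
    using prob_good[OF n N \<delta>, of ?K \<kappa>] fail by linarith
qed

definition samples :: "nat \<Rightarrow> nat \<Rightarrow> nat" where
  "samples m n = m\<^sup>2 * (log_steps n + 1)"

lemma threshold_power:
  assumes "1 \<le> m"
  shows "real (samples m n) * (1 / sqrt (real m)) ^ 4 = real (log_steps n + 1)"
proof -
  have 1: "sqrt (real m) ^ 4 = (real m)\<^sup>2"
    by (simp add: power4_eq_xxxx power2_eq_square)
  have 2: "((real m)\<^sup>2 * L) * (1 / (real m)\<^sup>2) = L" for L using assms by simp
  show ?thesis unfolding samples_def of_nat_mult of_nat_power power_divide 1 power_one by (rule 2)
qed

text \<open>Writes the base of the union bound as an exponential in the same logarithm that
  multiplies the number of samples, so that the exponents can be compared.\<close>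

lemma four_times_le: "1 \<le> n \<Longrightarrow> real (4 * n) \<le> exp (2 * real (log_steps n + 1))"
proof -
  assume "1 \<le> n"
  have "4 * n \<le> 4 * 2 ^ log_steps n" using log_steps_le[of n] by simp
  also have "\<dots> = 2 ^ (log_steps n + 2)" by simp
  also have "\<dots> \<le> 2 ^ (2 * (log_steps n + 1))" by (rule power_increasing) simp_all
  finally have "real (4 * n) \<le> real (2 ^ (2 * (log_steps n + 1)))" by (simp only: of_nat_le_iff)
  also have "\<dots> = 2 ^ (2 * (log_steps n + 1))" by simp
  also have "\<dots> \<le> exp 1 ^ (2 * (log_steps n + 1))"
    using exp_ge_add_one_self[of 1] by (intro power_mono) auto
  also have "\<dots> = exp (2 * real (log_steps n + 1))" by (simp only: exp_of_nat_mult[symmetric] of_nat_mult of_nat_numeral mult_1_right)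
  finally show ?thesis .
qed

text \<open>Of the factor \<open>m^2\<close> in the number of samples, one \<open>m\<close> is
  consumed by the squared accuracy and the other stays in the Chernoff exponent, along with the
  logarithm. There it has to exceed \<open>2 * J\<close> for the union bound and \<open>w\<close>
  for the failure probability.\<close>

lemma failure_bound:
  assumes n: "1 \<le> n" and m: "1 \<le> m" and C: "0 < C" and w: "0 \<le> w" "2 * exp (- w) \<le> 1 - p"
    and big: "(2 * real J + w) * (2 * C\<^sup>2 * 9 ^ J) \<le> real m * \<eta>\<^sup>2"
  shows "2 * real (4 * n) ^ J * exp (- (real (samples m n) * (\<eta> * (1 / sqrt (real m)) / C)\<^sup>2 / (2 * 9 ^ J))) \<le> 1 - p"
proof -
  define L where "L = real (log_steps n + 1)"
  have L: "1 \<le> L" unfolding L_def by simp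
  have "real (samples m n) * (\<eta> * (1 / sqrt (real m)) / C)\<^sup>2 / (2 * 9 ^ J) = L * (real m * \<eta>\<^sup>2 / (2 * C\<^sup>2 * 9 ^ J))"
  proof -
    have "(\<eta> * (1 / sqrt (real m)) / C)\<^sup>2 = \<eta>\<^sup>2 / (real m * C\<^sup>2)"
      by (simp add: power_mult_distrib power_divide)
    moreover have "real (samples m n) = real m * real m * L"
      unfolding samples_def L_def of_nat_mult of_nat_power power2_eq_square ..
    moreover have "real m \<noteq> 0" using m by simp
    ultimately show ?thesis using C by (simp add: field_simps)
  qed
  moreover have "2 * real J + w \<le> real m * \<eta>\<^sup>2 / (2 * C\<^sup>2 * 9 ^ J)"
    using big C by (simp add: pos_le_divide_eq)
  then have "L * (2 * real J + w) \<le> L * (real m * \<eta>\<^sup>2 / (2 * C\<^sup>2 * 9 ^ J))" using L by (intro mult_left_mono) auto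
  ultimately have "exp (- (real (samples m n) * (\<eta> * (1 / sqrt (real m)) / C)\<^sup>2 / (2 * 9 ^ J))) \<le> exp (- (L * (2 * real J + w)))"
    by simp
  moreover have "real (4 * n) ^ J \<le> exp (2 * L) ^ J" using four_times_le[OF n] unfolding L_def by (intro power_mono) auto
  then have "real (4 * n) ^ J \<le> exp (real J * (2 * L))" by (simp only: exp_of_nat_mult)
  ultimately have "2 * real (4 * n) ^ J * exp (- (real (samples m n) * (\<eta> * (1 / sqrt (real m)) / C)\<^sup>2 / (2 * 9 ^ J)))
      \<le> 2 * exp (real J * (2 * L)) * exp (- (L * (2 * real J + w)))" by (intro mult_mono) auto
  also have "\<dots> = 2 * exp (- (L * w))" unfolding mult.assoc exp_add[symmetric] by (simp add: algebra_simps)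
  also have "\<dots> \<le> 2 * exp (- w)" using mult_right_mono[OF L w(1)] by simp
  finally show ?thesis using w(2) by linarith
qed

lemma exponent_exists:
  assumes "p < (1::real)"
  obtains w where "0 \<le> w" "2 * exp (- w) \<le> 1 - p"
proof (rule that[of "max 0 (- ln ((1 - p) / 2))"])
  have "exp (- max 0 (- ln ((1 - p) / 2))) \<le> exp (ln ((1 - p) / 2))" by simp
  also have "\<dots> = (1 - p) / 2" using assms by simp
  finally show "2 * exp (- max 0 (- ln ((1 - p) / 2))) \<le> 1 - p" by simp
qed simp

lemma coarse_learning:
  assumes p: "p < 1" and \<epsilon>: "0 < \<epsilon>" and \<epsilon>': "0 < \<epsilon>'"
  shows "\<exists>m. \<forall>n\<ge>1. learns \<kappa> d p Skip predictor n \<epsilon> \<epsilon>' (samples m n)"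
proof -
  obtain w where w: "0 \<le> w" "2 * exp (- w) \<le> 1 - p" using exponent_exists[OF p] .
  obtain C where C: "C \<ge> 0" "\<And>n Obs. admissible_observable \<kappa> d n Obs \<Longrightarrow> (\<Sum>Q | length Q = n. \<bar>Re (pauli_coeffs n Obs Q)\<bar>) \<le> C"
    using pauli_l1_bound[of \<kappa> d] by blast
  obtain \<tau>\<^sub>0 where \<tau>0: "\<tau>\<^sub>0 > 0" "\<And>n N \<tau> \<eta> e. 0 < N \<Longrightarrow> 0 < \<tau> \<Longrightarrow> real N * \<tau> ^ 4 = real (log_steps n + 1) \<Longrightarrow> 2 * \<tau> \<le> \<tau>\<^sub>0 \<Longrightarrow>
    0 \<le> \<eta> \<Longrightarrow> \<eta> \<le> 1 / 2 \<Longrightarrow> 4 * \<eta>\<^sup>2 \<le> \<epsilon> / 3 \<Longrightarrow> e \<le> \<eta> * \<tau> \<Longrightarrow> accurate n N \<epsilon> \<epsilon>' e"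
    using accurate_coarse[OF \<epsilon>', of \<epsilon>] by blast
  \<comment> \<open>One is added because the accuracy is divided by this constant.\<close>
  define C' where "C' = C + 1"
  have C': "0 < C'" using C(1) unfolding C'_def by simp
  define J where "J = nat (trunc_degree \<epsilon>) + \<kappa>"
  \<comment> \<open>The error relative to the threshold: at most 1/2, so that kept coefficients are
    at least half the threshold, and with \<open>4 * \<eta>^2\<close> within the share
    \<open>\<epsilon> / 3\<close>.\<close>
  define \<eta> where "\<eta> = min (1 / 2) (sqrt (\<epsilon> / 12))"
  have \<eta>: "0 < \<eta>" "\<eta> \<le> 1 / 2" unfolding \<eta>_def using \<epsilon> by auto
  have "\<eta>\<^sup>2 \<le> (sqrt (\<epsilon> / 12))\<^sup>2" unfolding \<eta>_def using \<epsilon> by (intro power_mono) auto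
  then have \<eta>2: "4 * \<eta>\<^sup>2 \<le> \<epsilon> / 3" using \<epsilon> by simp
  \<comment> \<open>Three demands: the threshold \<open>1 / sqrt m\<close> is defined, it is at most
    \<open>\<tau>\<^sub>0 / 2\<close>, and the Chernoff exponent is large enough for
    \<open>failure_bound\<close>.\<close>
  obtain m :: nat where m: "max 1 (max (4 / \<tau>\<^sub>0\<^sup>2) ((2 * real J + w) * (2 * C'\<^sup>2 * 9 ^ J) / \<eta>\<^sup>2)) \<le> real m"
    using real_arch_simple by blast
  have m1: "1 \<le> m" using m by simp
  have big: "(2 * real J + w) * (2 * C'\<^sup>2 * 9 ^ J) \<le> real m * \<eta>\<^sup>2"
    using m \<eta> by (simp add: pos_divide_le_eq)
  have "4 \<le> real m * \<tau>\<^sub>0\<^sup>2" using m \<tau>0(1) by (simp add: pos_divide_le_eq)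
  then have "sqrt 4 \<le> sqrt (real m * \<tau>\<^sub>0\<^sup>2)" by (rule real_sqrt_le_mono)
  then have "2 \<le> sqrt (real m) * \<tau>\<^sub>0" using \<tau>0(1) by (simp add: real_sqrt_mult)
  then have small: "2 * (1 / sqrt (real m)) \<le> \<tau>\<^sub>0" using m1 by (simp add: pos_divide_le_eq mult.commute)
  have "learns \<kappa> d p Skip predictor n \<epsilon> \<epsilon>' (samples m n)" if n: "1 \<le> n" for n
  proof (rule learns_if[OF n _ \<epsilon>, where C = C' and \<delta> = "\<eta> * (1 / sqrt (real m)) / C'"])
    show pos: "0 < samples m n" unfolding samples_def using m1 by simp
    show "0 < \<eta> * (1 / sqrt (real m)) / C'" using \<eta> m1 C' by simp
    show "(\<Sum>Q | length Q = n. \<bar>Re (pauli_coeffs n Obs Q)\<bar>) \<le> C'" if "admissible_observable \<kappa> d n Obs" for Obs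
      using C(2)[OF that] unfolding C'_def by simp
    show "accurate n (samples m n) \<epsilon> \<epsilon>' (C' * (\<eta> * (1 / sqrt (real m)) / C'))"
      by (rule \<tau>0(2)[OF pos _ threshold_power[OF m1] small less_imp_le[OF \<eta>(1)] \<eta>(2) \<eta>2]) (use m1 C' in auto)
    show "2 * real (4 * n) ^ (nat (trunc_degree \<epsilon>) + \<kappa>) * exp (- (real (samples m n) * (\<eta> * (1 / sqrt (real m)) / C')\<^sup>2 /
        (2 * 9 ^ (nat (trunc_degree \<epsilon>) + \<kappa>)))) \<le> 1 - p"
      using failure_bound[OF n m1 C' w big] unfolding J_def .
  qed
  then show ?thesis by blast
qed

text \<open>For \<epsilon> up to 2/3 the logarithm that is rounded up is at least 1, so rounding at
  most doubles it.\<close>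

lemma small_error_degree:
  assumes "0 < \<epsilon>" "\<epsilon> \<le> 2 / 3"
  shows "1 \<le> nat (trunc_degree \<epsilon>)" "1 \<le> \<epsilon> * 2 ^ nat (trunc_degree \<epsilon>)"
    "real (nat (trunc_degree \<epsilon>)) \<le> 2 / ln 1.5 * ln (1 / \<epsilon>)"
proof -
  define y where "y = log 1.5 (1 / \<epsilon>)"
  have "1.5 \<le> 1 / \<epsilon>" using assms by (simp add: field_simps)
  then have y: "1 \<le> y" unfolding y_def using assms by (subst le_log_iff) auto
  have K: "y \<le> real (nat (trunc_degree \<epsilon>))" "real (nat (trunc_degree \<epsilon>)) \<le> y + 1"
    unfolding trunc_degree_def y_def[symmetric] using y by linarith+
  show "1 \<le> nat (trunc_degree \<epsilon>)" using K(1) y by linarith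
  have "1 / \<epsilon> = 1.5 powr y" unfolding y_def using assms by simp
  also have "\<dots> \<le> 1.5 powr real (nat (trunc_degree \<epsilon>))" by (rule powr_mono[OF K(1)]) simp
  also have "\<dots> = 1.5 ^ nat (trunc_degree \<epsilon>)" by (rule powr_realpow) simp
  also have "\<dots> \<le> 2 ^ nat (trunc_degree \<epsilon>)" by (rule power_mono) auto
  finally show "1 \<le> \<epsilon> * 2 ^ nat (trunc_degree \<epsilon>)" using assms(1) by (simp add: pos_divide_le_eq mult.commute)
  have "y = ln (1 / \<epsilon>) / ln 1.5" unfolding y_def log_def ..
  moreover have "real (nat (trunc_degree \<epsilon>)) \<le> 2 * y" using K(2) y by linarith
  ultimately show "real (nat (trunc_degree \<epsilon>)) \<le> 2 / ln 1.5 * ln (1 / \<epsilon>)" by simp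
qed

text \<open>All quantities to be beaten are of the form constant to the power \<open>K\<close>,
  possibly times \<open>n ^ K\<close>: the inverse error, the number of coefficients and the range
  of the sample values. As \<open>n\<close> is at least 2 and \<open>K\<close> at least 1, a fixed
  multiple of \<open>K\<close> in the exponent of \<open>n\<close> absorbs all of them.\<close>

lemma fine_learning:
  assumes p: "p < 1"
  shows "\<exists>r. \<forall>\<epsilon> n. 0 < \<epsilon> \<longrightarrow> \<epsilon> \<le> 2 / 3 \<longrightarrow> 2 \<le> n \<longrightarrow>
    learns \<kappa> d p Skip predictor n \<epsilon> 0 (samples (n ^ (r * nat (trunc_degree \<epsilon>))) n)"
proof -
  obtain w where w: "0 \<le> w" "2 * exp (- w) \<le> 1 - p" using exponent_exists[OF p] .
  obtain C where C: "C \<ge> 0" "\<And>n Obs. admissible_observable \<kappa> d n Obs \<Longrightarrow> (\<Sum>Q | length Q = n. \<bar>Re (pauli_coeffs n Obs Q)\<bar>) \<le> C"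
    using pauli_l1_bound[of \<kappa> d] by blast
  define C' where "C' = C + 1"
  have C': "0 < C'" using C(1) unfolding C'_def by simp
  \<comment> \<open>All factors that depend on neither \<open>K\<close> nor \<open>n\<close>,
    replaced by a power of two.\<close>
  obtain W where W: "2 * C'\<^sup>2 * ((2 + 2 * real \<kappa> + w) * 9 ^ \<kappa>) < 2 ^ W"
    using real_arch_pow[of 2] by auto
  show ?thesis
  proof (intro exI[of _ "W + 8"] allI impI)
    fix \<epsilon> :: real and n :: nat
    assume \<epsilon>: "0 < \<epsilon>" "\<epsilon> \<le> 2 / 3" and n2: "2 \<le> n"
    define K where "K = nat (trunc_degree \<epsilon>)"
    define m where "m = n ^ ((W + 8) * K)"
    \<comment> \<open>The exponent \<open>(W + 8) * K\<close> serves two estimates: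
      \<open>W + 5 * K\<close> is needed for the failure probability and \<open>4 + 4 * K\<close>
      for the total squared error.\<close>
    note deg = small_error_degree[OF \<epsilon>, folded K_def]
    have n: "1 \<le> n" using n2 by simp
    have m1: "1 \<le> m" unfolding m_def using n by simp
    have x: "2 \<le> real n" using n2 by simp
    have pow: "(2::real) ^ a \<le> real n ^ b" if "a \<le> b" for a b
    proof -
      have "(2::real) ^ a \<le> 2 ^ b" using that by (intro power_increasing) auto
      also have "\<dots> \<le> real n ^ b" using x by (intro power_mono) auto
      finally show ?thesis .
    qed
    have rm: "real m = real n ^ ((W + 8) * K)" unfolding m_def by simp
    have big: "(2 * real (K + \<kappa>) + w) * (2 * C'\<^sup>2 * 9 ^ (K + \<kappa>)) \<le> real m * 1\<^sup>2"
    proof -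
      have "2 * real (K + \<kappa>) + w \<le> (2 + 2 * real \<kappa> + w) * real K"
      proof -
        have "(2 * real \<kappa> + w) * 1 \<le> (2 * real \<kappa> + w) * real K" using deg(1) w(1) by (intro mult_left_mono) auto
        then show ?thesis by (simp add: algebra_simps)
      qed
      also have "\<dots> \<le> (2 + 2 * real \<kappa> + w) * 2 ^ K"
        using w(1) less_imp_le[OF of_nat_less_two_power[of K]] by (intro mult_left_mono) auto
      finally have "(2 * real (K + \<kappa>) + w) * (2 * C'\<^sup>2 * 9 ^ (K + \<kappa>)) \<le> ((2 + 2 * real \<kappa> + w) * 2 ^ K) * (2 * C'\<^sup>2 * 9 ^ (K + \<kappa>))"
        by (rule mult_right_mono) simp
      also have "\<dots> = (2 * C'\<^sup>2 * ((2 + 2 * real \<kappa> + w) * 9 ^ \<kappa>)) * (2 ^ K * 9 ^ K)"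
        by (simp add: power_add)
      also have "\<dots> \<le> 2 ^ W * (2 ^ K * 16 ^ K)"
        using W by (intro mult_mono power_mono) auto
      also have "\<dots> = 2 ^ (W + K + 4 * K)"
        unfolding power_add power_mult by simp
      also have "\<dots> \<le> real n ^ ((W + 8) * K)"
      proof (rule pow)
        have "W * 1 \<le> W * K" by (rule mult_le_mono2[OF deg(1)])
        then show "W + K + 4 * K \<le> (W + 8) * K" unfolding add_mult_distrib by linarith
      qed
      finally show ?thesis unfolding rm by simp
    qed
    have small: "real (4 * n) ^ K * (4 * (1 / sqrt (real m))\<^sup>2) \<le> \<epsilon> / 3"
    proof -
      have "12 * real (4 * n) ^ K * 2 ^ K \<le> real m"
      proof -
        have "12 * real (4 * n) ^ K * 2 ^ K \<le> 2 ^ 4 * real (4 * n) ^ K * 2 ^ K" by (intro mult_right_mono) auto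
        also have "\<dots> = 2 ^ (4 + 2 * K + K) * real n ^ K"
          unfolding power_add power_mult by (simp add: power_mult_distrib)
        also have "\<dots> \<le> real n ^ (4 + 2 * K + K) * real n ^ K" by (intro mult_right_mono pow) auto
        also have "\<dots> = real n ^ (4 + 2 * K + K + K)" by (rule power_add[symmetric])
        also have "\<dots> \<le> real n ^ ((W + 8) * K)"
        proof (rule power_increasing)
          have "4 * 1 \<le> 4 * K" by (rule mult_le_mono2[OF deg(1)])
          then show "4 + 2 * K + K + K \<le> (W + 8) * K" unfolding add_mult_distrib by linarith
        qed (use x in simp)
        finally show ?thesis unfolding rm .
      qed
      also have "real m \<le> \<epsilon> * 2 ^ K * real m" using mult_right_mono[OF deg(2), of "real m"] by simp
      finally have "12 * real (4 * n) ^ K \<le> \<epsilon> * real m" by (simp add: mult_ac)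
      then show ?thesis using m1 by (simp add: power_divide field_simps)
    qed
    show "learns \<kappa> d p Skip predictor n \<epsilon> 0 (samples (n ^ ((W + 8) * nat (trunc_degree \<epsilon>))) n)"
      unfolding K_def[symmetric] m_def[symmetric]
    proof (rule learns_if[OF n _ \<epsilon>(1), where C = C' and \<delta> = "1 * (1 / sqrt (real m)) / C'"])
      show pos: "0 < samples m n" unfolding samples_def using m1 by simp
      show "0 < 1 * (1 / sqrt (real m)) / C'" using m1 C' by simp
      show "(\<Sum>Q | length Q = n. \<bar>Re (pauli_coeffs n Obs Q)\<bar>) \<le> C'" if "admissible_observable \<kappa> d n Obs" for Obs
        using C(2)[OF that] unfolding C'_def by simp
      show "accurate n (samples m n) \<epsilon> 0 (C' * (1 * (1 / sqrt (real m)) / C'))"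
        by (rule accurate_fine[OF n pos _ threshold_power[OF m1] _ small[unfolded K_def]]) (use m1 C' in auto)
      show "2 * real (4 * n) ^ (nat (trunc_degree \<epsilon>) + \<kappa>) * exp (- (real (samples m n) * (1 * (1 / sqrt (real m)) / C')\<^sup>2 /
          (2 * 9 ^ (nat (trunc_degree \<epsilon>) + \<kappa>)))) \<le> 1 - p"
        using failure_bound[OF n m1 C' w big] unfolding K_def .
    qed
  qed
qed

section \<open>Growth of the sample size and of the running time\<close>

lemma log_steps_less: "1 \<le> n \<Longrightarrow> log_steps n + 1 \<le> n"
proof -
  assume "1 \<le> n"
  then obtain k where k: "n = Suc k" by (cases n) auto
  have "n \<le> 2 ^ k" unfolding k using less_exp[of k] by (simp add: Suc_le_eq)
  then show ?thesis unfolding log_steps_iff k by simp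
qed

lemma log_steps_ln:
  assumes "2 \<le> n"
  shows "real (log_steps n + 1) \<le> 3 / ln 2 * ln (real n)"
proof -
  have "\<not> n \<le> 2 ^ 0" using assms by simp
  then have pos: "0 < log_steps n" unfolding log_steps_iff by simp
  then have "\<not> n \<le> 2 ^ (log_steps n - 1)" unfolding log_steps_iff by simp
  then have "real (2 ^ (log_steps n - 1)) \<le> real n" by (simp only: of_nat_le_iff)
  then have "2 powr real (log_steps n - 1) \<le> real n" by (simp add: powr_realpow)
  then have "real (log_steps n - 1) \<le> log 2 (real n)" using assms by (subst le_log_iff) auto
  moreover have "1 \<le> log 2 (real n)" using assms by (subst le_log_iff) auto
  ultimately have "real (log_steps n + 1) \<le> 3 * log 2 (real n)" using pos by (simp add: of_nat_diff)
  then show ?thesis unfolding log_def by simp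
qed

lemma time_poly:
  assumes n: "1 \<le> n"
  shows "predictor_time n (samples m n) ((4 * n) ^ K) ((4 * n) ^ \<kappa>)
    \<le> (4 ^ K * (4 ^ \<kappa> * (28 * m\<^sup>2 + 6) + 8) + 3 * m\<^sup>2 + 15) * n ^ (K + \<kappa> + 2)"
proof -
  define N where "N = samples m n"
  have N: "N \<le> m\<^sup>2 * n" unfolding N_def samples_def by (intro mult_le_mono2 log_steps_less n)
  have ge1: "1 \<le> n ^ a" for a using n by simp
  have mono: "n ^ a \<le> n ^ b" if "a \<le> b" for a b using that n by (intro power_increasing) auto
  have "N * (19 * n + 9) \<le> (m\<^sup>2 * n) * (28 * n)" using n by (intro mult_le_mono N) simp
  have "N * (19 * n + 9) + 6 \<le> (28 * m\<^sup>2 + 6) * n ^ 2" 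
  proof -
    have "6 * 1 \<le> 6 * n ^ 2" by (rule mult_le_mono2[OF ge1])
    moreover have "(m\<^sup>2 * n) * (28 * n) = 28 * m\<^sup>2 * n ^ 2" by (simp add: power2_eq_square)
    ultimately show ?thesis unfolding add_mult_distrib using \<open>N * (19 * n + 9) \<le> (m\<^sup>2 * n) * (28 * n)\<close> by linarith
  qed
  then have "(4 * n) ^ \<kappa> * (N * (19 * n + 9) + 6) \<le> (4 * n) ^ \<kappa> * ((28 * m\<^sup>2 + 6) * n ^ 2)" by (rule mult_le_mono2)
  also have "\<dots> = 4 ^ \<kappa> * (28 * m\<^sup>2 + 6) * n ^ (\<kappa> + 2)" by (simp only: power_mult_distrib power_add mult_ac)
  finally have "(4 * n) ^ \<kappa> * (N * (19 * n + 9) + 6) + 8 \<le> (4 ^ \<kappa> * (28 * m\<^sup>2 + 6) + 8) * n ^ (\<kappa> + 2)"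
    unfolding add_mult_distrib using ge1[of "\<kappa> + 2"] by linarith
  then have "(4 * n) ^ K * ((4 * n) ^ \<kappa> * (N * (19 * n + 9) + 6) + 8) \<le> (4 * n) ^ K * ((4 ^ \<kappa> * (28 * m\<^sup>2 + 6) + 8) * n ^ (\<kappa> + 2))"
    by (rule mult_le_mono2)
  also have "\<dots> = 4 ^ K * (4 ^ \<kappa> * (28 * m\<^sup>2 + 6) + 8) * n ^ (K + \<kappa> + 2)" by (simp only: power_mult_distrib power_add mult_ac)
  finally have 1: "(4 * n) ^ K * ((4 * n) ^ \<kappa> * (N * (19 * n + 9) + 6) + 8) \<le> 4 ^ K * (4 ^ \<kappa> * (28 * m\<^sup>2 + 6) + 8) * n ^ (K + \<kappa> + 2)" .
  have nle: "n \<le> n ^ (K + \<kappa> + 2)" using mono[of 1 "K + \<kappa> + 2"] by simp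
  have "m\<^sup>2 * n \<le> m\<^sup>2 * n ^ (K + \<kappa> + 2)" by (rule mult_le_mono2[OF nle])
  then have 2: "3 * N \<le> 3 * m\<^sup>2 * n ^ (K + \<kappa> + 2)" using N by linarith
  have 3: "3 * n + 12 \<le> 15 * n ^ (K + \<kappa> + 2)" using nle n by linarith
  show ?thesis unfolding predictor_time_def N_def[symmetric] add_mult_distrib using 1 2 3 by linarith
qed

text \<open>Numerical factors become powers of \<open>n\<close> because \<open>n\<close> is at least
  2, and additive constants in the exponent become multiples of \<open>K\<close> because
  \<open>K\<close> is at least 1. A bound of the form \<open>n ^ (a * K)\<close> is what
  \<open>power_le_powr\<close> converts.\<close>

lemma time_poly_fine:
  assumes n: "2 \<le> n" and K: "1 \<le> K"
  shows "predictor_time n (samples (n ^ (r * K)) n) ((4 * n) ^ K) ((4 * n) ^ \<kappa>) \<le> n ^ ((2 * r + 3 * \<kappa> + 11) * K)"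
    and "samples (n ^ (r * K)) n \<le> n ^ ((2 * r + 3 * \<kappa> + 11) * K)"
proof -
  define m where "m = n ^ (r * K)"
  have m2: "m\<^sup>2 = n ^ (2 * r * K)" unfolding m_def by (simp add: power_mult[symmetric] mult_ac)
  have m1: "1 \<le> m\<^sup>2" unfolding m2 using n by simp
  have pow: "2 ^ a \<le> n ^ a" for a using n by (intro power_mono) auto
  have "4 ^ K * (4 ^ \<kappa> * (28 * m\<^sup>2 + 6) + 8) + 3 * m\<^sup>2 + 15 \<le> 4 ^ K * (4 ^ \<kappa> * (2 ^ 6 * m\<^sup>2))"
  proof -
    have "4 ^ \<kappa> * (28 * m\<^sup>2 + 6) + 8 \<le> 4 ^ \<kappa> * (28 * m\<^sup>2 + 6) + 4 ^ \<kappa> * 8" by simp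
    also have "\<dots> = 4 ^ \<kappa> * (28 * m\<^sup>2 + 14)" by (simp add: algebra_simps)
    also have "\<dots> \<le> 4 ^ \<kappa> * (42 * m\<^sup>2)" using m1 by (intro mult_le_mono2) linarith
    finally have "4 ^ K * (4 ^ \<kappa> * (28 * m\<^sup>2 + 6) + 8) \<le> 4 ^ K * (4 ^ \<kappa> * (42 * m\<^sup>2))" by (rule mult_le_mono2)
    moreover have "1 * (1 * (18 * m\<^sup>2)) \<le> 4 ^ K * (4 ^ \<kappa> * (18 * m\<^sup>2))" by (intro mult_le_mono) auto
    moreover have "4 ^ K * (4 ^ \<kappa> * (42 * m\<^sup>2)) + 4 ^ K * (4 ^ \<kappa> * (18 * m\<^sup>2)) \<le> 4 ^ K * (4 ^ \<kappa> * (2 ^ 6 * m\<^sup>2))"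
      by (simp add: algebra_simps)
    ultimately show ?thesis using m1 by linarith
  qed
  also have "\<dots> = 2 ^ (2 * K + 2 * \<kappa> + 6) * m\<^sup>2" unfolding power_add power_mult by simp
  also have "\<dots> \<le> n ^ (2 * K + 2 * \<kappa> + 6) * n ^ (2 * r * K)" unfolding m2 by (intro mult_le_mono1 pow)
  finally have "(4 ^ K * (4 ^ \<kappa> * (28 * m\<^sup>2 + 6) + 8) + 3 * m\<^sup>2 + 15) * n ^ (K + \<kappa> + 2)
      \<le> (n ^ (2 * K + 2 * \<kappa> + 6) * n ^ (2 * r * K)) * n ^ (K + \<kappa> + 2)" by (rule mult_le_mono1)
  also have "\<dots> = n ^ (2 * K + 2 * \<kappa> + 6 + 2 * r * K + (K + \<kappa> + 2))" by (simp only: power_add)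
  also have "\<dots> \<le> n ^ ((2 * r + 3 * \<kappa> + 11) * K)"
  proof (rule power_increasing)
    have "(3 * \<kappa> + 8) * 1 \<le> (3 * \<kappa> + 8) * K" by (rule mult_le_mono2[OF K])
    then show "2 * K + 2 * \<kappa> + 6 + 2 * r * K + (K + \<kappa> + 2) \<le> (2 * r + 3 * \<kappa> + 11) * K" by (simp add: algebra_simps)
  qed (use n in simp)
  finally show "predictor_time n (samples (n ^ (r * K)) n) ((4 * n) ^ K) ((4 * n) ^ \<kappa>) \<le> n ^ ((2 * r + 3 * \<kappa> + 11) * K)"
    using time_poly[of n m K \<kappa>] n unfolding m_def by (meson le_trans one_le_numeral order_trans)
  have "samples m n \<le> n ^ (2 * r * K) * n" unfolding samples_def m2 by (intro mult_le_mono2 log_steps_less) (use n in simp)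
  also have "\<dots> = n ^ (2 * r * K + 1)" by simp
  also have "\<dots> \<le> n ^ ((2 * r + 3 * \<kappa> + 11) * K)"
    using n K by (intro power_increasing) (auto simp: algebra_simps)
  finally show "samples (n ^ (r * K)) n \<le> n ^ ((2 * r + 3 * \<kappa> + 11) * K)" unfolding m_def .
qed

lemma power_le_powr:
  assumes "0 < \<epsilon>" "\<epsilon> \<le> 2 / 3" "2 \<le> n" "x \<le> n ^ (a * nat (trunc_degree \<epsilon>))"
  shows "real x \<le> 2 powr (2 * real a / (ln 1.5 * ln 2) * ln (1 / \<epsilon>) * ln (real n))"
proof -
  define K where "K = nat (trunc_degree \<epsilon>)"
  have ln: "0 \<le> ln (real n)" using assms by simp
  have "real x \<le> real (n ^ (a * K))" using assms(4) unfolding K_def by (simp only: of_nat_le_iff)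
  also have "\<dots> = real n powr real (a * K)" using assms(3) by (subst powr_realpow) auto
  also have "\<dots> = exp (real a * real K * ln (real n))" using assms(3) by (simp add: powr_def)
  also have "\<dots> \<le> exp (real a * (2 / ln 1.5 * ln (1 / \<epsilon>)) * ln (real n))"
    using small_error_degree(3)[OF assms(1,2)] ln unfolding K_def by (intro exp_le_cancel_iff[THEN iffD2] mult_right_mono mult_left_mono) auto
  also have "real a * (2 / ln 1.5 * ln (1 / \<epsilon>)) * ln (real n)
      = 2 * real a / (ln 1.5 * ln 2) * ln (1 / \<epsilon>) * ln (real n) * ln 2" by (simp add: field_simps)
  also have "exp \<dots> = 2 powr (2 * real a / (ln 1.5 * ln 2) * ln (1 / \<epsilon>) * ln (real n))" by (simp add: powr_def)
  finally show ?thesis .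
qed

theorem theorem1:
  fixes \<kappa> d :: nat and p :: real
  assumes "p < 1"
  shows "\<exists>(train :: com) (predict :: com)
           (N :: real \<Rightarrow> real \<Rightarrow> nat \<Rightarrow> nat) (T :: real \<Rightarrow> real \<Rightarrow> nat \<Rightarrow> nat).
    (\<forall>\<epsilon> > 0. \<forall>\<epsilon>' > 0.
       (\<lambda>n. real (N \<epsilon> \<epsilon>' n)) \<in> O(\<lambda>n. ln (real n)) \<and>
       (\<exists>c::nat. (\<lambda>n. real (T \<epsilon> \<epsilon>' n)) \<in> O(\<lambda>n. real n ^ c)) \<and>
       (\<forall>n \<ge> 1. learns \<kappa> d p train predict n \<epsilon> \<epsilon>' (N \<epsilon> \<epsilon>' n) \<and>
          time_bounded \<kappa> d train predict n \<epsilon> \<epsilon>' (N \<epsilon> \<epsilon>' n) (T \<epsilon> \<epsilon>' n))) \<and>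
    (\<exists>\<epsilon>\<^sub>0 > 0. \<exists>C > 0. \<forall>\<epsilon>. 0 < \<epsilon> \<and> \<epsilon> \<le> \<epsilon>\<^sub>0 \<longrightarrow> (\<forall>n \<ge> 2.
       real (N \<epsilon> 0 n) \<le> 2 powr (C * ln (1 / \<epsilon>) * ln (real n)) \<and>
       real (T \<epsilon> 0 n) \<le> 2 powr (C * ln (1 / \<epsilon>) * ln (real n)) \<and>
       learns \<kappa> d p train predict n \<epsilon> 0 (N \<epsilon> 0 n) \<and>
       time_bounded \<kappa> d train predict n \<epsilon> 0 (N \<epsilon> 0 n) (T \<epsilon> 0 n)))"
proof -
  obtain r where fine: "\<And>\<epsilon> n. 0 < \<epsilon> \<Longrightarrow> \<epsilon> \<le> 2 / 3 \<Longrightarrow> 2 \<le> n \<Longrightarrow>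
    learns \<kappa> d p Skip predictor n \<epsilon> 0 (samples (n ^ (r * nat (trunc_degree \<epsilon>))) n)"
    using fine_learning[OF assms, of \<kappa> d] by blast
  \<comment> \<open>An arbitrary choice is enough: the sample size is only claimed to exist as a
    function of the parameters, and the program obtains its threshold from \<open>n\<close> and the
    number of samples it is given.\<close>
  define M where "M \<epsilon> \<epsilon>' = (SOME m. \<forall>n\<ge>1. learns \<kappa> d p Skip predictor n \<epsilon> \<epsilon>' (samples m n))" for \<epsilon> \<epsilon>'
  have coarse: "learns \<kappa> d p Skip predictor n \<epsilon> \<epsilon>' (samples (M \<epsilon> \<epsilon>') n)" if "0 < \<epsilon>" "0 < \<epsilon>'" "1 \<le> n" for \<epsilon> \<epsilon>' n
    using someI_ex[OF coarse_learning[OF assms that(1,2), of \<kappa> d]] that(3) unfolding M_def by blast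
  \<comment> \<open>The two regimes run the same program and differ only in this parameter, which is
    constant in \<open>n\<close> for positive \<epsilon>' and a power of \<open>n\<close> for
    \<epsilon>' = 0.\<close>
  define m where "m \<epsilon> \<epsilon>' n = (if 0 < \<epsilon>' then M \<epsilon> \<epsilon>' else n ^ (r * nat (trunc_degree \<epsilon>)))" for \<epsilon> \<epsilon>' :: real and n
  define N where "N \<epsilon> \<epsilon>' n = samples (m \<epsilon> \<epsilon>' n) n" for \<epsilon> \<epsilon>' n
  define T where "T \<epsilon> \<epsilon>' n = predictor_time n (N \<epsilon> \<epsilon>' n) ((4 * n) ^ nat (trunc_degree \<epsilon>)) ((4 * n) ^ \<kappa>)" for \<epsilon> \<epsilon>' n
  have time: "time_bounded \<kappa> d Skip predictor n \<epsilon> \<epsilon>' (N \<epsilon> \<epsilon>' n) (T \<epsilon> \<epsilon>' n)" if "1 \<le> n" for \<epsilon> \<epsilon>' n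
    unfolding T_def by (rule time_bounded_predictor[OF that])
  define a where "a = 2 * r + 3 * \<kappa> + 11"
  define C where "C = 2 * real a / (ln 1.5 * ln 2)"
  have A: "\<forall>\<epsilon> > 0. \<forall>\<epsilon>' > 0.
       (\<lambda>n. real (N \<epsilon> \<epsilon>' n)) \<in> O(\<lambda>n. ln (real n)) \<and>
       (\<exists>c::nat. (\<lambda>n. real (T \<epsilon> \<epsilon>' n)) \<in> O(\<lambda>n. real n ^ c)) \<and>
       (\<forall>n \<ge> 1. learns \<kappa> d p Skip predictor n \<epsilon> \<epsilon>' (N \<epsilon> \<epsilon>' n) \<and>
          time_bounded \<kappa> d Skip predictor n \<epsilon> \<epsilon>' (N \<epsilon> \<epsilon>' n) (T \<epsilon> \<epsilon>' n))"
  proof (intro allI impI conjI)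
    fix \<epsilon> \<epsilon>' :: real
    assume \<epsilon>: "0 < \<epsilon>" "0 < \<epsilon>'"
    then have m: "m \<epsilon> \<epsilon>' n = M \<epsilon> \<epsilon>'" for n unfolding m_def by simp
    show "(\<lambda>n. real (N \<epsilon> \<epsilon>' n)) \<in> O(\<lambda>n. ln (real n))"
    \<comment> \<open>The estimate starts at \<open>n = 2\<close>, since \<open>ln 1 = 0\<close>
      bounds nothing.\<close>
    proof (rule bigoI[of _ "real ((M \<epsilon> \<epsilon>')\<^sup>2) * (3 / ln 2)"], rule eventually_sequentiallyI[of 2])
      fix n :: nat assume n: "2 \<le> n"
      have "real (N \<epsilon> \<epsilon>' n) \<le> real ((M \<epsilon> \<epsilon>')\<^sup>2) * (3 / ln 2 * ln (real n))"
        unfolding N_def m samples_def of_nat_mult by (intro mult_left_mono log_steps_ln[OF n]) simp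
      then show "norm (real (N \<epsilon> \<epsilon>' n)) \<le> real ((M \<epsilon> \<epsilon>')\<^sup>2) * (3 / ln 2) * norm (ln (real n))"
        using n by (simp add: mult.assoc)
    qed
    let ?K = "nat (trunc_degree \<epsilon>)"
    let ?D = "4 ^ ?K * (4 ^ \<kappa> * (28 * (M \<epsilon> \<epsilon>')\<^sup>2 + 6) + 8) + 3 * (M \<epsilon> \<epsilon>')\<^sup>2 + 15"
    show "\<exists>c::nat. (\<lambda>n. real (T \<epsilon> \<epsilon>' n)) \<in> O(\<lambda>n. real n ^ c)"
    proof (rule exI[of _ "?K + \<kappa> + 2"], rule bigoI[of _ "real ?D"], rule eventually_sequentiallyI[of 1])
      fix n :: nat assume n: "1 \<le> n"
      have "T \<epsilon> \<epsilon>' n \<le> ?D * n ^ (?K + \<kappa> + 2)" unfolding T_def N_def m by (rule time_poly[OF n])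
      then have "real (T \<epsilon> \<epsilon>' n) \<le> real (?D * n ^ (?K + \<kappa> + 2))" by (simp only: of_nat_le_iff)
      also have "\<dots> = real ?D * real n ^ (?K + \<kappa> + 2)" by (simp only: of_nat_mult of_nat_power)
      finally show "norm (real (T \<epsilon> \<epsilon>' n)) \<le> real ?D * norm (real n ^ (?K + \<kappa> + 2))"
        by (simp only: real_norm_def abs_of_nat power_abs)
    qed
    fix n :: nat assume n: "1 \<le> n"
    show "learns \<kappa> d p Skip predictor n \<epsilon> \<epsilon>' (N \<epsilon> \<epsilon>' n)" unfolding N_def m by (rule coarse[OF \<epsilon> n])
    show "time_bounded \<kappa> d Skip predictor n \<epsilon> \<epsilon>' (N \<epsilon> \<epsilon>' n) (T \<epsilon> \<epsilon>' n)" by (rule time[OF n])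
  qed
  have C: "0 < C" unfolding C_def a_def by simp
  have B: "\<exists>\<epsilon>\<^sub>0 > 0. \<exists>C > 0. \<forall>\<epsilon>. 0 < \<epsilon> \<and> \<epsilon> \<le> \<epsilon>\<^sub>0 \<longrightarrow> (\<forall>n \<ge> 2.
       real (N \<epsilon> 0 n) \<le> 2 powr (C * ln (1 / \<epsilon>) * ln (real n)) \<and>
       real (T \<epsilon> 0 n) \<le> 2 powr (C * ln (1 / \<epsilon>) * ln (real n)) \<and>
       learns \<kappa> d p Skip predictor n \<epsilon> 0 (N \<epsilon> 0 n) \<and>
       time_bounded \<kappa> d Skip predictor n \<epsilon> 0 (N \<epsilon> 0 n) (T \<epsilon> 0 n))"
  proof (rule exI[of _ "2 / 3"], rule conjI, simp, rule exI[of _ C], intro conjI allI impI C)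
    fix \<epsilon> :: real and n :: nat
    assume "0 < \<epsilon> \<and> \<epsilon> \<le> 2 / 3" and n: "2 \<le> n"
    then have \<epsilon>: "0 < \<epsilon>" "\<epsilon> \<le> 2 / 3" by auto
    note K = small_error_degree(1)[OF \<epsilon>]
    have NT: "N \<epsilon> 0 n = samples (n ^ (r * nat (trunc_degree \<epsilon>))) n" unfolding N_def m_def by simp
    show "real (N \<epsilon> 0 n) \<le> 2 powr (C * ln (1 / \<epsilon>) * ln (real n))"
      unfolding C_def by (rule power_le_powr[OF \<epsilon> n]) (unfold NT a_def, rule time_poly_fine(2)[OF n K])
    show "real (T \<epsilon> 0 n) \<le> 2 powr (C * ln (1 / \<epsilon>) * ln (real n))"
      unfolding C_def by (rule power_le_powr[OF \<epsilon> n]) (unfold T_def NT a_def, rule time_poly_fine(1)[OF n K])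
    show "learns \<kappa> d p Skip predictor n \<epsilon> 0 (N \<epsilon> 0 n)" unfolding NT by (rule fine[OF \<epsilon> n])
    show "time_bounded \<kappa> d Skip predictor n \<epsilon> 0 (N \<epsilon> 0 n) (T \<epsilon> 0 n)" by (rule time) (use n in simp)
  qed
  show ?thesis
    by (rule exI[of _ Skip], rule exI[of _ predictor], rule exI[of _ N], rule exI[of _ T], rule conjI[OF A B])
qed

end
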